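(* Let $F$ be a field of characteristic $0$, $V=V_0\oplus V_1$ a $\mathbb{Z}_2$-graded $F$-vector space with $\dim V_0=k<\infty$, $\dim V_1=\ell<\infty$, and $\Omega\subseteq\mathbb{Y}$ a filter containing the rectangle $((\ell+1)^{k+1})$. Then the following are equivalent: (1) $A_\Omega$ satisfies a nontrivial polynomial identity; (2) $A_\Omega$ has polynomial rate of growth, i.e. there is a polynomial $p$ with $\dim A_\Omega(n)\le p(n)$ for all $n$; (3) there is an integer $b>0$ with $D(2,0,b)=(b^2)$, $D(1,1,b)=(b,1^{b-1})$ and $D(0,2,b)=(2^b)$ all in $\Omega$. Moreover, in case (3), for every multilinear polynomial identity $g(x_1,\dots,x_r)$ of $E\otimes E$, the algebra $A_\Omega$ satisfies the identity \[ g(x_1,\dots,x_r)\,g(x_{r+1},\dots,x_{2r})\cdots g(x_{(t-1)r+1},\dots,x_{tr})=0,\qquad t=b^2 . \]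
   Context: $\mathbb{Y}$ is the set of all partitions with inclusion $\mu\subseteq\lambda$ iff $\mu_i\le\lambda_i$ for all $i$; a filter is an upward-closed subset; $((\ell+1)^{k+1})$ is the rectangle with $k+1$ rows of length $\ell+1$. $D(a_1,a_2,b)=(b^{a_1},a_2^{\,b-a_1})$. $T^n(V)=V^{\otimes n}$ carries the signed place-permutation right action of $S_n$: for homogeneous $z_i$, $(z_1\otimes\cdots\otimes z_n)*\sigma=\varepsilon z_{\sigma(1)}\otimes\cdots\otimes z_{\sigma(n)}$, $\varepsilon=(-1)^N$, $N$ the number of pairs of odd ($V_1$) factors whose relative order is reversed; $W_\lambda$ is the isotypic component of $\chi^\lambda$. $I_\Omega=\bigoplus_{\lambda\in\Omega}W_\lambda$ is a two-sided ideal of the tensor algebra $T(V)$, $A_\Omega=T(V)/I_\Omega$, $A_\Omega(n)=T^n(V)/(I_\Omega\cap T^n(V))$. $E$ is the infinite-dimensional Grassmann (exterior) algebra over $F$ (generated by $e_1,e_2,\dots$ with $e_ie_j=-e_je_i$), and $E\otimes E$ is its tensor square over $F$. *)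

theory Defs
  imports
    "HOL-Combinatorics.Permutations"
    "HOL-Computational_Algebra.Polynomial"
    "HOL-Library.Poly_Mapping"
    "HOL-Library.FuncSet"
    "HOL-Algebra.QuotRing"
    "HOL-Algebra.Module"
    "HOL-Algebra.Sym_Groups"
begin

section \<open>Algebras over a field\<close>

text \<open>
  The ground field is a type of class \<^class>\<open>field_char_0\<close>.  An algebra over it is a record of type
  \<open>('f, 'a) module\<close>, whose field \<^const>\<open>smult\<close> holds the action of the scalars.
  Algebras are not assumed to be commutative.
\<close>

definition lin_span :: "('f::field, 'a, 'm) module_scheme \<Rightarrow> 'a set \<Rightarrow> 'a set" where
  "lin_span M S = {\<Oplus>\<^bsub>M\<^esub>v\<in>X. c v \<odot>\<^bsub>M\<^esub> v | X c. finite X \<and> X \<subseteq> S}"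

definition lin_indep :: "('f::field, 'a, 'm) module_scheme \<Rightarrow> 'a set \<Rightarrow> bool" where
  "lin_indep M S \<longleftrightarrow>
     (\<forall>X c. finite X \<and> X \<subseteq> S \<and> (\<Oplus>\<^bsub>M\<^esub>v\<in>X. c v \<odot>\<^bsub>M\<^esub> v) = \<zero>\<^bsub>M\<^esub> \<longrightarrow> (\<forall>v\<in>X. c v = 0))"

definition is_basis :: "('f::field, 'a, 'm) module_scheme \<Rightarrow> 'a set \<Rightarrow> bool" where
  "is_basis M B \<longleftrightarrow> B \<subseteq> carrier M \<and> lin_indep M B \<and> lin_span M B = carrier M"

text \<open>As usual for \<^const>\<open>card\<close>, this is \<open>0\<close> on infinite-dimensional spaces; it is only
  applied below to spaces spanned by a finite set.\<close>

definition vdim :: "('f::field, 'a, 'm) module_scheme \<Rightarrow> nat" where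
  "vdim M = card (SOME B. is_basis M B)"

text \<open>The ring is the library's \<^const>\<open>FactRing\<close>; only the scalars are added.  For the
  underlying vector spaces it is also used when \<open>I\<close> is just a subspace.\<close>

definition quot_alg :: "('f, 'a, 'm) module_scheme \<Rightarrow> 'a set \<Rightarrow> ('f, 'a set) module" where
  "quot_alg M I =
     ring.extend (M Quot I) (module.fields (\<lambda>c X. \<Union>x\<in>X. I +>\<^bsub>M\<^esub> (c \<odot>\<^bsub>M\<^esub> x)))"

definition monoid_algebra :: "('g, 'm) monoid_scheme \<Rightarrow> ('f::field, 'g \<Rightarrow>\<^sub>0 'f) module" where
  "monoid_algebra G =
     \<lparr> carrier = {p. Poly_Mapping.keys p \<subseteq> carrier G},
       mult = (\<lambda>p q. \<Sum>x\<in>Poly_Mapping.keys p. \<Sum>y\<in>Poly_Mapping.keys q.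
                  Poly_Mapping.single (x \<otimes>\<^bsub>G\<^esub> y) (Poly_Mapping.lookup p x * Poly_Mapping.lookup q y)),
       one = Poly_Mapping.single \<one>\<^bsub>G\<^esub> 1,
       zero = 0,
       add = (+),
       smult = (\<lambda>c. Poly_Mapping.map ((*) c)) \<rparr>"

definition free_algebra :: "('f::field, 'x list \<Rightarrow>\<^sub>0 'f) module" where
  "free_algebra = monoid_algebra \<lparr> carrier = UNIV, mult = (@), one = [] \<rparr>"

text \<open>The tensor product of algebras: the free vector space on pairs \<open>(a, b)\<close>, with product
  \<open>(a, b) (a', b') = (a a', b b')\<close>, modulo bilinearity.  The linear span of the bilinearity
  relations is closed under multiplication by pairs, so it coincides with the ideal used here.\<close>

definition tensor_product ::
  "('f::field, 'a, 'm) module_scheme \<Rightarrow> ('f, 'b, 'n) module_scheme \<Rightarrow> ('f, ('a \<times> 'b \<Rightarrow>\<^sub>0 'f) set) module"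
where
  "tensor_product A B =
     quot_alg (monoid_algebra (A \<times>\<times> B))
       (Idl\<^bsub>monoid_algebra (A \<times>\<times> B)\<^esub>
         ({Poly_Mapping.single (a \<oplus>\<^bsub>A\<^esub> a', b) 1
             - Poly_Mapping.single (a, b) 1 - Poly_Mapping.single (a', b) 1 | a a' b.
             a \<in> carrier A \<and> a' \<in> carrier A \<and> b \<in> carrier B} \<union>
          {Poly_Mapping.single (a, b \<oplus>\<^bsub>B\<^esub> b') 1
             - Poly_Mapping.single (a, b) 1 - Poly_Mapping.single (a, b') 1 | a b b'.
             a \<in> carrier A \<and> b \<in> carrier B \<and> b' \<in> carrier B} \<union>
          {Poly_Mapping.single (c \<odot>\<^bsub>A\<^esub> a, b) 1 - Poly_Mapping.single (a, b) c | c a b.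
             a \<in> carrier A \<and> b \<in> carrier B} \<union>
          {Poly_Mapping.single (a, c \<odot>\<^bsub>B\<^esub> b) 1 - Poly_Mapping.single (a, b) c | c a b.
             a \<in> carrier A \<and> b \<in> carrier B}))"

definition grassmann :: "('f::field, (nat list \<Rightarrow>\<^sub>0 'f) set) module" where
  "grassmann =
     quot_alg free_algebra
       (Idl\<^bsub>free_algebra\<^esub> {Poly_Mapping.single [i, j] 1 + Poly_Mapping.single [j, i] 1 | i j. True})"


section \<open>Polynomial identities\<close>

text \<open>Noncommutative polynomials are the elements of \<open>free_algebra\<close> over \<^typ>\<open>nat\<close>; the variable
  \<open>x\<^sub>i\<close> is the one-letter word \<open>[i]\<close>.\<close>

definition nc_eval ::
  "('f::field, 'a, 'm) module_scheme \<Rightarrow> (nat \<Rightarrow> 'a) \<Rightarrow> (nat list \<Rightarrow>\<^sub>0 'f) \<Rightarrow> 'a" where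
  "nc_eval A a f =
     (\<Oplus>\<^bsub>A\<^esub>w\<in>Poly_Mapping.keys f.
        Poly_Mapping.lookup f w \<odot>\<^bsub>A\<^esub> foldr (\<lambda>i y. a i \<otimes>\<^bsub>A\<^esub> y) w \<one>\<^bsub>A\<^esub>)"

definition is_identity :: "('f::field, 'a, 'm) module_scheme \<Rightarrow> (nat list \<Rightarrow>\<^sub>0 'f) \<Rightarrow> bool" where
  "is_identity A f \<longleftrightarrow> (\<forall>a. (\<forall>i. a i \<in> carrier A) \<longrightarrow> nc_eval A a f = \<zero>\<^bsub>A\<^esub>)"

definition PI_algebra :: "('f::field, 'a, 'm) module_scheme \<Rightarrow> bool" where
  "PI_algebra A \<longleftrightarrow> (\<exists>f. f \<noteq> 0 \<and> is_identity A f)"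

text \<open>Multilinear in \<open>x\<^sub>1, \<dots>, x\<^sub>r\<close>.\<close>

definition multilinear :: "nat \<Rightarrow> (nat list \<Rightarrow>\<^sub>0 'f::field) \<Rightarrow> bool" where
  "multilinear r g \<longleftrightarrow> (\<forall>w\<in>Poly_Mapping.keys g. distinct w \<and> set w = {1..r})"

text \<open>\<open>g(x\<^sub>1, \<dots>, x\<^sub>r) g(x\<^sub>r\<^sub>+\<^sub>1, \<dots>, x\<^sub>2\<^sub>r) \<cdots>\<close> with \<open>t\<close> factors.\<close>

definition shifted_product :: "nat \<Rightarrow> nat \<Rightarrow> (nat list \<Rightarrow>\<^sub>0 'f::field) \<Rightarrow> (nat list \<Rightarrow>\<^sub>0 'f)" where
  "shifted_product r t g =
     foldr (\<lambda>j y. nc_eval free_algebra (\<lambda>i. Poly_Mapping.single [j * r + i] 1) g \<otimes>\<^bsub>free_algebra\<^esub> y)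
       [0..<t] \<one>\<^bsub>free_algebra\<^esub>"


section \<open>Partitions and Specht modules\<close>

text \<open>A partition is an eventually vanishing, weakly decreasing sequence whose parts are indexed
  from \<open>0\<close>; inclusion is the pointwise order of functions.\<close>

definition partitions :: "(nat \<Rightarrow> nat) set" where
  "partitions = {\<nu>. antimono \<nu> \<and> finite {i. \<nu> i \<noteq> 0}}"

definition psize :: "(nat \<Rightarrow> nat) \<Rightarrow> nat" where
  "psize \<nu> = (\<Sum>i | \<nu> i \<noteq> 0. \<nu> i)"

definition is_filter_of_partitions :: "(nat \<Rightarrow> nat) set \<Rightarrow> bool" where
  "is_filter_of_partitions \<Omega> \<longleftrightarrow>
     \<Omega> \<subseteq> partitions \<and> (\<forall>\<mu>\<in>\<Omega>. \<forall>\<nu>\<in>partitions. \<mu> \<le> \<nu> \<longrightarrow> \<nu> \<in> \<Omega>)"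

text \<open>The partition \<open>(p\<^sup>m)\<close> with \<open>m\<close> rows of length \<open>p\<close>.\<close>

definition rectangle :: "nat \<Rightarrow> nat \<Rightarrow> nat \<Rightarrow> nat" where
  "rectangle p m = (\<lambda>i. if i < m then p else 0)"

text \<open>\<open>b\<close> repeated \<open>a\<^sub>1\<close> times, followed by \<open>a\<^sub>2\<close> repeated \<open>b - a\<^sub>1\<close> times; the truncated
  subtraction matters only for \<open>D(2,0,1) = (1\<^sup>2)\<close>.\<close>

definition D :: "nat \<Rightarrow> nat \<Rightarrow> nat \<Rightarrow> nat \<Rightarrow> nat" where
  "D a\<^sub>1 a\<^sub>2 b = (\<lambda>i. if i < a\<^sub>1 then b else if i < a\<^sub>1 + (b - a\<^sub>1) then a\<^sub>2 else 0)"

definition cells :: "(nat \<Rightarrow> nat) \<Rightarrow> (nat \<times> nat) set" where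
  "cells \<nu> = {(i, j). j < \<nu> i}"

definition is_tableau :: "(nat \<Rightarrow> nat) \<Rightarrow> (nat \<times> nat \<Rightarrow> nat) \<Rightarrow> bool" where
  "is_tableau \<nu> T \<longleftrightarrow> bij_betw T (cells \<nu>) {1..psize \<nu>}"

definition row_group :: "(nat \<Rightarrow> nat) \<Rightarrow> (nat \<times> nat \<Rightarrow> nat) \<Rightarrow> (nat \<Rightarrow> nat) set" where
  "row_group \<nu> T = {p \<in> carrier (sym_group (psize \<nu>)).
     \<forall>(i, j)\<in>cells \<nu>. \<exists>j'. (i, j') \<in> cells \<nu> \<and> p (T (i, j)) = T (i, j')}"

definition column_group :: "(nat \<Rightarrow> nat) \<Rightarrow> (nat \<times> nat \<Rightarrow> nat) \<Rightarrow> (nat \<Rightarrow> nat) set" where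
  "column_group \<nu> T = {q \<in> carrier (sym_group (psize \<nu>)).
     \<forall>(i, j)\<in>cells \<nu>. \<exists>i'. (i', j) \<in> cells \<nu> \<and> q (T (i, j)) = T (i', j)}"

definition young_symmetrizer ::
  "(nat \<Rightarrow> nat) \<Rightarrow> (nat \<times> nat \<Rightarrow> nat) \<Rightarrow> ((nat \<Rightarrow> nat) \<Rightarrow>\<^sub>0 'f::field)" where
  "young_symmetrizer \<nu> T =
     (\<Sum>p\<in>row_group \<nu> T. \<Sum>q\<in>column_group \<nu> T.
        Poly_Mapping.single (p \<otimes>\<^bsub>sym_group (psize \<nu>)\<^esub> q) (of_int (sign q)))"

text \<open>The Specht module as a right ideal of the group algebra.  For every tableau of shape \<open>\<nu>\<close> it is
  the irreducible right module with character \<open>\<chi>\<^sup>\<nu>\<close>: one row gives the trivial character, one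
  column the sign.\<close>

definition specht :: "(nat \<Rightarrow> nat) \<Rightarrow> (nat \<times> nat \<Rightarrow> nat) \<Rightarrow> ((nat \<Rightarrow> nat) \<Rightarrow>\<^sub>0 'f::field) set" where
  "specht \<nu> T =
     {young_symmetrizer \<nu> T \<otimes>\<^bsub>monoid_algebra (sym_group (psize \<nu>))\<^esub> x | x.
        x \<in> carrier (monoid_algebra (sym_group (psize \<nu>)))}"


section \<open>The tensor algebra of a graded vector space\<close>

locale graded_space = vector_space scale
  for scale :: "'f::field_char_0 \<Rightarrow> 'v::ab_group_add \<Rightarrow> 'v" +
  fixes V0 V1 :: "'v set"
  assumes subspace_V0: "subspace V0"
    and subspace_V1: "subspace V1"
    and sum_V0_V1: "{x + y | x y. x \<in> V0 \<and> y \<in> V1} = UNIV"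
    and inter_V0_V1: "V0 \<inter> V1 = {0}"

text \<open>The tensor algebra as the free algebra on all vectors modulo linearity of \<open>v \<mapsto> [v]\<close>.\<close>

definition tensor_relations :: "('f::field \<Rightarrow> 'v::ab_group_add \<Rightarrow> 'v) \<Rightarrow> ('v list \<Rightarrow>\<^sub>0 'f) set" where
  "tensor_relations scale =
     Idl\<^bsub>free_algebra\<^esub>
       ({Poly_Mapping.single [u + v] 1 - Poly_Mapping.single [u] 1 - Poly_Mapping.single [v] 1 | u v. True} \<union>
        {Poly_Mapping.single [scale c v] 1 - Poly_Mapping.single [v] c | c v. True})"

definition tensor_algebra ::
  "('f::field \<Rightarrow> 'v::ab_group_add \<Rightarrow> 'v) \<Rightarrow> ('f, ('v list \<Rightarrow>\<^sub>0 'f) set) module" where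
  "tensor_algebra scale = quot_alg free_algebra (tensor_relations scale)"

text \<open>\<open>z\<^sub>1 \<otimes> \<cdots> \<otimes> z\<^sub>n\<close> for a list of vectors \<open>z\<close>.\<close>

definition pure_tensor ::
  "('f::field \<Rightarrow> 'v::ab_group_add \<Rightarrow> 'v) \<Rightarrow> 'v list \<Rightarrow> ('v list \<Rightarrow>\<^sub>0 'f) set" where
  "pure_tensor scale z = tensor_relations scale +>\<^bsub>free_algebra\<^esub> Poly_Mapping.single z 1"

definition tensor_power ::
  "('f::field \<Rightarrow> 'v::ab_group_add \<Rightarrow> 'v) \<Rightarrow> nat \<Rightarrow> ('v list \<Rightarrow>\<^sub>0 'f) set set" where
  "tensor_power scale n =
     lin_span (tensor_algebra scale) {pure_tensor scale z | z. length z = n}"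

text \<open>Permutations act on \<open>{1..n}\<close> whereas list positions start at \<open>0\<close>.\<close>

definition permute_word :: "nat \<Rightarrow> (nat \<Rightarrow> nat) \<Rightarrow> 'v list \<Rightarrow> 'v list" where
  "permute_word n \<sigma> z = map (\<lambda>i. z ! (\<sigma> i - 1)) [1..<n + 1]"

text \<open>The number \<open>N\<close> of pairs of factors from \<open>V\<^sub>1\<close> whose relative order is reversed, the pairs being
  indexed by their positions \<open>i < j\<close> in the permuted word.\<close>

definition odd_inversions :: "'v set \<Rightarrow> nat \<Rightarrow> (nat \<Rightarrow> nat) \<Rightarrow> 'v list \<Rightarrow> nat" where
  "odd_inversions V1 n \<sigma> z =
     card {(i, j). i \<in> {1..n} \<and> j \<in> {1..n} \<and> i < j \<and> \<sigma> i > \<sigma> j \<and>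
                   z ! (\<sigma> i - 1) \<in> V1 \<and> z ! (\<sigma> j - 1) \<in> V1}"

text \<open>The right action \<open>x \<mapsto> x * \<sigma>\<close> on the \<open>n\<close>-th tensor power, which is the linear map with the
  prescribed values on tensors of homogeneous vectors.\<close>

definition sign_action ::
  "('f::field \<Rightarrow> 'v::ab_group_add \<Rightarrow> 'v) \<Rightarrow> 'v set \<Rightarrow> 'v set \<Rightarrow> nat \<Rightarrow> (nat \<Rightarrow> nat)
     \<Rightarrow> ('v list \<Rightarrow>\<^sub>0 'f) set \<Rightarrow> ('v list \<Rightarrow>\<^sub>0 'f) set" where
  "sign_action scale V0 V1 n \<sigma> =
     (THE f. f \<in> extensional (tensor_power scale n) \<and>
        (\<forall>x\<in>tensor_power scale n. \<forall>y\<in>tensor_power scale n.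
           f (x \<oplus>\<^bsub>tensor_algebra scale\<^esub> y) = f x \<oplus>\<^bsub>tensor_algebra scale\<^esub> f y) \<and>
        (\<forall>c. \<forall>x\<in>tensor_power scale n.
           f (c \<odot>\<^bsub>tensor_algebra scale\<^esub> x) = c \<odot>\<^bsub>tensor_algebra scale\<^esub> f x) \<and>
        (\<forall>z. length z = n \<and> set z \<subseteq> V0 \<union> V1 \<longrightarrow>
           f (pure_tensor scale z) =
             (-1) ^ odd_inversions V1 n \<sigma> z
               \<odot>\<^bsub>tensor_algebra scale\<^esub> pure_tensor scale (permute_word n \<sigma> z)))"

text \<open>\<open>M\<close> is a submodule of \<open>T\<^sup>n(V)\<close>, \<open>n = |\<nu>|\<close>, isomorphic to the Specht module.  That \<open>M\<close> is a
  submodule follows from its being the image of \<open>\<phi>\<close>.\<close>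

definition specht_submodule ::
  "('f::field \<Rightarrow> 'v::ab_group_add \<Rightarrow> 'v) \<Rightarrow> 'v set \<Rightarrow> 'v set \<Rightarrow> (nat \<Rightarrow> nat)
     \<Rightarrow> ('v list \<Rightarrow>\<^sub>0 'f) set set \<Rightarrow> bool" where
  "specht_submodule scale V0 V1 \<nu> M \<longleftrightarrow>
     M \<subseteq> tensor_power scale (psize \<nu>) \<and>
     (\<exists>T \<phi>. is_tableau \<nu> T \<and> bij_betw \<phi> (specht \<nu> T) M \<and>
        (\<forall>x\<in>specht \<nu> T. \<forall>y\<in>specht \<nu> T. \<phi> (x + y) = \<phi> x \<oplus>\<^bsub>tensor_algebra scale\<^esub> \<phi> y) \<and>
        (\<forall>c. \<forall>x\<in>specht \<nu> T.
           \<phi> (c \<odot>\<^bsub>monoid_algebra (sym_group (psize \<nu>))\<^esub> x) = c \<odot>\<^bsub>tensor_algebra scale\<^esub> \<phi> x) \<and>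
        (\<forall>\<sigma>\<in>carrier (sym_group (psize \<nu>)). \<forall>x\<in>specht \<nu> T.
           \<phi> (x \<otimes>\<^bsub>monoid_algebra (sym_group (psize \<nu>))\<^esub> Poly_Mapping.single \<sigma> 1) =
             sign_action scale V0 V1 (psize \<nu>) \<sigma> (\<phi> x)))"

text \<open>The isotypic component \<open>W\<^sub>\<nu>\<close>: the sum of all submodules with character \<open>\<chi>\<^sup>\<nu>\<close>.\<close>

definition isotypic ::
  "('f::field \<Rightarrow> 'v::ab_group_add \<Rightarrow> 'v) \<Rightarrow> 'v set \<Rightarrow> 'v set \<Rightarrow> (nat \<Rightarrow> nat)
     \<Rightarrow> ('v list \<Rightarrow>\<^sub>0 'f) set set" where
  "isotypic scale V0 V1 \<nu> =
     lin_span (tensor_algebra scale) (\<Union>{M. specht_submodule scale V0 V1 \<nu> M})"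

definition I_ideal ::
  "('f::field \<Rightarrow> 'v::ab_group_add \<Rightarrow> 'v) \<Rightarrow> 'v set \<Rightarrow> 'v set \<Rightarrow> (nat \<Rightarrow> nat) set
     \<Rightarrow> ('v list \<Rightarrow>\<^sub>0 'f) set set" where
  "I_ideal scale V0 V1 \<Omega> =
     lin_span (tensor_algebra scale) (\<Union>\<nu>\<in>\<Omega>. isotypic scale V0 V1 \<nu>)"

definition A_algebra ::
  "('f::field \<Rightarrow> 'v::ab_group_add \<Rightarrow> 'v) \<Rightarrow> 'v set \<Rightarrow> 'v set \<Rightarrow> (nat \<Rightarrow> nat) set
     \<Rightarrow> ('f, ('v list \<Rightarrow>\<^sub>0 'f) set set) module" where
  "A_algebra scale V0 V1 \<Omega> = quot_alg (tensor_algebra scale) (I_ideal scale V0 V1 \<Omega>)"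

text \<open>The vector space \<open>A\<^sub>\<Omega>(n) = T\<^sup>n(V) / (I\<^sub>\<Omega> \<inter> T\<^sup>n(V))\<close>; the multiplication of this record is
  irrelevant.\<close>

definition A_component ::
  "('f::field \<Rightarrow> 'v::ab_group_add \<Rightarrow> 'v) \<Rightarrow> 'v set \<Rightarrow> 'v set \<Rightarrow> (nat \<Rightarrow> nat) set \<Rightarrow> nat
     \<Rightarrow> ('f, ('v list \<Rightarrow>\<^sub>0 'f) set set) module" where
  "A_component scale V0 V1 \<Omega> n =
     quot_alg (tensor_algebra scale \<lparr> carrier := tensor_power scale n \<rparr>)
       (I_ideal scale V0 V1 \<Omega> \<inter> tensor_power scale n)"

definition polynomial_growth ::
  "('f::field \<Rightarrow> 'v::ab_group_add \<Rightarrow> 'v) \<Rightarrow> 'v set \<Rightarrow> 'v set \<Rightarrow> (nat \<Rightarrow> nat) set \<Rightarrow> bool" where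
  "polynomial_growth scale V0 V1 \<Omega> \<longleftrightarrow>
     (\<exists>p :: real poly. \<forall>n. real (vdim (A_component scale V0 V1 \<Omega> n)) \<le> poly p (real n))"

end

theory Submission
  imports Defs
begin

text \<open>
  Branching: if \<open>\<nu> \<le> \<mu>\<close> fails, the central idempotents \<open>e\<^sub>\<nu>\<close>, \<open>e\<^sub>\<mu>\<close> of the group algebras annihilate each
  other.  So for a filter the idempotents \<open>e\<^sub>\<Omega>\<^sub>,\<^sub>n = \<Sum> e\<^sub>\<nu>\<close>, \<open>\<nu> \<in> \<Omega>\<close>, \<open>|\<nu>| = n\<close>, define projections of the tensor
  powers whose images form the ideal \<open>I\<^sub>\<Omega>\<close>.

  If one of the shapes \<open>D(a, 2 - a, b)\<close> is missing for every \<open>b\<close>, then every member of \<open>\<Omega>\<close> contains the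
  cell \<open>(a, 2 - a)\<close>, and by the hook theorem it kills all words in \<open>a\<close> even and \<open>2 - a\<close> odd basis vectors.
  Hence \<open>A\<^sub>\<Omega>\<close> contains a free algebra in two generators, is not PI and grows exponentially.

  If all three shapes are in \<open>\<Omega>\<close>, a partition of \<open>n\<close> outside \<open>\<Omega>\<close> has fewer than \<open>t = b\<^sup>2\<close> cells outside its
  first row, or outside its first column.  So modulo \<open>I\<^sub>\<Omega>\<close> only the tensors \<open>w * s\<close> with \<open>s\<close> a symmetrizer or
  antisymmetrizer of more than \<open>n - t\<close> positions survive; up to sign there are polynomially many.
  A product of \<open>t\<close> values of \<open>g\<close> on words is killed by such \<open>s\<close>: one of the factors lies within
  the positions of \<open>s\<close>, where permuting its blocks only produces signs \<open>sgn\<^sub>U sgn\<^sub>U\<^sub>'\<close>, and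
  \<open>\<Sum> g\<^sub>\<sigma> sgn\<^sub>U(\<sigma>) sgn\<^sub>U\<^sub>'(\<sigma>) = 0\<close> is what the identity \<open>g\<close> of \<open>E \<otimes> E\<close> says on elements \<open>1\<close>, \<open>e\<^sub>i\<close> in each factor.
  As \<open>9! > 4\<^sup>9\<close>, some nonzero \<open>g\<close> of degree \<open>9\<close> satisfies all these equations.
\<close>

text \<open>Idempotents of symmetric groups of different degrees have to be multiplied, so all of
  them live in one group algebra, that of the finitary permutations of the naturals. Over an
  arbitrary field of characteristic 0 there is no inner product; the rationality of the coefficients
  of Young symmetrizers replaces it, since a sum of rational squares vanishes only termwise.
  Character theory is avoided: branching is deduced from the hook theorem, and that from a vanishing
  statement about coefficient functions. The algebras of the statement are nested quotient records;
  once homogeneous bases are chosen, all computations take place among finitely supported functions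
  on words, and the ideal becomes the kernel of one linear map \<open>kappa\<close>. The exponent
  b^2 bounds the (b - 1) by b box that holds the cells of an excluded shape off its long row or
  column. The conditions on g are indexed by pairs of subsets of its r variables, 4^r in number,
  against r! coefficients; 9 is the least r with r! > 4^r.\<close>

abbreviation lk :: "('a \<Rightarrow>\<^sub>0 'b::zero) \<Rightarrow> 'a \<Rightarrow> 'b" where "lk \<equiv> Poly_Mapping.lookup"
abbreviation sng :: "'a \<Rightarrow> 'b::zero \<Rightarrow> ('a \<Rightarrow>\<^sub>0 'b)" where "sng \<equiv> Poly_Mapping.single"
abbreviation ks :: "('a \<Rightarrow>\<^sub>0 'b::zero) \<Rightarrow> 'a set" where "ks \<equiv> Poly_Mapping.keys"

section \<open>Linear algebra of finitely supported functions\<close>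

text \<open>The \<open>smult\<close> of \<open>monoid_algebra\<close>, named so that the span,
  independence and dimension of the library's \<open>vector_space\<close> become available.\<close>

definition psc :: "'f::field \<Rightarrow> ('a \<Rightarrow>\<^sub>0 'f) \<Rightarrow> ('a \<Rightarrow>\<^sub>0 'f)" where
  "psc c = Poly_Mapping.map ((*) c)"

lemma lk_psc [simp]: "lk (psc c p) x = c * lk p x"
  by (simp add: psc_def map.rep_eq when_def)

lemma psc_sng [simp]: "psc c (sng x d) = sng x (c * d)"
  by (rule poly_mapping_eqI) (simp add: lookup_single when_def)

lemma keys_psc: "ks (psc c p) \<subseteq> ks p"
  by (auto simp: in_keys_iff)

global_interpretation pm: vector_space "psc :: 'f::field \<Rightarrow> ('a \<Rightarrow>\<^sub>0 'f) \<Rightarrow> ('a \<Rightarrow>\<^sub>0 'f)"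
  by unfold_locales (auto intro!: poly_mapping_eqI simp: lookup_add algebra_simps)

abbreviation plin :: "(('a \<Rightarrow>\<^sub>0 'f::field) \<Rightarrow> ('b \<Rightarrow>\<^sub>0 'f)) \<Rightarrow> bool" where
  "plin \<equiv> Vector_Spaces.linear psc psc"

lemma plinI:
  assumes "\<And>x y. F (x + y) = F x + F y" "\<And>c x. F (psc c x) = psc c (F x)"
  shows "plin F"
  using assms by unfold_locales auto

lemma plin_add: "plin F \<Longrightarrow> F (x + y) = F x + F y"
  and plin_psc: "plin F \<Longrightarrow> F (psc c x) = psc c (F x)"
  and plin_0: "plin F \<Longrightarrow> F 0 = 0"
  and plin_diff: "plin F \<Longrightarrow> F (x - y) = F x - F y"
  and plin_sum: "plin F \<Longrightarrow> F (sum f S) = (\<Sum>i\<in>S. F (f i))"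
proof -
  assume "plin F"
  then interpret Vector_Spaces.linear psc psc F .
  show "F (x + y) = F x + F y" "F (psc c x) = psc c (F x)" "F 0 = 0" "F (x - y) = F x - F y"
    "F (sum f S) = (\<Sum>i\<in>S. F (f i))"
    by (auto simp: add scale zero diff sum)
qed

lemma plin_comp: "plin F \<Longrightarrow> plin G \<Longrightarrow> plin (\<lambda>x. F (G x))"
  by (intro plinI) (simp_all add: plin_add plin_psc)

lemma poly_mapping_expand:
  assumes "finite S" "ks p \<subseteq> S"
  shows "p = (\<Sum>x\<in>S. psc (lk p x) (sng x 1))"
proof (rule poly_mapping_eqI)
  fix k
  have "lk (\<Sum>x\<in>S. psc (lk p x) (sng x 1)) k = (\<Sum>x\<in>S. if x = k then lk p k else 0)"
    by (auto simp: lookup_sum lookup_single when_def intro!: sum.cong)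
  also have "\<dots> = lk p k"
    using assms by (auto simp: sum.delta in_keys_iff subset_iff)
  finally show "lk p k = lk (\<Sum>x\<in>S. psc (lk p x) (sng x 1)) k" by simp
qed

text \<open>The workhorse for multilinear identities: one application per argument reduces them to
  point masses, that is to single words or single permutations.\<close>

lemma plin_eqI:
  assumes "plin F" "plin G" "ks p \<subseteq> S" "\<And>x. x \<in> S \<Longrightarrow> F (sng x 1) = G (sng x 1)"
  shows "F p = G p"
proof -
  have *: "p = (\<Sum>x\<in>ks p. psc (lk p x) (sng x 1))"
    by (rule poly_mapping_expand) auto
  have "F p = (\<Sum>x\<in>ks p. psc (lk p x) (F (sng x 1)))"
    by (subst *) (simp only: plin_sum[OF assms(1)] plin_psc[OF assms(1)])
  also have "\<dots> = (\<Sum>x\<in>ks p. psc (lk p x) (G (sng x 1)))"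
    using assms by (intro sum.cong) auto
  also have "\<dots> = G p"
    by (subst (3) *) (simp only: plin_sum[OF assms(2)] plin_psc[OF assms(2)])
  finally show ?thesis .
qed

text \<open>The linear extension of \<open>h\<close> from the basis of point masses. Products,
  actions, evaluations and functionals are all written in this form, so their linearity comes for
  free.\<close>

definition lext :: "('a \<Rightarrow> ('b \<Rightarrow>\<^sub>0 'f)) \<Rightarrow> ('a \<Rightarrow>\<^sub>0 'f::field) \<Rightarrow> ('b \<Rightarrow>\<^sub>0 'f)" where
  "lext h p = (\<Sum>x\<in>ks p. psc (lk p x) (h x))"

lemma lext_superset:
  assumes "finite S" "ks p \<subseteq> S"
  shows "lext h p = (\<Sum>x\<in>S. psc (lk p x) (h x))"
  unfolding lext_def
  by (rule sum.mono_neutral_left) (use assms in \<open>auto simp: in_keys_iff\<close>)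

lemma plin_lext:
  fixes h :: "'a \<Rightarrow> ('b \<Rightarrow>\<^sub>0 'f::field)"
  shows "plin (lext h)"
proof (rule plinI)
  fix p q :: "'a \<Rightarrow>\<^sub>0 'f"
  define S where "S = ks p \<union> ks q"
  have S: "finite S" "ks p \<subseteq> S" "ks q \<subseteq> S" "ks (p + q) \<subseteq> S"
    using keys_add[of p q] by (auto simp: S_def)
  show "lext h (p + q) = lext h p + lext h q"
    unfolding lext_superset[OF S(1,2)] lext_superset[OF S(1,3)] lext_superset[OF S(1,4)]
    by (simp add: lookup_add pm.scale_left_distrib sum.distrib)
next
  fix c and p :: "'a \<Rightarrow>\<^sub>0 'f"
  show "lext h (psc c p) = psc c (lext h p)"
    by (subst lext_superset[where p = "psc c p", OF finite_keys[of p] keys_psc[of c p]])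
      (simp only: lext_def[of h p] pm.scale_sum_right lk_psc pm.scale_scale)
qed

lemma lext_sng [simp]: "lext h (sng x c) = psc c (h x)"
  by (simp add: lext_def)

lemma keys_lext: "ks (lext h p) \<subseteq> (\<Union>x\<in>ks p. ks (h x))"
  unfolding lext_def
  by (rule order_trans[OF keys_sum]) (intro UN_mono order_refl keys_psc)

lemma keys_sumI: "(\<And>i. i \<in> I \<Longrightarrow> ks (f i) \<subseteq> K) \<Longrightarrow> ks (sum f I) \<subseteq> K"
  using keys_sum[of f I] by blast

lemma keys_addI: "ks a \<subseteq> K \<Longrightarrow> ks b \<subseteq> K \<Longrightarrow> ks (a + b) \<subseteq> K"
  using keys_add[of a b] by blast

lemma keys_diffI: "ks (a::_ \<Rightarrow>\<^sub>0 'f::field) \<subseteq> K \<Longrightarrow> ks b \<subseteq> K \<Longrightarrow> ks (a - b) \<subseteq> K"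
  by (auto simp: in_keys_iff lookup_minus subset_iff) (metis diff_zero)


section \<open>Monoid algebras\<close>

lemma monoid_algebra_sel [simp]:
  "carrier (monoid_algebra G) = {p. ks p \<subseteq> carrier G}"
  "one (monoid_algebra G) = sng \<one>\<^bsub>G\<^esub> 1"
  "zero (monoid_algebra G) = 0"
  "add (monoid_algebra G) = (+)"
  "smult (monoid_algebra G) = psc"
  by (auto simp: monoid_algebra_def psc_def)

lemma mult_monoid_algebra:
  "p \<otimes>\<^bsub>monoid_algebra G\<^esub> q = lext (\<lambda>x. lext (\<lambda>y. sng (x \<otimes>\<^bsub>G\<^esub> y) 1) q) p"
  by (simp add: monoid_algebra_def lext_def pm.scale_sum_right)

lemma mult_monoid_algebra_sng [simp]:
  "sng x c \<otimes>\<^bsub>monoid_algebra G\<^esub> sng y d = sng (x \<otimes>\<^bsub>G\<^esub> y) (c * d)"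
  by (simp add: mult_monoid_algebra)

lemma plin_mult_left: "plin (\<lambda>p. p \<otimes>\<^bsub>monoid_algebra G\<^esub> q)"
  unfolding mult_monoid_algebra by (rule plin_lext)

lemma plin_mult_right: "plin (\<lambda>q. p \<otimes>\<^bsub>monoid_algebra G\<^esub> q)"
  unfolding mult_monoid_algebra
  by (rule plinI)
    (simp_all add: lext_def[of _ p] plin_add[OF plin_lext] plin_psc[OF plin_lext] pm.scale_right_distrib
       sum.distrib pm.scale_sum_right mult.commute)

lemma keys_mult_monoid_algebra:
  "ks (p \<otimes>\<^bsub>monoid_algebra G\<^esub> q) \<subseteq> (\<lambda>(x, y). x \<otimes>\<^bsub>G\<^esub> y) ` (ks p \<times> ks q)"
proof -
  have "ks (lext (\<lambda>y. sng (x \<otimes>\<^bsub>G\<^esub> y) 1) q) \<subseteq> (\<lambda>y. x \<otimes>\<^bsub>G\<^esub> y) ` ks q" for x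
    using keys_lext[of "\<lambda>y. sng (x \<otimes>\<^bsub>G\<^esub> y) (1::'b)" q] by auto
  then show ?thesis
    unfolding mult_monoid_algebra
    using keys_lext[of "\<lambda>x. lext (\<lambda>y. sng (x \<otimes>\<^bsub>G\<^esub> y) 1) q" p] by fastforce
qed

lemma monoid_algebra_assoc:
  assumes "monoid G" "ks p \<subseteq> carrier G" "ks q \<subseteq> carrier G" "ks r \<subseteq> carrier G"
  shows "(p \<otimes>\<^bsub>monoid_algebra G\<^esub> q) \<otimes>\<^bsub>monoid_algebra G\<^esub> r
    = p \<otimes>\<^bsub>monoid_algebra G\<^esub> (q \<otimes>\<^bsub>monoid_algebra G\<^esub> r)"
proof -
  let ?m = "\<lambda>p q. p \<otimes>\<^bsub>monoid_algebra G\<^esub> q"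
  note L = plin_mult_left[of G] and R = plin_mult_right[of G]
  have 1: "?m (?m (sng x 1) (sng y 1)) r = ?m (sng x 1) (?m (sng y 1) r)"
    if "x \<in> carrier G" "y \<in> carrier G" for x y
    by (rule plin_eqI[where S = "carrier G" and p = r and F = "?m (?m (sng x 1) (sng y 1))"
          and G = "\<lambda>r. ?m (sng x 1) (?m (sng y 1) r)", OF R plin_comp[OF R R] assms(4)])
      (use that assms in \<open>simp add: monoid.m_assoc\<close>)
  have 2: "?m (?m (sng x 1) q) r = ?m (sng x 1) (?m q r)" if "x \<in> carrier G" for x
    by (rule plin_eqI[where S = "carrier G" and p = q and F = "\<lambda>q. ?m (?m (sng x 1) q) r"
          and G = "\<lambda>q. ?m (sng x 1) (?m q r)", OF plin_comp[OF L R] plin_comp[OF R L] assms(3)])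
      (use that 1 in blast)
  show ?thesis
    by (rule plin_eqI[where S = "carrier G" and p = p and F = "\<lambda>p. ?m (?m p q) r"
          and G = "\<lambda>p. ?m p (?m q r)", OF plin_comp[OF L L] L assms(2)])
      (use 2 in blast)
qed

lemma plin_id: "plin (\<lambda>x. x)"
  by (rule plinI) auto

lemma ring_monoid_algebra:
  assumes "monoid G"
  shows "ring (monoid_algebra G :: ('f::field, _) module)"
proof (rule ringI)
  let ?A = "monoid_algebra G :: ('f, 'a \<Rightarrow>\<^sub>0 'f) module"
  show "abelian_group ?A"
  proof (rule abelian_groupI)
    show "\<exists>y\<in>carrier ?A. y \<oplus>\<^bsub>?A\<^esub> x = \<zero>\<^bsub>?A\<^esub>" if "x \<in> carrier ?A" for x
      by (rule bexI[of _ "- x"]) (use that in auto)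
    show "x \<oplus>\<^bsub>?A\<^esub> y \<in> carrier ?A" if "x \<in> carrier ?A" "y \<in> carrier ?A" for x y
      using that keys_addI[of x "carrier G" y] by simp
  qed (auto simp: algebra_simps)
  have m1: "sng \<one>\<^bsub>G\<^esub> 1 \<otimes>\<^bsub>?A\<^esub> x = x" if "ks x \<subseteq> carrier G" for x
    by (rule plin_eqI[where S = "carrier G" and p = x and G = "\<lambda>x. x", OF plin_mult_right plin_id that])
      (use assms in \<open>simp add: monoid.l_one\<close>)
  have m2: "x \<otimes>\<^bsub>?A\<^esub> sng \<one>\<^bsub>G\<^esub> 1 = x" if "ks x \<subseteq> carrier G" for x
    by (rule plin_eqI[where S = "carrier G" and p = x and G = "\<lambda>x. x", OF plin_mult_left plin_id that])
      (use assms in \<open>simp add: monoid.r_one\<close>)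
  have cl: "ks (x \<otimes>\<^bsub>?A\<^esub> y) \<subseteq> carrier G" if "ks x \<subseteq> carrier G" "ks y \<subseteq> carrier G" for x y
    by (rule order_trans[OF keys_mult_monoid_algebra]) (use that monoid.m_closed[OF assms] in auto)
  show "monoid ?A"
    by (rule monoidI) (use m1 m2 cl monoid_algebra_assoc[OF assms] assms in \<open>auto simp: monoid.one_closed\<close>)
  show "(x \<oplus>\<^bsub>?A\<^esub> y) \<otimes>\<^bsub>?A\<^esub> z = x \<otimes>\<^bsub>?A\<^esub> z \<oplus>\<^bsub>?A\<^esub> y \<otimes>\<^bsub>?A\<^esub> z" for x y z
    using plin_add[OF plin_mult_left[of G z]] by simp
  show "z \<otimes>\<^bsub>?A\<^esub> (x \<oplus>\<^bsub>?A\<^esub> y) = z \<otimes>\<^bsub>?A\<^esub> x \<oplus>\<^bsub>?A\<^esub> z \<otimes>\<^bsub>?A\<^esub> y" for x y z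
    using plin_add[OF plin_mult_right[of G z]] by simp
qed

lemma keys_mult_monoid_algebraI:
  "monoid G \<Longrightarrow> ks p \<subseteq> carrier G \<Longrightarrow> ks q \<subseteq> carrier G \<Longrightarrow> ks (p \<otimes>\<^bsub>monoid_algebra G\<^esub> q) \<subseteq> carrier G"
  by (rule order_trans[OF keys_mult_monoid_algebra]) (auto intro!: monoid.m_closed)


section \<open>The group algebra of finitary permutations\<close>

text \<open>Composition is written additively because the product of \<open>poly_mapping\<close> is
  the convolution over an additive monoid: thus \<open>*\<close> on functions on
  \<open>fperm\<close> is the product of the group algebra. The class \<open>group_add\<close> does
  not demand commutativity.\<close>

typedef fperm = "{p :: nat \<Rightarrow> nat. permutation p}" morphisms ap Ap
  using permutation_id by blast

setup_lifting type_definition_fperm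

instantiation fperm :: group_add
begin
lift_definition zero_fperm :: fperm is id by (rule permutation_id)
lift_definition plus_fperm :: "fperm \<Rightarrow> fperm \<Rightarrow> fperm" is "(\<circ>)" by (rule permutation_compose)
lift_definition uminus_fperm :: "fperm \<Rightarrow> fperm" is inv' by (rule permutation_inverse)
definition minus_fperm :: "fperm \<Rightarrow> fperm \<Rightarrow> fperm" where "minus_fperm a b = a + - b"
instance
proof
  fix a b c :: fperm
  show "a + b + c = a + (b + c)" by transfer auto
  show "0 + a = a" "a + 0 = a" by (transfer; simp)+
  show "- a + a = 0" by transfer (simp add: permutation_bijective bij_is_inj)
  show "a + - b = a - b" by (simp add: minus_fperm_def)
qed
end

lemma ap_plus: "ap (a + b) x = ap a (ap b x)"
  and ap_0 [simp]: "ap 0 x = x"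
  by (transfer; simp)+

lemma ap_uminus [simp]: "ap (- a) (ap a x) = x" "ap a (ap (- a) x) = x"
  by (metis ap_plus ap_0 left_minus right_minus)+

lemma ap_eq_iff [simp]: "ap a x = ap a y \<longleftrightarrow> x = y"
  by (metis ap_uminus(1))

lemma ap_uminus_fun: "ap (- a) = inv' (ap a)"
  by (simp add: uminus_fperm.rep_eq)

lemma fperm_eqI: "(\<And>x. ap a x = ap b x) \<Longrightarrow> a = b"
  by (metis ap_inject ext)

lemma bij_ap: "bij (ap a)"
  using ap[of a] permutation_bijective by auto

definition psgn :: "fperm \<Rightarrow> 'f::field_char_0" where
  "psgn a = of_int (sign (ap a))"

lemma psgn_add: "psgn (a + b) = psgn a * psgn b"
  using ap[of a] ap[of b] by (simp add: psgn_def plus_fperm.rep_eq sign_compose)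

lemma psgn_sq [simp]: "psgn a * psgn a = 1"
  by (simp add: psgn_def flip: of_int_mult)

section \<open>Permutations supported on a set, and Young subgroups\<close>

definition Sym :: "nat set \<Rightarrow> fperm set" where
  "Sym X = {a. ap a permutes X}"

lemma ap_Ap: "p permutes X \<Longrightarrow> finite X \<Longrightarrow> ap (Ap p) = p"
  by (metis Ap_inverse mem_Collect_eq permutation_permutes)

lemma finite_Sym: "finite X \<Longrightarrow> finite (Sym X)"
  by (rule finite_imageD[of ap]) (auto simp: Sym_def ap_inject inj_on_def
      intro: finite_subset[OF _ finite_permutations])

lemma Sym_in: "a \<in> Sym X \<Longrightarrow> ap a x \<in> X \<longleftrightarrow> x \<in> X"
  by (simp add: Sym_def permutes_in_image)

lemma Sym_out: "a \<in> Sym X \<Longrightarrow> x \<notin> X \<Longrightarrow> ap a x = x"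
  by (simp add: Sym_def permutes_not_in)

lemma Sym_iff: "a \<in> Sym X \<longleftrightarrow> (\<forall>x. x \<notin> X \<longrightarrow> ap a x = x)"
  using bij_ap[of a] by (auto simp: Sym_def bij_imp_permutes permutes_def bij_iff)

definition subgrp :: "fperm set \<Rightarrow> bool" where
  "subgrp H \<longleftrightarrow> finite H \<and> 0 \<in> H \<and> (\<forall>a\<in>H. \<forall>b\<in>H. a + b \<in> H) \<and> (\<forall>a\<in>H. - a \<in> H)"

lemma subgrpD:
  assumes "subgrp H"
  shows "finite H" "0 \<in> H" "a \<in> H \<Longrightarrow> b \<in> H \<Longrightarrow> a + b \<in> H" "a \<in> H \<Longrightarrow> - a \<in> H"
  using assms by (auto simp: subgrp_def)

text \<open>The Young subgroup of the colouring \<open>r\<close>: the row group of a tableau if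
  \<open>r\<close> is the row coordinate, the column group if it is the column coordinate. Arbitrary
  colourings are needed for the letters of a word.\<close>

definition Stab :: "nat set \<Rightarrow> (nat \<Rightarrow> 'c) \<Rightarrow> fperm set" where
  "Stab X r = {a \<in> Sym X. \<forall>x\<in>X. r (ap a x) = r x}"

lemma Sym_0 [simp]: "0 \<in> Sym X" by (simp add: Sym_iff)
lemma Sym_add: "a \<in> Sym X \<Longrightarrow> b \<in> Sym X \<Longrightarrow> a + b \<in> Sym X" by (simp add: Sym_iff ap_plus)
lemma Sym_uminus: "a \<in> Sym X \<Longrightarrow> - a \<in> Sym X" by (metis Sym_iff ap_uminus(1))
lemma Sym_mono: "X \<subseteq> Y \<Longrightarrow> a \<in> Sym X \<Longrightarrow> a \<in> Sym Y" by (auto simp: Sym_iff)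

lemma subgrp_Sym: "finite X \<Longrightarrow> subgrp (Sym X)"
  by (auto simp: subgrp_def finite_Sym Sym_add Sym_uminus)

lemma subgrp_Stab: "finite X \<Longrightarrow> subgrp (Stab X r)"
  unfolding subgrp_def Stab_def
  by (auto simp: finite_Sym Sym_add Sym_uminus ap_plus Sym_in) (metis Sym_in Sym_uminus ap_uminus(2))

lemma Stab_Sym: "a \<in> Stab X r \<Longrightarrow> a \<in> Sym X" by (simp add: Stab_def)

lemma Sym_eq_Stab: "Sym X = Stab X (\<lambda>_. 0::nat)" by (simp add: Stab_def)

text \<open>Scalars are the multiples \<open>sng 0 c\<close> of the identity permutation, and these
  are central.\<close>

lemma psc_mult [simp]:
  fixes x y :: "fperm \<Rightarrow>\<^sub>0 'f::field"
  shows "psc c x * y = psc c (x * y)" "x * psc c y = psc c (x * y)"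
proof -
  have 0: "psc c z = sng 0 c * z" for c and z :: "fperm \<Rightarrow>\<^sub>0 'f"
    by (simp add: psc_def mult_map_scale_conv_mult)
  have comm: "sng 0 c * (sng 0 d * z) = sng 0 d * (sng 0 c * z)" for d and z :: "fperm \<Rightarrow>\<^sub>0 'f"
    unfolding mult.assoc[symmetric] by (simp add: mult_single mult.commute)
  have 1: "sng 0 c * z = z * sng 0 c" for z :: "fperm \<Rightarrow>\<^sub>0 'f"
  proof (rule plin_eqI[where S = UNIV and p = z and F = "\<lambda>z. sng 0 c * z" and G = "\<lambda>z. z * sng 0 c"])
    show "plin (\<lambda>z::fperm \<Rightarrow>\<^sub>0 'f. sng 0 c * z)"
      by (rule plinI) (simp_all only: distrib_left 0 comm)
    show "plin (\<lambda>z::fperm \<Rightarrow>\<^sub>0 'f. z * sng 0 c)"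
      by (rule plinI) (simp_all only: distrib_right 0 mult.assoc)
  qed (auto simp: mult_single mult.commute)
  show "psc c x * y = psc c (x * y)" by (simp add: 0 mult.assoc)
  show "x * psc c y = psc c (x * y)" by (metis 0 1 mult.assoc)
qed

lemma plin_times: "plin (\<lambda>x::fperm \<Rightarrow>\<^sub>0 'f::field. a * x)" "plin (\<lambda>x::fperm \<Rightarrow>\<^sub>0 'f::field. x * a)"
  by (auto intro!: plinI simp: algebra_simps)

abbreviation dl :: "fperm \<Rightarrow> (fperm \<Rightarrow>\<^sub>0 'f::field_char_0)" where "dl a \<equiv> sng a 1"

lemma dl_mult: "dl a * dl b = dl (a + b)" by (simp add: mult_single)

lemma dl_0: "dl 0 = 1" by simp

lemma dl_inv [simp]: "dl a * dl (- a) = 1" "dl (- a) * dl a = 1"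
  by (simp_all add: dl_mult)

lemma lk_mult_dl:
  fixes x :: "fperm \<Rightarrow>\<^sub>0 'f::field_char_0"
  shows "lk (dl a * x) b = lk x (- a + b)" "lk (x * dl a) b = lk x (b - a)"
proof -
  have x: "x = (\<Sum>y\<in>ks x. psc (lk x y) (dl y))" by (rule poly_mapping_expand) auto
  have 1: "a + y = b \<longleftrightarrow> y = - a + b" "y + a = b \<longleftrightarrow> y = b - a" for y
    by (auto simp: algebra_simps)
  have 2: "(\<Sum>y\<in>ks x. lk x y * (if y = c then 1 else 0)) = lk x c" for c
    by (auto simp: in_keys_iff if_distrib[of "(*) _"] sum.delta cong: if_cong)
  have "lk (dl a * x) b = lk (\<Sum>y\<in>ks x. psc (lk x y) (dl a * dl y)) b"
    using plin_sum[OF plin_times(1), of "dl a" "\<lambda>y. psc (lk x y) (dl y)" "ks x"] x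
    by (simp only: psc_mult)
  also have "\<dots> = (\<Sum>y\<in>ks x. lk x y * (if y = - a + b then 1 else 0))"
    unfolding lookup_sum by (intro sum.cong) (auto simp: mult_single lookup_single when_def 1)
  finally show "lk (dl a * x) b = lk x (- a + b)" by (simp only: 2)
  have "lk (x * dl a) b = lk (\<Sum>y\<in>ks x. psc (lk x y) (dl y * dl a)) b"
    using plin_sum[OF plin_times(2), of "\<lambda>y. psc (lk x y) (dl y)" "ks x" "dl a"] x
    by (simp only: psc_mult)
  also have "\<dots> = (\<Sum>y\<in>ks x. lk x y * (if y = b - a then 1 else 0))"
    unfolding lookup_sum by (intro sum.cong) (auto simp: mult_single lookup_single when_def 1)
  finally show "lk (x * dl a) b = lk x (b - a)" by (simp only: 2)
qed

text \<open>Up to normalization the idempotent of the character \<chi> of H: a symmetrizer for the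
  trivial character, an antisymmetrizer for the sign.\<close>

definition gsum :: "fperm set \<Rightarrow> (fperm \<Rightarrow> 'f) \<Rightarrow> (fperm \<Rightarrow>\<^sub>0 'f::field_char_0)" where
  "gsum H \<chi> = (\<Sum>a\<in>H. psc (\<chi> a) (dl a))"

lemma lk_gsum: "finite H \<Longrightarrow> lk (gsum H \<chi>) a = (if a \<in> H then \<chi> a else 0)"
  by (simp add: gsum_def lookup_sum lookup_single when_def if_distrib[of "(*) _"] cong: if_cong)

text \<open>Both characters take values of square 1 and are constant on conjugacy classes, so
  inverses and conjugates can be ignored.\<close>

definition pchar :: "(fperm \<Rightarrow> 'f::field_char_0) \<Rightarrow> bool" where
  "pchar \<chi> \<longleftrightarrow> \<chi> = (\<lambda>_. 1) \<or> \<chi> = psgn"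

lemma pchar_simps [simp]: "pchar (\<lambda>_. 1)" "pchar psgn" by (auto simp: pchar_def)

lemma pchar_add: "pchar \<chi> \<Longrightarrow> \<chi> (a + b) = \<chi> a * \<chi> b"
  and pchar_sq: "pchar \<chi> \<Longrightarrow> \<chi> a * \<chi> a = 1"
  by (auto simp: pchar_def psgn_add)

lemma pchar_0: "pchar \<chi> \<Longrightarrow> \<chi> 0 = 1"
  by (metis pchar_add pchar_sq add.left_neutral)

lemma pchar_uminus: "pchar \<chi> \<Longrightarrow> \<chi> (- a) = \<chi> a"
  by (metis (no_types) mult.assoc mult.left_neutral mult.right_neutral pchar_0 pchar_add pchar_sq right_minus)

lemma pchar_conj: "pchar \<chi> \<Longrightarrow> \<chi> (b + a + - b) = \<chi> a"
  using pchar_sq[of \<chi> b] by (simp add: pchar_add pchar_uminus mult.commute mult.left_commute del: add_uminus_conv_diff)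

lemma gsum_absorb:
  assumes "subgrp H" "pchar \<chi>" "a \<in> H"
  shows "dl a * gsum H \<chi> = psc (\<chi> a) (gsum H \<chi>)" "gsum H \<chi> * dl a = psc (\<chi> a) (gsum H \<chi>)"
proof -
  note H = subgrpD[OF assms(1)]
  have 1: "- a + b \<in> H \<longleftrightarrow> b \<in> H" for b
    using H(3)[of a "- a + b"] H(3)[of "- a" b] H(4) assms(3) by (auto simp flip: add.assoc)
  have 2: "b - a \<in> H \<longleftrightarrow> b \<in> H" for b
    using H(3)[of "b - a" a] H(3)[of b "- a"] H(4) assms(3) by auto
  have 3: "\<chi> (- a + b) = \<chi> a * \<chi> b" "\<chi> (b - a) = \<chi> a * \<chi> b" for b
    using pchar_add[OF assms(2), of b "- a"]
    by (simp_all add: pchar_add[OF assms(2)] pchar_uminus[OF assms(2)])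
  show "dl a * gsum H \<chi> = psc (\<chi> a) (gsum H \<chi>)" "gsum H \<chi> * dl a = psc (\<chi> a) (gsum H \<chi>)"
    by (auto intro!: poly_mapping_eqI simp: lk_mult_dl lk_gsum H(1) 1 2 3)
qed

text \<open>The order of H is invertible in characteristic 0, so a symmetrizer may shed or absorb
  the symmetrizers of its subgroups at the cost of a nonzero scalar.\<close>

lemma gsum_mult_sub:
  assumes "subgrp H" "subgrp K" "H \<subseteq> K" "pchar \<chi>"
  shows "gsum H \<chi> * gsum K \<chi> = psc (of_nat (card H)) (gsum K \<chi>)"
    "gsum K \<chi> * gsum H \<chi> = psc (of_nat (card H)) (gsum K \<chi>)"
proof -
  have *: "psc (\<chi> a) (dl a) * gsum K \<chi> = gsum K \<chi>" "gsum K \<chi> * psc (\<chi> a) (dl a) = gsum K \<chi>"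
    if "a \<in> H" for a
    unfolding psc_mult gsum_absorb[OF assms(2,4) subsetD[OF assms(3) that]]
    by (simp_all add: pchar_sq[OF assms(4)] del: psc_mult)
  have c: "(\<Sum>a\<in>H. gsum K \<chi>) = psc (of_nat (card H)) (gsum K \<chi>)"
    by (rule poly_mapping_eqI) (simp add: lookup_sum del: sum_constant sum_constant_scale, simp)
  show "gsum H \<chi> * gsum K \<chi> = psc (of_nat (card H)) (gsum K \<chi>)"
    unfolding gsum_def[of H] sum_distrib_right c[symmetric] by (rule sum.cong) (use * in auto)
  show "gsum K \<chi> * gsum H \<chi> = psc (of_nat (card H)) (gsum K \<chi>)"
    unfolding gsum_def[of H] sum_distrib_left c[symmetric] by (rule sum.cong) (use * in auto)
qed

lemma subgrp_card: "subgrp H \<Longrightarrow> (of_nat (card H) :: 'f::field_char_0) \<noteq> 0"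
  using subgrpD(1,2)[of H] by (auto simp: card_gt_0_iff)

lemma conj_inj: "a + b - a = a + c - a \<longleftrightarrow> b = (c::fperm)"
  by (metis add_diff_cancel add_left_cancel diff_add_cancel)

lemma gsum_conj:
  assumes "pchar \<chi>"
  shows "dl a * gsum H \<chi> = gsum ((\<lambda>b. a + b - a) ` H) \<chi> * dl a"
proof -
  have "gsum ((\<lambda>b. a + b - a) ` H) \<chi> * dl a = (\<Sum>b\<in>H. psc (\<chi> (a + b - a)) (dl (a + b - a))) * dl a"
    unfolding gsum_def by (subst sum.reindex) (auto simp: inj_on_def conj_inj)
  also have "\<dots> = (\<Sum>b\<in>H. psc (\<chi> b) (dl (a + b)))"
    using pchar_conj[OF assms, of a] by (simp add: sum_distrib_right mult_single add.assoc)
  finally show ?thesis by (simp add: gsum_def sum_distrib_left mult_single)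
qed

lemma Stab_conj: "(\<lambda>b. a + b - a) ` Stab X r = Stab (ap a ` X) (\<lambda>x. r (ap (- a) x))"
proof (intro equalityI subsetI)
  fix b assume "b \<in> (\<lambda>b. a + b - a) ` Stab X r"
  then show "b \<in> Stab (ap a ` X) (\<lambda>x. r (ap (- a) x))"
    by (auto simp: Stab_def Sym_iff ap_plus simp del: add_uminus_conv_diff simp flip: add_uminus_conv_diff)
      (metis ap_uminus(2) imageI)
next
  fix b assume b: "b \<in> Stab (ap a ` X) (\<lambda>x. r (ap (- a) x))"
  have "ap (- a) (ap b (ap a x)) = x" if "x \<notin> X" for x
    using b that by (auto simp: Stab_def Sym_iff image_iff) (metis ap_eq_iff ap_uminus(1))
  then have "- a + b + a \<in> Stab X r"
    using b by (auto simp: Stab_def Sym_iff ap_plus)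
  then have "a + (- a + b + a) - a \<in> (\<lambda>b. a + b - a) ` Stab X r" by blast
  moreover have "a + (- a + b + a) - a = b"
    unfolding diff_conv_add_uminus add.assoc by simp
  ultimately show "b \<in> (\<lambda>b. a + b - a) ` Stab X r" by simp
qed

lemma gsum_Stab_conj:
  "pchar \<chi> \<Longrightarrow> dl a * gsum (Stab X r) \<chi> = gsum (Stab (ap a ` X) (\<lambda>x. r (ap (- a) x))) \<chi> * dl a"
  by (simp add: gsum_conj Stab_conj)

lemma Stab_cong: "X = X' \<Longrightarrow> (\<And>x. x \<in> X' \<Longrightarrow> r x = r' x) \<Longrightarrow> Stab X r = Stab X' r'"
  by (auto simp: Stab_def Sym_in)

text \<open>The antiautomorphism that inverts permutations. Together with the coefficient of the
  identity it provides the bilinear form behind the positivity argument, and it turns row-column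
  products into column-row products.\<close>

definition star :: "(fperm \<Rightarrow>\<^sub>0 'f) \<Rightarrow> (fperm \<Rightarrow>\<^sub>0 'f::field_char_0)" where
  "star = lext (\<lambda>a. dl (- a))"

lemma plin_star: "plin star" by (simp add: star_def plin_lext)

lemma star_dl [simp]: "star (dl a) = dl (- a)" by (simp add: star_def)

lemma star_sng [simp]: "star (sng a c) = sng (- a) c" by (simp add: star_def)

lemma star_mult: "star (x * y) = star y * star x"
proof -
  have "star (dl a * y) = star y * star (dl a)" for a
    by (rule plin_eqI[where S = UNIV and p = y and F = "\<lambda>y. star (dl a * y)" and G = "\<lambda>y. star y * star (dl a)"])
      (auto intro!: plin_comp[OF plin_star plin_times(1)] plin_comp[OF plin_times(2) plin_star]
        simp: mult_single minus_add)
  then show ?thesis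
    by (intro plin_eqI[where S = UNIV and p = x and F = "\<lambda>x. star (x * y)" and G = "\<lambda>x. star y * star x"])
      (auto intro!: plin_comp[OF plin_star plin_times(2)] plin_comp[OF plin_times(1) plin_star])
qed

lemma star_star [simp]: "star (star x) = x"
  by (rule plin_eqI[where S = UNIV and p = x and F = "\<lambda>x. star (star x)" and G = "\<lambda>x. x"])
    (auto intro!: plin_id plin_comp[OF plin_star plin_star])

lemma lk_star: "lk (star x) a = lk x (- a)"
proof -
  have "lk (star x) a = (\<Sum>y\<in>ks x. lk x y * (if y = - a then 1 else 0))"
    unfolding star_def lext_def lookup_sum
    by (intro sum.cong) (auto simp: lookup_single when_def minus_equation_iff)
  also have "\<dots> = lk x (- a)"
    by (auto simp: in_keys_iff if_distrib[of "(*) _"] sum.delta cong: if_cong)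
  finally show ?thesis .
qed

lemma star_gsum:
  assumes "subgrp H" "pchar \<chi>" shows "star (gsum H \<chi>) = gsum H \<chi>"
  using subgrpD[OF assms(1)] pchar_uminus[OF assms(2)]
  by (intro poly_mapping_eqI) (auto simp: lk_star lk_gsum, metis minus_minus)

section \<open>Young symmetrizers\<close>

abbreviation Rs :: "nat set \<Rightarrow> (nat \<Rightarrow> 'c) \<Rightarrow> (fperm \<Rightarrow>\<^sub>0 'f::field_char_0)" where
  "Rs X r \<equiv> gsum (Stab X r) (\<lambda>_. 1)"

abbreviation Cs :: "nat set \<Rightarrow> (nat \<Rightarrow> 'c) \<Rightarrow> (fperm \<Rightarrow>\<^sub>0 'f::field_char_0)" where
  "Cs X c \<equiv> gsum (Stab X c) psgn"

text \<open>Unlike in \<^const>\<open>is_tableau\<close>, a tableau is given by the row and column coordinates of its entries.\<close>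

definition tab :: "nat set \<Rightarrow> (nat \<Rightarrow> nat) \<Rightarrow> (nat \<Rightarrow> nat) \<Rightarrow> (nat \<Rightarrow> nat) \<Rightarrow> bool" where
  "tab Y r c \<nu> \<longleftrightarrow> finite Y \<and> \<nu> \<in> partitions \<and> bij_betw (\<lambda>x. (r x, c x)) Y (cells \<nu>)"

definition GA :: "nat set \<Rightarrow> (fperm \<Rightarrow>\<^sub>0 'f::field_char_0) set" where
  "GA Y = {x. ks x \<subseteq> Sym Y}"

lemma GA_mult: "x \<in> GA Y \<Longrightarrow> y \<in> GA Y \<Longrightarrow> x * y \<in> GA Y"
  unfolding GA_def mem_Collect_eq
  by (rule order_trans[OF keys_mult]) (auto simp: subset_iff intro: Sym_add)

lemma GA_dl: "a \<in> Sym Y \<Longrightarrow> dl a \<in> GA Y" by (simp add: GA_def)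
lemma GA_psc: "x \<in> GA Y \<Longrightarrow> psc c x \<in> GA Y" using keys_psc[of c x] by (auto simp: GA_def)
lemma GA_add: "x \<in> GA Y \<Longrightarrow> y \<in> GA Y \<Longrightarrow> x + y \<in> GA Y" by (simp add: GA_def keys_addI)
lemma GA_diff: "x \<in> GA Y \<Longrightarrow> y \<in> GA Y \<Longrightarrow> x - y \<in> GA Y" by (simp add: GA_def keys_diffI)
lemma GA_sum: "(\<And>i. i \<in> I \<Longrightarrow> f i \<in> GA Y) \<Longrightarrow> sum f I \<in> GA Y" by (simp add: GA_def keys_sumI)
lemma GA_1: "1 \<in> GA Y" and GA_0: "0 \<in> GA Y" by (auto simp: GA_def)
lemma GA_mono: "X \<subseteq> Y \<Longrightarrow> x \<in> GA X \<Longrightarrow> x \<in> GA Y" by (auto simp: GA_def dest: Sym_mono)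

lemma GA_gsum: "H \<subseteq> Sym Y \<Longrightarrow> gsum H \<chi> \<in> GA Y"
  unfolding gsum_def by (intro GA_sum GA_psc GA_dl) auto

lemma GA_star: "x \<in> GA Y \<Longrightarrow> star x \<in> GA Y"
  by (auto simp: GA_def in_keys_iff lk_star) (metis Sym_uminus in_keys_iff minus_minus subset_iff)

lemma GA_Stab: "gsum (Stab Y r) \<chi> \<in> GA Y"
  by (rule GA_gsum) (auto dest: Stab_Sym)

lemmas GA_intros = GA_mult GA_dl GA_psc GA_add GA_diff GA_1 GA_0 GA_star GA_Stab Sym_uminus Sym_add

lemma GA_expand: "x \<in> GA Y \<Longrightarrow> finite Y \<Longrightarrow> x = (\<Sum>a\<in>Sym Y. psc (lk x a) (dl a))"
  by (rule poly_mapping_expand) (auto simp: GA_def finite_Sym)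

lemma lk_gsum_mult:
  assumes "finite H" "finite K"
  shows "lk (gsum H \<chi> * gsum K \<psi>) d = (\<Sum>a\<in>H. \<Sum>b\<in>K. if a + b = d then \<chi> a * \<psi> b else 0)"
  unfolding gsum_def
  by (simp add: sum_distrib_left sum_distrib_right lookup_sum mult_single lookup_single when_def,
      rule sum.swap)

text \<open>The trivial intersection leaves only one way to write the identity as a product. This
  fixes the normalization of Young symmetrizers and shows that they do not vanish.\<close>

lemma lk_gsum_mult_0:
  assumes "subgrp H" "subgrp K" "H \<inter> K = {0}" "pchar \<chi>" "pchar \<psi>"
  shows "lk (gsum H \<chi> * gsum K \<psi>) 0 = 1"
proof -
  have *: "(a + b = 0) \<longleftrightarrow> a = 0 \<and> b = 0" if "a \<in> H" "b \<in> K" for a b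
  proof
    assume "a + b = 0"
    then have "b = - a" by (simp add: eq_neg_iff_add_eq_0 minus_unique)
    moreover have "b \<in> H" using \<open>b = - a\<close> that subgrpD(4)[OF assms(1)] by simp
    ultimately show "a = 0 \<and> b = 0" using that assms(3) by (metis IntI neg_equal_0_iff_equal singletonD)
  qed simp
  have "lk (gsum H \<chi> * gsum K \<psi>) 0 = (\<Sum>a\<in>H. \<Sum>b\<in>K. if b = 0 then (if a = 0 then 1 else 0) else 0)"
    unfolding lk_gsum_mult[OF subgrpD(1)[OF assms(1)] subgrpD(1)[OF assms(2)]]
    by (intro sum.cong) (auto simp: * pchar_0 assms)
  also have "\<dots> = 1"
    using subgrpD(1,2)[OF assms(1)] subgrpD(1,2)[OF assms(2)] by (simp add: sum.delta)
  finally show ?thesis .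
qed

section \<open>Column combinatorics and von Neumann's lemma\<close>

lemma partitions_mono: "\<nu> \<in> partitions \<Longrightarrow> i \<le> i' \<Longrightarrow> \<nu> i' \<le> \<nu> i"
  by (simp add: partitions_def antimonoD)

lemma partitions_finite_col: "\<nu> \<in> partitions \<Longrightarrow> {i. j < \<nu> i} = {..<card {i. j < \<nu> i}}"
proof -
  assume nu: "\<nu> \<in> partitions"
  define S where "S = {i. j < \<nu> i}"
  have fin: "finite S"
    by (rule finite_subset[of _ "{i. \<nu> i \<noteq> 0}"]) (use nu in \<open>auto simp: partitions_def S_def\<close>)
  have down: "i \<in> S \<Longrightarrow> i' \<le> i \<Longrightarrow> i' \<in> S" for i i'
    using partitions_mono[OF nu, of i' i] by (simp add: S_def)
  have "S = {..<card S}"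
  proof (cases "S = {}")
    case False
    have "S = {..Max S}"
      using Max_in[OF fin False] Max_ge[OF fin] down by blast
    then show ?thesis by (metis card_atMost lessThan_Suc_atMost)
  qed simp
  then show ?thesis by (simp add: S_def)
qed

text \<open>Exchanging the elements outside the initial segment for the missing ones lowers the sum
  strictly. Applied to the row numbers met in one column, it turns an equality of total sums into an
  equality of sets column by column.\<close>

lemma sum_distinct_nat:
  fixes S :: "nat set"
  assumes "finite S"
  shows "\<Sum>{..<card S} \<le> \<Sum>S" "\<Sum>S = \<Sum>{..<card S} \<Longrightarrow> S = {..<card S}"
proof -
  define m where "m = card S"
  define B where "B = S - {..<m}"
  define C where "C = {..<m} - S"
  have fin: "finite B" "finite C" by (auto simp: B_def C_def assms)
  have "card S = card (S \<inter> {..<m}) + card B" "m = card ({..<m} \<inter> S) + card C"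
    unfolding B_def C_def using card_Int_Diff[OF assms] card_Int_Diff[of "{..<m}"] by (simp_all add: assms)
  then have BC: "card B = card C" by (simp add: m_def Int_commute)
  have 1: "\<Sum>S = \<Sum>(S \<inter> {..<m}) + \<Sum>B" "\<Sum>{..<m} = \<Sum>(S \<inter> {..<m}) + \<Sum>C"
    unfolding B_def C_def
    using sum.Int_Diff[OF assms, of "\<lambda>x. x" "{..<m}"] sum.Int_Diff[of "{..<m}" "\<lambda>x. x" S]
    by (simp_all add: Int_commute)
  have 2: "card B * m \<le> \<Sum>B" using sum_bounded_below[of B m "\<lambda>x. x"] by (auto simp: B_def)
  have "\<Sum>C + card C = (\<Sum>x\<in>C. x + 1)" unfolding sum.distrib by simp
  also have "\<dots> \<le> card C * m" using sum_bounded_above[of C "\<lambda>x. x + 1" m] by (auto simp: C_def)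
  finally have 3: "\<Sum>C + card C \<le> card C * m" .
  then show "\<Sum>{..<card S} \<le> \<Sum>S" using 1 2 BC by (simp add: m_def[symmetric])
  assume "\<Sum>S = \<Sum>{..<card S}"
  then have "card C = 0" using 1 2 3 BC by (simp add: m_def[symmetric])
  then have "{..<m} \<subseteq> S" using fin by (auto simp: C_def)
  then show "S = {..<card S}" using assms by (metis card_lessThan card_subset_eq m_def)
qed

text \<open>The type argument carries the coefficient field, which the combinatorial parameters do
  not mention.\<close>

locale tableau =
  fixes Y :: "nat set" and r c \<nu> :: "nat \<Rightarrow> nat" and F :: "'f::field_char_0 itself"
  assumes tab: "tab Y r c \<nu>"
begin

lemma finY [simp, intro]: "finite Y" using tab by (simp add: tab_def)

lemma nu: "\<nu> \<in> partitions" using tab by (simp add: tab_def)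

lemma inj: "x \<in> Y \<Longrightarrow> y \<in> Y \<Longrightarrow> r x = r y \<Longrightarrow> c x = c y \<Longrightarrow> x = y"
  using tab by (auto simp: tab_def bij_betw_def inj_on_def)

lemma cellsI: "x \<in> Y \<Longrightarrow> c x < \<nu> (r x)"
  using tab by (auto simp: tab_def bij_betw_def cells_def)

lemma cells_ex: "j < \<nu> i \<Longrightarrow> \<exists>x\<in>Y. r x = i \<and> c x = j"
proof -
  assume "j < \<nu> i"
  then have "(i, j) \<in> (\<lambda>x. (r x, c x)) ` Y" using tab by (simp add: tab_def bij_betw_def cells_def)
  then show ?thesis by force
qed

lemma col_image: "r ` {x \<in> Y. c x = j} = {..<card {x \<in> Y. c x = j}}"
proof -
  have 1: "r ` {x \<in> Y. c x = j} = {i. j < \<nu> i}" using cellsI cells_ex by force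
  have 2: "inj_on r {x \<in> Y. c x = j}" by (auto simp: inj_on_def intro: inj)
  have 3: "card {x \<in> Y. c x = j} = card {i. j < \<nu> i}" using card_image[OF 2] 1 by simp
  show ?thesis unfolding 1 3 by (rule partitions_finite_col[OF nu])
qed

lemma Stab_inter: "Stab Y r \<inter> Stab Y c = {0}"
proof -
  have "a = 0" if "a \<in> Stab Y r" "a \<in> Stab Y c" for a
  proof (rule fperm_eqI)
    fix x show "ap a x = ap 0 x"
      using that inj[of "ap a x" x] Sym_in[of a Y x] Sym_out[of a Y x]
      by (cases "x \<in> Y") (auto simp: Stab_def)
  qed
  then show ?thesis by (auto intro: subgrpD(2) subgrp_Stab)
qed

lemma sgr [simp, intro]: "subgrp (Stab Y f)" "subgrp (Sym Y)"
  by (auto intro: subgrp_Stab subgrp_Sym)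

definition u :: "fperm \<Rightarrow>\<^sub>0 'f" where "u = Rs Y r * Cs Y c"

lemma u_GA: "u \<in> GA Y" by (simp add: u_def GA_intros)

lemma lk_u_0: "lk u 0 = 1"
  unfolding u_def by (rule lk_gsum_mult_0) (auto simp: Stab_inter)

lemma u_nz: "u \<noteq> 0" using lk_u_0 by (metis lookup_zero zero_neq_one)

lemma star_u: "star u = Cs Y c * Rs Y r" by (simp add: u_def star_mult star_gsum)

text \<open>In each column the rows of the images are distinct, so their sum is at least that of the
  original rows, which form an initial segment. The totals over all columns agree because
  \<open>a\<close> permutes Y, so there is equality in every column and a permutation within the
  columns produces the same rows.\<close>

lemma column_sort:
  assumes a: "a \<in> Sym Y"
    and inj_col: "\<And>x y. x \<in> Y \<Longrightarrow> y \<in> Y \<Longrightarrow> c x = c y \<Longrightarrow> r (ap a x) = r (ap a y) \<Longrightarrow> x = y"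
  shows "\<exists>b\<in>Stab Y c. \<forall>x\<in>Y. r (ap b x) = r (ap a x)"
proof -
  define f where "f = (\<lambda>x. r (ap a x))"
  define Yc where "Yc = (\<lambda>j. {x \<in> Y. c x = j})"
  have injf: "inj_on f (Yc j)" and injr: "inj_on r (Yc j)" for j
    using inj_col inj by (auto simp: inj_on_def Yc_def f_def)
  have finc: "finite (Yc j)" for j by (simp add: Yc_def)
  have "bij_betw (ap a) Y Y" using a permutes_imp_bij by (auto simp: Sym_def)
  then have eq: "(\<Sum>x\<in>Y. f x) = (\<Sum>x\<in>Y. r x)"
    unfolding f_def by (rule sum.reindex_bij_betw)
  have s: "(\<Sum>x\<in>Yc j. g x) = \<Sum>(g ` Yc j)" "card (g ` Yc j) = card (Yc j)" if "inj_on g (Yc j)" for g j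
    using that by (simp_all add: sum.reindex card_image)
  have le: "(\<Sum>x\<in>Yc j. r x) \<le> (\<Sum>x\<in>Yc j. f x)" for j
    using sum_distinct_nat(1)[of "f ` Yc j"] col_image[of j] finc
    by (simp add: s injf injr) (simp add: Yc_def)
  have im: "f ` Yc j = r ` Yc j" if "j \<in> c ` Y" for j
  proof -
    have "(\<Sum>j\<in>c ` Y. \<Sum>x\<in>Yc j. r x) = (\<Sum>j\<in>c ` Y. \<Sum>x\<in>Yc j. f x)"
      using eq sum.image_gen[OF finY, of r c] sum.image_gen[OF finY, of f c] by (simp add: Yc_def)
    from sum_mono_inv[OF this le that] have "(\<Sum>x\<in>Yc j. r x) = (\<Sum>x\<in>Yc j. f x)" by simp
    then show ?thesis
      using sum_distinct_nat(2)[of "f ` Yc j"] col_image[of j] finc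
      by (simp add: s injf injr) (simp add: Yc_def)
  qed
  define p where "p = (\<lambda>x. if x \<in> Y then inv_into (Yc (c x)) r (f x) else x)"
  have p: "p x \<in> Y" "c (p x) = c x" "r (p x) = f x" if "x \<in> Y" for x
  proof -
    have "f x \<in> r ` Yc (c x)" using that im[of "c x"] by (auto simp: Yc_def)
    then have "inv_into (Yc (c x)) r (f x) \<in> Yc (c x)" "r (inv_into (Yc (c x)) r (f x)) = f x"
      by (auto intro: inv_into_into f_inv_into_f)
    then show "p x \<in> Y" "c (p x) = c x" "r (p x) = f x" using that by (auto simp: p_def Yc_def)
  qed
  have "inj_on p Y"
  proof (rule inj_onI)
    fix x y assume xy: "x \<in> Y" "y \<in> Y" "p x = p y"
    then have "c x = c y" "f x = f y" using p[of x] p[of y] by auto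
    with xy show "x = y" using inj_col by (auto simp: f_def)
  qed
  then have "bij_betw p Y Y" using p endo_inj_surj[OF finY, of p] by (auto simp: bij_betw_def)
  then have pp: "p permutes Y" by (rule bij_imp_permutes) (simp add: p_def)
  then have ap: "ap (Ap p) = p" by (simp add: ap_Ap)
  show ?thesis
    by (rule bexI[of _ "Ap p"]) (use p in \<open>auto simp: ap f_def Stab_def Sym_def pp\<close>)
qed

text \<open>If \<open>a\<close> sends two entries of one column into one row, their transposition is
  absorbed with sign -1 by the column group and, after conjugation, with sign 1 by the row group, so
  the product is its own negative. Otherwise \<open>column_sort\<close> factors \<open>a\<close>
  into a row permutation times a column permutation.\<close>

lemma von_Neumann_dl:
  assumes a: "a \<in> Sym Y"
  shows "\<exists>k::'f. Rs Y r * dl a * Cs Y c = psc k u"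
proof (cases "\<exists>x\<in>Y. \<exists>y\<in>Y. x \<noteq> y \<and> c x = c y \<and> r (ap a x) = r (ap a y)")
  case True
  then obtain x y where xy: "x \<in> Y" "y \<in> Y" "x \<noteq> y" "c x = c y" "r (ap a x) = r (ap a y)" by blast
  define t where "t = Ap (transpose x y)"
  have t: "ap t = transpose x y" unfolding t_def
    by (rule ap_Ap[of _ Y]) (use xy in \<open>auto intro: permutes_swap_id\<close>)
  have tS: "t \<in> Sym Y" using xy by (auto simp: Sym_def t intro: permutes_swap_id)
  have tc: "t \<in> Stab Y c" using tS xy by (auto simp: Stab_def t transpose_def)
  have "r (ap a (ap t (ap (- a) z))) = r z" for z
  proof -
    define w where "w = ap (- a) z"
    have "z = ap a w" by (simp add: w_def)
    then show ?thesis using xy(5) by (simp add: t transpose_def)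
  qed
  moreover have "a + t - a \<in> Sym Y" using a tS
    by (metis Sym_add Sym_uminus add_uminus_conv_diff)
  ultimately have tr: "a + t - a \<in> Stab Y r"
    by (auto simp: Stab_def ap_plus simp del: add_uminus_conv_diff simp flip: add_uminus_conv_diff)
  have sg: "psgn t = - 1" using xy by (simp add: psgn_def t sign_swap_id)
  have "Rs Y r * dl a * Cs Y c = - (Rs Y r * dl a * (dl t * Cs Y c))"
    by (simp add: gsum_absorb[OF _ _ tc] sg)
  also have "\<dots> = - (Rs Y r * (dl a * dl t) * Cs Y c)" by (simp add: mult.assoc)
  also have "dl a * dl t = dl (a + t - a) * dl a" by (simp add: dl_mult)
  also have "Rs Y r * (dl (a + t - a) * dl a) = Rs Y r * dl a"
    by (simp add: gsum_absorb[OF _ _ tr] flip: mult.assoc)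
  finally have *: "Rs Y r * dl a * Cs Y c = - (Rs Y r * dl a * Cs Y c)" .
  have "2 * (Rs Y r * dl a * Cs Y c) = 0" by (subst mult_2, subst (1) *) simp
  then have "psc 2 (Rs Y r * dl a * Cs Y c) = 0" by (simp add: pm.scale_left_distrib[of 1 1, simplified] mult_2)
  then have "Rs Y r * dl a * Cs Y c = psc 0 u" by (simp add: pm.scale_eq_0_iff)
  then show ?thesis ..
next
  case False
  then obtain b where b: "b \<in> Stab Y c" "\<forall>x\<in>Y. r (ap b x) = r (ap a x)"
    using column_sort[OF a] by blast
  have bS: "b \<in> Sym Y" using b by (simp add: Stab_def)
  have "r (ap a (ap (- b) y)) = r y" if "y \<in> Y" for y
  proof -
    have "ap (- b) y \<in> Y" using that Sym_in[OF Sym_uminus[OF bS]] by simp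
    then show ?thesis using b(2) by (metis ap_uminus(2))
  qed
  then have "a - b \<in> Stab Y r"
    using a bS
    by (auto simp: Stab_def Sym_add Sym_uminus ap_plus simp del: add_uminus_conv_diff simp flip: add_uminus_conv_diff)
  from gsum_absorb(2)[OF sgr(1) _ this, of "\<lambda>_. 1"]
  have 1: "Rs Y r * dl (a - b) = Rs Y r" by simp
  have "Rs Y r * dl a * Cs Y c = Rs Y r * dl (a - b) * (dl b * Cs Y c)"
    by (simp add: dl_mult mult.assoc[symmetric]) (simp add: mult.assoc dl_mult)
  then have "Rs Y r * dl a * Cs Y c = psc (psgn b) u"
    unfolding 1 by (simp add: gsum_absorb[OF _ _ b(1)] u_def)
  then show ?thesis ..
qed

lemma von_Neumann:
  fixes x :: "fperm \<Rightarrow>\<^sub>0 'f"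
  assumes "x \<in> GA Y"
  shows "\<exists>k. Rs Y r * x * Cs Y c = psc k u"
proof -
  obtain K where K: "\<And>a. a \<in> Sym Y \<Longrightarrow> Rs Y r * dl a * Cs Y c = psc (K a :: 'f) u"
    using bchoice[of "Sym Y" "\<lambda>a k. Rs Y r * dl a * Cs Y c = psc (k :: 'f) u"] von_Neumann_dl by blast
  have "Rs Y r * x * Cs Y c = (\<Sum>a\<in>Sym Y. psc (lk x a) (Rs Y r * dl a * Cs Y c))"
    by (subst (1) GA_expand[OF assms finY]) (simp add: sum_distrib_left sum_distrib_right del: psc_sng)
  also have "\<dots> = psc (\<Sum>a\<in>Sym Y. lk x a * K a) u"
    by (simp add: K pm.scale_sum_left)
  finally show ?thesis ..
qed

text \<open>The corner of the group algebra at \<open>u\<close> is at most one-dimensional. This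
  primitivity takes the place of Schur's lemma.\<close>

lemma u_mid: "x \<in> GA Y \<Longrightarrow> \<exists>k. u * x * u = psc k u"
  using von_Neumann[of "Cs Y c * x * Rs Y r"] by (simp add: GA_intros u_def mult.assoc)

end

section \<open>Central idempotents\<close>

lemma lk_mult: "lk (x * y) b = (\<Sum>a\<in>ks x. lk x a * lk y (- a + b))"
  for x y :: "fperm \<Rightarrow>\<^sub>0 'f::field_char_0"
proof -
  have x: "x = (\<Sum>a\<in>ks x. psc (lk x a) (dl a))" by (rule poly_mapping_expand) auto
  have "x * y = (\<Sum>a\<in>ks x. psc (lk x a) (dl a * y))"
    by (subst (1) x) (simp add: sum_distrib_right del: psc_sng)
  then show ?thesis by (simp add: lookup_sum lk_mult_dl)
qed

section \<open>Rational coefficients and positivity\<close>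

definition ratl :: "(fperm \<Rightarrow>\<^sub>0 'f::field_char_0) \<Rightarrow> bool" where
  "ratl x \<longleftrightarrow> (\<forall>a. lk x a \<in> \<rat>)"

lemma ratl_mult: "ratl x \<Longrightarrow> ratl y \<Longrightarrow> ratl (x * y)"
  by (auto simp: ratl_def lk_mult)

lemma ratl_sum: "(\<And>i. i \<in> I \<Longrightarrow> ratl (f i)) \<Longrightarrow> ratl (sum f I)"
  by (auto simp: ratl_def lookup_sum)

lemma ratl_dl: "ratl (dl a)" by (auto simp: ratl_def lookup_single when_def)
lemma ratl_star: "ratl x \<Longrightarrow> ratl (star x)" by (auto simp: ratl_def lk_star)
lemma ratl_gsum: "finite H \<Longrightarrow> pchar \<chi> \<Longrightarrow> ratl (gsum H \<chi>)"
  by (auto simp: ratl_def lk_gsum pchar_def psgn_def)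

text \<open>Positivity: over the rationals \<open>x x\<^sup>*\<close> has a sum of squares as coefficient of the identity.\<close>

lemma ratl_pos:
  fixes x :: "fperm \<Rightarrow>\<^sub>0 'f::field_char_0"
  assumes "ratl x" "lk (x * star x) 0 = 0"
  shows "x = 0"
proof (rule poly_mapping_eqI)
  have "\<forall>a. \<exists>q. lk x a = of_rat q" using assms(1) by (auto simp: ratl_def Rats_def)
  then obtain q where q: "\<And>a. lk x a = of_rat (q a)" by metis
  have "of_rat (\<Sum>a\<in>ks x. q a * q a) = (\<Sum>a\<in>ks x. lk x a * lk x a)"
    unfolding of_rat_sum of_rat_mult by (simp only: q)
  also have "\<dots> = 0"
    using assms(2) by (simp add: lk_mult lk_star)
  finally have "of_rat (\<Sum>a\<in>ks x. q a * q a) = (0::'f)" .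
  then have "(\<Sum>a\<in>ks x. q a * q a) = 0" by simp
  then have "\<forall>a\<in>ks x. q a * q a = 0" by (subst (asm) sum_nonneg_eq_0_iff) auto
  then show "lk x k = lk 0 k" for k by (cases "k \<in> ks x") (auto simp: q in_keys_iff)
qed

text \<open>Conjugation by a permutation only rearranges the summands.\<close>

lemma conj_sum_central:
  assumes "finite Y" "x \<in> GA Y"
  shows "x * (\<Sum>a\<in>Sym Y. dl a * z * dl (- a)) = (\<Sum>a\<in>Sym Y. dl a * z * dl (- a)) * x"
proof -
  let ?c = "\<Sum>a\<in>Sym Y. dl a * z * dl (- a)"
  have *: "dl b * ?c = ?c * dl b" if b: "b \<in> Sym Y" for b
  proof -
    have "dl b * ?c = (\<Sum>a\<in>Sym Y. dl (b + a) * z * dl (- (b + a)) * dl b)"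
      by (simp add: sum_distrib_left mult.assoc dl_mult minus_add) (simp add: dl_mult flip: mult.assoc)
    also have "\<dots> = (\<Sum>a\<in>Sym Y. dl a * z * dl (- a) * dl b)"
      by (rule sum.reindex_bij_witness[of _ "\<lambda>a. - b + a" "\<lambda>a. b + a"])
        (use b in \<open>auto intro: Sym_add Sym_uminus simp flip: add.assoc\<close>)
    finally show ?thesis by (simp add: sum_distrib_right)
  qed
  show ?thesis
    by (subst (1 2) GA_expand[OF assms(2,1)])
      (simp add: sum_distrib_left[of ?c] sum_distrib_right[of _ _ ?c] * del: psc_sng)
qed

context tableau
begin

lemma ratl_u: "ratl u"
  unfolding u_def by (intro ratl_mult ratl_gsum subgrpD(1)) auto

text \<open>The scalar with \<open>u * u = psc h u\<close>, classically the product of the hook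
  lengths. It can be read off at the identity because \<open>u\<close> has coefficient 1
  there.\<close>

definition h :: "'f" where "h = lk (u * u) 0"

lemma u_u: "u * u = psc h u"
proof -
  obtain k where "u * 1 * u = psc k u" using u_mid[OF GA_1] by blast
  then have "u * u = psc k u" by simp
  moreover from this have "h = k" by (simp add: h_def lk_u_0)
  ultimately show ?thesis by simp
qed

lemma u_star_u: "\<exists>k. k \<noteq> 0 \<and> u * star u * u = psc k (u * u)"
proof -
  have "u * star u * u = Rs Y r * (Cs Y c * Cs Y c) * (Rs Y r * Rs Y r) * Cs Y c"
    unfolding star_u by (simp add: u_def mult.assoc)
  also have "\<dots> = psc (of_nat (card (Stab Y r)) * of_nat (card (Stab Y c))) (u * u)"
    by (simp add: gsum_mult_sub[OF sgr(1) sgr(1) order_refl]) (simp add: u_def mult.assoc)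
  finally show ?thesis
    using subgrp_card[OF sgr(1)[of r]] subgrp_card[OF sgr(1)[of c]]
    by (intro exI[of _ "of_nat (card (Stab Y r)) * of_nat (card (Stab Y c))"]) auto
qed

text \<open>If \<open>h\<close> vanished, so would \<open>u * star u * u\<close>, hence the product
  of \<open>u * star u\<close> with its own \<open>star\<close>; positivity then gives first
  \<open>u * star u = 0\<close> and next \<open>u = 0\<close>.\<close>

lemma h_nz: "h \<noteq> 0"
proof
  assume "h = (0::'f)"
  then have "u * star u * u = (0 :: fperm \<Rightarrow>\<^sub>0 'f)" using u_star_u u_u by (metis pm.scale_zero_left pm.scale_zero_right)
  then have "(u * star u) * star (u * star u) = (0 :: fperm \<Rightarrow>\<^sub>0 'f)" by (simp add: star_mult flip: mult.assoc)
  then have "u * star u = (0 :: fperm \<Rightarrow>\<^sub>0 'f)" by (intro ratl_pos) (auto intro: ratl_mult ratl_star ratl_u)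
  then have "u = (0 :: fperm \<Rightarrow>\<^sub>0 'f)" by (intro ratl_pos) (auto intro: ratl_u)
  with u_nz show False by blast
qed

text \<open>Allows a factor \<open>star u\<close> to be inserted next to \<open>u\<close>, so that
  vanishing statements pass from \<open>star u\<close> to \<open>u\<close>.\<close>

lemma u_star_u': "\<exists>k. k \<noteq> 0 \<and> u = psc k (u * star u * u)"
proof -
  obtain k where "k \<noteq> 0" "u * star u * u = psc k (psc h u)" using u_star_u u_u by metis
  then show ?thesis using h_nz by (intro exI[of _ "inverse (k * h)"]) (auto simp: field_simps)
qed

lemma star_u_u': "\<exists>k. k \<noteq> 0 \<and> star u = psc k (star u * u * star u)"
proof -
  obtain k :: 'f where k: "k \<noteq> 0" "u = psc k (u * star u * u)" using u_star_u' by blast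
  have "star u = psc k (star u * u * star u)"
    by (subst k(2)) (simp only: plin_psc[OF plin_star] star_mult star_star mult.assoc)
  with k show ?thesis by blast
qed

text \<open>The sum of the conjugates of \<open>u * star u\<close>: central, fixed by
  \<open>star\<close>, with rational coefficients, and a sum of terms that contain \<open>u\<close>
  as a factor. Divided by the scalar \<open>kap\<close> by which it acts on \<open>u\<close>, it
  becomes the central idempotent \<open>eid\<close>.\<close>

definition cen :: "fperm \<Rightarrow>\<^sub>0 'f" where
  "cen = (\<Sum>a\<in>Sym Y. dl a * (u * star u) * dl (- a))"

lemma cen_GA: "cen \<in> GA Y"
  unfolding cen_def by (intro GA_sum GA_intros u_GA)

lemma cen_central: "x \<in> GA Y \<Longrightarrow> x * cen = cen * x"
  unfolding cen_def by (rule conj_sum_central) auto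

lemma star_cen: "star cen = cen"
  unfolding cen_def by (simp add: plin_sum[OF plin_star] star_mult mult.assoc)

lemma ratl_cen: "ratl cen"
  unfolding cen_def by (intro ratl_sum ratl_mult ratl_dl ratl_u ratl_star)

lemma cen_nz: "cen \<noteq> 0"
proof
  assume *: "cen = (0 :: fperm \<Rightarrow>\<^sub>0 'f)"
  have "lk cen 0 = (\<Sum>a\<in>Sym Y. lk (u * star u :: fperm \<Rightarrow>\<^sub>0 'f) 0)"
    unfolding cen_def lookup_sum mult.assoc lk_mult_dl
    by (intro sum.cong) (simp_all add: lk_mult_dl flip: mult.assoc)
  then have "of_nat (card (Sym Y)) * lk (u * star u :: fperm \<Rightarrow>\<^sub>0 'f) 0 = 0" using * by simp
  then have "lk (u * star u :: fperm \<Rightarrow>\<^sub>0 'f) 0 = 0" using subgrp_card[OF sgr(2)] by (auto dest: subgrp_card)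
  then have "u = (0 :: fperm \<Rightarrow>\<^sub>0 'f)" by (rule ratl_pos[OF ratl_u])
  with u_nz show False by blast
qed

definition kap :: "'f" where "kap = lk (cen * u) 0"

text \<open>By centrality \<open>u * cen * u\<close> is \<open>h\<close> times
  \<open>cen * u\<close>; by primitivity it is also a multiple of \<open>u\<close>.\<close>

lemma cen_u: "cen * u = psc kap u"
proof -
  obtain k :: 'f where "u * cen * u = psc k u" using u_mid[OF cen_GA] by blast
  moreover have "u * cen * u = psc h (cen * u)" by (simp add: cen_central[OF u_GA] mult.assoc u_u)
  ultimately have "psc (inverse h) (psc h (cen * u)) = psc (inverse h) (psc k u)" by simp
  then have *: "cen * u = psc (inverse h * k) u" using h_nz by simp
  then have "kap = inverse h * k" by (simp add: kap_def lk_u_0)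
  with * show ?thesis by simp
qed

text \<open>Each summand of \<open>cen * star cen\<close> contains the factor
  \<open>cen * u\<close>, so \<open>kap = 0\<close> would contradict positivity for
  \<open>cen\<close>.\<close>

lemma kap_nz: "kap \<noteq> 0"
proof
  assume "kap = (0::'f)"
  then have *: "cen * u = (0 :: fperm \<Rightarrow>\<^sub>0 'f)" by (simp add: cen_u)
  have "cen * star cen = (\<Sum>a\<in>Sym Y. dl a * (cen * u) * star u * dl (- a) :: fperm \<Rightarrow>\<^sub>0 'f)"
    unfolding star_cen
    by (subst (2) cen_def) (simp add: sum_distrib_left GA_dl cen_central flip: mult.assoc)
  then have "cen * star cen = (0 :: fperm \<Rightarrow>\<^sub>0 'f)" by (simp add: *)
  then have "cen = (0 :: fperm \<Rightarrow>\<^sub>0 'f)" by (intro ratl_pos ratl_cen) simp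
  with cen_nz show False by blast
qed

definition eid :: "fperm \<Rightarrow>\<^sub>0 'f" where "eid = psc (inverse kap) cen"

lemma eid_GA: "eid \<in> GA Y" by (simp add: eid_def GA_psc cen_GA)
lemma eid_central: "x \<in> GA Y \<Longrightarrow> x * eid = eid * x" by (simp add: eid_def cen_central)
lemma eid_u: "eid * u = u" using kap_nz by (simp add: eid_def cen_u)
lemma u_eid: "u * eid = u" by (simp add: eid_central u_GA eid_u)

text \<open>The form in which the idempotent is used: every summand contains \<open>u\<close>, so a
  claim about \<open>eid\<close> reduces to one about the Young symmetrizer between group algebra
  elements.\<close>

lemma eid_expand: "eid = (\<Sum>a\<in>Sym Y. dl a * u * (psc (inverse kap) (star u * dl (- a))))"
  by (simp add: eid_def cen_def pm.scale_sum_right mult.assoc)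

lemma eid_idem: "eid * eid = eid"
proof -
  have "eid * eid = (\<Sum>a\<in>Sym Y. dl a * (eid * u) * (psc (inverse kap) (star u * dl (- a))))"
    by (subst (2) eid_expand) (simp add: sum_distrib_left GA_dl eid_central flip: mult.assoc)
  then show ?thesis by (simp only: eid_u eid_expand[symmetric])
qed

lemma eid_nz: "eid \<noteq> 0" using eid_u u_nz by (metis mult_zero_left)

text \<open>Minimality of the left ideal of \<open>u\<close>. Expanding \<open>eid\<close> in front
  of \<open>x * u\<close> yields a nonzero term with a factor \<open>u * w * u\<close>, which by
  primitivity is a nonzero multiple of \<open>u\<close>.\<close>

lemma left_regenerate:
  assumes "x \<in> GA Y" "x * u \<noteq> 0"
  shows "\<exists>y\<in>GA Y. y * (x * u) = u"
proof -
  have "x * u = x * eid * u" by (simp add: mult.assoc eid_u)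
  also have "\<dots> = eid * (x * u)" by (simp add: eid_central assms mult.assoc)
  also have "\<dots> = (\<Sum>a\<in>Sym Y. dl a * psc (inverse kap) (u * (star u * dl (- a) * x) * u))"
    by (simp add: eid_expand sum_distrib_right mult.assoc)
  finally obtain a where a: "a \<in> Sym Y" "u * (star u * dl (- a) * x) * u \<noteq> 0"
    using assms(2) sum.neutral by (smt (verit, best) mult_zero_right pm.scale_zero_right)
  obtain k where k: "u * (star u * dl (- a) * x) * u = psc k u"
    using u_mid[of "star u * dl (- a) * x"] assms(1) a(1) u_GA by (blast intro: GA_intros)
  with a have "k \<noteq> 0" by auto
  then have "psc (inverse k) (u * star u * dl (- a)) * (x * u) = u"
    using k by (simp add: mult.assoc)
  then show ?thesis using a(1) u_GA by (metis GA_dl GA_mult GA_psc GA_star Sym_uminus)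
qed

text \<open>Minimality of the right ideal of \<open>u\<close>, the Specht module. It makes every
  nonzero map x \<mapsto> y * u * x injective on that ideal.\<close>

lemma right_regenerate:
  assumes "x \<in> GA Y" "u * x \<noteq> 0"
  shows "\<exists>y\<in>GA Y. u * x * y = u"
proof -
  have "u * x = u * eid * x" by (simp add: u_eid)
  also have "\<dots> = u * x * eid" by (simp add: eid_central[OF assms(1)] mult.assoc)
  also have "\<dots> = (\<Sum>a\<in>Sym Y. psc (inverse kap) (u * (x * dl a) * u * (star u * dl (- a))))"
    by (simp add: eid_expand sum_distrib_left mult.assoc)
  finally obtain a where a: "a \<in> Sym Y" "u * (x * dl a) * u \<noteq> 0"
    using assms(2) sum.neutral by (smt (verit, best) mult_zero_left pm.scale_zero_right)
  obtain k where k: "u * (x * dl a) * u = psc k u"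
    using u_mid[of "x * dl a"] assms(1) a(1) by (blast intro: GA_intros)
  with a have "k \<noteq> 0" by auto
  then have "u * x * psc (inverse k) (dl a * u) = u"
    using k by (simp add: mult.assoc)
  then show ?thesis using a(1) u_GA by (metis GA_dl GA_mult GA_psc)
qed

end

lemma tab_conj:
  assumes "tab Y r c \<nu>" "tab Y r' c' \<nu>"
  shows "\<exists>a\<in>Sym Y. \<forall>x\<in>Y. r' (ap a x) = r x \<and> c' (ap a x) = c x"
proof -
  interpret A: tableau Y r c \<nu> "TYPE(rat)" by unfold_locales fact
  interpret B: tableau Y r' c' \<nu> "TYPE(rat)" by unfold_locales fact
  have "\<forall>x\<in>Y. \<exists>y. y \<in> Y \<and> r' y = r x \<and> c' y = c x" using B.cells_ex A.cellsI by blast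
  then obtain p where p: "\<And>x. x \<in> Y \<Longrightarrow> p x \<in> Y \<and> r' (p x) = r x \<and> c' (p x) = c x" by metis
  have "inj_on p Y" using p A.inj by (metis inj_onI)
  then have "bij_betw p Y Y" using p endo_inj_surj[OF A.finY, of p] by (auto simp: bij_betw_def)
  then have "bij_betw (\<lambda>x. if x \<in> Y then p x else x) Y Y" by (rule bij_betw_cong[THEN iffD1, rotated]) simp
  then have pp: "(\<lambda>x. if x \<in> Y then p x else x) permutes Y" by (rule bij_imp_permutes) simp
  show ?thesis
    by (rule bexI[of _ "Ap (\<lambda>x. if x \<in> Y then p x else x)"]) (auto simp: ap_Ap[OF pp] p Sym_def pp)
qed

lemma Sym_image: "a \<in> Sym Y \<Longrightarrow> ap a ` Y = Y"
  by (simp add: Sym_def permutes_image)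

text \<open>A change of tableau conjugates \<open>u\<close> by a permutation of Y, and
  \<open>cen\<close>, a sum over all conjugates, does not notice it.\<close>

lemma eid_unique:
  assumes "tab Y r c \<nu>" "tab Y r' c' \<nu>"
  shows "tableau.eid Y r c = (tableau.eid Y r' c' :: fperm \<Rightarrow>\<^sub>0 'f::field_char_0)"
proof -
  interpret A: tableau Y r c \<nu> "TYPE('f)" by unfold_locales fact
  interpret B: tableau Y r' c' \<nu> "TYPE('f)" by unfold_locales fact
  obtain a where a: "a \<in> Sym Y" "\<And>x. x \<in> Y \<Longrightarrow> r' (ap a x) = r x \<and> c' (ap a x) = c x"
    using tab_conj[OF assms] by blast
  have st: "Stab Y (\<lambda>x. r (ap (- a) x)) = Stab Y r'" "Stab Y (\<lambda>x. c (ap (- a) x)) = Stab Y c'"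
    using a Sym_in[OF Sym_uminus[OF a(1)]] by (auto intro!: Stab_cong) (metis ap_uminus(2))+
  have R: "dl a * Rs Y r = Rs Y r' * (dl a :: fperm \<Rightarrow>\<^sub>0 'f)"
    and C: "dl a * Cs Y c = Cs Y c' * (dl a :: fperm \<Rightarrow>\<^sub>0 'f)"
    using gsum_Stab_conj[of "\<lambda>_. 1" a Y r] gsum_Stab_conj[of psgn a Y c]
    unfolding Sym_image[OF a(1)] st by simp_all
  have u: "dl a * A.u = B.u * dl a"
    unfolding A.u_def B.u_def mult.assoc[symmetric] R unfolding mult.assoc C ..
  have B: "B.u = dl a * A.u * dl (- a)" by (simp add: u mult.assoc)
  have "B.cen = dl a * A.cen * dl (- a)"
  proof -
    have "B.cen = (\<Sum>b\<in>Sym Y. dl (b + a) * (A.u * star A.u) * dl (- (b + a)))"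
      by (simp add: B.cen_def B star_mult mult.assoc minus_add flip: dl_mult)
        (simp add: dl_mult flip: mult.assoc)
    also have "\<dots> = A.cen" unfolding A.cen_def
      by (rule sum.reindex_bij_witness[of _ "\<lambda>b. b - a" "\<lambda>b. b + a"])
        (use a in \<open>auto intro: Sym_add Sym_uminus simp del: add_uminus_conv_diff
           simp: diff_conv_add_uminus add.assoc\<close>)
    also have "\<dots> = dl a * A.cen * dl (- a)"
      by (simp add: A.cen_central[OF GA_dl[OF a(1)]] mult.assoc)
    finally show ?thesis .
  qed
  then have 1: "B.cen = A.cen" by (simp add: A.cen_central[OF GA_dl[OF a(1)]] mult.assoc)
  have "A.cen * B.u = dl a * (A.cen * A.u) * dl (- a)"
    by (simp add: B A.cen_central[OF GA_dl[OF a(1)]] flip: mult.assoc)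
  then have "A.cen * B.u = psc A.kap B.u" by (simp add: A.cen_u flip: B)
  then have "psc B.kap B.u = psc A.kap B.u" unfolding B.cen_u[symmetric] 1 .
  then have "B.kap = A.kap" using B.u_nz unfolding pm.scale_cancel_right by blast
  then show ?thesis by (simp add: A.eid_def B.eid_def 1)
qed

section \<open>The hook theorem and branching\<close>

text \<open>Think of \<open>V\<close> as the coordinates, in words over the letters \<open>0, \<dots>, p\<close>, of an \<open>SL\<close>-invariant tensor
  that is symmetric along the fibres of \<open>\<alpha>\<close> and alternating along those of \<open>\<beta>\<close>.  Contracting it with
  functionals \<open>\<xi>\<^sub>0, \<dots>, \<xi>\<^sub>p\<^sub>-\<^sub>1\<close> along the fibres of \<open>\<alpha>\<close>, invariance allows one to assume that all
  \<open>\<xi>\<^sub>i\<close> vanish on the last basis vector, whose \<open>q + 1\<close> occurrences must then share the \<open>q\<close>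
  alternating fibres.  The induction on \<open>i\<close> below is this change of basis, coefficientwise.\<close>

lemma invariant_tensor_vanishes:
  fixes V :: "(nat \<Rightarrow> nat) \<Rightarrow> 'f::field_char_0"
  assumes fin: "finite X0" "finite X1" and disj: "X0 \<inter> X1 = {}"
    and inv: "\<And>f a b. a \<le> p \<Longrightarrow> b \<le> p \<Longrightarrow> a \<noteq> b \<Longrightarrow> (\<forall>x\<in>X0 \<union> X1. f x \<le> p) \<Longrightarrow>
      (\<Sum>k\<in>{k \<in> X0 \<union> X1. f k = b}. V (f(k := a))) = 0"
    and symm: "\<And>f x y. x \<in> X0 \<Longrightarrow> y \<in> X0 \<Longrightarrow> \<alpha> x = \<alpha> y \<Longrightarrow> V (f \<circ> transpose x y) = V f"
    and alt: "\<And>f x y. x \<in> X1 \<Longrightarrow> y \<in> X1 \<Longrightarrow> x \<noteq> y \<Longrightarrow> \<beta> x = \<beta> y \<Longrightarrow> V (f \<circ> transpose x y) = - V f"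
    and content: "\<And>f. V f \<noteq> 0 \<Longrightarrow> q < card {x \<in> X0 \<union> X1. f x = p}"
    and \<alpha>: "\<And>x. x \<in> X0 \<Longrightarrow> \<alpha> x < p" and \<beta>: "\<And>x. x \<in> X1 \<Longrightarrow> \<beta> x < (q::nat)"
    and range: "\<forall>x\<in>X0 \<union> X1. f x \<le> p"
  shows "V f = 0"
proof -
  \<comment> \<open>\<open>P i\<close> is the vanishing under the restriction that positions of
    colour below \<open>i\<close> carry a letter at most their colour. The induction runs downwards:
    \<open>P p\<close> confines the letter \<open>p\<close> to X1, where the pigeonhole principle
    applies, and \<open>P 0\<close> is the unrestricted claim.\<close>
  define P where "P = (\<lambda>i. \<forall>f. (\<forall>x\<in>X0 \<union> X1. f x \<le> p) \<and> (\<forall>x\<in>X0. \<alpha> x < i \<longrightarrow> f x \<le> \<alpha> x) \<longrightarrow> V f = 0)"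
  have "P 0"
  proof (rule inc_induct[of 0 p P])
    show "0 \<le> p" by simp
    show "P p" unfolding P_def
    proof (intro allI impI, elim conjE, rule ccontr)
      fix f assume f0: "\<forall>x\<in>X0 \<union> X1. f x \<le> p" and f: "\<forall>x\<in>X0. \<alpha> x < p \<longrightarrow> f x \<le> \<alpha> x" and nz: "V f \<noteq> 0"
      have "{x \<in> X0 \<union> X1. f x = p} \<subseteq> X1" using f \<alpha> by fastforce
      then have "\<beta> ` {x \<in> X0 \<union> X1. f x = p} \<subseteq> {..<q}" using \<beta> by auto
      then have "card (\<beta> ` {x \<in> X0 \<union> X1. f x = p}) < card {x \<in> X0 \<union> X1. f x = p}"
        using content[OF nz] card_mono[of "{..<q}" "\<beta> ` {x \<in> X0 \<union> X1. f x = p}"] by simp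
      then obtain x y where xy: "x \<in> X0 \<union> X1" "y \<in> X0 \<union> X1" "f x = p" "f y = p" "x \<noteq> y" "\<beta> x = \<beta> y"
        using pigeonhole unfolding inj_on_def by blast
      then have "x \<in> X1" "y \<in> X1" using f \<alpha> by fastforce+
      then have "V (f \<circ> transpose x y) = - V f" using xy alt by blast
      moreover have "f \<circ> transpose x y = f" using xy by (auto simp: transpose_def)
      ultimately show False using nz by simp
    qed
  next
    fix i assume i: "0 \<le> i" "i < p" and IH0: "P (Suc i)"
    have IH: "V f = 0" if "\<forall>x\<in>X0 \<union> X1. f x \<le> p" "\<forall>x\<in>X0. \<alpha> x < Suc i \<longrightarrow> f x \<le> \<alpha> x" for f
      using IH0 that unfolding P_def by blast
    have "V f = 0" if "\<forall>x\<in>X0 \<union> X1. f x \<le> p" "\<forall>x\<in>X0. \<alpha> x < i \<longrightarrow> f x \<le> \<alpha> x" for f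
      using that
    \<comment> \<open>The inner induction lowers the number of positions of colour \<open>i\<close>
      whose letter exceeds \<open>i\<close>.\<close>
    proof (induction "card {x \<in> X0. \<alpha> x = i \<and> i < f x}" arbitrary: f rule: less_induct)
      case less
      show ?case
      proof (cases "\<exists>x\<in>X0. \<alpha> x = i \<and> i < f x")
        case False
        then have "\<forall>x\<in>X0. \<alpha> x < Suc i \<longrightarrow> f x \<le> \<alpha> x"
          using less.prems(2) by (metis less_SucE not_le)
        then show ?thesis using IH less.prems by blast
      next
        case True
        then obtain x where x: "x \<in> X0" "\<alpha> x = i" "i < f x" by blast
        \<comment> \<open>Invariance is applied to the word in which the offending letter at
          \<open>x\<close> has been lowered to \<open>i\<close>. The terms that raise a position of
          colour \<open>i\<close> in X0 equal \<open>V f\<close> by symmetry; every other term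
          leaves \<open>x\<close> repaired and creates no new violation, so it vanishes by
          induction. A positive multiple of \<open>V f\<close> remains.\<close>
        define w where "w = f(x := i)"
        define K where "K = {k \<in> X0 \<union> X1. w k = i}"
        define K0 where "K0 = {k \<in> X0. \<alpha> k = i \<and> w k = i}"
        have wr: "\<forall>z\<in>X0 \<union> X1. w z \<le> p" using less.prems x i by (auto simp: w_def)
        have sumz: "(\<Sum>k\<in>K. V (w(k := f x))) = 0"
          unfolding K_def by (rule inv) (use wr x less.prems i in auto)
        have K0: "V (w(k := f x)) = V f" if "k \<in> K0" for k
        proof (cases "k = x")
          case True then show ?thesis by (simp add: w_def)
        next
          case False
          then have "w(k := f x) = f \<circ> transpose x k"
            using that x by (auto simp: w_def K0_def transpose_def fun_eq_iff)
          then show ?thesis using symm[of x k f] that x by (simp add: K0_def)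
        qed
        have K1: "V (w(k := f x)) = 0" if k: "k \<in> K - K0" for k
        proof (rule less.hyps)
          have kx: "k \<noteq> x" using k x by (auto simp: K0_def w_def)
          have kX: "\<not> (k \<in> X0 \<and> \<alpha> k \<le> i)"
            using k kx less.prems(2) by (auto simp: K_def K0_def w_def)
          have "{z \<in> X0. \<alpha> z = i \<and> i < (w(k := f x)) z} \<subset> {z \<in> X0. \<alpha> z = i \<and> i < f z}"
            using x kx kX by (auto simp: w_def split: if_splits)
          then show "card {z \<in> X0. \<alpha> z = i \<and> i < (w(k := f x)) z} < card {z \<in> X0. \<alpha> z = i \<and> i < f z}"
            by (intro psubset_card_mono) (use fin in auto)
          show "\<forall>z\<in>X0 \<union> X1. (w(k := f x)) z \<le> p" using wr less.prems x by auto
          show "\<forall>z\<in>X0. \<alpha> z < i \<longrightarrow> (w(k := f x)) z \<le> \<alpha> z"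
            using less.prems(2) x kX by (auto simp: w_def)
        qed
        have "finite K" "K0 \<subseteq> K" using fin by (auto simp: K_def K0_def)
        then have "(\<Sum>k\<in>K. V (w(k := f x))) = (\<Sum>k\<in>K0. V f)"
          using K0 K1 by (intro sum.mono_neutral_cong_right) auto
        then have "of_nat (card K0) * V f = 0" using sumz by simp
        moreover have "x \<in> K0" "finite K0" using x fin by (auto simp: K0_def w_def)
        ultimately show ?thesis by (auto simp: card_gt_0_iff)
      qed
    qed
    then show "P i" unfolding P_def by blast
  qed
  then show ?thesis using range unfolding P_def by simp
qed

section \<open>Young symmetrizers as coefficient functions on words\<close>

lemma gsum_dl_commute:
  assumes "pchar \<chi>"
  shows "gsum (Stab X r) \<chi> * dl a = dl a * gsum (Stab (ap (- a) ` X) (\<lambda>x. r (ap a x))) \<chi>"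
proof -
  have "dl (- a) * gsum (Stab X r) \<chi> = gsum (Stab (ap (- a) ` X) (\<lambda>x. r (ap a x))) \<chi> * dl (- a)"
    using gsum_Stab_conj[OF assms, of "- a" X r] by simp
  then have "dl a * (dl (- a) * gsum (Stab X r) \<chi>) * dl a
      = dl a * (gsum (Stab (ap (- a) ` X) (\<lambda>x. r (ap a x))) \<chi> * dl (- a)) * dl a" by simp
  then show ?thesis by (simp add: mult.assoc dl_mult) (simp add: dl_mult flip: mult.assoc)
qed

lemma gsum_disjoint_commute:
  assumes "X0 \<inter> X1 = {}" "pchar \<chi>" "pchar \<psi>" "finite X0" "finite X1"
  shows "gsum (Stab X0 r) \<chi> * gsum (Stab X1 s) \<psi> = gsum (Stab X1 s) \<psi> * gsum (Stab X0 r) \<chi>"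
proof -
  have *: "gsum (Stab X0 r) \<chi> * dl a = dl a * gsum (Stab X0 r) \<chi>" if "a \<in> Stab X1 s" for a
  proof -
    have fx: "ap a x = x" "ap (- a) x = x" if "x \<in> X0" for x
      using that \<open>a \<in> Stab X1 s\<close> assms(1) Sym_out[of a X1 x] Sym_out[of "- a" X1 x]
      by (auto simp: Stab_def Sym_uminus)
    then have "ap (- a) ` X0 = X0" by (simp cong: image_cong)
    then show ?thesis
      unfolding gsum_dl_commute[OF assms(2)] by (metis (no_types, lifting) Stab_cong fx(1))
  qed
  show ?thesis
    unfolding gsum_def[of "Stab X1 s"]
    by (simp add: sum_distrib_left sum_distrib_right * del: psc_sng)
qed

context tableau
begin

text \<open>Let permutations act on the word \<open>r\<close> of row numbers: this is the coordinate
  of the result of \<open>x\<close> at the word \<open>f\<close>. Since the row group fixes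
  \<open>r\<close>, it is also a coefficient of \<open>x * Rs Y r\<close>.\<close>

definition wc :: "(fperm \<Rightarrow>\<^sub>0 'f) \<Rightarrow> (nat \<Rightarrow> nat) \<Rightarrow> 'f" where
  "wc x f = (\<Sum>a\<in>Sym Y. if \<forall>y\<in>Y. r (ap (- a) y) = f y then lk x a else 0)"

lemma wc_Rs: "a \<in> Sym Y \<Longrightarrow> lk (x * Rs Y r) a = wc x (\<lambda>y. r (ap (- a) y))"
proof -
  assume a: "a \<in> Sym Y"
  have "lk (x * Rs Y r) a = (\<Sum>b\<in>Stab Y r. lk x (a - b))"
    unfolding gsum_def by (simp add: sum_distrib_left lookup_sum lk_mult_dl)
  also have "\<dots> = (\<Sum>b\<in>{b \<in> Sym Y. \<forall>y\<in>Y. r (ap (- b) y) = r (ap (- a) y)}. lk x b)"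
  proof (rule sum.reindex_bij_witness[of _ "\<lambda>b. - b + a" "\<lambda>b. a - b"])
    fix b assume b: "b \<in> Stab Y r"
    show "- (a - b) + a = b" by (simp add: add.assoc)
    have "- (a - b) = b + - a" by simp
    then show "a - b \<in> {b \<in> Sym Y. \<forall>y\<in>Y. r (ap (- b) y) = r (ap (- a) y)}"
      using b a Sym_in[OF Sym_uminus[OF a]]
      by (auto simp: Stab_def ap_plus Sym_add Sym_uminus simp del: add_uminus_conv_diff
          simp flip: add_uminus_conv_diff)
  next
    fix b assume b: "b \<in> {b \<in> Sym Y. \<forall>y\<in>Y. r (ap (- b) y) = r (ap (- a) y)}"
    show *: "a - (- b + a) = b" by (simp add: diff_conv_add_uminus minus_add del: add_uminus_conv_diff flip: add.assoc)
    have "r (ap (- b) (ap a y)) = r y" if "y \<in> Y" for y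
      using b that a by (auto simp: Sym_in)
    then show "- b + a \<in> Stab Y r" using a b by (auto simp: Stab_def ap_plus Sym_add Sym_uminus)
  next
    fix b show "lk x (a - b) = lk x (a - b)" ..
  qed
  also have "\<dots> = wc x (\<lambda>y. r (ap (- a) y))"
    unfolding wc_def by (simp add: sum.inter_filter finite_Sym)
  finally show ?thesis .
qed

lemma wc_dl: "a \<in> Sym Y \<Longrightarrow> wc (dl a * x) f = wc x (f \<circ> ap a)"
proof -
  assume a: "a \<in> Sym Y"
  have 1: "(\<forall>y\<in>Y. r (ap (- (a + b)) y) = f y) \<longleftrightarrow> (\<forall>y\<in>Y. r (ap (- b) y) = f (ap a y))" for b
  proof -
    have "(\<forall>y\<in>Y. r (ap (- b) (ap (- a) y)) = f y) \<longleftrightarrow> (\<forall>y\<in>ap a ` Y. r (ap (- b) (ap (- a) y)) = f y)"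
      by (simp only: Sym_image[OF a])
    then show ?thesis by (simp add: minus_add ap_plus del: add_uminus_conv_diff)
  qed
  have 2: "(\<forall>y\<in>Y. r (ap (- (- a + b)) y) = f (ap a y)) \<longleftrightarrow> (\<forall>y\<in>Y. r (ap (- b) y) = f y)" for b
    using 1[of "- a + b"] by (simp flip: add.assoc)
  show ?thesis unfolding wc_def
    by (rule sum.reindex_bij_witness[of _ "\<lambda>b. a + b" "\<lambda>b. - a + b"])
      (use a in \<open>auto simp: lk_mult_dl Sym_add Sym_uminus 2 simp flip: add.assoc\<close>)
qed

lemma wc_content:
  assumes "wc x f \<noteq> 0"
  shows "card {y \<in> Y. f y = i} = card {y \<in> Y. r y = i}"
proof -
  obtain a where a: "a \<in> Sym Y" "\<forall>y\<in>Y. r (ap (- a) y) = f y"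
  proof (rule ccontr)
    assume "\<not> thesis"
    then have "wc x f = 0" unfolding wc_def by (intro sum.neutral) (use that in auto)
    with assms show False ..
  qed
  have in_Y: "ap a y \<in> Y" "ap (- a) y \<in> Y" if "y \<in> Y" for y
    using that Sym_in[OF a(1)] Sym_in[OF Sym_uminus[OF a(1)]] by auto
  have fa: "f (ap a y) = r y" if "y \<in> Y" for y
    using a(2) in_Y(1)[OF that] by (metis ap_uminus(1))
  have "bij_betw (ap a) {y \<in> Y. r y = i} {y \<in> Y. f y = i}"
  proof (rule bij_betw_byWitness[where f' = "ap (- a)"])
    show "ap a ` {y \<in> Y. r y = i} \<subseteq> {y \<in> Y. f y = i}" using in_Y(1) fa by blast
    show "ap (- a) ` {y \<in> Y. f y = i} \<subseteq> {y \<in> Y. r y = i}" using in_Y(2) a(2) by blast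
  qed simp_all
  from bij_betw_same_card[OF this] show ?thesis by simp
qed

lemma wc_sum: "wc (\<Sum>i\<in>I. psc (g i) (x i)) f = (\<Sum>i\<in>I. g i * wc (x i) f)"
proof -
  have "wc (\<Sum>i\<in>I. psc (g i) (x i)) f
    = (\<Sum>a\<in>Sym Y. \<Sum>i\<in>I. g i * (if \<forall>y\<in>Y. r (ap (- a) y) = f y then lk (x i) a else 0))"
  proof -
    have "(if Q then \<Sum>i\<in>I. lk (psc (g i) (x i)) a else 0) = (\<Sum>i\<in>I. g i * (if Q then lk (x i) a else 0))"
      for Q a by simp
    then show ?thesis unfolding wc_def lookup_sum by (intro sum.cong refl)
  qed
  also have "\<dots> = (\<Sum>i\<in>I. g i * wc (x i) f)"
    unfolding wc_def sum_distrib_left by (rule sum.swap)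
  finally show ?thesis .
qed

text \<open>A sign reversing involution exchanges the letters \<open>a\<close> and \<open>b\<close> within the column of \<open>k\<close>.\<close>

lemma wc_Cs_invariant:
  assumes cols: "\<And>j. j \<in> c ` Y \<Longrightarrow> b < card {x \<in> Y. c x = j}" and ab: "a \<noteq> b"
  shows "(\<Sum>k\<in>{k \<in> Y. f k = b}. wc (Cs Y c) (f(k := a))) = 0"
proof -
  have "\<exists>z\<in>Y. c z = c k \<and> r z = b" if "k \<in> Y" for k
  proof -
    have "b \<in> r ` {x \<in> Y. c x = c k}" using cols[OF imageI[OF that]] unfolding col_image by simp
    then show ?thesis by blast
  qed
  then obtain cell where cell: "\<And>k. k \<in> Y \<Longrightarrow> cell k \<in> Y \<and> c (cell k) = c k \<and> r (cell k) = b" by metis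
  define Q where "Q = (\<lambda>k s. \<forall>y\<in>Y. r (ap (- s) y) = (f(k := a)) y)"
  define S where "S = {(k, s). k \<in> Y \<and> f k = b \<and> s \<in> Stab Y c \<and> Q k s}"
  define S0 where "S0 = {k \<in> Y. f k = b} \<times> Stab Y c"
  \<comment> \<open>In the word of \<open>s\<close> the position \<open>ap s (cell k)\<close>
    carries the letter \<open>b\<close>, hence differs from \<open>k\<close>. Composing with the
    transposition of the two moves the replaced letter \<open>a\<close> there, stays in the column
    group and flips the sign.\<close>
  define tw where "tw = (\<lambda>(k, s). (ap s (cell k), Ap (transpose k (ap s (cell k))) + s))"
  have fin1: "finite (Stab Y c)" by (rule subgrpD(1)[OF sgr(1)])
  have fin: "finite S0" unfolding S0_def by (simp add: fin1)
  have SS: "S = {z \<in> S0. Q (fst z) (snd z)}" by (auto simp: S_def S0_def)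
  have "wc (Cs Y c) (f(k := a)) = (\<Sum>s\<in>Stab Y c. if Q k s then psgn s else 0)" for k
    unfolding wc_def Q_def
    by (intro sum.mono_neutral_cong_right)
      (use fin1 in \<open>auto simp: lk_gsum finite_Sym Stab_Sym simp del: fun_upd_apply\<close>)
  then have "(\<Sum>k\<in>{k \<in> Y. f k = b}. wc (Cs Y c) (f(k := a)))
    = (\<Sum>k\<in>{k \<in> Y. f k = b}. \<Sum>s\<in>Stab Y c. if Q k s then psgn s else 0)" by simp
  also have "\<dots> = (\<Sum>z\<in>S0. if Q (fst z) (snd z) then psgn (snd z) else 0)"
    unfolding S0_def by (simp add: sum.cartesian_product case_prod_beta)
  also have "\<dots> = (\<Sum>z\<in>S. psgn (snd z))"
    unfolding SS using fin by (simp add: sum.inter_filter)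
  finally have eq: "(\<Sum>k\<in>{k \<in> Y. f k = b}. wc (Cs Y c) (f(k := a))) = (\<Sum>z\<in>S. psgn (snd z))" .
  have tw: "tw z \<in> S \<and> tw (tw z) = z \<and> psgn (snd (tw z)) = (- psgn (snd z) :: 'f)" if "z \<in> S" for z
  proof -
    obtain k s where z: "z = (k, s)" by (cases z)
    have k: "k \<in> Y" "f k = b" and s: "s \<in> Stab Y c" and rs: "\<And>y. y \<in> Y \<Longrightarrow> r (ap (- s) y) = (f(k := a)) y"
      using that by (auto simp: S_def z Q_def)
    define k' where "k' = ap s (cell k)"
    define t where "t = Ap (transpose k k')"
    note sS = Stab_Sym[OF s]
    have k': "k' \<in> Y" "c k' = c k" using s cell[OF k(1)] sS by (auto simp: k'_def Stab_def Sym_in)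
    have "(f(k := a)) k' = b" using rs[OF k'(1)] cell[OF k(1)] by (simp add: k'_def)
    then have k'k: "k' \<noteq> k" "f k' = b" using ab by (auto split: if_splits)
    have t: "ap t = transpose k k'" unfolding t_def
      by (rule ap_Ap[of _ Y]) (use k k' in \<open>auto intro: permutes_swap_id\<close>)
    have tS: "t \<in> Sym Y" using k k' by (auto simp: Sym_def t intro: permutes_swap_id)
    have tt: "- t = t" by (rule fperm_eqI) (metis ap_uminus(2) t transpose_involutory)
    have tc: "t \<in> Stab Y c" using tS k k' by (auto simp: Stab_def t transpose_def)
    have ts: "t + s \<in> Stab Y c" using subgrpD(3)[OF sgr(1) tc s] .
    have "r (ap (- (t + s)) y) = (f(k' := a)) y" if "y \<in> Y" for y
    proof -
      have "ap t y \<in> Y" using that tS by (simp add: Sym_in)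
      then have "r (ap (- s) (ap t y)) = (f(k := a)) (ap t y)" by (rule rs)
      also have "\<dots> = (f(k' := a)) y" using k k'k by (auto simp: t transpose_def)
      finally show ?thesis by (simp add: minus_add ap_plus tt del: add_uminus_conv_diff)
    qed
    then have 1: "(k', t + s) \<in> S" using k' k'k ts by (auto simp: S_def Q_def)
    have "cell k' = cell k" using inj cell[OF k(1)] cell[OF k'(1)] k'(2) by metis
    then have "ap (t + s) (cell k') = k" by (simp add: ap_plus t flip: k'_def)
    then have 2: "tw (k', t + s) = (k, Ap (transpose k' k) + (t + s))" by (simp add: tw_def)
    have "Ap (transpose k' k) + t = 0" unfolding transpose_commute[of k' k] t_def[symmetric]
      using tt by (metis right_minus)
    then have 3: "tw (k', t + s) = (k, s)" unfolding 2 by (simp flip: add.assoc)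
    have 4: "tw z = (k', t + s)" by (simp add: tw_def z k'_def t_def)
    have "psgn t = (- 1 :: 'f)" using k'k by (auto simp: psgn_def t sign_swap_id)
    then show ?thesis using 1 3 by (simp add: 4[unfolded z] z psgn_add)
  qed
  have "(\<Sum>z\<in>S. psgn (snd z)) = (\<Sum>z\<in>S. - psgn (snd z) :: 'f)"
    by (rule sum.reindex_bij_witness[of _ tw tw]) (use tw in \<open>auto simp: eq_neg_iff_add_eq_0 neg_eq_iff_add_eq_0 \<close>)
  then have "(\<Sum>z\<in>S. psgn (snd z)) = (0 :: 'f)" by (simp add: sum_negf)
  then show ?thesis unfolding eq .
qed

lemma Stab_subset: "X \<subseteq> Z \<Longrightarrow> Stab X f \<subseteq> Stab Z f"
  by (auto simp: Stab_def Sym_iff)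

end

text \<open>In a full rectangle every column contains all the rows 0 to \<open>p\<close>, which
  yields invariance for each pair of letters, and the letter \<open>p\<close> occurs q + 1 times,
  once more than there are alternating colours. The factor \<open>star u\<close> is used because it
  ends in the row symmetrizer, which coefficient functions can express.\<close>

lemma hook_rectangle_star:
  assumes tab: "tab Y r c \<nu>" and rect: "\<nu> = rectangle (q + 1) (p + 1)"
    and X: "X0 \<union> X1 = Y" "X0 \<inter> X1 = {}"
    and \<alpha>: "\<And>x. x \<in> X0 \<Longrightarrow> \<alpha> x < p" and \<beta>: "\<And>x. x \<in> X1 \<Longrightarrow> \<beta> x < q"
  shows "Rs X0 \<alpha> * Cs X1 \<beta> * star (tableau.u Y r c) = (0 :: fperm \<Rightarrow>\<^sub>0 'f::field_char_0)"
proof -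
  interpret tableau Y r c \<nu> "TYPE('f)" by unfold_locales fact
  have fin: "finite X0" "finite X1" using X(1) finY by (metis finite_Un)+
  define W where "W = Rs X0 \<alpha> * (Cs X1 \<beta> :: fperm \<Rightarrow>\<^sub>0 'f)"
  define V where "V = wc (W * Cs Y c)"
  have WGA: "W \<in> GA Y" unfolding W_def
    using X by (intro GA_mult GA_mono[OF _ GA_Stab[of X0]] GA_mono[OF _ GA_Stab[of X1]]) auto
  have Vdl: "V f = (\<Sum>a\<in>Sym Y. lk W a * wc (Cs Y c) (f \<circ> ap a))" for f
  proof -
    have "W * Cs Y c = (\<Sum>a\<in>Sym Y. psc (lk W a) (dl a * Cs Y c))"
      by (subst (1) GA_expand[OF WGA finY]) (simp add: sum_distrib_right del: psc_sng)
    then show ?thesis unfolding V_def by (simp add: wc_sum wc_dl del: psc_mult)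
  qed
  have Vt: "V (f \<circ> ap t) = k * V f" if t: "t \<in> Sym Y" and tW: "dl t * W = psc k W" for t k f
  proof -
    have "V (f \<circ> ap t) = wc (dl t * (W * Cs Y c)) f" unfolding V_def by (rule wc_dl[OF t, symmetric])
    also have "dl t * (W * Cs Y c) = psc k (W * Cs Y c)" by (simp add: tW flip: mult.assoc)
    also have "wc \<dots> f = k * V f"
      using wc_sum[of "\<lambda>_. k" "\<lambda>_. W * Cs Y c" "{()}" f] by (simp add: V_def)
    finally show ?thesis .
  qed
  have tr: "ap (Ap (transpose x y)) = transpose x y" "Ap (transpose x y) \<in> Sym Z"
    if "x \<in> Z" "y \<in> Z" "finite Z" for x y Z
    using that permutes_swap_id[of x Z y] by (simp_all add: Sym_def ap_Ap)
  have ra: "r y \<le> p" "c y \<le> q" if "y \<in> Y" for y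
    using cellsI[OF that] by (auto simp: rect rectangle_def split: if_splits)
  have card_row: "card {y \<in> Y. r y = i} = q + 1" if "i \<le> p" for i
  proof -
    have "c ` {y \<in> Y. r y = i} = {..<q + 1}"
    proof (intro equalityI subsetI)
      fix j assume "j \<in> {..<q + 1}"
      then have "\<exists>y\<in>Y. r y = i \<and> c y = j" using that by (intro cells_ex) (simp add: rect rectangle_def)
      then show "j \<in> c ` {y \<in> Y. r y = i}" by blast
    qed (use ra in \<open>auto simp: less_Suc_eq_le\<close>)
    moreover have "inj_on c {y \<in> Y. r y = i}" using inj by (auto simp: inj_on_def)
    ultimately show ?thesis by (metis card_image card_lessThan)
  qed
  have card_col: "card {y \<in> Y. c y = j} = p + 1" if "j \<le> q" for j
  proof -
    have "r ` {y \<in> Y. c y = j} = {..<p + 1}"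
    proof (intro equalityI subsetI)
      fix i assume "i \<in> {..<p + 1}"
      then have "\<exists>y\<in>Y. r y = i \<and> c y = j" using that by (intro cells_ex) (simp add: rect rectangle_def)
      then show "i \<in> r ` {y \<in> Y. c y = j}" by blast
    qed (use ra in \<open>auto simp: less_Suc_eq_le\<close>)
    then show ?thesis using col_image[of j] by (metis card_lessThan)
  qed
  have "V f = 0" if "\<forall>x\<in>X0 \<union> X1. f x \<le> p" for f
  proof (rule invariant_tensor_vanishes[of X0 X1 p V \<alpha> \<beta> q])
    fix f a b assume ab: "a \<le> p" "b \<le> p" "a \<noteq> b"
    have "(\<Sum>k\<in>{k \<in> Y. f k = b}. V (f(k := a))) = 0"
    proof -
      have "(\<Sum>k\<in>{k \<in> Y. f k = b}. wc (Cs Y c) (f(k := a) \<circ> ap s)) = 0" if s: "s \<in> Sym Y" for s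
      proof -
        have "(\<Sum>k\<in>{k \<in> Y. f k = b}. wc (Cs Y c) (f(k := a) \<circ> ap s))
          = (\<Sum>k\<in>{k \<in> Y. (f \<circ> ap s) k = b}. wc (Cs Y c) ((f \<circ> ap s)(k := a)))"
        proof (rule sum.reindex_bij_witness[of _ "ap s" "ap (- s)"])
          fix k
          have "(f \<circ> ap s)(ap (- s) k := a) = f(k := a) \<circ> ap s"
            by (auto simp: fun_eq_iff)
          then show "wc (Cs Y c) ((f \<circ> ap s)(ap (- s) k := a)) = wc (Cs Y c) (f(k := a) \<circ> ap s)" by simp
        qed (use s Sym_uminus[OF s] in \<open>auto simp: Sym_in\<close>)
        also have "\<dots> = 0"
          by (rule wc_Cs_invariant) (use ab card_col ra in auto)
        finally show ?thesis .
      qed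
      then have "(\<Sum>s\<in>Sym Y. lk W s * (\<Sum>k\<in>{k \<in> Y. f k = b}. wc (Cs Y c) (f(k := a) \<circ> ap s))) = 0"
        by simp
      then show ?thesis
        unfolding Vdl sum_distrib_left by (subst sum.swap)
    qed
    then show "(\<Sum>k\<in>{k \<in> X0 \<union> X1. f k = b}. V (f(k := a))) = 0" by (simp add: X)
  next
    fix f x y assume xy: "x \<in> X0" "y \<in> X0" "\<alpha> x = \<alpha> y"
    let ?t = "Ap (transpose x y)"
    note t = tr[OF xy(1,2) fin(1)]
    have "?t \<in> Stab X0 \<alpha>" using t xy by (auto simp: Stab_def transpose_def)
    then have "dl ?t * W = psc 1 W"
      by (simp add: W_def gsum_absorb subgrp_Stab fin flip: mult.assoc)
    from Vt[OF _ this] show "V (f \<circ> transpose x y) = V f"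
      using t X(1) Sym_mono[of X0 Y ?t] by auto
  next
    fix f x y assume xy: "x \<in> X1" "y \<in> X1" "x \<noteq> y" "\<beta> x = \<beta> y"
    let ?t = "Ap (transpose x y)"
    note t = tr[OF xy(1,2) fin(2)]
    have "?t \<in> Stab X1 \<beta>" using t xy by (auto simp: Stab_def transpose_def)
    then have "dl ?t * W = psc (psgn ?t) W"
      by (simp add: W_def gsum_disjoint_commute[OF X(2) _ _ fin] gsum_absorb subgrp_Stab fin flip: mult.assoc)
    moreover have "psgn ?t = (- 1 :: 'f)" using xy t by (simp add: psgn_def sign_swap_id)
    ultimately have "dl ?t * W = psc (- 1) W" by simp
    from Vt[OF _ this] show "V (f \<circ> transpose x y) = - V f"
      using t X(1) Sym_mono[of X1 Y ?t] by auto
  next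
    fix f assume "V f \<noteq> 0"
    then show "q < card {x \<in> X0 \<union> X1. f x = p}"
      using wc_content[of "W * Cs Y c" f p] card_row[of p] by (simp add: V_def X)
  qed (use fin X \<alpha> \<beta> that in auto)
  then have V0: "wc (W * Cs Y c) (\<lambda>y. r (ap (- a) y)) = 0" if "a \<in> Sym Y" for a
    using ra Sym_in[OF Sym_uminus[OF that]] by (simp add: V_def X)
  have "W * Cs Y c * Rs Y r = 0"
  proof (rule poly_mapping_eqI)
    fix a
    have "W * Cs Y c * Rs Y r \<in> GA Y" using WGA by (simp add: GA_intros)
    then have "a \<notin> Sym Y \<Longrightarrow> lk (W * Cs Y c * Rs Y r) a = 0"
      by (auto simp: GA_def in_keys_iff)
    then show "lk (W * Cs Y c * Rs Y r) a = lk 0 a" using wc_Rs V0 by (cases "a \<in> Sym Y") simp_all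
  qed
  then show ?thesis by (simp add: W_def star_u mult.assoc)
qed

section \<open>From rectangles to arbitrary shapes\<close>

lemma Stab_card: "finite X \<Longrightarrow> card (Stab X r) \<noteq> 0"
  using subgrpD(1,2)[OF subgrp_Stab, of X r] by auto

lemma GA_expand_mult:
  assumes "x \<in> GA Y" "finite Y"
  shows "A * x * B = (\<Sum>a\<in>Sym Y. psc (lk x a) (A * dl a * B))"
  by (subst (1) GA_expand[OF assms]) (simp add: sum_distrib_left sum_distrib_right del: psc_sng)

text \<open>Moving a permutation to the left through the symmetrizers merely changes the colouring,
  so a vanishing statement for all colourings survives the insertion of a group algebra
  element.\<close>

lemma coloured_mult_zero:
  fixes B :: "fperm \<Rightarrow>\<^sub>0 'f::field_char_0"
  assumes Z: "X0 \<union> X1 = Z" "X0 \<inter> X1 = {}" "finite Z"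
    and \<alpha>: "\<And>x. x \<in> X0 \<Longrightarrow> \<alpha> x < p" and \<beta>: "\<And>x. x \<in> X1 \<Longrightarrow> \<beta> x < q" and x: "x \<in> GA Z"
    and B: "\<And>X0 X1 \<alpha> \<beta>. X0 \<union> X1 = Z \<Longrightarrow> X0 \<inter> X1 = {} \<Longrightarrow> \<forall>x\<in>X0. \<alpha> x < p \<Longrightarrow> \<forall>x\<in>X1. \<beta> x < q \<Longrightarrow>
      Rs X0 \<alpha> * Cs X1 \<beta> * B = 0"
  shows "Rs X0 (\<alpha> :: nat \<Rightarrow> nat) * Cs X1 (\<beta> :: nat \<Rightarrow> nat) * x * B = 0"
proof -
  have "Rs X0 \<alpha> * Cs X1 \<beta> * dl a * B = 0" if a: "a \<in> Sym Z" for a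
  proof -
    let ?f = "\<lambda>X. ap (- a) ` X"
    have "Rs X0 \<alpha> * Cs X1 \<beta> * dl a
      = dl a * (Rs (?f X0) (\<lambda>x. \<alpha> (ap a x)) * Cs (?f X1) (\<lambda>x. \<beta> (ap a x)) :: fperm \<Rightarrow>\<^sub>0 'f)"
      by (simp add: mult.assoc gsum_dl_commute) (simp add: gsum_dl_commute flip: mult.assoc)
    moreover have "Rs (?f X0) (\<lambda>x. \<alpha> (ap a x)) * Cs (?f X1) (\<lambda>x. \<beta> (ap a x)) * B = 0"
    proof (rule B)
      show "?f X0 \<union> ?f X1 = Z"
        using Z(1) Sym_image[OF Sym_uminus[OF a]] by (simp flip: image_Un)
      show "?f X0 \<inter> ?f X1 = {}" using Z(2) by (auto simp: image_iff)
    qed (use \<alpha> \<beta> in auto)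
    ultimately show ?thesis by (simp add: mult.assoc)
  qed
  then show ?thesis unfolding GA_expand_mult[OF x Z(3)] by simp
qed

text \<open>The Berele-Regev hook condition inside the group algebra. The cell (p, q) forces a
  rectangle of p + 1 rows and q + 1 columns into the shape, and the Young symmetrizer of that part
  is, up to a nonzero scalar, a middle factor of \<open>u\<close>.\<close>

theorem hook_theorem:
  fixes x :: "fperm \<Rightarrow>\<^sub>0 'f::field_char_0"
  assumes tab: "tab Y r c \<nu>" and cell: "q < \<nu> p"
    and Z: "X0 \<union> X1 = Z" "X0 \<inter> X1 = {}" "finite Z" "Y \<subseteq> Z"
    and \<alpha>: "\<And>x. x \<in> X0 \<Longrightarrow> \<alpha> x < p" and \<beta>: "\<And>x. x \<in> X1 \<Longrightarrow> \<beta> x < q" and x: "x \<in> GA Z"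
  shows "Rs X0 \<alpha> * Cs X1 \<beta> * x * tableau.u Y r c = 0"
proof -
  interpret tableau Y r c \<nu> "TYPE('f)" by unfold_locales fact
  define Y' where "Y' = {y \<in> Y. r y \<le> p \<and> c y \<le> q}"
  define \<rho> where "\<rho> = rectangle (q + 1) (p + 1)"
  have Y': "Y' \<subseteq> Y" "finite Y'" by (auto simp: Y'_def)
  have "{i. \<rho> i \<noteq> 0} \<subseteq> {..p}" by (auto simp: \<rho>_def rectangle_def)
  then have \<rho>: "\<rho> \<in> partitions"
    using finite_subset[OF _ finite_atMost] by (auto simp: \<rho>_def partitions_def rectangle_def intro!: antimonoI)
  have "bij_betw (\<lambda>x. (r x, c x)) Y' (cells \<rho>)"
  proof (rule bij_betw_imageI)
    show "inj_on (\<lambda>x. (r x, c x)) Y'" using inj Y'(1) by (auto simp: inj_on_def)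
    have "\<exists>y\<in>Y. r y = i \<and> c y = j" if "i \<le> p" "j \<le> q" for i j
      using cells_ex[of j i] partitions_mono[OF nu that(1)] cell that by fastforce
    then have *: "(i, j) \<in> (\<lambda>x. (r x, c x)) ` Y'" if "i \<le> p" "j \<le> q" for i j
      using that by (force simp: Y'_def)
    show "(\<lambda>x. (r x, c x)) ` Y' = cells \<rho>"
    proof (intro equalityI subsetI)
      fix z assume "z \<in> cells \<rho>"
      then show "z \<in> (\<lambda>x. (r x, c x)) ` Y'"
        by (cases z) (auto simp: cells_def \<rho>_def rectangle_def split: if_splits intro!: *)
    qed (auto simp: Y'_def cells_def \<rho>_def rectangle_def)
  qed
  then have tab': "tab Y' r c \<rho>" using Y' \<rho> by (simp add: tab_def)
  interpret T: tableau Y' r c \<rho> "TYPE('f)" by unfold_locales fact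
  have T0: "Rs X0 \<alpha> * Cs X1 \<beta> * T.u = 0"
    if X: "X0 \<union> X1 = Y'" "X0 \<inter> X1 = {}" and \<alpha>: "\<forall>x\<in>X0. \<alpha> x < p" and \<beta>: "\<forall>x\<in>X1. \<beta> x < q"
    for X0 X1 and \<alpha> \<beta> :: "nat \<Rightarrow> nat"
  proof -
    \<comment> \<open>The rectangle case concerns \<open>star T.u\<close>; this identity produces
      that factor, and the \<open>T.u\<close> in front of it is absorbed by recolouring.\<close>
    obtain k where k: "T.u = psc k (T.u * star T.u * T.u)" using T.u_star_u' by blast
    have "Rs X0 \<alpha> * Cs X1 \<beta> * T.u * star T.u = 0"
    proof (rule coloured_mult_zero[OF X Y'(2) _ _ T.u_GA, where p = p and q = q])
      fix X0 X1 and \<alpha> \<beta> :: "nat \<Rightarrow> nat"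
      assume "X0 \<union> X1 = Y'" "X0 \<inter> X1 = {}" "\<forall>x\<in>X0. \<alpha> x < p" "\<forall>x\<in>X1. \<beta> x < q"
      then show "Rs X0 \<alpha> * Cs X1 \<beta> * star T.u = 0" by (intro hook_rectangle_star[OF tab' \<rho>_def]) auto
    qed (use \<alpha> \<beta> in auto)
    then have "Rs X0 \<alpha> * Cs X1 \<beta> * (T.u * star T.u * T.u) = 0" by (simp flip: mult.assoc)
    then show ?thesis by (subst k) simp
  qed
  have T1: "Rs X0 \<alpha> * Cs X1 \<beta> * T.u = 0"
    if X: "X0 \<union> X1 = Z" "X0 \<inter> X1 = {}" and \<alpha>: "\<forall>x\<in>X0. \<alpha> x < p" and \<beta>: "\<forall>x\<in>X1. \<beta> x < q"
    for X0 X1 and \<alpha> \<beta> :: "nat \<Rightarrow> nat"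
  proof -
    have fin: "finite X0" "finite X1" using X(1) Z(3) by auto
    let ?R = "Rs X0 \<alpha> :: fperm \<Rightarrow>\<^sub>0 'f" and ?R' = "Rs (X0 \<inter> Y') \<alpha> :: fperm \<Rightarrow>\<^sub>0 'f"
    let ?C = "Cs X1 \<beta> :: fperm \<Rightarrow>\<^sub>0 'f" and ?C' = "Cs (X1 \<inter> Y') \<beta> :: fperm \<Rightarrow>\<^sub>0 'f"
    \<comment> \<open>The symmetrizers on Z contain those of the same colours restricted to the
      rectangle, for which the vanishing is already known.\<close>
    have R: "?R * ?R' = psc (of_nat (card (Stab (X0 \<inter> Y') \<alpha>))) ?R"
      and C: "?C * ?C' = psc (of_nat (card (Stab (X1 \<inter> Y') \<beta>))) ?C"
      using fin by (auto intro!: gsum_mult_sub Stab_subset subgrp_Stab)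
    have "?R * ?C * (?R' * ?C' * T.u) = 0"
    proof -
      have "?R' * ?C' * T.u = 0"
        by (rule T0) (use X Y'(1) Z(4) \<alpha> \<beta> in auto)
      then show ?thesis by (simp only: mult_zero_right)
    qed
    have "?R' * ?C = ?C * ?R'"
      using X(2) fin by (intro gsum_disjoint_commute) auto
    have "(?R * ?R') * (?C * ?C') * T.u = ?R * (?R' * ?C) * ?C' * T.u"
      by (simp only: mult.assoc)
    also have "\<dots> = ?R * ?C * (?R' * ?C' * T.u)"
      unfolding \<open>?R' * ?C = ?C * ?R'\<close> by (simp only: mult.assoc)
    also note \<open>?R * ?C * (?R' * ?C' * T.u) = 0\<close>
    finally have "(?R * ?R') * (?C * ?C') * T.u = 0" .
    then show ?thesis
      using fin by (simp add: R C Stab_card)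
  qed
  have "Rs Y r * T.u * Cs Y c = Rs Y r * Rs Y' r * (Cs Y' c * Cs Y c)" by (simp add: T.u_def mult.assoc)
  also have "\<dots> = psc (of_nat (card (Stab Y' r)) * of_nat (card (Stab Y' c))) u"
    by (simp add: gsum_mult_sub[OF T.sgr(1) sgr(1) Stab_subset[OF Y'(1)]] u_def)
  finally have u: "u = psc (inverse (of_nat (card (Stab Y' r)) * of_nat (card (Stab Y' c)))) (Rs Y r * T.u * Cs Y c)"
    using Y'(2) by (simp add: Stab_card field_simps)
  have "Rs X0 \<alpha> * Cs X1 \<beta> * (x * Rs Y r) * T.u = 0"
    by (rule coloured_mult_zero[OF Z(1-3) \<alpha> \<beta>]) (use T1 x Z(4) GA_mono[OF _ GA_Stab] in \<open>auto intro!: GA_mult\<close>)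
  then have "Rs X0 \<alpha> * Cs X1 \<beta> * (x * Rs Y r) * T.u * Cs Y c = 0" by simp
  then show ?thesis by (subst u) (simp add: mult.assoc)
qed

section \<open>Branching\<close>

context tableau
begin

text \<open>Colouring the rows above \<open>p\<close> by row and all other cells by column is
  compatible with the tableau: its own row and column symmetrizers absorb the coloured ones, and a
  nonzero multiple of \<open>u * u\<close> survives.\<close>

lemma hook_nonzero:
  "Rs {y \<in> Y. r y < p} r * Cs {y \<in> Y. p \<le> r y} c * star u \<noteq> 0"
proof
  let ?A = "Stab {y \<in> Y. r y < p} r" and ?B = "Stab {y \<in> Y. p \<le> r y} c"
  have A: "gsum (Stab Y r) (\<lambda>_. 1) * gsum ?A (\<lambda>_. 1) = psc (of_nat (card ?A)) (Rs Y r :: fperm \<Rightarrow>\<^sub>0 'f)"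
    and B: "gsum ?B psgn * gsum (Stab Y c) psgn = psc (of_nat (card ?B)) (Cs Y c :: fperm \<Rightarrow>\<^sub>0 'f)"
    by (auto intro!: gsum_mult_sub subgrp_Stab Stab_subset)
  assume 0: "Rs {y \<in> Y. r y < p} r * Cs {y \<in> Y. p \<le> r y} c * star u = 0"
  have "Rs Y r * (Rs {y \<in> Y. r y < p} r * Cs {y \<in> Y. p \<le> r y} c * star u) * Cs Y c
    = (Rs Y r * gsum ?A (\<lambda>_. 1)) * (gsum ?B psgn * Cs Y c) * u"
    unfolding star_u by (simp add: u_def mult.assoc)
  also have "\<dots> = psc (of_nat (card ?A) * of_nat (card ?B)) (u * u)"
    by (simp add: A B) (simp add: u_def)
  finally have "psc (of_nat (card ?A) * of_nat (card ?B)) (u * u) = 0" using 0 by simp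
  then show False
    using h_nz u_nz by (simp add: u_u pm.scale_eq_0_iff Stab_card)
qed

end

text \<open>Take a row \<open>p\<close> in which \<nu> is longer than \<mu>. Colour Z by the first
  \<open>p\<close> rows of \<mu> and, below, by its columns, of which fewer than or equal to \<mu> p
  are met: the hook theorem kills the symmetrizer of \<nu>, which contains the cell (p, \<mu> p),
  while \<open>hook_nonzero\<close> protects that of \<mu>. A nonzero product would regenerate the
  symmetrizer of \<mu> from one containing that of \<nu>.\<close>

theorem branching:
  fixes x :: "fperm \<Rightarrow>\<^sub>0 'f::field_char_0"
  assumes tab: "tab Y r c \<nu>" "tab Z r' c' \<mu>" and "Y \<subseteq> Z" and nle: "\<not> \<nu> \<le> \<mu>" and x: "x \<in> GA Z"
  shows "tableau.u Y r c * x * tableau.u Z r' c' = 0"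
proof (rule ccontr)
  interpret A: tableau Y r c \<nu> "TYPE('f)" by unfold_locales fact
  interpret B: tableau Z r' c' \<mu> "TYPE('f)" by unfold_locales fact
  assume nz: "A.u * x * B.u \<noteq> 0"
  have "A.u * x \<in> GA Z" using A.u_GA x \<open>Y \<subseteq> Z\<close> by (blast intro: GA_mult GA_mono)
  from B.left_regenerate[OF this nz] obtain y where y: "y \<in> GA Z" "y * (A.u * x * B.u) = B.u" by blast
  obtain p where p: "\<mu> p < \<nu> p" using nle by (auto simp: le_fun_def not_le)
  let ?R = "Rs {y \<in> Z. r' y < p} r' :: fperm \<Rightarrow>\<^sub>0 'f" and ?C = "Cs {y \<in> Z. p \<le> r' y} c' :: fperm \<Rightarrow>\<^sub>0 'f"
  have c: "c' z < \<mu> p" if "z \<in> Z" "p \<le> r' z" for z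
    using B.cellsI[OF that(1)] partitions_mono[OF B.nu that(2)] by simp
  have "?R * ?C * (star B.u * y) * A.u = 0"
    by (rule hook_theorem[OF tab(1) p, of _ _ Z])
      (use \<open>Y \<subseteq> Z\<close> y B.u_GA c in \<open>auto intro: GA_intros\<close>)
  then have "?R * ?C * (star B.u * y) * A.u * (x * B.u * star B.u) = 0" by simp
  then have 0: "?R * ?C * star B.u * (y * (A.u * x * B.u)) * star B.u = 0" by (simp add: mult.assoc)
  obtain k where k: "star B.u = psc k (star B.u * B.u * star B.u)" using B.star_u_u' by blast
  have "?R * ?C * star B.u = 0"
    by (subst k) (use 0[unfolded y(2)] in \<open>simp flip: mult.assoc\<close>)
  with B.hook_nonzero[of p] show False by simp
qed

section \<open>Conjugacy classes of the symmetric group\<close>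

definition cprod :: "'a list list \<Rightarrow> 'a \<Rightarrow> 'a" where
  "cprod css = foldr (\<lambda>cs q. cycle_of_list cs \<circ> q) css id"

lemma cprod_simps [simp]: "cprod [] = id" "cprod (cs # css) = cycle_of_list cs \<circ> cprod css"
  by (simp_all add: cprod_def)

lemma cprod_insort:
  assumes "distinct (concat (cs # css))"
  shows "cprod (insort_key f cs css) = cprod (cs # css)"
  using assms
proof (induction css)
  case (Cons ds css)
  have "distinct (concat (cs # css))" using Cons.prems by auto
  from Cons.IH[OF this] have IH: "cprod (insort_key f cs css) = cycle_of_list cs \<circ> cprod css"
    by (simp only: cprod_simps)
  have "cycle_of_list cs \<circ> cycle_of_list ds = cycle_of_list ds \<circ> cycle_of_list cs"
    using Cons.prems by (intro cycles_commute) auto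
  then show ?case by (simp only: insort_key.simps cprod_simps IH comp_assoc[symmetric] split: if_splits) simp
qed simp

lemma distinct_concat_mset: "mset xss = mset yss \<Longrightarrow> distinct (concat xss) \<longleftrightarrow> distinct (concat yss)"
proof -
  assume "mset xss = mset yss"
  then have "mset (concat xss) = mset (concat yss)"
    by (metis mset_concat mset_map sum_mset_sum_list)
  then show ?thesis by (rule mset_eq_imp_distinct_iff)
qed

lemma cprod_sort:
  assumes "distinct (concat css)"
  shows "cprod (sort_key f css) = cprod css" "distinct (concat (sort_key f css))"
  using assms
proof (induction css)
  case (Cons cs css)
  {
    case 1
    have "distinct (concat (cs # sort_key f css))"
      using 1 Cons by auto
    then show ?case using cprod_insort[of cs "sort_key f css" f] Cons 1 by (simp add: sort_key_def)
  next
    case 2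
    then show ?case by (metis distinct_concat_mset mset_sort)
  }
qed simp_all

lemma cycle_list_ex:
  assumes "p permutes S" "finite S"
  shows "\<exists>css. distinct (concat css) \<and> set (concat css) = S \<and> [] \<notin> set css \<and> p = cprod css"
  using cycle_decomposition[OF assms]
proof (induction rule: cycle_decomp.induct)
  case empty show ?case by (rule exI[of _ "[]"]) simp
next
  case (comp I p cs)
  then obtain css where css: "distinct (concat css)" "set (concat css) = I" "[] \<notin> set css" "p = cprod css"
    by blast
  show ?case
  proof (cases "cs = []")
    case True then show ?thesis using css by (intro exI[of _ css]) simp
  next
    case False then show ?thesis using css comp by (intro exI[of _ "cs # css"]) auto
  qed
qed

lemma cprod_conj:
  assumes "distinct (concat css)" "bij p"
  shows "p \<circ> cprod css \<circ> inv' p = cprod (map (map p) css)"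
  using assms(1)
proof (induction css)
  case Nil
  have "p \<circ> inv' p = id" using assms(2) bij_is_surj surj_iff by blast
  then show ?case by (simp only: list.map cprod_simps comp_id)
next
  case (Cons cs css)
  have "inv' p \<circ> p = id" using assms(2) by (simp add: bij_is_inj)
  then have "p \<circ> cprod (cs # css) \<circ> inv' p = (p \<circ> cycle_of_list cs \<circ> inv' p) \<circ> (p \<circ> cprod css \<circ> inv' p)"
    by (simp add: fun_eq_iff)
  also have "p \<circ> cycle_of_list cs \<circ> inv' p = cycle_of_list (map p cs)"
    using Cons.prems by (intro conjugation_of_cycle assms(2)) auto
  also have "p \<circ> cprod css \<circ> inv' p = cprod (map (map p) css)"
    using Cons.prems by (intro Cons.IH) auto
  finally show ?case by (simp only: list.map cprod_simps)
qed

text \<open>The permutation that carries one concatenated list onto the other, letter by letter,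
  matches the cycles because their lengths agree.\<close>

lemma cycle_type_conj:
  assumes css: "distinct (concat css)" "distinct (concat css')" "set (concat css) = set (concat css')"
    and len: "map length css = map length css'"
  shows "\<exists>p. p permutes set (concat css) \<and> cprod css' = p \<circ> cprod css \<circ> inv' p"
proof -
  let ?x = "concat css" and ?y = "concat css'"
  define m where "m = length ?x"
  have my: "length ?y = m" using len by (simp add: m_def length_concat)
  have bx: "bij_betw ((!) ?x) {..<m} (set ?x)" and bY: "bij_betw ((!) ?y) {..<m} (set ?x)"
    unfolding m_def using css bij_betw_nth[of ?x "{..<m}"] bij_betw_nth[of ?y "{..<m}"] my by (auto simp: m_def)
  define q where "q = (\<lambda>z. if z \<in> set ?x then ?y ! inv_into {..<m} ((!) ?x) z else z)"
  have "bij_betw (\<lambda>z. ?y ! inv_into {..<m} ((!) ?x) z) (set ?x) (set ?x)"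
    using bij_betw_trans[OF bij_betw_inv_into[OF bx] bY] by (simp add: comp_def)
  then have "bij_betw q (set ?x) (set ?x)"
    by (rule bij_betw_cong[THEN iffD1, rotated]) (simp add: q_def)
  then have q: "q permutes set ?x" by (rule bij_imp_permutes) (simp add: q_def)
  have "map q ?x = ?y"
  proof (rule nth_equalityI)
    fix i assume "i < length (map q ?x)"
    then have i: "i < m" by (simp add: m_def)
    then have "inv_into {..<m} ((!) ?x) (?x ! i) = i" using bx by (auto simp: bij_betw_def inv_into_f_f)
    then show "map q ?x ! i = ?y ! i" using i nth_mem[of i ?x] by (simp add: q_def m_def del: set_concat)
  qed (simp add: my m_def)
  then have "concat (map (map q) css) = ?y" by (simp add: map_concat)
  moreover have "length css = length css'" using len by (metis length_map)
  moreover have "length x = length y" if "(x, y) \<in> set (zip (map (map q) css) css')" for x y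
    using that len by (auto simp: in_set_zip) (metis length_map nth_map)
  ultimately have "map (map q) css = css'" by (intro concat_injective) auto
  then show ?thesis using cprod_conj[OF css(1) permutes_bij[OF q]] q by auto
qed

section \<open>Partitions as cycle types\<close>

definition pn :: "nat \<Rightarrow> (nat \<Rightarrow> nat) set" where
  "pn n = {\<nu> \<in> partitions. psize \<nu> = n}"

text \<open>Cycle lengths are sorted increasingly whereas the parts of a partition decrease, hence
  the reversal.\<close>

definition list_part :: "nat list \<Rightarrow> nat \<Rightarrow> nat" where
  "list_part ls i = (if i < length ls then rev ls ! i else 0)"

lemma list_part:
  assumes "sorted ls" "0 \<notin> set ls"
  shows "list_part ls \<in> pn (sum_list ls)" "ls = rev (map (list_part ls) [0..<card {i. list_part ls i \<noteq> 0}])"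
proof -
  have "rev ls ! i \<noteq> 0" if "i < length ls" for i
    using nth_mem[of i "rev ls"] assms(2) that by (metis length_rev set_rev)
  then have supp: "{i. list_part ls i \<noteq> 0} = {..<length ls}"
    by (auto simp: list_part_def split: if_splits)
  have "antimono (list_part ls)"
    using assms(1) by (auto intro!: antimonoI simp: list_part_def rev_nth intro!: sorted_nth_mono)
  moreover have "psize (list_part ls) = sum_list ls"
  proof -
    have "psize (list_part ls) = (\<Sum>i<length ls. rev ls ! i)"
      unfolding psize_def supp by (auto simp: list_part_def)
    also have "\<dots> = sum_list (rev ls)" by (simp add: sum_list_sum_nth atLeast0LessThan)
    finally show ?thesis by (simp add: sum_list_rev)
  qed
  ultimately show "list_part ls \<in> pn (sum_list ls)" by (simp add: pn_def partitions_def supp del: neq0_conv)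
  have "rev ls = map (list_part ls) [0..<length ls]" by (rule nth_equalityI) (auto simp: list_part_def)
  then show "ls = rev (map (list_part ls) [0..<card {i. list_part ls i \<noteq> 0}])" unfolding supp
    by (metis card_lessThan rev_rev_ident)
qed

lemma sorted_cycle_list_ex:
  assumes "a \<in> Sym {1..n}"
  shows "\<exists>css. distinct (concat css) \<and> set (concat css) = {1..n} \<and> sorted (map length css)
    \<and> 0 \<notin> set (map length css) \<and> ap a = cprod css"
proof -
  obtain css where css: "distinct (concat css)" "set (concat css) = {1..n}" "[] \<notin> set css" "ap a = cprod css"
    using cycle_list_ex[of "ap a" "{1..n}"] assms by (auto simp: Sym_def)
  show ?thesis
    by (rule exI[of _ "sort_key length css"]) (use css cprod_sort[OF css(1), of length] in auto)
qed

text \<open>Fixed points are kept as cycles of length 1, so the lengths add up to \<open>n\<close>;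
  sorting makes the list of lengths a function of their multiset.\<close>

definition cyc :: "nat \<Rightarrow> fperm \<Rightarrow> nat list list" where
  "cyc n a = (SOME css. distinct (concat css) \<and> set (concat css) = {1..n} \<and> sorted (map length css)
    \<and> 0 \<notin> set (map length css) \<and> ap a = cprod css)"

definition ctype :: "nat \<Rightarrow> fperm \<Rightarrow> nat \<Rightarrow> nat" where
  "ctype n a = list_part (map length (cyc n a))"

lemma cyc:
  assumes "a \<in> Sym {1..n}"
  shows "distinct (concat (cyc n a))" "set (concat (cyc n a)) = {1..n}" "sorted (map length (cyc n a))"
    "0 \<notin> set (map length (cyc n a))" "ap a = cprod (cyc n a)"
  using someI_ex[OF sorted_cycle_list_ex[OF assms]] unfolding cyc_def by blast+

lemma ctype_pn: "a \<in> Sym {1..n} \<Longrightarrow> ctype n a \<in> pn n"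
proof -
  assume a: "a \<in> Sym {1..n}"
  have "sum_list (map length (cyc n a)) = card (set (concat (cyc n a)))"
    using distinct_card[OF cyc(1)[OF a]] by (simp add: length_concat)
  then show ?thesis using list_part(1)[OF cyc(3,4)[OF a]] cyc(2)[OF a] by (simp add: ctype_def)
qed

text \<open>This direction bounds the number of conjugacy classes by the number of partitions, which
  is what the count of central idempotents requires.\<close>

lemma ctype_conj:
  assumes "a \<in> Sym {1..n}" "b \<in> Sym {1..n}" "ctype n a = ctype n b"
  shows "\<exists>s\<in>Sym {1..n}. b = s + a - s"
proof -
  have "map length (cyc n a) = map length (cyc n b)"
    using list_part(2)[OF cyc(3,4)[OF assms(1)]] list_part(2)[OF cyc(3,4)[OF assms(2)]] assms(3)
    unfolding ctype_def by metis
  from cycle_type_conj[OF cyc(1)[OF assms(1)] cyc(1)[OF assms(2)] _ this]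
  obtain p where p: "p permutes {1..n}" "ap b = p \<circ> ap a \<circ> inv' p"
    using cyc[OF assms(1)] cyc[OF assms(2)] by auto
  have "ap (Ap p) = p" using p(1) by (simp add: ap_Ap)
  then have "b = Ap p + a - Ap p"
    by (intro fperm_eqI) (simp add: p(2) ap_plus diff_conv_add_uminus ap_uminus_fun del: add_uminus_conv_diff)
  then show ?thesis using p(1) \<open>ap (Ap p) = p\<close> by (intro bexI[of _ "Ap p"]) (simp_all add: Sym_def)
qed

lemma finite_pn: "finite (pn n)"
proof -
  have fin: "finite {i. \<nu> i \<noteq> 0}" if "\<nu> \<in> pn n" for \<nu> using that by (simp add: pn_def partitions_def)
  have le: "\<nu> i \<le> n" if "\<nu> \<in> pn n" for \<nu> i
    using member_le_sum[of i "{i. \<nu> i \<noteq> 0}" \<nu>] fin[OF that] that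
    by (cases "\<nu> i = 0") (auto simp: pn_def psize_def)
  have z: "\<nu> i = 0" if "\<nu> \<in> pn n" "n \<le> i" for \<nu> i
  proof (rule ccontr)
    assume "\<nu> i \<noteq> 0"
    moreover have "\<nu> i \<le> \<nu> j" if "j \<le> i" for j
      using partitions_mono[of \<nu> j i] \<open>\<nu> \<in> pn n\<close> that by (simp add: pn_def)
    ultimately have "{..i} \<subseteq> {i. \<nu> i \<noteq> 0}" by fastforce
    from card_mono[OF fin[OF that(1)] this] have "i + 1 \<le> card {i. \<nu> i \<noteq> 0}" by simp
    also have "\<dots> \<le> psize \<nu>" unfolding psize_def
      using sum_bounded_below[of "{i. \<nu> i \<noteq> 0}" 1 \<nu>] by auto
    finally show False using that by (simp add: pn_def)
  qed
  have "pn n \<subseteq> {\<nu>. \<forall>i. (i \<in> {..<n} \<longrightarrow> \<nu> i \<in> {..n}) \<and> (i \<notin> {..<n} \<longrightarrow> \<nu> i = 0)}"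
    using le z by auto
  then show ?thesis by (rule finite_subset) (intro finite_set_of_finite_funs; simp)
qed


section \<open>Completeness of the Young idempotents\<close>

lemma finite_cells: "\<nu> \<in> partitions \<Longrightarrow> finite (cells \<nu>) \<and> card (cells \<nu>) = psize \<nu>"
proof -
  assume "\<nu> \<in> partitions"
  then have fin: "finite {i. \<nu> i \<noteq> 0}" by (simp add: partitions_def)
  have "cells \<nu> = (SIGMA i:{i. \<nu> i \<noteq> 0}. {..<\<nu> i})" by (auto simp: cells_def)
  then show ?thesis using fin by (simp add: psize_def)
qed

lemma tab_ex: "\<nu> \<in> pn n \<Longrightarrow> \<exists>r c. tab {1..n} r c \<nu>"
proof -
  assume nu: "\<nu> \<in> pn n"
  then have "\<exists>h. bij_betw h {1..n} (cells \<nu>)"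
    using finite_cells[of \<nu>] by (intro finite_same_card_bij) (auto simp: pn_def)
  then obtain h where h: "bij_betw h {1..n} (cells \<nu>)" by blast
  then have "tab {1..n} (fst \<circ> h) (snd \<circ> h) \<nu>" using nu by (simp add: tab_def pn_def)
  then show ?thesis by blast
qed

text \<open>The choice of the tableau is immaterial by \<open>eid_unique\<close>; its entries are
  the numbers from 1 to the size of the shape.\<close>

definition eidem :: "(nat \<Rightarrow> nat) \<Rightarrow> (fperm \<Rightarrow>\<^sub>0 'f::field_char_0)" where
  "eidem \<nu> = (SOME e. \<exists>r c. tab {1..psize \<nu>} r c \<nu> \<and> e = tableau.eid {1..psize \<nu>} r c)"

lemma eidem_eq:
  assumes "tab {1..n} r c \<nu>" "\<nu> \<in> pn n"
  shows "eidem \<nu> = (tableau.eid {1..n} r c :: fperm \<Rightarrow>\<^sub>0 'f::field_char_0)"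
proof -
  have n: "psize \<nu> = n" using assms(2) by (simp add: pn_def)
  have "\<exists>e. \<exists>r c. tab {1..n} r c \<nu> \<and> e = (tableau.eid {1..n} r c :: fperm \<Rightarrow>\<^sub>0 'f)" using assms by blast
  from someI_ex[OF this] obtain r1 c1 where "tab {1..n} r1 c1 \<nu>"
    "eidem \<nu> = (tableau.eid {1..n} r1 c1 :: fperm \<Rightarrow>\<^sub>0 'f)"
    unfolding eidem_def n by blast
  then show ?thesis using eid_unique assms(1) by metis
qed

lemma eidem_props:
  assumes "\<nu> \<in> pn n"
  shows "(eidem \<nu> :: fperm \<Rightarrow>\<^sub>0 'f::field_char_0) \<in> GA {1..n}"
    "eidem \<nu> * eidem \<nu> = (eidem \<nu> :: fperm \<Rightarrow>\<^sub>0 'f)" "eidem \<nu> \<noteq> (0 :: fperm \<Rightarrow>\<^sub>0 'f)"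
    "x \<in> GA {1..n} \<Longrightarrow> x * eidem \<nu> = eidem \<nu> * (x :: fperm \<Rightarrow>\<^sub>0 'f)"
proof -
  obtain r c where rc: "tab {1..n} r c \<nu>" using tab_ex[OF assms] by blast
  interpret tableau "{1..n}" r c \<nu> "TYPE('f)" by unfold_locales fact
  show "(eidem \<nu> :: fperm \<Rightarrow>\<^sub>0 'f) \<in> GA {1..n}"
    "eidem \<nu> * eidem \<nu> = (eidem \<nu> :: fperm \<Rightarrow>\<^sub>0 'f)" "eidem \<nu> \<noteq> (0 :: fperm \<Rightarrow>\<^sub>0 'f)"
    "x \<in> GA {1..n} \<Longrightarrow> x * eidem \<nu> = eidem \<nu> * (x :: fperm \<Rightarrow>\<^sub>0 'f)"
    unfolding eidem_eq[OF rc assms] by (rule eid_GA eid_idem eid_nz eid_central; assumption?)+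
qed

text \<open>After both idempotents are expanded, each term has a Young symmetrizer of \<nu>, a group
  algebra element and a Young symmetrizer of \<mu> in succession, which is the situation of
  \<open>branching\<close>.\<close>

lemma eidem_mult_zero:
  fixes x :: "fperm \<Rightarrow>\<^sub>0 'f::field_char_0"
  assumes "\<nu> \<in> pn n" "\<mu> \<in> pn m" "n \<le> m" "\<not> \<nu> \<le> \<mu>"
  shows "eidem \<nu> * eidem \<mu> = (0 :: fperm \<Rightarrow>\<^sub>0 'f)"
proof -
  obtain r c where rc: "tab {1..n} r c \<nu>" using tab_ex[OF assms(1)] by blast
  obtain r' c' where rc': "tab {1..m} r' c' \<mu>" using tab_ex[OF assms(2)] by blast
  interpret A: tableau "{1..n}" r c \<nu> "TYPE('f)" by unfold_locales fact
  interpret B: tableau "{1..m}" r' c' \<mu> "TYPE('f)" by unfold_locales fact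
  have sub: "{1..n} \<subseteq> {1..m}" using assms(3) by auto
  have "A.u * x * B.u = 0" if "x \<in> GA {1..m}" for x
    by (rule branching[OF rc rc' sub assms(4) that])
  moreover have "psc (inverse A.kap) (star A.u * dl (- a)) * dl b \<in> GA {1..m}"
    if "a \<in> Sym {1..n}" "b \<in> Sym {1..m}" for a b
    using that sub A.u_GA by (intro GA_mult GA_psc GA_dl GA_mono[OF sub]) (auto intro: GA_intros)
  ultimately have *: "A.u * (psc (inverse A.kap) (star A.u * dl (- a)) * dl b) * B.u = 0"
    if "a \<in> Sym {1..n}" "b \<in> Sym {1..m}" for a b using that by blast
  have "A.eid * B.eid = (\<Sum>a\<in>Sym {1..n}. \<Sum>b\<in>Sym {1..m}. dl a *
      (A.u * (psc (inverse A.kap) (star A.u * dl (- a)) * dl b) * B.u) *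
      (psc (inverse B.kap) (star B.u * dl (- b))))"
    unfolding A.eid_expand B.eid_expand sum_product by (simp add: mult.assoc)
  also have "\<dots> = 0" by (intro sum.neutral ballI) (simp only: * mult_zero_left mult_zero_right)
  finally show ?thesis unfolding eidem_eq[OF rc assms(1)] eidem_eq[OF rc' assms(2)] .
qed

lemma pn_le_eq: "\<nu> \<in> pn n \<Longrightarrow> \<mu> \<in> pn n \<Longrightarrow> \<nu> \<le> \<mu> \<Longrightarrow> \<nu> = \<mu>"
proof -
  assume *: "\<nu> \<in> pn n" "\<mu> \<in> pn n" "\<nu> \<le> \<mu>"
  then have fin: "finite (cells \<mu>)" "card (cells \<mu>) = card (cells \<nu>)" using finite_cells by (auto simp: pn_def)
  have "cells \<nu> \<subseteq> cells \<mu>" using *(3) by (force simp: cells_def le_fun_def intro: less_le_trans)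
  then have "cells \<nu> = cells \<mu>" using fin by (metis card_subset_eq)
  then have "j < \<nu> i \<longleftrightarrow> j < \<mu> i" for i j by (auto simp: cells_def set_eq_iff)
  then show ?thesis by (intro ext) (metis nat_neq_iff)
qed

lemma eidem_orth:
  "\<nu> \<in> pn n \<Longrightarrow> \<mu> \<in> pn n \<Longrightarrow> \<nu> \<noteq> \<mu> \<Longrightarrow> eidem \<nu> * eidem \<mu> = (0 :: fperm \<Rightarrow>\<^sub>0 'f::field_char_0)"
  using eidem_mult_zero pn_le_eq by (metis order_refl)

text \<open>The centre has dimension at most the number of cycle types, so there is no room for a
  further central idempotent orthogonal to those of the partitions of \<open>n\<close>.\<close>

theorem eidem_complete: "(\<Sum>\<nu>\<in>pn n. eidem \<nu>) = (1 :: fperm \<Rightarrow>\<^sub>0 'f::field_char_0)"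
proof (rule ccontr)
  let ?Y = "{1..n}"
  define f :: "fperm \<Rightarrow>\<^sub>0 'f" where "f = 1 - (\<Sum>\<nu>\<in>pn n. eidem \<nu>)"
  assume "(\<Sum>\<nu>\<in>pn n. eidem \<nu>) \<noteq> (1 :: fperm \<Rightarrow>\<^sub>0 'f)"
  then have f0: "f \<noteq> 0" by (simp add: f_def)
  define S :: "(fperm \<Rightarrow>\<^sub>0 'f) set" where "S = insert f (eidem ` pn n)"
  have sumid: "eidem \<nu> * (\<Sum>\<nu>\<in>pn n. eidem \<nu>) = (eidem \<nu> :: fperm \<Rightarrow>\<^sub>0 'f)"
    "(\<Sum>\<nu>\<in>pn n. eidem \<nu>) * eidem \<nu> = (eidem \<nu> :: fperm \<Rightarrow>\<^sub>0 'f)" if "\<nu> \<in> pn n" for \<nu>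
  proof -
    have "eidem \<nu> * eidem \<mu> = (if \<mu> = \<nu> then eidem \<nu> else 0 :: fperm \<Rightarrow>\<^sub>0 'f)"
      "eidem \<mu> * eidem \<nu> = (if \<mu> = \<nu> then eidem \<nu> else 0 :: fperm \<Rightarrow>\<^sub>0 'f)" if "\<mu> \<in> pn n" for \<mu>
      using eidem_orth[OF \<open>\<nu> \<in> pn n\<close> that] eidem_orth[OF that \<open>\<nu> \<in> pn n\<close>] eidem_props(2)[OF that] by auto
    then show "eidem \<nu> * (\<Sum>\<nu>\<in>pn n. eidem \<nu>) = (eidem \<nu> :: fperm \<Rightarrow>\<^sub>0 'f)"
      "(\<Sum>\<nu>\<in>pn n. eidem \<nu>) * eidem \<nu> = (eidem \<nu> :: fperm \<Rightarrow>\<^sub>0 'f)"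
      using that finite_pn[of n] by (simp_all add: sum_distrib_left sum_distrib_right)
  qed
  have f_orth: "eidem \<nu> * f = 0" "f * eidem \<nu> = 0" if "\<nu> \<in> pn n" for \<nu>
    using sumid[OF that] by (simp_all add: f_def right_diff_distrib left_diff_distrib)
  have f_idem: "f * f = f"
  proof -
    have "f * f = f - f * (\<Sum>\<nu>\<in>pn n. eidem \<nu>)" by (subst (2) f_def) (simp add: right_diff_distrib)
    also have "f * (\<Sum>\<nu>\<in>pn n. eidem \<nu>) = 0" by (simp add: sum_distrib_left f_orth)
    finally show ?thesis by simp
  qed
  have S0: "v \<noteq> 0" "v * v = v" if "v \<in> S" for v
  proof -
    consider "v = f" | \<nu> where "\<nu> \<in> pn n" "v = eidem \<nu>" using \<open>v \<in> S\<close> unfolding S_def by blast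
    then show "v \<noteq> 0" "v * v = v"
      by (cases; simp add: f0 f_idem eidem_props(2,3))+
  qed
  have Sorth: "v * w = 0" if "v \<in> S" "w \<in> S" "v \<noteq> w" for v w
    using that f_orth eidem_orth[of _ n] by (auto simp: S_def)
  have fS: "f \<notin> eidem ` pn n"
    using f_orth S0(2)[of f] f0 by (auto simp: S_def)
  have inj: "inj_on (eidem :: _ \<Rightarrow> fperm \<Rightarrow>\<^sub>0 'f) (pn n)"
    by (rule inj_onI) (metis eidem_orth eidem_props(2,3))
  have finS: "finite S" by (simp add: S_def finite_pn)
  have cardS: "card S = Suc (card (pn n))"
    using fS inj finite_pn[of n] by (simp add: S_def card_image)
  have "pm.independent S"
  proof (rule pm.independent_if_scalars_zero[OF finS])
    fix g v assume 0: "(\<Sum>w\<in>S. psc (g w) w) = 0" and v: "v \<in> S"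
    have "v * psc (g w) w = (if w = v then psc (g v) v else 0)" if "w \<in> S" for w
      using Sorth[OF v that] S0(2)[OF v] by auto
    then have "v * (\<Sum>w\<in>S. psc (g w) w) = psc (g v) v"
      using v finS by (simp add: sum_distrib_left)
    then show "g v = 0" using 0 S0(1)[OF v] by (simp add: pm.scale_eq_0_iff)
  qed
  moreover
  \<comment> \<open>Sums of all permutations of one cycle type. The coefficients of a central
    element are constant on conjugacy classes, so these sums span the centre.\<close>
  define K :: "(nat \<Rightarrow> nat) \<Rightarrow> (fperm \<Rightarrow>\<^sub>0 'f)" where "K = (\<lambda>t. \<Sum>a\<in>{a \<in> Sym ?Y. ctype n a = t}. dl a)"
  have central: "v \<in> pm.span (K ` pn n)"
    if v: "v \<in> GA ?Y" "\<And>a. a \<in> Sym ?Y \<Longrightarrow> dl a * v = v * dl a" for v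
  proof -
    have conj: "lk v (s + a - s) = lk v a" if "s \<in> Sym ?Y" for s a
    proof -
      have "lk v (s + a - s) = lk (v * dl s) (s + a)" by (simp add: lk_mult_dl)
      also have "\<dots> = lk (dl s * v) (s + a)" by (simp add: v(2)[OF that])
      also have "\<dots> = lk v a" by (simp add: lk_mult_dl flip: add.assoc)
      finally show ?thesis .
    qed
    define g where "g = (\<lambda>t. lk v (SOME a. a \<in> Sym ?Y \<and> ctype n a = t))"
    have g: "lk v a = g (ctype n a)" if "a \<in> Sym ?Y" for a
    proof -
      have "\<exists>b. b \<in> Sym ?Y \<and> ctype n b = ctype n a" using that by blast
      from someI_ex[OF this] show ?thesis
        unfolding g_def using ctype_conj[OF _ that] conj by metis
    qed
    have "v = (\<Sum>a\<in>Sym ?Y. psc (lk v a) (dl a))" by (rule GA_expand) (use v in auto)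
    also have "\<dots> = (\<Sum>t\<in>pn n. \<Sum>a\<in>{a \<in> Sym ?Y. ctype n a = t}. psc (lk v a) (dl a))"
      by (rule sum.group[symmetric]) (auto simp: finite_Sym finite_pn ctype_pn)
    also have "\<dots> = (\<Sum>t\<in>pn n. psc (g t) (K t))"
      unfolding K_def pm.scale_sum_right by (intro sum.cong refl) (auto simp: g)
    also have "\<dots> \<in> pm.span (K ` pn n)"
      by (intro pm.span_sum pm.span_scale pm.span_base) auto
    finally show ?thesis .
  qed
  have eC: "eidem \<nu> \<in> GA ?Y" "a \<in> Sym ?Y \<Longrightarrow> dl a * eidem \<nu> = eidem \<nu> * (dl a :: fperm \<Rightarrow>\<^sub>0 'f)"
    if "\<nu> \<in> pn n" for \<nu> and a
    using eidem_props(1)[OF that] eidem_props(4)[OF that GA_dl] by auto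
  have fGA: "f \<in> GA ?Y" unfolding f_def by (intro GA_diff GA_1 GA_sum eC)
  have fC: "dl a * f = f * dl a" if "a \<in> Sym ?Y" for a
  proof -
    have "dl a * (\<Sum>\<nu>\<in>pn n. eidem \<nu>) = (\<Sum>\<nu>\<in>pn n. eidem \<nu>) * (dl a :: fperm \<Rightarrow>\<^sub>0 'f)"
      unfolding sum_distrib_left sum_distrib_right by (intro sum.cong refl eC that)
    then show ?thesis unfolding f_def by (simp add: right_diff_distrib left_diff_distrib)
  qed
  have "S \<subseteq> pm.span (K ` pn n)"
    unfolding S_def using central[OF fGA fC] central eC by auto
  ultimately have "card S \<le> card (K ` pn n)"
    using pm.independent_span_bound[of "K ` pn n" S] finite_pn by blast
  also have "\<dots> \<le> card (pn n)" using card_image_le[OF finite_pn] .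
  finally show False using cardS by simp
qed

section \<open>The signed action on words\<close>

lemma length_permute_word [simp]: "length (permute_word n p z) = n"
  by (simp add: permute_word_def)

lemma nth_permute_word [simp]: "i < n \<Longrightarrow> permute_word n p z ! i = z ! (p (Suc i) - 1)"
  by (simp add: permute_word_def del: upt_Suc)

text \<open>Permuting first by \<open>p\<close> and then by \<open>q\<close> amounts to p \<circ> q:
  places are permuted, and the action is a right action.\<close>

lemma permute_word_comp:
  assumes "q permutes {1..n}"
  shows "permute_word n q (permute_word n p z) = permute_word n (p \<circ> q) z"
proof (rule nth_equalityI)
  fix i assume "i < length (permute_word n q (permute_word n p z))"
  then have i: "i < n" by simp
  then have "q (Suc i) \<in> {1..n}" using permutes_in_image[OF assms, of "Suc i"] by simp
  then show "permute_word n q (permute_word n p z) ! i = permute_word n (p \<circ> q) z ! i"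
    using i by (simp add: less_eq_Suc_le)
qed simp

lemma permute_word_id: "length z = n \<Longrightarrow> permute_word n id z = z"
  by (rule nth_equalityI) auto

lemma set_permute_word:
  assumes "p permutes {1..n}" "length z = n"
  shows "set (permute_word n p z) = set z"
proof -
  have "set (permute_word n p z) = (\<lambda>i. z ! (i - 1)) ` p ` {1..n}"
    by (simp add: permute_word_def image_image atLeastLessThanSuc_atLeastAtMost del: upt_Suc)
  also have "\<dots> = set z"
  proof -
    have "{1..n} = Suc ` {..<n}" by (simp add: image_Suc_lessThan)
    then show ?thesis unfolding permutes_image[OF assms(1)] using assms(2)
      by (auto simp: image_image set_conv_nth)
  qed
  finally show ?thesis .
qed

section \<open>The sign of permuted odd letters\<close>

abbreviation wsgn :: "'v set \<Rightarrow> nat \<Rightarrow> (nat \<Rightarrow> nat) \<Rightarrow> 'v list \<Rightarrow> 'f::field_char_0" where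
  "wsgn OD n p z \<equiv> (- 1) ^ odd_inversions OD n p z"

text \<open>The contribution of a pair of positions, stated symmetrically in the two so that a
  permutation may reindex unordered pairs without regard to their order.\<close>

definition pair_sgn :: "(nat \<Rightarrow> bool) \<Rightarrow> (nat \<Rightarrow> nat) \<Rightarrow> nat \<times> nat \<Rightarrow> 'f::field_char_0" where
  "pair_sgn od p = (\<lambda>(i, j). if od (p i) \<and> od (p j) \<and> (i < j) \<noteq> (p i < p j) then - 1 else 1)"

lemma wsgn_prod:
  assumes p: "p permutes {1..n}"
  shows "(wsgn OD n p z :: 'f::field_char_0) = (\<Prod>e\<in>{(i, j) \<in> {1..n} \<times> {1..n}. i < j}. pair_sgn (\<lambda>i. z ! (i - 1) \<in> OD) p e)"
proof -
  define Q where "Q = {(i, j) \<in> {1..n} \<times> {1..n}. i < j}"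
  define I where "I = {(i, j). i \<in> {1..n} \<and> j \<in> {1..n} \<and> i < j \<and> p i > p j \<and> z ! (p i - 1) \<in> OD \<and> z ! (p j - 1) \<in> OD}"
  have fin: "finite Q" unfolding Q_def by (rule finite_subset[of _ "{1..n} \<times> {1..n}"]) auto
  have IQ: "I \<subseteq> Q" by (auto simp: I_def Q_def)
  have "pair_sgn (\<lambda>i. z ! (i - 1) \<in> OD) p e = (if e \<in> I then - 1 else 1 :: 'f)" if "e \<in> Q" for e
  proof -
    obtain i j where e: "e = (i, j)" "i < j" "i \<in> {1..n}" "j \<in> {1..n}" using \<open>e \<in> Q\<close> unfolding Q_def by blast
    have "p i \<noteq> p j" using permutes_inj[OF p] e(2) by (auto dest: injD)
    then have "(i < j) \<noteq> (p i < p j) \<longleftrightarrow> p i > p j" using e(2) by auto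
    then show ?thesis using e(2-4) unfolding e(1) pair_sgn_def I_def by simp
  qed
  then have "(\<Prod>e\<in>Q. pair_sgn (\<lambda>i. z ! (i - 1) \<in> OD) p e) = (\<Prod>e\<in>Q. if e \<in> I then - 1 else 1 :: 'f)"
    by (intro prod.cong refl)
  also have "\<dots> = (\<Prod>e\<in>I. - 1)"
    by (rule prod.mono_neutral_cong_right[OF fin IQ]) auto
  also have "\<dots> = (- 1) ^ card I" by simp
  also have "card I = odd_inversions OD n p z" by (simp only: odd_inversions_def I_def)
  finally show ?thesis unfolding Q_def by (rule sym)
qed

text \<open>The cocycle identity that makes the signed permutation an action. A pair of odd letters
  is reversed by the composite exactly if one but not both of the factors reverse it;
  \<open>sw\<close> lists the image of a pair in increasing order.\<close>

lemma wsgn_comp: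
  assumes p: "p permutes {1..n}" and q: "q permutes {1..n}"
  shows "wsgn OD n (p \<circ> q) z = (wsgn OD n p z * wsgn OD n q (permute_word n p z) :: 'f::field_char_0)"
proof -
  let ?Q = "{(i, j) \<in> {1..n} \<times> {1..n}. i < j}"
  define od where "od = (\<lambda>i. z ! (i - 1) \<in> OD)"
  have q1: "q i \<in> {1..n} \<longleftrightarrow> i \<in> {1..n}" "inv' q i \<in> {1..n} \<longleftrightarrow> i \<in> {1..n}" for i
    using permutes_in_image[OF q, of i] permutes_in_image[OF permutes_inv[OF q], of i] by auto
  have inj: "q i = q j \<longleftrightarrow> i = j" "p i = p j \<longleftrightarrow> i = j" for i j
    using permutes_inj[OF p] permutes_inj[OF q] by (auto dest: injD)
  have od': "(permute_word n p z ! (i - 1) \<in> OD) = od (p i)" if "i \<in> {1..n}" for i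
    using that by (cases i) (auto simp: od_def)
  define sw where "sw = (\<lambda>f :: nat \<Rightarrow> nat. \<lambda>(i, j). if f i < f j then (f i, f j) else (f j, f i))"
  have "wsgn OD n (p \<circ> q) z = (\<Prod>e\<in>?Q. pair_sgn od (p \<circ> q) e :: 'f)"
    unfolding od_def by (rule wsgn_prod) (intro permutes_compose p q)
  also have "\<dots> = (\<Prod>e\<in>?Q. pair_sgn od p (sw q e) * pair_sgn (\<lambda>i. od (p i)) q e)"
  proof (rule prod.cong[OF refl])
    fix e assume "e \<in> ?Q"
    then obtain i j where e: "e = (i, j)" "i < j" by auto
    then have "q i \<noteq> q j" "p (q i) \<noteq> p (q j)" using inj by auto
    then show "pair_sgn od (p \<circ> q) e = (pair_sgn od p (sw q e) * pair_sgn (\<lambda>i. od (p i)) q e :: 'f)"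
      using e by (auto simp: pair_sgn_def sw_def)
  qed
  also have "\<dots> = (\<Prod>e\<in>?Q. pair_sgn od p (sw q e)) * (\<Prod>e\<in>?Q. pair_sgn (\<lambda>i. od (p i)) q e)"
    by (rule prod.distrib)
  also have "(\<Prod>e\<in>?Q. pair_sgn od p (sw q e)) = (\<Prod>e\<in>?Q. pair_sgn od p e :: 'f)"
  proof (rule prod.reindex_bij_witness[of _ "sw (inv' q)" "sw q"])
    have ii: "inv' q (q i) = i" "q (inv' q i) = i" for i using permutes_inverses[OF q] by auto
    fix e assume "e \<in> ?Q"
    then obtain i j where e: "e = (i, j)" "i < j" "i \<in> {1..n}" "j \<in> {1..n}" by auto
    have n: "q i \<noteq> q j" "inv' q i \<noteq> inv' q j" using e(2) inj ii by (auto, metis nat_neq_iff)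
    show "sw (inv' q) (sw q e) = e" "sw q (sw (inv' q) e) = e"
      using e(2) by (auto simp: e(1) sw_def ii)
    show "sw q e \<in> ?Q" "sw (inv' q) e \<in> ?Q"
      using n q1 e by (auto simp: sw_def not_less le_less simp del: atLeastAtMost_iff)
  qed auto
  also have "(\<Prod>e\<in>?Q. pair_sgn od p e :: 'f) = wsgn OD n p z" unfolding od_def by (rule wsgn_prod[OF p, symmetric])
  also have "(\<Prod>e\<in>?Q. pair_sgn (\<lambda>i. od (p i)) q e :: 'f)
    = (\<Prod>e\<in>?Q. pair_sgn (\<lambda>i. permute_word n p z ! (i - 1) \<in> OD) q e)"
    by (intro prod.cong refl) (use q1 od' in \<open>auto simp: pair_sgn_def simp del: atLeastAtMost_iff\<close>)
  also have "\<dots> = wsgn OD n q (permute_word n p z)" by (rule wsgn_prod[OF q, symmetric])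
  finally show ?thesis .
qed

text \<open>The degree is read off from the word, so one definition serves all tensor
  powers.\<close>

definition wact :: "'v set \<Rightarrow> 'v list \<Rightarrow> fperm \<Rightarrow> ('v list \<Rightarrow>\<^sub>0 'f::field_char_0)" where
  "wact OD z a = sng (permute_word (length z) (ap a) z) (wsgn OD (length z) (ap a) z)"

definition act :: "'v set \<Rightarrow> ('v list \<Rightarrow>\<^sub>0 'f) \<Rightarrow> (fperm \<Rightarrow>\<^sub>0 'f) \<Rightarrow> ('v list \<Rightarrow>\<^sub>0 'f::field_char_0)" where
  "act OD x a = lext (\<lambda>z. lext (wact OD z) a) x"

lemma plin_act_left: "plin (\<lambda>x. act OD x a)"
  unfolding act_def by (rule plin_lext)

lemma plin_act_right: "plin (act OD x)"
  unfolding act_def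
  by (rule plinI)
    (simp_all add: lext_def[of _ x] plin_add[OF plin_lext] plin_psc[OF plin_lext] pm.scale_right_distrib
      sum.distrib pm.scale_sum_right mult.commute)

lemma act_sng_dl [simp]: "act OD (sng z 1) (dl a) = wact OD z a"
  by (simp add: act_def)

definition Wd :: "nat \<Rightarrow> 'v set \<Rightarrow> 'v list set" where "Wd n L = {z. length z = n \<and> set z \<subseteq> L}"

definition TL :: "nat \<Rightarrow> 'v set \<Rightarrow> ('v list \<Rightarrow>\<^sub>0 'f::field_char_0) set" where
  "TL n L = {x. ks x \<subseteq> Wd n L}"

lemma wact_TL: "z \<in> Wd n L \<Longrightarrow> a \<in> Sym {1..n} \<Longrightarrow> wact OD z a \<in> TL n L"
  using set_permute_word[of "ap a" n z] by (auto simp: TL_def Wd_def wact_def Sym_def)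

lemma TL_sum: "(\<And>i. i \<in> I \<Longrightarrow> f i \<in> TL n L) \<Longrightarrow> sum f I \<in> TL n L" by (simp add: TL_def keys_sumI)
lemma TL_psc: "x \<in> TL n L \<Longrightarrow> psc c x \<in> TL n L" using keys_psc[of c x] by (auto simp: TL_def)
lemma TL_add: "x \<in> TL n L \<Longrightarrow> y \<in> TL n L \<Longrightarrow> x + y \<in> TL n L" by (simp add: TL_def keys_addI)
lemma TL_diff: "x \<in> TL n L \<Longrightarrow> y \<in> TL n L \<Longrightarrow> x - y \<in> TL n L" by (simp add: TL_def keys_diffI)
lemma TL_0 [simp]: "0 \<in> TL n L" by (simp add: TL_def)
lemma TL_sng: "z \<in> Wd n L \<Longrightarrow> sng z c \<in> TL n L" by (auto simp: TL_def)
lemma TL_mono: "L \<subseteq> M \<Longrightarrow> x \<in> TL n L \<Longrightarrow> x \<in> TL n M" by (auto simp: TL_def Wd_def)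

lemma act_TL:
  assumes "x \<in> TL n L" "a \<in> GA {1..n}"
  shows "act OD x a \<in> TL n L"
proof -
  have "ks (lext (wact OD z) a) \<subseteq> Wd n L" if "z \<in> ks x" for z
  proof -
    have "ks (wact OD z s :: _ \<Rightarrow>\<^sub>0 'b) \<subseteq> Wd n L" if "s \<in> ks a" for s
      using wact_TL[of z n L s] assms \<open>z \<in> ks x\<close> that by (auto simp: TL_def GA_def)
    then show ?thesis using keys_lext[of "wact OD z" a] by blast
  qed
  then show ?thesis
    unfolding act_def TL_def using keys_lext[of "\<lambda>z. lext (wact OD z) a" x] by blast
qed

lemma act_mult:
  assumes x: "x \<in> TL n UNIV" and a: "a \<in> GA {1..n}" and b: "b \<in> GA {1..n}"
  shows "act OD (act OD x a) b = act OD x (a * b)"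
proof -
  have 1: "act OD (act OD (sng z 1) (dl s)) (dl t) = act OD (sng z 1) (dl s * dl t :: fperm \<Rightarrow>\<^sub>0 'b)"
    if "length z = n" "s \<in> Sym {1..n}" "t \<in> Sym {1..n}" for z s t
  proof -
    have st: "ap s permutes {1..n}" "ap t permutes {1..n}" using that by (auto simp: Sym_def)
    have "act OD (wact OD z s) (dl t) = psc (wsgn OD n (ap s) z) (wact OD (permute_word n (ap s) z) t)"
      using that by (simp add: act_def wact_def)
    also have "\<dots> = wact OD z (s + t)"
      using that by (simp add: wact_def permute_word_comp[OF st(2)] wsgn_comp[OF st] plus_fperm.rep_eq)
    finally show ?thesis by (simp add: dl_mult)
  qed
  have 2: "act OD (act OD x (dl s)) (dl t) = act OD x (dl s * dl t)"
    if "s \<in> Sym {1..n}" "t \<in> Sym {1..n}" for s t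
    by (rule plin_eqI[OF plin_comp[OF plin_act_left plin_act_left] plin_act_left, where S = "Wd n UNIV"])
      (use x that 1 in \<open>auto simp: TL_def Wd_def\<close>)
  have 3: "act OD (act OD x (dl s)) b = act OD x (dl s * b)" if "s \<in> Sym {1..n}" for s
    by (rule plin_eqI[OF plin_act_right plin_comp[OF plin_act_right plin_times(1)], where S = "Sym {1..n}"])
      (use b that 2 in \<open>auto simp: GA_def\<close>)
  show ?thesis
    by (rule plin_eqI[OF plin_comp[OF plin_act_left plin_act_right] plin_comp[OF plin_act_right plin_times(2)],
          where S = "Sym {1..n}"])
      (use a 3 in \<open>auto simp: GA_def\<close>)
qed

lemma act_one:
  assumes "x \<in> TL n L" shows "act OD x 1 = x"
proof (rule plin_eqI[OF plin_act_left plin_id, where S = UNIV])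
  fix z :: "'a list"
  have "odd_inversions OD (length z) id z = 0"
    by (auto simp: odd_inversions_def card_eq_0_iff)
  moreover have "ap 0 = id" by (auto simp: fun_eq_iff)
  ultimately show "act OD (sng z 1) 1 = sng z 1"
    unfolding dl_0[symmetric] act_sng_dl by (simp add: wact_def permute_word_id)
qed simp


subsection \<open>Concatenation\<close>

abbreviation fmul :: "('v list \<Rightarrow>\<^sub>0 'f) \<Rightarrow> ('v list \<Rightarrow>\<^sub>0 'f) \<Rightarrow> ('v list \<Rightarrow>\<^sub>0 'f::field)" where
  "fmul x y \<equiv> x \<otimes>\<^bsub>free_algebra\<^esub> y"

lemma monoid_words: "monoid \<lparr>carrier = UNIV, mult = (@), one = []\<rparr>"
  by (rule monoidI) auto

lemma ring_free: "ring (free_algebra :: ('f::field, 'x list \<Rightarrow>\<^sub>0 'f) module)"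
  unfolding free_algebra_def by (rule ring_monoid_algebra[OF monoid_words])

lemma free_algebra_sel [simp]:
  "carrier free_algebra = UNIV" "one free_algebra = sng [] 1" "zero free_algebra = 0"
  "add free_algebra = (+)" "smult free_algebra = psc" "fmul (sng z c) (sng w d) = sng (z @ w) (c * d)"
  by (auto simp: free_algebra_def)

lemma plin_fmul: "plin (\<lambda>x. fmul x y)" "plin (fmul x)"
  unfolding free_algebra_def by (rule plin_mult_left plin_mult_right)+

lemma fmul_assoc: "fmul (fmul x y) z = fmul x (fmul y z)"
  unfolding free_algebra_def by (rule monoid_algebra_assoc[OF monoid_words]) auto

lemma keys_fmul: "ks (fmul x y) \<subseteq> (\<lambda>(z, w). z @ w) ` (ks x \<times> ks y)"
  using keys_mult_monoid_algebra[of "\<lparr>carrier = UNIV, mult = (@), one = []\<rparr>" x y]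
  by (simp add: free_algebra_def)

lemma fmul_TL: "x \<in> TL n L \<Longrightarrow> y \<in> TL m L \<Longrightarrow> fmul x y \<in> TL (n + m) L"
  using keys_fmul[of x y] by (fastforce simp: TL_def Wd_def)

lemma wact_append_left:
  assumes a: "a \<in> Sym {1..length z}"
  shows "wact OD (z @ w) a = fmul (wact OD z a) (sng w 1)"
proof -
  let ?n = "length z" and ?m = "length w" and ?p = "ap a"
  have out: "?p i = i" if "i \<notin> {1..?n}" for i using a that by (rule Sym_out)
  have inn: "?p i \<in> {1..?n}" if "i \<in> {1..?n}" for i using Sym_in[OF a] that by blast
  have "permute_word (?n + ?m) ?p (z @ w) = permute_word ?n ?p z @ w"
  proof (rule nth_equalityI)
    fix i assume "i < length (permute_word (?n + ?m) ?p (z @ w))"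
    then have i: "i < ?n + ?m" by simp
    show "permute_word (?n + ?m) ?p (z @ w) ! i = (permute_word ?n ?p z @ w) ! i"
      using i inn[of "Suc i"] out[of "Suc i"] by (cases "i < ?n") (auto simp: nth_append)
  qed simp
  moreover have "odd_inversions OD (?n + ?m) ?p (z @ w) = odd_inversions OD ?n ?p z"
    unfolding odd_inversions_def
  proof (rule arg_cong[where f = card], intro Collect_cong, clarify)
    fix i j
    show "(i \<in> {1..?n + ?m} \<and> j \<in> {1..?n + ?m} \<and> i < j \<and> ?p j < ?p i \<and>
        (z @ w) ! (?p i - 1) \<in> OD \<and> (z @ w) ! (?p j - 1) \<in> OD)
      = (i \<in> {1..?n} \<and> j \<in> {1..?n} \<and> i < j \<and> ?p j < ?p i \<and> z ! (?p i - 1) \<in> OD \<and> z ! (?p j - 1) \<in> OD)"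
      using inn[of i] inn[of j] out[of i] out[of j]
      by (cases "i \<in> {1..?n}"; cases "j \<in> {1..?n}") (auto simp: nth_append)
  qed
  ultimately show ?thesis by (simp add: wact_def)
qed

definition shiftp :: "nat \<Rightarrow> (nat \<Rightarrow> nat) \<Rightarrow> nat \<Rightarrow> nat" where
  "shiftp k p i = (if i \<le> k then i else p (i - k) + k)"

lemma wact_append_right:
  assumes a: "a \<in> Sym {1..length z}" and b: "ap b = shiftp (length w) (ap a)"
  shows "wact OD (w @ z) b = fmul (sng w 1) (wact OD z a)"
proof -
  let ?n = "length z" and ?m = "length w" and ?p = "ap a"
  have inn: "?p i \<in> {1..?n}" if "i \<in> {1..?n}" for i using Sym_in[OF a] that by blast
  have "permute_word (?m + ?n) (ap b) (w @ z) = w @ permute_word ?n ?p z"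
  proof (rule nth_equalityI)
    fix i assume "i < length (permute_word (?m + ?n) (ap b) (w @ z))"
    then have i: "i < ?m + ?n" by simp
    have "ap a (Suc (i - ?m)) \<ge> 1" if "\<not> i < ?m" using inn[of "Suc (i - ?m)"] i that by auto
    then show "permute_word (?m + ?n) (ap b) (w @ z) ! i = (w @ permute_word ?n ?p z) ! i"
      using i by (cases "i < ?m") (auto simp: nth_append b shiftp_def Suc_diff_le)
  qed simp
  moreover have "odd_inversions OD (?m + ?n) (ap b) (w @ z) = odd_inversions OD ?n ?p z"
  proof -
    let ?I = "{(i, j). i \<in> {1..?n} \<and> j \<in> {1..?n} \<and> i < j \<and> ?p i > ?p j \<and> z ! (?p i - 1) \<in> OD \<and> z ! (?p j - 1) \<in> OD}"
    let ?J = "{(i, j). i \<in> {1..?m + ?n} \<and> j \<in> {1..?m + ?n} \<and> i < j \<and> ap b i > ap b j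
      \<and> (w @ z) ! (ap b i - 1) \<in> OD \<and> (w @ z) ! (ap b j - 1) \<in> OD}"
    have nth: "(w @ z) ! (?p i + ?m - 1) = z ! (?p i - 1)" if "i \<in> {1..?n}" for i
      using inn[OF that] by (auto simp: nth_append)
    have 1: "\<exists>i'\<in>{1..?n}. i = i' + ?m" if "i \<in> {1..?m + ?n}" "\<not> i \<le> ?m" for i
      using that by (intro bexI[of _ "i - ?m"]) auto
    have b1: "ap b (i + ?m) = ?p i + ?m" if "i \<in> {1..?n}" for i using that by (auto simp: b shiftp_def)
    have "?J = (\<lambda>(i, j). (i + ?m, j + ?m)) ` ?I"
    proof (intro equalityI subsetI)
      fix e assume "e \<in> ?J"
      then obtain i j where e: "e = (i, j)" and ij: "i \<in> {1..?m + ?n}" "j \<in> {1..?m + ?n}" "i < j" "ap b j < ap b i"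
        "(w @ z) ! (ap b i - 1) \<in> OD" "(w @ z) ! (ap b j - 1) \<in> OD" by blast
      have "\<not> i \<le> ?m" using ij(3,4) by (auto simp: b shiftp_def split: if_splits)
      moreover from this have "\<not> j \<le> ?m" using ij(3) by simp
      ultimately obtain i' j' where "i' \<in> {1..?n}" "j' \<in> {1..?n}" "i = i' + ?m" "j = j' + ?m"
        using 1 ij by metis
      then show "e \<in> (\<lambda>(i, j). (i + ?m, j + ?m)) ` ?I"
        using ij nth by (auto simp: e b1 simp del: atLeastAtMost_iff intro!: image_eqI[where x = "(i', j')"])
    next
      fix e assume "e \<in> (\<lambda>(i, j). (i + ?m, j + ?m)) ` ?I"
      then show "e \<in> ?J" using nth b1 by auto
    qed
    moreover have "inj_on (\<lambda>(i, j). (i + ?m, j + ?m)) ?I" by (auto simp: inj_on_def)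
    ultimately show ?thesis unfolding odd_inversions_def by (simp only: card_image)
  qed
  ultimately show ?thesis by (simp add: wact_def)
qed


lemma act_fmul_left:
  assumes x: "x \<in> TL n UNIV" and a: "a \<in> GA {1..n}"
  shows "act OD (fmul x y) a = fmul (act OD x a) y"
proof -
  have 1: "act OD (fmul (sng z 1) (sng w 1)) (dl s) = fmul (act OD (sng z 1) (dl s)) (sng w 1)"
    if "z \<in> Wd n UNIV" "s \<in> Sym {1..n}" for z w s
    using that wact_append_left[of s z OD w] by (simp add: Wd_def)
  have 2: "act OD (fmul (sng z 1) y) (dl s) = fmul (act OD (sng z 1) (dl s)) y"
    if "z \<in> Wd n UNIV" "s \<in> Sym {1..n}" for z s
    by (rule plin_eqI[OF plin_comp[OF plin_act_left plin_fmul(2)] plin_fmul(2), where S = UNIV])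
      (use that 1 in auto)
  have 3: "act OD (fmul (sng z 1) y) a = fmul (act OD (sng z 1) a) y" if "z \<in> Wd n UNIV" for z
    by (rule plin_eqI[OF plin_act_right plin_comp[OF plin_fmul(1) plin_act_right], where S = "Sym {1..n}"])
      (use that a 2 in \<open>auto simp: GA_def\<close>)
  show ?thesis
    by (rule plin_eqI[OF plin_comp[OF plin_act_left plin_fmul(1)] plin_comp[OF plin_fmul(1) plin_act_left], where S = "Wd n UNIV"])
      (use x 3 in \<open>auto simp: TL_def\<close>)
qed

text \<open>Acting on the last \<open>n\<close> of k + n places is conjugate to acting on the first
  \<open>n\<close>, by a block rotation \<open>t\<close> that does not depend on \<open>a\<close>.
  This reduces right factors of a concatenation to left factors.\<close>

lemma shiftp_conj:
  "\<exists>t. \<forall>a\<in>Sym {1..n}. t + a - t \<in> Sym {1..k + n} \<and> ap (t + a - t) = shiftp k (ap a)" "\<exists>t\<in>Sym {1..k + n}. \<forall>a\<in>Sym {1..n}. ap (t + a - t) = shiftp k (ap a)"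
proof -
  define f where "f = (\<lambda>i. if i \<in> {1..n} then i + k else if i \<in> {n + 1..n + k} then i - n else i)"
  define g where "g = (\<lambda>i. if i \<in> {1..k} then i + n else if i \<in> {k + 1..k + n} then i - k else i)"
  have fg: "f (g i) = i" "g (f i) = i" for i by (auto simp: f_def g_def)
  have "bij_betw f {1..k + n} {1..k + n}"
    by (rule bij_betw_byWitness[where f' = g]) (auto simp: fg, auto simp: f_def g_def)
  then have f: "f permutes {1..k + n}" by (rule bij_imp_permutes) (auto simp: f_def)
  define t where "t = Ap f"
  have t: "ap t = f" "ap (- t) = g"
  proof -
    show 1: "ap t = f" using f by (simp add: t_def ap_Ap)
    show "ap (- t) = g" by (rule ext) (metis 1 ap_uminus(1) fg(1))
  qed
  have tS: "t \<in> Sym {1..k + n}" using f by (simp add: Sym_def t)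
  have c: "ap (t + a - t) = shiftp k (ap a)" if a: "a \<in> Sym {1..n}" for a
  proof
    fix i
    have "ap (t + a - t) i = f (ap a (g i))"
      by (simp add: ap_plus diff_conv_add_uminus t del: add_uminus_conv_diff)
    also have "\<dots> = shiftp k (ap a) i"
    proof (cases "i \<in> {k + 1..k + n}")
      case True
      then have "g i = i - k" "i - k \<in> {1..n}" by (auto simp: g_def)
      moreover from this have "ap a (i - k) \<in> {1..n}" using Sym_in[OF a] by blast
      ultimately show ?thesis using True by (auto simp: f_def shiftp_def)
    next
      case False
      then have "g i \<notin> {1..n}" by (auto simp: g_def)
      then have "ap a (g i) = g i" by (rule Sym_out[OF a])
      moreover have "ap a (i - k) = i - k" if "\<not> i \<le> k" using False that by (intro Sym_out[OF a]) auto
      ultimately show ?thesis by (simp add: fg shiftp_def)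
    qed
    finally show "ap (t + a - t) i = shiftp k (ap a) i" .
  qed
  show "\<exists>t\<in>Sym {1..k + n}. \<forall>a\<in>Sym {1..n}. ap (t + a - t) = shiftp k (ap a)"
    using tS c by blast
  have "t + a - t \<in> Sym {1..k + n}" if "a \<in> Sym {1..n}" for a
    using tS Sym_mono[of "{1..n}" "{1..k + n}" a] that
    by (auto simp: diff_conv_add_uminus simp del: add_uminus_conv_diff intro!: Sym_add Sym_uminus)
  then show "\<exists>t. \<forall>a\<in>Sym {1..n}. t + a - t \<in> Sym {1..k + n} \<and> ap (t + a - t) = shiftp k (ap a)"
    using c by blast
qed

lemma act_fmul_right:
  fixes a :: "fperm \<Rightarrow>\<^sub>0 'f::field_char_0"
  assumes a: "a \<in> GA {1..n}"
  shows "\<exists>t\<in>Sym {1..k + n}. \<forall>x\<in>TL n UNIV. \<forall>y\<in>TL k UNIV.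
    act OD (fmul y x) (dl t * a * dl (- t)) = fmul y (act OD x a)"
proof -
  obtain t where t: "t \<in> Sym {1..k + n}" "\<And>a. a \<in> Sym {1..n} \<Longrightarrow> ap (t + a - t) = shiftp k (ap a)"
    using shiftp_conj(2)[of k n] by blast
  have 1: "act OD (fmul (sng w 1) (sng z 1)) (dl t * dl s * dl (- t)) = fmul (sng w 1) (act OD (sng z 1) (dl s) :: _ \<Rightarrow>\<^sub>0 'f)"
    if "z \<in> Wd n UNIV" "w \<in> Wd k UNIV" "s \<in> Sym {1..n}" for z w s
    using that t(2)[OF that(3)] wact_append_right[of s z "t + s - t" w OD] by (simp add: Wd_def dl_mult)
  have 2: "act OD (fmul (sng w 1) (sng z 1)) (dl t * a * dl (- t)) = fmul (sng w 1) (act OD (sng z 1) a :: _ \<Rightarrow>\<^sub>0 'f)"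
    if "z \<in> Wd n UNIV" "w \<in> Wd k UNIV" for z w
    by (rule plin_eqI[where p = a and S = "Sym {1..n}" and F = "\<lambda>a. act OD (fmul (sng w 1) (sng z 1)) (dl t * a * dl (- t))"
          and G = "\<lambda>a. fmul (sng w 1) (act OD (sng z 1) a)",
          OF plin_comp[OF plin_act_right plin_comp[OF plin_times(2) plin_times(1)]] plin_comp[OF plin_fmul(2) plin_act_right]])
      (use that a 1 in \<open>auto simp: GA_def\<close>)
  have 3: "act OD (fmul (sng w 1) x) (dl t * a * dl (- t)) = fmul (sng w 1) (act OD x a)"
    if "x \<in> TL n UNIV" "w \<in> Wd k UNIV" for x w
    by (rule plin_eqI[where p = x and S = "Wd n UNIV" and F = "\<lambda>x. act OD (fmul (sng w 1) x) (dl t * a * dl (- t))"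
          and G = "\<lambda>x. fmul (sng w 1) (act OD x a)",
          OF plin_comp[OF plin_act_left plin_fmul(2)] plin_comp[OF plin_fmul(2) plin_act_left]])
      (use that 2 in \<open>auto simp: TL_def\<close>)
  have 4: "act OD (fmul y x) (dl t * a * dl (- t)) = fmul y (act OD x a)"
    if "x \<in> TL n UNIV" "y \<in> TL k UNIV" for x y
    by (rule plin_eqI[where p = y and S = "Wd k UNIV" and F = "\<lambda>y. act OD (fmul y x) (dl t * a * dl (- t))"
          and G = "\<lambda>y. fmul y (act OD x a)",
          OF plin_comp[OF plin_act_left plin_fmul(1)] plin_fmul(1)])
      (use that 3 in \<open>auto simp: TL_def\<close>)
  show ?thesis using t(1) 4 by blast
qed


subsection \<open>Symmetrizers acting on words\<close>

lemma act_gsum: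
  assumes "x \<in> TL n UNIV" "a \<in> Stab X r" "X \<subseteq> {1..n}" "pchar \<chi>"
  shows "act OD (act OD x (dl a)) (gsum (Stab X r) \<chi>) = psc (\<chi> a) (act OD x (gsum (Stab X r) \<chi>))"
proof -
  have "finite X" using assms(3) finite_subset by blast
  moreover have "a \<in> Sym {1..n}" using assms(2,3) by (auto dest: Stab_Sym Sym_mono)
  moreover have "gsum (Stab X r) \<chi> \<in> GA {1..n}" using GA_mono[OF assms(3) GA_Stab] .
  ultimately show ?thesis
    using assms by (simp add: act_mult GA_dl gsum_absorb subgrp_Stab plin_psc[OF plin_act_right])
qed

text \<open>The elementary move of all later sign computations: the character value of an adjacent
  transposition times the sign of a pair of odd letters.\<close>

lemma act_swap:
  fixes \<chi> :: "fperm \<Rightarrow> 'f::field_char_0"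
  assumes i: "{length x + 1, length x + 2} \<subseteq> X" and X: "X \<subseteq> {1..length x + 2 + length y}"
    and chi: "pchar \<chi>"
  defines "t \<equiv> Ap (transpose (length x + 1) (length x + 2))"
  shows "act OD (sng (x @ a # b # y) 1) (gsum (Sym X) \<chi>)
    = psc (\<chi> t * (if a \<in> OD \<and> b \<in> OD then - 1 else 1)) (act OD (sng (x @ b # a # y) 1) (gsum (Sym X) \<chi>))"
proof -
  let ?n = "length x + 2 + length y" and ?i = "length x + 1" and ?j = "length x + 2"
  let ?z = "x @ a # b # y" and ?z' = "x @ b # a # y"
  have tp: "transpose ?i ?j permutes {1..?n}" by (rule permutes_swap_id) auto
  have t: "ap t = transpose ?i ?j" unfolding t_def by (rule ap_Ap[OF tp]) simp
  have tX: "t \<in> Sym X" using i by (auto simp: Sym_iff t transpose_def)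
  have len: "length ?z = ?n" by simp
  have pw: "permute_word ?n (ap t) ?z = ?z'"
  proof (rule nth_equalityI)
    fix m assume "m < length (permute_word ?n (ap t) ?z)"
    then show "permute_word ?n (ap t) ?z ! m = ?z' ! m"
      by (auto simp: t transpose_def nth_append nth_Cons' )
  qed simp
  have "{(m, k). m \<in> {1..?n} \<and> k \<in> {1..?n} \<and> m < k \<and> ap t m > ap t k \<and> ?z ! (ap t m - 1) \<in> OD \<and> ?z ! (ap t k - 1) \<in> OD}
    = (if a \<in> OD \<and> b \<in> OD then {(?i, ?j)} else {})"
  proof -
    have lt: "m < k \<and> ap t m > ap t k \<longleftrightarrow> m = ?i \<and> k = ?j" for m k
      by (auto simp: t transpose_def)
    have v: "ap t ?i = ?j" "ap t ?j = ?i" by (simp_all add: t)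
    have zz: "?z ! (?j - 1) = b" "?z ! (?i - 1) = a" by (simp_all add: nth_append)
    have "(m \<in> {1..?n} \<and> k \<in> {1..?n} \<and> m < k \<and> ap t m > ap t k
        \<and> ?z ! (ap t m - 1) \<in> OD \<and> ?z ! (ap t k - 1) \<in> OD) \<longleftrightarrow> m = ?i \<and> k = ?j \<and> a \<in> OD \<and> b \<in> OD" for m k
    proof (cases "m = ?i \<and> k = ?j")
      case True
      then have mk: "m = ?i" "k = ?j" by auto
      show ?thesis unfolding mk v zz by auto
    next
      case False then show ?thesis using lt[of m k] by blast
    qed
    then show ?thesis by simp
  qed
  then have oi: "odd_inversions OD ?n (ap t) ?z = (if a \<in> OD \<and> b \<in> OD then 1 else 0)"
    unfolding odd_inversions_def by (simp split: if_splits)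
  have "act OD (act OD (sng ?z 1) (dl t)) (gsum (Sym X) \<chi>) = psc (\<chi> t) (act OD (sng ?z 1) (gsum (Sym X) \<chi>))"
    unfolding Sym_eq_Stab
    by (rule act_gsum[where n = ?n]) (use tX X chi in \<open>auto simp: TL_def Wd_def Sym_eq_Stab[symmetric]\<close>)
  moreover have "act OD (sng ?z 1) (dl t) = psc (if a \<in> OD \<and> b \<in> OD then - 1 else 1) (sng ?z' (1 :: 'f))"
  proof -
    have "wact OD ?z t = sng (permute_word ?n (ap t) ?z) (wsgn OD ?n (ap t) ?z :: 'f)"
      unfolding wact_def len ..
    then show ?thesis unfolding act_sng_dl pw oi by simp
  qed
  ultimately have "psc (if a \<in> OD \<and> b \<in> OD then - 1 else 1) (act OD (sng ?z' 1) (gsum (Sym X) \<chi>))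
    = psc (\<chi> t) (act OD (sng ?z 1) (gsum (Sym X) \<chi>))"
    by (simp only: plin_psc[OF plin_act_left])
  from arg_cong[OF this, of "psc (\<chi> t)"] show ?thesis by (simp add: pchar_sq[OF chi])
qed

text \<open>When only odd positions move, the sign of the action is the ordinary sign: a
  transposition reverses its own pair and two further odd pairs for every odd position in
  between.\<close>

lemma wsgn_odd_positions:
  assumes a: "a \<in> Sym X" and X: "X = {i \<in> {1..length z}. z ! (i - 1) \<in> OD}"
  shows "wsgn OD (length z) (ap a) z = (psgn a :: 'f::field_char_0)"
proof -
  let ?n = "length z"
  have XS: "X \<subseteq> {1..?n}" "finite X" using X by auto
  have sgn_t: "wsgn OD ?n (transpose x y) w = (- 1 :: 'f)"
    if xy: "x \<in> X" "y \<in> X" "x < y" and w: "length w = ?n" "\<And>i. i \<in> {1..?n} \<Longrightarrow> w ! (i - 1) \<in> OD \<longleftrightarrow> i \<in> X" for x y w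
  proof -
    let ?t = "transpose x y"
    define M where "M = {m \<in> X. x < m \<and> m < y}"
    have tX: "?t i \<in> X \<longleftrightarrow> i \<in> X" for i using xy by (auto simp: transpose_def)
    have tn: "?t i \<in> {1..?n} \<longleftrightarrow> i \<in> {1..?n}" for i using xy XS(1) by (auto simp: transpose_def)
    have "{(i, j). i \<in> {1..?n} \<and> j \<in> {1..?n} \<and> i < j \<and> ?t i > ?t j \<and> w ! (?t i - 1) \<in> OD \<and> w ! (?t j - 1) \<in> OD}
      = {(i, j). i \<in> X \<and> j \<in> X \<and> i < j \<and> ?t i > ?t j}"
      using w(2)[of "?t _"] tX tn XS(1) by (auto simp del: atLeastAtMost_iff)
    also have "\<dots> = (\<lambda>m. (x, m)) ` M \<union> (\<lambda>m. (m, y)) ` M \<union> {(x, y)}"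
      using xy by (auto simp: M_def transpose_def split: if_splits)
    also have "card \<dots> = card M + card M + 1"
    proof -
      have "finite M" using XS by (simp add: M_def)
      moreover have "card ((\<lambda>m. (x, m)) ` M) = card M" "card ((\<lambda>m. (m, y)) ` M) = card M"
        by (auto intro!: card_image inj_onI)
      moreover have "(\<lambda>m. (x, m)) ` M \<inter> (\<lambda>m. (m, y)) ` M = {}" "(x, y) \<notin> (\<lambda>m. (x, m)) ` M \<union> (\<lambda>m. (m, y)) ` M"
        by (auto simp: M_def)
      ultimately show ?thesis by (simp add: card_Un_disjoint)
    qed
    finally show ?thesis by (simp add: odd_inversions_def)
  qed
  have "wsgn OD ?n p z = (of_int (sign p) :: 'f)" if "p permutes X" for p
  proof (rule permutes_induct[OF that XS(2)])
    have "odd_inversions OD ?n id z = 0" by (auto simp: odd_inversions_def card_eq_0_iff)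
    then show "wsgn OD ?n id z = (of_int (sign id) :: 'f)" by simp
  next
    fix x y p assume xX: "x \<in> X" and yX: "y \<in> X" and xy: "x \<noteq> y" and pX': "p permutes X"
      and IH: "wsgn OD ?n p z = (of_int (sign p) :: 'f)"
    note swap = xX yX xy IH pX'
    show "wsgn OD ?n (transpose x y \<circ> p) z = (of_int (sign (transpose x y \<circ> p)) :: 'f)"
    proof -
      have False: "x \<noteq> y" by fact
      have pn: "p permutes {1..?n}" using pX' XS(1) by (rule permutes_subset)
      have tn: "transpose x y permutes {1..?n}" using swap XS(1) by (intro permutes_swap_id) auto
      have pX: "permute_word ?n (transpose x y) z ! (i - 1) \<in> OD \<longleftrightarrow> i \<in> X" if "i \<in> {1..?n}" for i
      proof -
        have "transpose x y i \<in> {1..?n}" using that swap XS(1) by (auto simp: transpose_def)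
        then have "z ! (transpose x y i - 1) \<in> OD \<longleftrightarrow> transpose x y i \<in> X" using X by blast
        moreover have "transpose x y i \<in> X \<longleftrightarrow> i \<in> X" using swap by (auto simp: transpose_def)
        ultimately show ?thesis using that by (cases i) auto
      qed
      have e1: "wsgn OD ?n (transpose x y) z = (- 1 :: 'f)"
        using sgn_t[of x y z] sgn_t[of y x z] swap False X by (cases "x < y") (auto simp: transpose_commute)
      have e2: "wsgn OD ?n p (permute_word ?n (transpose x y) z) = (wsgn OD ?n p z :: 'f)"
      proof -
        have "odd_inversions OD ?n p (permute_word ?n (transpose x y) z) = odd_inversions OD ?n p z"
          unfolding odd_inversions_def
        proof (rule arg_cong[where f = card], intro Collect_cong, clarify)
          fix i j
          have "p m \<in> {1..?n}" if "m \<in> {1..?n}" for m using permutes_in_image[OF pn] that by blast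
          then show "(i \<in> {1..?n} \<and> j \<in> {1..?n} \<and> i < j \<and> p j < p i \<and>
              permute_word ?n (transpose x y) z ! (p i - 1) \<in> OD \<and> permute_word ?n (transpose x y) z ! (p j - 1) \<in> OD)
            = (i \<in> {1..?n} \<and> j \<in> {1..?n} \<and> i < j \<and> p j < p i \<and> z ! (p i - 1) \<in> OD \<and> z ! (p j - 1) \<in> OD)"
            using pX X by blast
        qed
        then show ?thesis by simp
      qed
      have "wsgn OD ?n (transpose x y \<circ> p) z
        = (wsgn OD ?n (transpose x y) z * wsgn OD ?n p (permute_word ?n (transpose x y) z) :: 'f)"
        by (rule wsgn_comp[OF tn pn])
      then have "wsgn OD ?n (transpose x y \<circ> p) z = - (of_int (sign p) :: 'f)" unfolding e1 e2 IH by simp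
      moreover have "permutation p" using pX' XS(2) permutation_permutes by blast
      ultimately show ?thesis
        using False by (simp add: sign_compose permutation_swap_id sign_swap_id)
    qed
  qed
  then show ?thesis using a by (simp add: Sym_def psgn_def)
qed

text \<open>Equal even letters commute and equal odd letters anticommute under the action, so a word
  is an eigenvector of the symmetrizers attached to colours that determine its letters. This is the
  link between words and the hook theorem.\<close>

lemma act_word_colour:
  fixes z :: "'v list" and OD :: "'v set"
  defines "n \<equiv> length z"
  defines "X0 \<equiv> {i \<in> {1..n}. z ! (i - 1) \<notin> OD}" and "X1 \<equiv> {i \<in> {1..n}. z ! (i - 1) \<in> OD}"
  assumes col0: "\<And>i j. i \<in> X0 \<Longrightarrow> j \<in> X0 \<Longrightarrow> \<alpha> i = \<alpha> j \<Longrightarrow> z ! (i - 1) = z ! (j - 1)"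
    and col1: "\<And>i j. i \<in> X1 \<Longrightarrow> j \<in> X1 \<Longrightarrow> \<beta> i = \<beta> j \<Longrightarrow> z ! (i - 1) = z ! (j - 1)"
  shows "\<exists>k. k \<noteq> 0 \<and> act OD (sng z 1) (Rs X0 \<alpha> * Cs X1 \<beta>) = psc k (sng z (1 :: 'f::field_char_0))"
proof -
  have X: "X0 \<subseteq> {1..n}" "X1 \<subseteq> {1..n}" "finite X0" "finite X1" "X0 \<inter> X1 = {}" by (auto simp: X0_def X1_def)
  have zT: "sng z (1::'f) \<in> TL n UNIV" by (simp add: TL_def Wd_def n_def)
  have pw: "permute_word n (ap a) z = z" if "a \<in> Sym S" "S \<subseteq> {1..n}"
    "\<And>i. i \<in> S \<Longrightarrow> z ! (ap a i - 1) = z ! (i - 1)" for a S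
  proof (rule nth_equalityI)
    fix i assume "i < length (permute_word n (ap a) z)"
    then show "permute_word n (ap a) z ! i = z ! i"
      using that(3)[of "Suc i"] Sym_out[OF that(1), of "Suc i"] by (cases "Suc i \<in> S") auto
  qed (simp add: n_def)
  have 0: "act OD (sng z 1) (dl a) = sng z (1::'f)" if a: "a \<in> Stab X0 \<alpha>" for a
  proof -
    have aS: "a \<in> Sym X0" and \<alpha>: "\<And>i. i \<in> X0 \<Longrightarrow> \<alpha> (ap a i) = \<alpha> i" using a by (auto simp: Stab_def)
    have "permute_word n (ap a) z = z"
      by (rule pw[OF aS X(1)], rule col0) (simp_all add: Sym_in[OF aS] \<alpha>)
    moreover have "odd_inversions OD n (ap a) z = 0"
    proof -
      have o: "ap a i = i" if "z ! (ap a i - 1) \<in> OD" "i \<in> {1..n}" for i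
        using that Sym_in[OF aS, of i] Sym_out[OF aS, of i] by (cases "i \<in> X0") (auto simp: X0_def)
      have "{(i, j). i \<in> {1..n} \<and> j \<in> {1..n} \<and> i < j \<and> ap a i > ap a j \<and> z ! (ap a i - 1) \<in> OD \<and> z ! (ap a j - 1) \<in> OD} = {}"
        using o by (auto simp del: atLeastAtMost_iff) (metis less_asym)
      then show ?thesis unfolding odd_inversions_def by (simp only: card.empty)
    qed
    ultimately show ?thesis by (simp add: wact_def flip: n_def)
  qed
  have 1: "act OD (sng z 1) (psc (psgn a) (dl a)) = sng z (1::'f)" if a: "a \<in> Stab X1 \<beta>" for a
  proof -
    have aS: "a \<in> Sym X1" and \<beta>: "\<And>i. i \<in> X1 \<Longrightarrow> \<beta> (ap a i) = \<beta> i" using a by (auto simp: Stab_def)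
    have "permute_word n (ap a) z = z"
      by (rule pw[OF aS X(2)], rule col1) (simp_all add: Sym_in[OF aS] \<beta>)
    moreover have "wsgn OD n (ap a) z = (psgn a :: 'f)"
      using wsgn_odd_positions[OF aS, of z OD] by (simp add: X1_def n_def)
    ultimately have "act OD (sng z 1) (dl a) = sng z (psgn a :: 'f)" by (simp add: wact_def flip: n_def)
    then show ?thesis by (simp add: plin_psc[OF plin_act_right] del: psc_sng) simp
  qed
  have sumc: "(\<Sum>a\<in>H. sng z (1::'f)) = psc (of_nat (card H)) (sng z 1)" for H :: "fperm set"
    by (rule poly_mapping_eqI) (simp add: lookup_sum lookup_single when_def)
  have R: "act OD (sng z 1) (Rs X0 \<alpha>) = psc (of_nat (card (Stab X0 \<alpha>))) (sng z (1::'f))"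
    unfolding gsum_def plin_sum[OF plin_act_right] sumc[symmetric] by (intro sum.cong refl) (simp add: 0 del: act_sng_dl)
  have C: "act OD (sng z 1) (Cs X1 \<beta>) = psc (of_nat (card (Stab X1 \<beta>))) (sng z (1::'f))"
    unfolding gsum_def plin_sum[OF plin_act_right] sumc[symmetric] by (intro sum.cong refl 1)
  have "act OD (sng z 1) (Rs X0 \<alpha> * Cs X1 \<beta>) = act OD (act OD (sng z (1::'f)) (Rs X0 \<alpha>)) (Cs X1 \<beta>)"
    by (rule act_mult[OF zT, symmetric]) (use X in \<open>auto intro: GA_mono[OF _ GA_Stab]\<close>)
  also have "\<dots> = psc (of_nat (card (Stab X0 \<alpha>)) * of_nat (card (Stab X1 \<beta>))) (sng z 1)"
    unfolding R plin_psc[OF plin_act_left] C by simp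
  finally show ?thesis
    using Stab_card[OF X(3), of \<alpha>] Stab_card[OF X(4), of \<beta>]
    by (intro exI[of _ "of_nat (card (Stab X0 \<alpha>)) * of_nat (card (Stab X1 \<beta>))"]) auto
qed

text \<open>Numbering the even letters below \<open>p\<close> and the odd ones below
  \<open>q\<close> gives colours for which the word reproduces itself up to a nonzero scalar, and
  the hook theorem annihilates the product that follows.\<close>

theorem hook_kills_words:
  fixes x :: "'v list \<Rightarrow>\<^sub>0 'f::field_char_0"
  assumes L: "finite L" "card (L - OD) \<le> p" "card (L \<inter> OD) \<le> q"
    and tab: "tab {1..n} r c \<nu>" and cell: "q < \<nu> p" and x: "x \<in> TL n L" and y: "y \<in> GA {1..n}"
  shows "act OD x (y * tableau.u {1..n} r c) = 0"
proof -
  interpret tableau "{1..n}" r c \<nu> "TYPE('f)" by unfold_locales fact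
  obtain f0 where f0: "inj_on f0 (L - OD)" "f0 ` (L - OD) \<subseteq> {..<p}"
    using L card_le_inj[of "L - OD" "{..<p}"] by auto
  obtain f1 where f1: "inj_on f1 (L \<inter> OD)" "f1 ` (L \<inter> OD) \<subseteq> {..<q}"
    using L card_le_inj[of "L \<inter> OD" "{..<q}"] by auto
  have yu: "y * u \<in> GA {1..n}" using y u_GA by (intro GA_mult)
  have "act OD (sng z 1) (y * u) = 0" if z: "z \<in> Wd n L" for z
  proof -
    have n: "n = length z" and zL: "z ! (i - 1) \<in> L" if "i \<in> {1..n}" for i
      using z that by (auto simp: Wd_def subset_iff)
    have n: "length z = n" using z by (simp add: Wd_def)
    let ?X0 = "{i \<in> {1..n}. z ! (i - 1) \<notin> OD}" and ?X1 = "{i \<in> {1..n}. z ! (i - 1) \<in> OD}"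
    let ?\<alpha> = "\<lambda>i. f0 (z ! (i - 1))" and ?\<beta> = "\<lambda>i. f1 (z ! (i - 1))"
    have "\<exists>k. k \<noteq> 0 \<and> act OD (sng z 1) (Rs ?X0 ?\<alpha> * Cs ?X1 ?\<beta>) = psc k (sng z (1 :: 'f))"
      using act_word_colour[of z OD ?\<alpha> ?\<beta>] f0(1) f1(1) zL unfolding n
      by (auto simp: inj_on_def simp del: atLeastAtMost_iff)
    then obtain k where k: "k \<noteq> 0" "act OD (sng z 1) (Rs ?X0 ?\<alpha> * Cs ?X1 ?\<beta>) = psc k (sng z (1 :: 'f))"
      by blast
    have zT: "sng z (1::'f) \<in> TL n UNIV" using n by (simp add: TL_def Wd_def)
    have W: "Rs ?X0 ?\<alpha> * Cs ?X1 ?\<beta> \<in> GA {1..n}"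
      by (intro GA_mult GA_mono[OF _ GA_Stab[of ?X0]] GA_mono[OF _ GA_Stab[of ?X1]]) auto
    have "psc k (act OD (sng z 1) (y * u)) = act OD (psc k (sng z 1)) (y * u)"
      by (simp only: plin_psc[OF plin_act_left])
    also have "\<dots> = act OD (sng z 1) (Rs ?X0 ?\<alpha> * Cs ?X1 ?\<beta> * (y * u))"
      unfolding k(2)[symmetric] by (rule act_mult[OF zT W yu])
    also have "Rs ?X0 ?\<alpha> * Cs ?X1 ?\<beta> * (y * u) = Rs ?X0 ?\<alpha> * Cs ?X1 ?\<beta> * y * u" by (simp only: mult.assoc)
    also have "\<dots> = 0"
    proof (rule hook_theorem[OF tab cell _ _ _ order_refl _ _ y])
      show "?\<alpha> i < p" if "i \<in> ?X0" for i using f0(2) zL[of i] that by blast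
      show "?\<beta> i < q" if "i \<in> ?X1" for i using f1(2) zL[of i] that by blast
    qed auto
    finally show ?thesis using k(1) by (simp add: plin_0[OF plin_act_right] pm.scale_eq_0_iff)
  qed
  then show ?thesis
    by (intro plin_eqI[where p = x and S = "Wd n L" and F = "\<lambda>x. act OD x (y * u)" and G = "\<lambda>_. 0"])
      (use x in \<open>auto simp: TL_def intro: plin_act_left plinI\<close>)
qed

section \<open>Quotients of concretely presented algebras\<close>

text \<open>\<open>vmodel M Q J h\<close>: the record \<open>M\<close> is the quotient of the subspace \<open>Q\<close> by \<open>J\<close>, via \<open>h\<close>.\<close>

definition vmodel :: "('f::field, 'a, 'm) module_scheme \<Rightarrow> ('b \<Rightarrow>\<^sub>0 'f) set \<Rightarrow> ('b \<Rightarrow>\<^sub>0 'f) set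
    \<Rightarrow> (('b \<Rightarrow>\<^sub>0 'f) \<Rightarrow> 'a) \<Rightarrow> bool" where
  "vmodel M Q J h \<longleftrightarrow> pm.subspace Q \<and> pm.subspace J \<and> J \<subseteq> Q \<and> carrier M = h ` Q \<and> \<zero>\<^bsub>M\<^esub> = h 0 \<and>
     (\<forall>x\<in>Q. \<forall>y\<in>Q. h x \<oplus>\<^bsub>M\<^esub> h y = h (x + y)) \<and> (\<forall>c. \<forall>x\<in>Q. c \<odot>\<^bsub>M\<^esub> h x = h (psc c x)) \<and>
     (\<forall>x\<in>Q. \<forall>y\<in>Q. h x = h y \<longleftrightarrow> x - y \<in> J)"

lemma vmodelD:
  assumes "vmodel M Q J h"
  shows "pm.subspace Q" "pm.subspace J" "J \<subseteq> Q" "carrier M = h ` Q" "\<zero>\<^bsub>M\<^esub> = h 0"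
    "\<And>x y. x \<in> Q \<Longrightarrow> y \<in> Q \<Longrightarrow> h x \<oplus>\<^bsub>M\<^esub> h y = h (x + y)" "\<And>c x. x \<in> Q \<Longrightarrow> c \<odot>\<^bsub>M\<^esub> h x = h (psc c x)"
    "\<And>x y. x \<in> Q \<Longrightarrow> y \<in> Q \<Longrightarrow> h x = h y \<longleftrightarrow> x - y \<in> J"
  using assms by (auto simp: vmodel_def)

lemma vmodel_coset:
  assumes M: "vmodel M Q J h" and J': "J' \<subseteq> Q" and x: "x \<in> Q"
  shows "(h ` J') +>\<^bsub>M\<^esub> h x = (\<lambda>i. h (i + x)) ` J'"
proof -
  have "(h ` J') +>\<^bsub>M\<^esub> h x = (\<lambda>i. h i \<oplus>\<^bsub>M\<^esub> h x) ` J'" unfolding a_r_coset_def' by auto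
  also have "\<dots> = (\<lambda>i. h (i + x)) ` J'"
    using vmodelD(6)[OF M _ x] J' by (intro image_cong refl) blast
  finally show ?thesis .
qed

lemma quot_alg_sel:
  "carrier (quot_alg M I) = a_rcosets\<^bsub>M\<^esub> I" "mult (quot_alg M I) = rcoset_mult M I"
  "one (quot_alg M I) = I +>\<^bsub>M\<^esub> \<one>\<^bsub>M\<^esub>" "zero (quot_alg M I) = I" "add (quot_alg M I) = set_add M"
  "smult (quot_alg M I) = (\<lambda>c X. \<Union>x\<in>X. I +>\<^bsub>M\<^esub> (c \<odot>\<^bsub>M\<^esub> x))"
  by (simp_all add: quot_alg_def FactRing_def ring.defs module.defs)

lemma coset_eq_iff:
  assumes M: "vmodel M Q J h" and J': "pm.subspace J'" "J \<subseteq> J'" "J' \<subseteq> Q" and x: "x \<in> Q" and y: "y \<in> Q"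
  shows "(h ` J') +>\<^bsub>M\<^esub> h x = (h ` J') +>\<^bsub>M\<^esub> h y \<longleftrightarrow> x - y \<in> J'"
proof
  note D = vmodelD[OF M]
  have sub: "i + x \<in> Q" if "i \<in> J'" "x \<in> Q" for i x using that J'(3) pm.subspace_add[OF D(1)] by blast
  {
    assume "(h ` J') +>\<^bsub>M\<^esub> h x = (h ` J') +>\<^bsub>M\<^esub> h y"
    moreover have "h (0 + x) \<in> (\<lambda>i. h (i + x)) ` J'" using pm.subspace_0[OF J'(1)] by blast
    ultimately obtain i where i: "i \<in> J'" "h x = h (i + y)"
      unfolding vmodel_coset[OF M J'(3) x] vmodel_coset[OF M J'(3) y] by auto
    then have "x - (i + y) \<in> J" using D(8)[OF x sub[OF i(1) y]] by simp
    then have "(x - (i + y)) + i \<in> J'" using J'(2) i(1) pm.subspace_add[OF J'(1)] by blast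
    then show "x - y \<in> J'" by (simp add: algebra_simps)
  next
    assume xy: "x - y \<in> J'"
    have "(\<lambda>i. h (i + x)) ` J' \<subseteq> (\<lambda>i. h (i + y)) ` J'" if "x - y \<in> J'" for x y
    proof
      fix z assume "z \<in> (\<lambda>i. h (i + x)) ` J'"
      then obtain i where i: "i \<in> J'" "z = h (i + x)" by blast
      have "z = h ((i + (x - y)) + y)" by (simp add: i(2))
      moreover have "i + (x - y) \<in> J'" using pm.subspace_add[OF J'(1) i(1) that] .
      ultimately show "z \<in> (\<lambda>i. h (i + y)) ` J'" by blast
    qed
    moreover have "y - x \<in> J'" using pm.subspace_neg[OF J'(1) xy] by simp
    ultimately show "(h ` J') +>\<^bsub>M\<^esub> h x = (h ` J') +>\<^bsub>M\<^esub> h y"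
      unfolding vmodel_coset[OF M J'(3) x] vmodel_coset[OF M J'(3) y] using xy by blast
  }
qed

text \<open>A quotient of a quotient is presented by the same representatives with a larger kernel,
  so nested quotient records are peeled off one at a time without working with sets of sets.\<close>

lemma vmodel_quot:
  assumes M: "vmodel M Q J h" and J': "pm.subspace J'" "J \<subseteq> J'" "J' \<subseteq> Q"
  shows "vmodel (quot_alg M (h ` J')) Q J' (\<lambda>x. (h ` J') +>\<^bsub>M\<^esub> h x)"
proof -
  note D = vmodelD[OF M]
  note co = vmodel_coset[OF M J'(3)]
  note eqv = coset_eq_iff[OF M J']
  have Qi: "i + x \<in> Q" if "i \<in> J'" "x \<in> Q" for i x using that J'(3) pm.subspace_add[OF D(1)] by blast
  have Qadd: "x + y \<in> Q" if "x \<in> Q" "y \<in> Q" for x y using that pm.subspace_add[OF D(1)] by blast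
  have Qs: "psc c x \<in> Q" if "x \<in> Q" for c x using that pm.subspace_scale[OF D(1)] by blast
  have car: "a_rcosets\<^bsub>M\<^esub> (h ` J') = (\<lambda>x. (h ` J') +>\<^bsub>M\<^esub> h x) ` Q"
    by (auto simp: A_RCOSETS_def' D(4))
  have zero: "h ` J' = (h ` J') +>\<^bsub>M\<^esub> h 0" using co[OF pm.subspace_0[OF D(1)]] by simp
  have add: "set_add M ((h ` J') +>\<^bsub>M\<^esub> h x) ((h ` J') +>\<^bsub>M\<^esub> h y) = (h ` J') +>\<^bsub>M\<^esub> h (x + y)"
    if x: "x \<in> Q" and y: "y \<in> Q" for x y
  proof -
    have "set_add M ((h ` J') +>\<^bsub>M\<^esub> h x) ((h ` J') +>\<^bsub>M\<^esub> h y) = {h ((i + x) + (j + y)) | i j. i \<in> J' \<and> j \<in> J'}"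
      unfolding co[OF x] co[OF y] set_add_def' using D(6)[OF Qi Qi] x y by fastforce
    also have "\<dots> = (\<lambda>i. h (i + (x + y))) ` J'"
    proof (intro equalityI subsetI)
      fix z assume "z \<in> {h ((i + x) + (j + y)) | i j. i \<in> J' \<and> j \<in> J'}"
      then obtain i j where ij: "i \<in> J'" "j \<in> J'" "z = h ((i + x) + (j + y))" by blast
      have eq: "(i + x) + (j + y) = (i + j) + (x + y)" by (simp add: algebra_simps)
      show "z \<in> (\<lambda>i. h (i + (x + y))) ` J'"
        unfolding ij(3) eq using pm.subspace_add[OF J'(1) ij(1,2)] by (rule imageI)
    next
      fix z assume "z \<in> (\<lambda>i. h (i + (x + y))) ` J'"
      then obtain i where i: "i \<in> J'" "z = h (i + (x + y))" by blast
      then show "z \<in> {h ((i + x) + (j + y)) | i j. i \<in> J' \<and> j \<in> J'}"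
        using pm.subspace_0[OF J'(1)] by (intro CollectI exI[of _ i] exI[of _ 0]) (simp add: add.assoc)
    qed
    finally show ?thesis unfolding co[OF Qadd[OF x y]] .
  qed
  have scale: "(\<Union>z\<in>(h ` J') +>\<^bsub>M\<^esub> h x. (h ` J') +>\<^bsub>M\<^esub> (c \<odot>\<^bsub>M\<^esub> z)) = (h ` J') +>\<^bsub>M\<^esub> h (psc c x)"
    if x: "x \<in> Q" for c x
  proof -
    have "(h ` J') +>\<^bsub>M\<^esub> (c \<odot>\<^bsub>M\<^esub> h (i + x)) = (h ` J') +>\<^bsub>M\<^esub> h (psc c x)" if i: "i \<in> J'" for i
      unfolding D(7)[OF Qi[OF i x]] eqv[OF Qs[OF Qi[OF i x]] Qs[OF x]]
      using pm.subspace_scale[OF J'(1) i, of c] by (simp add: pm.scale_right_distrib)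
    then show ?thesis unfolding co[OF x] using pm.subspace_0[OF J'(1)] by auto
  qed
  show ?thesis
    unfolding vmodel_def quot_alg_sel using D(1) J' car zero add scale eqv by auto
qed

lemma vmodel_finsum:
  assumes M: "vmodel M Q J h" and X: "finite X" "\<And>x. x \<in> X \<Longrightarrow> g x \<in> Q"
  shows "(\<Oplus>\<^bsub>M\<^esub>x\<in>X. h (g x)) = h (\<Sum>x\<in>X. g x)"
proof -
  note D = vmodelD[OF M]
  have Qadd: "x + y \<in> Q" if "x \<in> Q" "y \<in> Q" for x y using that pm.subspace_add[OF D(1)] by blast
  interpret abelian_monoid M
    by (rule abelian_monoidI)
      (use D(4-6) Qadd pm.subspace_0[OF D(1)] in \<open>auto simp: algebra_simps\<close>)
  have hQ: "h x \<in> carrier M" if "x \<in> Q" for x using D(4) that by blast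
  show ?thesis using X
  proof (induction X rule: finite_induct)
    case empty show ?case by (simp add: D(5))
  next
    case (insert x X)
    have "(\<Sum>x\<in>X. g x) \<in> Q" using insert.prems by (intro pm.subspace_sum D(1)) auto
    then show ?case using insert by (simp add: finsum_insert hQ D(6) Pi_def)
  qed
qed

lemma vmodel_lin_span:
  assumes M: "vmodel M Q J h" and S: "S \<subseteq> Q"
  shows "lin_span M (h ` S) = h ` pm.span S"
proof (intro equalityI subsetI)
  note D = vmodelD[OF M]
  have spQ: "pm.span S \<subseteq> Q" using S D(1) by (rule pm.span_minimal)
  {
    fix z assume "z \<in> lin_span M (h ` S)"
    then obtain X c where X: "finite X" "X \<subseteq> h ` S" "z = (\<Oplus>\<^bsub>M\<^esub>v\<in>X. c v \<odot>\<^bsub>M\<^esub> v)"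
      unfolding lin_span_def by blast
    define s where "s = inv_into S h"
    have s: "s v \<in> S" "h (s v) = v" if "v \<in> X" for v
      using that X(2) by (auto simp: s_def inv_into_into f_inv_into_f subset_iff)
    have "z = (\<Oplus>\<^bsub>M\<^esub>v\<in>X. h (psc (c v) (s v)))"
    proof -
      interpret abelian_monoid M
        by (rule abelian_monoidI)
          (use D(4-6) pm.subspace_add[OF D(1)] pm.subspace_0[OF D(1)] in \<open>auto simp: algebra_simps\<close>)
      show ?thesis unfolding X(3)
        by (rule finsum_cong') (use s S D(4,7) pm.subspace_scale[OF D(1)] in \<open>auto simp: subset_iff, (metis)+\<close>)
    qed
    also have "\<dots> = h (\<Sum>v\<in>X. psc (c v) (s v))"
      by (rule vmodel_finsum[OF M X(1)]) (use s S pm.subspace_scale[OF D(1)] in blast)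
    also have "\<dots> \<in> h ` pm.span S"
      using s by (intro imageI pm.span_sum pm.span_scale pm.span_base) auto
    finally show "z \<in> h ` pm.span S" .
  next
    fix z assume "z \<in> h ` pm.span S"
    then obtain x where x: "x \<in> pm.span S" "z = h x" by blast
    then obtain T c where T: "finite T" "T \<subseteq> S" "x = (\<Sum>v\<in>T. psc (c v) v)"
      unfolding pm.span_explicit by blast
    define X where "X = h ` T"
    define s where "s = inv_into T h"
    \<comment> \<open>The map \<open>h\<close> may identify elements of T, so the coefficients of
      elements with a common image are added up.\<close>
    define d where "d = (\<lambda>v. \<Sum>t\<in>{t \<in> T. h t = v}. c t)"
    have sT: "s v \<in> T" "h (s v) = v" if "v \<in> X" for v
      using that by (auto simp: s_def X_def inv_into_into f_inv_into_f)
    have TQ: "t \<in> Q" if "t \<in> T" for t using that T(2) S by blast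
    have "x - (\<Sum>v\<in>X. psc (d v) (s v)) = (\<Sum>v\<in>X. \<Sum>t\<in>{t \<in> T. h t = v}. psc (c t) (t - s v))"
    proof -
      have "x = (\<Sum>v\<in>X. \<Sum>t\<in>{t \<in> T. h t = v}. psc (c t) t)"
        unfolding T(3) X_def by (rule sum.image_gen[OF T(1)])
      then show ?thesis
        by (simp add: d_def pm.scale_sum_left pm.scale_right_diff_distrib sum_subtractf)
    qed
    also have "\<dots> \<in> J"
    proof (intro pm.subspace_sum pm.subspace_scale D(2))
      fix v t assume "v \<in> X" "t \<in> {t \<in> T. h t = v}"
      then show "t - s v \<in> J" using D(8)[OF TQ TQ[OF sT(1)], of t v] sT(2)[of v] by auto
    qed
    finally have "x - (\<Sum>v\<in>X. psc (d v) (s v)) \<in> J" .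
    moreover have xQ: "x \<in> Q" using x(1) spQ by blast
    moreover have sQ: "(\<Sum>v\<in>X. psc (d v) (s v)) \<in> Q"
      using sT TQ by (intro pm.subspace_sum pm.subspace_scale D(1)) auto
    ultimately have "z = h (\<Sum>v\<in>X. psc (d v) (s v))" using D(8)[OF xQ sQ] x(2) by simp
    also have "\<dots> = (\<Oplus>\<^bsub>M\<^esub>v\<in>X. h (psc (d v) (s v)))"
      by (rule vmodel_finsum[OF M, symmetric]) (use T(1) sT TQ pm.subspace_scale[OF D(1)] in \<open>auto simp: X_def\<close>)
    also have "\<dots> = (\<Oplus>\<^bsub>M\<^esub>v\<in>X. d v \<odot>\<^bsub>M\<^esub> v)"
    proof -
      interpret abelian_monoid M
        by (rule abelian_monoidI)
          (use D(4-6) pm.subspace_add[OF D(1)] pm.subspace_0[OF D(1)] in \<open>auto simp: algebra_simps\<close>)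
      have "d v \<odot>\<^bsub>M\<^esub> v = h (psc (d v) (s v))" if "v \<in> X" for v
        using D(7)[OF TQ[OF sT(1)[OF that]], of "d v"] sT(2)[OF that] by simp
      moreover have "h (psc (d v) (s v)) \<in> carrier M" if "v \<in> X" for v
        unfolding D(4) using TQ[OF sT(1)[OF that]] pm.subspace_scale[OF D(1)] by blast
      ultimately show ?thesis by (intro finsum_cong') auto
    qed
    finally have "z = (\<Oplus>\<^bsub>M\<^esub>v\<in>X. d v \<odot>\<^bsub>M\<^esub> v)" .
    moreover have "X \<subseteq> h ` S" "finite X" unfolding X_def using T(1,2) by blast+
    ultimately show "z \<in> lin_span M (h ` S)" unfolding lin_span_def by blast
  }
qed

text \<open>Translates the dimension of the record into the library's dimension: modulo J the space
  is carried isomorphically onto the image of \<kappa>. Every basis of the record yields one of the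
  image, so the choice inside \<open>vdim\<close> does not matter, and a basis of the image
  lifts.\<close>

lemma vmodel_dim:
  fixes \<kappa> :: "('b \<Rightarrow>\<^sub>0 'f::field) \<Rightarrow> ('c \<Rightarrow>\<^sub>0 'f)"
  assumes M: "vmodel M Q J h" and \<kappa>: "plin \<kappa>" "\<And>x. x \<in> Q \<Longrightarrow> x \<in> J \<longleftrightarrow> \<kappa> x = 0"
  shows "vdim M = pm.dim (\<kappa> ` Q)"
proof -
  note D = vmodelD[OF M]
  have Qd: "x - y \<in> Q" if "x \<in> Q" "y \<in> Q" for x y using that pm.subspace_diff[OF D(1)] by blast
  have hk: "h x = h y \<longleftrightarrow> \<kappa> x = \<kappa> y" if "x \<in> Q" "y \<in> Q" for x y
    using D(8)[OF that] \<kappa>(2)[OF Qd[OF that]] by (simp add: plin_diff[OF \<kappa>(1)])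
  define rep where "rep = inv_into Q h"
  have rep: "rep v \<in> Q" "h (rep v) = v" if "v \<in> carrier M" for v
    using that D(4) by (auto simp: rep_def inv_into_into f_inv_into_f)
  have fsum: "(\<Oplus>\<^bsub>M\<^esub>v\<in>X. c v \<odot>\<^bsub>M\<^esub> v) = h (\<Sum>v\<in>X. psc (c v) (rep v))" if X: "finite X" "X \<subseteq> carrier M" for X c
  proof -
    interpret abelian_monoid M
      by (rule abelian_monoidI)
        (use D(4-6) pm.subspace_add[OF D(1)] pm.subspace_0[OF D(1)] in \<open>auto simp: algebra_simps\<close>)
    have "c v \<odot>\<^bsub>M\<^esub> v = h (psc (c v) (rep v))" if "v \<in> X" for v
      using D(7)[OF rep(1), of v "c v"] rep(2) that X(2) by auto
    moreover have inQ: "psc (c v) (rep v) \<in> Q" if "v \<in> X" for v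
      using rep(1) X(2) that pm.subspace_scale[OF D(1)] by blast
    ultimately have "(\<Oplus>\<^bsub>M\<^esub>v\<in>X. c v \<odot>\<^bsub>M\<^esub> v) = (\<Oplus>\<^bsub>M\<^esub>v\<in>X. h (psc (c v) (rep v)))"
      by (intro finsum_cong') (auto simp: D(4))
    also have "\<dots> = h (\<Sum>v\<in>X. psc (c v) (rep v))"
      by (rule vmodel_finsum[OF M X(1)]) (rule inQ)
    finally show ?thesis .
  qed
  have sumQ: "(\<Sum>v\<in>X. psc (c v) (rep v)) \<in> Q" if "X \<subseteq> carrier M" for X c
    using rep(1) that by (intro pm.subspace_sum pm.subspace_scale D(1)) auto
  have ksum: "\<kappa> (\<Sum>v\<in>X. psc (c v) (rep v)) = (\<Sum>v\<in>X. psc (c v) (\<kappa> (rep v)))" for X c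
    by (simp add: plin_sum[OF \<kappa>(1)] plin_psc[OF \<kappa>(1)])
  have Q0: "0 \<in> Q" using pm.subspace_0[OF D(1)] .
  have card: "card B = pm.dim (\<kappa> ` Q)" if B: "is_basis M B" for B
  proof -
    have Bc: "B \<subseteq> carrier M" and Bi: "lin_indep M B" and Bs: "lin_span M B = carrier M"
      using B by (auto simp: is_basis_def)
    have inj: "inj_on (\<lambda>v. \<kappa> (rep v)) B"
      using hk rep Bc by (intro inj_onI) (metis subset_iff)
    have "pm.independent ((\<lambda>v. \<kappa> (rep v)) ` B)"
      unfolding pm.independent_explicit_module
    proof (intro allI impI)
      fix t u v assume t: "finite t" "t \<subseteq> (\<lambda>v. \<kappa> (rep v)) ` B" "(\<Sum>v\<in>t. psc (u v) v) = 0" "v \<in> t"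
      then obtain X where X: "X \<subseteq> B" "t = (\<lambda>v. \<kappa> (rep v)) ` X" by (meson subset_imageE)
      have injX: "inj_on (\<lambda>v. \<kappa> (rep v)) X" using inj X(1) by (rule inj_on_subset)
      then have fX: "finite X" using t(1) X(2) by (simp add: finite_image_iff)
      have Xc: "X \<subseteq> carrier M" using X(1) Bc by blast
      let ?c = "\<lambda>v. u (\<kappa> (rep v))"
      have "\<kappa> (\<Sum>v\<in>X. psc (?c v) (rep v)) = \<kappa> 0"
        using t(3) unfolding X(2) sum.reindex[OF injX] ksum by (simp add: plin_0[OF \<kappa>(1)])
      then have "(\<Oplus>\<^bsub>M\<^esub>v\<in>X. ?c v \<odot>\<^bsub>M\<^esub> v) = \<zero>\<^bsub>M\<^esub>"
        using hk[OF sumQ[OF Xc] Q0] by (simp add: fsum[OF fX Xc] D(5))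
      then have "\<forall>v\<in>X. ?c v = 0" using Bi[unfolded lin_indep_def, rule_format, of X ?c] fX X(1) by blast
      then show "u v = 0" using t(4) X(2) by auto
    qed
    moreover have "\<kappa> ` Q \<subseteq> pm.span ((\<lambda>v. \<kappa> (rep v)) ` B)"
    proof
      fix y assume "y \<in> \<kappa> ` Q"
      then obtain x where x: "x \<in> Q" "y = \<kappa> x" by blast
      then have "h x \<in> lin_span M B" using Bs D(4) by blast
      then obtain X c where X: "finite X" "X \<subseteq> B" "h x = (\<Oplus>\<^bsub>M\<^esub>v\<in>X. c v \<odot>\<^bsub>M\<^esub> v)"
        unfolding lin_span_def by blast
      then have Xc: "X \<subseteq> carrier M" using Bc by blast
      have "y = \<kappa> (\<Sum>v\<in>X. psc (c v) (rep v))"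
        using X(3) hk[OF x(1) sumQ[OF Xc]] by (simp add: fsum[OF X(1) Xc] x(2))
      then have y: "y = (\<Sum>v\<in>X. psc (c v) (\<kappa> (rep v)))" unfolding ksum .
      show "y \<in> pm.span ((\<lambda>v. \<kappa> (rep v)) ` B)"
        unfolding y by (intro pm.span_sum pm.span_scale pm.span_base imageI) (use X(2) in blast)
    qed
    moreover have "(\<lambda>v. \<kappa> (rep v)) ` B \<subseteq> \<kappa> ` Q" using rep(1) Bc by blast
    ultimately have "card ((\<lambda>v. \<kappa> (rep v)) ` B) = pm.dim (\<kappa> ` Q)"
      by (intro pm.basis_card_eq_dim) auto
    then show ?thesis by (simp add: card_image[OF inj])
  qed
  have "\<exists>B. is_basis M B"
  proof -
    obtain K where K: "K \<subseteq> \<kappa> ` Q" "pm.independent K" "\<kappa> ` Q \<subseteq> pm.span K"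
      using pm.basis_exists[of "\<kappa> ` Q"] by metis
    define s where "s = inv_into Q \<kappa>"
    have s: "s k \<in> Q" "\<kappa> (s k) = k" if "k \<in> K" for k
      using that K(1) by (auto simp: s_def inv_into_into f_inv_into_f subset_iff)
    define B where "B = h ` s ` K"
    have sKQ: "s ` K \<subseteq> Q" using s by blast
    have "B \<subseteq> carrier M" unfolding B_def D(4) using sKQ by blast
    moreover have "lin_indep M B"
      unfolding lin_indep_def
    proof (intro allI impI, elim conjE, intro ballI)
      fix X c v assume X: "finite X" "X \<subseteq> B" "(\<Oplus>\<^bsub>M\<^esub>v\<in>X. c v \<odot>\<^bsub>M\<^esub> v) = \<zero>\<^bsub>M\<^esub>" and v: "v \<in> X"
      have Xc: "X \<subseteq> carrier M" using X(2) \<open>B \<subseteq> carrier M\<close> by blast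
      have kr: "\<kappa> (rep v) \<in> K" if "v \<in> X" for v
      proof -
        obtain k where k: "k \<in> K" "v = h (s k)" using \<open>v \<in> X\<close> X(2) by (auto simp: B_def)
        then have "\<kappa> (rep v) = \<kappa> (s k)" using hk rep Xc that s by (metis subset_iff)
        then show ?thesis using k s by simp
      qed
      have inj: "inj_on (\<lambda>v. \<kappa> (rep v)) X" using hk rep Xc by (intro inj_onI) (metis subset_iff)
      have "\<kappa> (\<Sum>v\<in>X. psc (c v) (rep v)) = \<kappa> 0"
        using X(3) hk[OF sumQ[OF Xc] Q0] by (simp add: fsum[OF X(1) Xc] D(5))
      then have 0: "(\<Sum>v\<in>X. psc (c v) (\<kappa> (rep v))) = 0" unfolding ksum by (simp add: plin_0[OF \<kappa>(1)])
      let ?f = "the_inv_into X (\<lambda>v. \<kappa> (rep v))"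
      have "(\<Sum>k\<in>(\<lambda>v. \<kappa> (rep v)) ` X. psc (c (?f k)) k) = (\<Sum>v\<in>X. psc (c v) (\<kappa> (rep v)))"
        unfolding sum.reindex[OF inj] by (intro sum.cong refl) (simp add: the_inv_into_f_f[OF inj])
      then have "c (?f (\<kappa> (rep v))) = 0"
        using K(2)[unfolded pm.independent_explicit_module, rule_format,
            of "(\<lambda>v. \<kappa> (rep v)) ` X" "\<lambda>k. c (?f k)" "\<kappa> (rep v)"] X(1) kr v 0 by auto
      then show "c v = 0" by (simp add: the_inv_into_f_f[OF inj v])
    qed
    moreover have "lin_span M B = carrier M"
    proof -
      have "lin_span M B = h ` pm.span (s ` K)" unfolding B_def by (rule vmodel_lin_span[OF M sKQ])
      also have "\<dots> = h ` Q"
      proof (intro equalityI subsetI)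
        show "\<And>y. y \<in> h ` pm.span (s ` K) \<Longrightarrow> y \<in> h ` Q" using pm.span_minimal[OF sKQ D(1)] by blast
        fix y assume "y \<in> h ` Q"
        then obtain x where x: "x \<in> Q" "y = h x" by blast
        then have "\<kappa> x \<in> pm.span K" using K(3) by blast
        then obtain T c where T: "finite T" "T \<subseteq> K" "\<kappa> x = (\<Sum>k\<in>T. psc (c k) k)"
          unfolding pm.span_explicit by blast
        have "\<kappa> (\<Sum>k\<in>T. psc (c k) (s k)) = \<kappa> x"
          unfolding T(3) by (simp add: plin_sum[OF \<kappa>(1)] plin_psc[OF \<kappa>(1)]) (use s T(2) in \<open>auto intro!: sum.cong\<close>)
        moreover have sp: "(\<Sum>k\<in>T. psc (c k) (s k)) \<in> pm.span (s ` K)"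
          using T(2) by (intro pm.span_sum pm.span_scale pm.span_base) auto
        moreover have "(\<Sum>k\<in>T. psc (c k) (s k)) \<in> Q" using sp pm.span_minimal[OF sKQ D(1)] by blast
        ultimately have "h (\<Sum>k\<in>T. psc (c k) (s k)) = y" using hk[OF _ x(1)] x(2) by blast
        then show "y \<in> h ` pm.span (s ` K)" using sp by blast
      qed
      finally show ?thesis by (simp add: D(4))
    qed
    ultimately show ?thesis by (auto simp: is_basis_def)
  qed
  from someI_ex[OF this] show ?thesis unfolding vdim_def using card by blast
qed


subsection \<open>Multiplication\<close>

text \<open>The product is given on representatives, and \<open>mul\<close> is biadditive on all
  functions, so products of cosets expand without side conditions.\<close>

definition amodel :: "('f::field, 'a, 'm) module_scheme \<Rightarrow> ('b \<Rightarrow>\<^sub>0 'f) set \<Rightarrow> ('b \<Rightarrow>\<^sub>0 'f) set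
    \<Rightarrow> (('b \<Rightarrow>\<^sub>0 'f) \<Rightarrow> ('b \<Rightarrow>\<^sub>0 'f) \<Rightarrow> ('b \<Rightarrow>\<^sub>0 'f)) \<Rightarrow> ('b \<Rightarrow>\<^sub>0 'f) \<Rightarrow> (('b \<Rightarrow>\<^sub>0 'f) \<Rightarrow> 'a) \<Rightarrow> bool" where
  "amodel M Q J mul e h \<longleftrightarrow> vmodel M Q J h \<and> e \<in> Q \<and> \<one>\<^bsub>M\<^esub> = h e \<and>
     (\<forall>x y z. mul (x + y) z = mul x z + mul y z \<and> mul z (x + y) = mul z x + mul z y) \<and>
     (\<forall>x\<in>Q. \<forall>y\<in>Q. mul x y \<in> Q \<and> h x \<otimes>\<^bsub>M\<^esub> h y = h (mul x y))"

lemma amodelD: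
  assumes "amodel M Q J mul e h"
  shows "vmodel M Q J h" "e \<in> Q" "\<one>\<^bsub>M\<^esub> = h e" "\<And>x y z. mul (x + y) z = mul x z + mul y z"
    "\<And>x y z. mul z (x + y) = mul z x + mul z y"
    "\<And>x y. x \<in> Q \<Longrightarrow> y \<in> Q \<Longrightarrow> mul x y \<in> Q" "\<And>x y. x \<in> Q \<Longrightarrow> y \<in> Q \<Longrightarrow> h x \<otimes>\<^bsub>M\<^esub> h y = h (mul x y)"
  using assms by (auto simp: amodel_def)

lemma amodel_quot:
  assumes A: "amodel M Q J mul e h" and J': "pm.subspace J'" "J \<subseteq> J'" "J' \<subseteq> Q"
    and id: "\<And>x y. x \<in> J' \<Longrightarrow> y \<in> Q \<Longrightarrow> mul x y \<in> J'" "\<And>x y. x \<in> J' \<Longrightarrow> y \<in> Q \<Longrightarrow> mul y x \<in> J'"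
  shows "amodel (quot_alg M (h ` J')) Q J' mul e (\<lambda>x. (h ` J') +>\<^bsub>M\<^esub> h x)"
proof -
  note A' = amodelD[OF A]
  note D = vmodelD[OF A'(1)]
  have Qi: "i + x \<in> Q" if "i \<in> J'" "x \<in> Q" for i x using that J'(3) pm.subspace_add[OF D(1)] by blast
  have mult: "rcoset_mult M (h ` J') ((h ` J') +>\<^bsub>M\<^esub> h x) ((h ` J') +>\<^bsub>M\<^esub> h y) = (h ` J') +>\<^bsub>M\<^esub> h (mul x y)"
    if x: "x \<in> Q" and y: "y \<in> Q" for x y
  proof -
    have "(h ` J') +>\<^bsub>M\<^esub> (h (i + x) \<otimes>\<^bsub>M\<^esub> h (j + y)) = (h ` J') +>\<^bsub>M\<^esub> h (mul x y)" if i: "i \<in> J'" and j: "j \<in> J'" for i j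
    proof -
      have "mul (i + x) (j + y) - mul x y = mul i (j + y) + mul x j"
        by (simp add: A'(4,5))
      also have "\<dots> \<in> J'" using id(1)[OF i Qi[OF j y]] id(2)[OF j x] by (rule pm.subspace_add[OF J'(1)])
      finally show ?thesis
        unfolding A'(7)[OF Qi[OF i x] Qi[OF j y]]
        by (subst coset_eq_iff[OF A'(1) J']) (use A'(6) Qi i j x y in auto)
    qed
    then show ?thesis
      unfolding rcoset_mult_def vmodel_coset[OF A'(1) J'(3) x] vmodel_coset[OF A'(1) J'(3) y]
      using pm.subspace_0[OF J'(1)] by auto
  qed
  show ?thesis
    unfolding amodel_def quot_alg_sel using vmodel_quot[OF A'(1) J'] A'(2-6) mult by auto
qed

definition mprod :: "('a \<Rightarrow> 'a \<Rightarrow> 'a) \<Rightarrow> 'a \<Rightarrow> (nat \<Rightarrow> 'a) \<Rightarrow> nat list \<Rightarrow> 'a" where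
  "mprod mul e q w = foldr (\<lambda>i y. mul (q i) y) w e"

lemma amodel_nc_eval:
  assumes A: "amodel M Q J mul e h" and q: "\<And>i. q i \<in> Q"
  shows "nc_eval M (\<lambda>i. h (q i)) f = h (lext (mprod mul e q) f)"
proof -
  note A' = amodelD[OF A]
  note D = vmodelD[OF A'(1)]
  have pQ: "mprod mul e q w \<in> Q" for w
    by (induction w) (use A'(2,6) q in \<open>auto simp: mprod_def\<close>)
  have "foldr (\<lambda>i y. h (q i) \<otimes>\<^bsub>M\<^esub> y) w \<one>\<^bsub>M\<^esub> = h (mprod mul e q w)" for w
  proof (induction w)
    case (Cons i w) then show ?case using A'(7)[OF q pQ] by (simp add: mprod_def)
  qed (simp add: mprod_def A'(3))
  then have "nc_eval M (\<lambda>i. h (q i)) f = (\<Oplus>\<^bsub>M\<^esub>w\<in>ks f. h (psc (lk f w) (mprod mul e q w)))"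
    unfolding nc_eval_def using D(7)[OF pQ] by simp
  also have "\<dots> = h (lext (mprod mul e q) f)"
    unfolding lext_def by (rule vmodel_finsum[OF A'(1)]) (auto intro: pQ pm.subspace_scale[OF D(1)])
  finally show ?thesis .
qed

lemma amodel_monoid_algebra:
  assumes "monoid G"
  shows "amodel (monoid_algebra G) {p. ks p \<subseteq> carrier G} {0} (\<lambda>x y. x \<otimes>\<^bsub>monoid_algebra G\<^esub> y) (sng \<one>\<^bsub>G\<^esub> 1) (\<lambda>x. x)"
proof -
  have "pm.subspace {p. ks p \<subseteq> carrier G}"
    by (rule pm.subspaceI) (auto dest!: subsetD[OF keys_psc] subsetD[OF keys_add])
  moreover have "pm.subspace {0}" by (rule pm.subspaceI) auto
  ultimately show ?thesis
    using keys_mult_monoid_algebraI[OF assms] monoid.one_closed[OF assms]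
    unfolding amodel_def vmodel_def
    by (auto simp: plin_add[OF plin_mult_left[of G]] plin_add[OF plin_mult_right[of G]])
qed

text \<open>A ring ideal is also a subspace, since scalars act as multiples of the unit
  element.\<close>

lemma ideal_amodel:
  assumes A: "amodel M Q {0} mul e (\<lambda>x. x)" and R: "ring M" and I: "ideal I M"
    and sc: "\<And>c x. x \<in> Q \<Longrightarrow> psc c x = mul (psc c e) x"
  shows "amodel (quot_alg M I) Q I mul e (\<lambda>x. I +>\<^bsub>M\<^esub> x)"
proof -
  note A' = amodelD[OF A]
  note D = vmodelD[OF A'(1)]
  interpret ideal I M by fact
  have IQ: "I \<subseteq> Q" using a_subset D(4) by simp
  have mul: "x \<otimes>\<^bsub>M\<^esub> y = mul x y" if "x \<in> Q" "y \<in> Q" for x y using A'(7)[OF that] .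
  have i1: "mul x y \<in> I" "mul y x \<in> I" if "x \<in> I" "y \<in> Q" for x y
    using I_r_closed[of x y] I_l_closed[of x y] mul[of x y] mul[of y x] that IQ D(4) by (simp_all add: subset_iff)
  have z: "0 \<in> I" using additive_subgroup.zero_closed[OF is_additive_subgroup] D(5) by simp
  have I: "pm.subspace I"
  proof (rule pm.subspaceI)
    show "0 \<in> I" by fact
    show "x + y \<in> I" if "x \<in> I" "y \<in> I" for x y
    proof -
      have "x \<oplus>\<^bsub>M\<^esub> y = x + y" using D(6)[of x y] IQ that by blast
      then show ?thesis using additive_subgroup.a_closed[OF is_additive_subgroup that] by argo
    qed
    show "psc c x \<in> I" if "x \<in> I" for c x
    proof -
      have "psc c e \<in> Q" using pm.subspace_scale[OF D(1) A'(2)] .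
      then show ?thesis using i1(2)[OF that] sc[of x c] IQ that by (simp add: subset_iff)
    qed
  qed
  have "{0} \<subseteq> I" using z by simp
  from amodel_quot[OF A I this IQ i1] show ?thesis by simp
qed

section \<open>The tensor algebra\<close>

lemma a_inv_amodel:
  assumes A: "amodel M Q {0} mul e (\<lambda>x. x)" and R: "ring M" and x: "x \<in> Q"
  shows "\<ominus>\<^bsub>M\<^esub> x = - x"
proof -
  note D = vmodelD[OF amodelD(1)[OF A]]
  interpret ring M by fact
  have m: "- x \<in> Q" using pm.subspace_neg[OF D(1) x] .
  have "- x \<oplus>\<^bsub>M\<^esub> x = \<zero>\<^bsub>M\<^esub>" using D(5) D(6)[OF m x] by simp
  then show ?thesis using minus_equality[of "- x" x] m x D(4) by simp
qed

lemma subspace_ideal: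
  assumes A: "amodel M Q {0} mul e (\<lambda>x. x)" and R: "ring M"
    and J: "pm.subspace J" "J \<subseteq> Q" "\<And>x y. x \<in> J \<Longrightarrow> y \<in> Q \<Longrightarrow> mul x y \<in> J \<and> mul y x \<in> J"
  shows "ideal J M"
proof (rule idealI[OF R])
  note A' = amodelD[OF A]
  note D = vmodelD[OF A'(1)]
  have mul: "x \<otimes>\<^bsub>M\<^esub> y = mul x y" if "x \<in> Q" "y \<in> Q" for x y using A'(7)[OF that] .
  show "subgroup J (add_monoid M)"
  proof (rule subgroup.intro)
    show "J \<subseteq> carrier (add_monoid M)" using J(2) D(4) by simp
    show "x \<otimes>\<^bsub>add_monoid M\<^esub> y \<in> J" if "x \<in> J" "y \<in> J" for x y
      using pm.subspace_add[OF J(1) that] D(6)[of x y] that J(2) by (simp add: subset_iff)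
    show "\<one>\<^bsub>add_monoid M\<^esub> \<in> J" using pm.subspace_0[OF J(1)] D(5) by simp
    show "inv\<^bsub>add_monoid M\<^esub> x \<in> J" if "x \<in> J" for x
      using a_inv_amodel[OF A R, of x] pm.subspace_neg[OF J(1) that] that J(2) by (auto simp: a_inv_def)
  qed
  show "x \<otimes>\<^bsub>M\<^esub> a \<in> J" "a \<otimes>\<^bsub>M\<^esub> x \<in> J" if "a \<in> J" "x \<in> carrier M" for a x
    using that J(2) J(3)[of a x] mul[of a x] mul[of x a] D(4) by (simp_all add: subset_iff)
qed

lemma amodel_free: "amodel (free_algebra :: ('f::field, 'x list \<Rightarrow>\<^sub>0 'f) module) UNIV {0} fmul (sng [] 1) (\<lambda>x. x)"
  using amodel_monoid_algebra[OF monoid_words] by (simp add: free_algebra_def)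

lemma psc_fmul: "psc c x = fmul (psc c (sng [] 1)) x"
  unfolding plin_psc[OF plin_fmul(1)]
  by (rule arg_cong[where f = "psc c"], rule plin_eqI[where S = UNIV and G = "fmul (sng [] 1)", OF plin_id plin_fmul(2)]) auto

lemma fmul_one [simp]: "fmul (sng [] 1) x = x" "fmul x (sng [] 1) = x"
  by (rule plin_eqI[where S = UNIV and p = x and F = "fmul (sng [] 1)" and G = "\<lambda>x. x", OF plin_fmul(2) plin_id], auto)
    (rule plin_eqI[where S = UNIV and p = x and F = "\<lambda>x. fmul x (sng [] 1)" and G = "\<lambda>x. x", OF plin_fmul(1) plin_id], auto)

lemma finite_Wd: "finite L \<Longrightarrow> finite (Wd n L)"
  using finite_lists_length_eq[of L n] by (simp add: Wd_def conj_commute)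

lemma Wd_Suc: "Wd (Suc n) L = (\<lambda>(b, w). b # w) ` (L \<times> Wd n L)"
  by (auto simp: Wd_def length_Suc_conv)

lemma TL_subspace: "pm.subspace (TL n L)"
  by (rule pm.subspaceI) (auto intro: TL_add TL_psc)

lemma span_words: "(pm.span ((\<lambda>z. sng z 1) ` Wd n L) :: (_ \<Rightarrow>\<^sub>0 'f::field_char_0) set) = TL n L"
proof (intro equalityI subsetI)
  fix x :: "_ \<Rightarrow>\<^sub>0 'f" assume "x \<in> pm.span ((\<lambda>z. sng z 1) ` Wd n L)"
  moreover have "pm.span ((\<lambda>z. sng z (1::'f)) ` Wd n L) \<subseteq> TL n L"
    by (rule pm.span_minimal[OF _ TL_subspace]) (auto intro: TL_sng)
  ultimately show "x \<in> TL n L" by blast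
next
  fix x :: "_ \<Rightarrow>\<^sub>0 'f" assume x: "x \<in> TL n L"
  have "x = (\<Sum>z\<in>ks x. psc (lk x z) (sng z 1))" by (rule poly_mapping_expand) auto
  also have "\<dots> \<in> pm.span ((\<lambda>z. sng z 1) ` Wd n L)"
    by (intro pm.span_sum pm.span_scale pm.span_base imageI) (use x in \<open>auto simp: TL_def\<close>)
  finally show "x \<in> pm.span ((\<lambda>z. sng z 1) ` Wd n L)" .
qed

text \<open>Bases of the two parts are fixed, so tensors are represented by combinations of words in
  homogeneous basis vectors.\<close>

locale fin_graded = graded_space scale V0 V1
  for scale :: "'f::field_char_0 \<Rightarrow> 'v::ab_group_add \<Rightarrow> 'v" and V0 V1 +
  fixes B0 B1 :: "'v set"
  assumes finB: "finite B0" "finite B1" and indB: "independent B0" "independent B1"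
    and spanB: "span B0 = V0" "span B1 = V1"
begin

definition B :: "'v set" where "B = B0 \<union> B1"

lemma finite_B [simp]: "finite B" by (simp add: B_def finB)

lemma BV: "B0 \<subseteq> V0" "B1 \<subseteq> V1" using span_superset spanB by blast+

lemma zero_notin_B: "0 \<notin> B0" "0 \<notin> B1" using indB dependent_zero by blast+

lemma B0_V1: "b \<in> B0 \<Longrightarrow> b \<notin> V1" and B1_V0: "b \<in> B1 \<Longrightarrow> b \<notin> V0"
proof -
  have "b = 0" if "b \<in> V0" "b \<in> V1" using that inter_V0_V1 by blast
  then show "b \<in> B0 \<Longrightarrow> b \<notin> V1" "b \<in> B1 \<Longrightarrow> b \<notin> V0" using BV zero_notin_B by blast+
qed

lemma indep_B: "independent B"
proof (rule independent_if_scalars_zero[OF finite_B])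
  fix g x assume 0: "(\<Sum>b\<in>B. scale (g b) b) = 0" and x: "x \<in> B"
  have disj: "B0 \<inter> B1 = {}" using B0_V1 BV by blast
  define s where "s = (\<Sum>b\<in>B0. scale (g b) b)"
  have s1: "s = - (\<Sum>b\<in>B1. scale (g b) b)"
    using 0 unfolding B_def sum.union_disjoint[OF finB disj] by (simp add: s_def eq_neg_iff_add_eq_0)
  have "s \<in> V0" unfolding s_def spanB(1)[symmetric] by (intro span_sum span_scale span_base)
  moreover have "s \<in> V1" unfolding s1 spanB(2)[symmetric] by (intro span_neg span_sum span_scale span_base)
  ultimately have "s = 0" using inter_V0_V1 by blast
  then have "(\<Sum>b\<in>B0. scale (g b) b) = 0" "(\<Sum>b\<in>B1. scale (g b) b) = 0" using s1 by (auto simp: s_def)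
  then show "g x = 0"
    using x independentD[OF indB(1) finB(1) order_refl, of g x] independentD[OF indB(2) finB(2) order_refl, of g x]
    by (auto simp: B_def)
qed

lemma span_B: "span B = UNIV"
proof -
  have "v \<in> span B" for v
  proof -
    have "v \<in> {x + y | x y. x \<in> V0 \<and> y \<in> V1}" using sum_V0_V1 by blast
    then obtain x y where xy: "v = x + y" "x \<in> span B0" "y \<in> span B1" using spanB by auto
    then show ?thesis using span_mono[of B0 B] span_mono[of B1 B] by (auto simp: B_def intro!: span_add)
  qed
  then show ?thesis by blast
qed

section \<open>Expansion of words of vectors into words of basis vectors\<close>

abbreviation coord :: "'v \<Rightarrow> 'v \<Rightarrow> 'f" where "coord \<equiv> representation B"

lemma coord_add: "coord (u + v) b = coord u b + coord v b"
  and coord_scale: "coord (scale c v) b = c * coord v b"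
  and coord_basis: "b \<in> B \<Longrightarrow> coord b = (\<lambda>b'. if b' = b then 1 else 0)"
  and coord_sum: "(\<Sum>b\<in>B. scale (coord v b) b) = v"
  and coord_zero: "coord 0 b = 0"
  using representation_add[OF indep_B] representation_scale[OF indep_B] representation_basis[OF indep_B]
    sum_representation_eq[OF indep_B _ finite_B order_refl] span_B
  by (auto simp: representation_zero)

lemma coord_homogeneous:
  assumes "v \<in> V0 \<union> V1" "v \<noteq> 0" "coord v b \<noteq> 0"
  shows "b \<in> B" "b \<in> V1 \<longleftrightarrow> v \<in> V1"
proof -
  show "b \<in> B" using representation_ne_zero[OF assms(3)] .
  show "b \<in> V1 \<longleftrightarrow> v \<in> V1"
  proof (cases "v \<in> V1")
    case True
    then have "coord v = representation B1 v"
      using representation_extend[OF indep_B, of v B1] spanB(2) by (simp add: B_def)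
    then have "b \<in> B1" using representation_ne_zero assms(3) by metis
    then show ?thesis using True BV by auto
  next
    case False
    then have "coord v = representation B0 v"
      using representation_extend[OF indep_B, of v B0] spanB(1) assms(1) by (simp add: B_def)
    then have "b \<in> B0" using representation_ne_zero assms(3) by metis
    then show ?thesis using False B0_V1 by auto
  qed
qed

definition vexp :: "'v \<Rightarrow> ('v list \<Rightarrow>\<^sub>0 'f)" where
  "vexp v = (\<Sum>b\<in>B. sng [b] (coord v b))"

text \<open>The multilinear expansion of the pure tensor of \<open>z\<close> in basis words.\<close>

definition wexp :: "'v list \<Rightarrow> ('v list \<Rightarrow>\<^sub>0 'f)" where
  "wexp z = foldr (\<lambda>v y. fmul (vexp v) y) z (sng [] 1)"

lemma wexp_simps [simp]: "wexp [] = sng [] 1" "wexp (v # z) = fmul (vexp v) (wexp z)"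
  by (simp_all add: wexp_def)

definition wcoef :: "'v list \<Rightarrow> 'v list \<Rightarrow> 'f" where
  "wcoef z b = (\<Prod>i<length z. coord (z ! i) (b ! i))"

lemma wexp_closed: "wexp z = (\<Sum>b\<in>Wd (length z) B. sng b (wcoef z b))"
proof (induction z)
  case Nil
  have "Wd 0 B = {[]}" by (auto simp: Wd_def)
  then show ?case by (simp add: wcoef_def)
next
  case (Cons v z)
  have c: "wcoef (v # z) (b # w) = coord v b * wcoef z w" for b w
    by (simp add: wcoef_def prod.lessThan_Suc_shift del: prod.lessThan_Suc)
  have "wexp (v # z) = (\<Sum>b\<in>B. \<Sum>w\<in>Wd (length z) B. sng (b # w) (wcoef (v # z) (b # w)))"
    by (simp add: Cons vexp_def plin_sum[OF plin_fmul(1)] plin_sum[OF plin_fmul(2)] c) (rule sum.swap)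
  also have "\<dots> = (\<Sum>(b, w)\<in>B \<times> Wd (length z) B. sng (b # w) (wcoef (v # z) (b # w)))"
    by (rule sum.cartesian_product)
  also have "\<dots> = (\<Sum>b\<in>Wd (length (v # z)) B. sng b (wcoef (v # z) b))"
    unfolding length_Cons Wd_Suc by (subst sum.reindex) (auto simp: inj_on_def intro!: sum.cong)
  finally show ?case .
qed

lemma wexp_TL: "wexp z \<in> TL (length z) B"
  unfolding wexp_closed by (intro TL_sum TL_sng)

lemma wexp_append: "wexp (z @ w) = fmul (wexp z) (wexp w)"
  by (induction z) (simp_all add: fmul_assoc)

lemma wexp_basis: "set z \<subseteq> B \<Longrightarrow> wexp z = sng z 1"
proof (induction z)
  case (Cons v z)
  then have "vexp v = sng [v] 1"
    by (simp add: vexp_def coord_basis if_distrib[of "sng _"] sum.delta cong: if_cong)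
  then show ?case using Cons by simp
qed simp

text \<open>The normal form of a tensor: two combinations of words of vectors represent the same
  tensor exactly if their values under \<open>ps\<close> agree.\<close>

definition ps :: "('v list \<Rightarrow>\<^sub>0 'f) \<Rightarrow> ('v list \<Rightarrow>\<^sub>0 'f)" where "ps = lext wexp"

lemma plin_ps: "plin ps" by (simp add: ps_def plin_lext)

lemma ps_sng [simp]: "ps (sng z c) = psc c (wexp z)" by (simp add: ps_def)

lemma ps_fmul: "ps (fmul x y) = fmul (ps x) (ps y)"
proof -
  have "ps (fmul (sng z 1) y) = fmul (ps (sng z 1)) (ps y)" for z
    by (rule plin_eqI[where p = y and S = UNIV and F = "\<lambda>y. ps (fmul (sng z 1) y)" and G = "\<lambda>y. fmul (ps (sng z 1)) (ps y)",
          OF plin_comp[OF plin_ps plin_fmul(2)] plin_comp[OF plin_fmul(2) plin_ps]]) (auto simp: wexp_append)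
  then show ?thesis
    by (intro plin_eqI[where p = x and S = UNIV and F = "\<lambda>x. ps (fmul x y)" and G = "\<lambda>x. fmul (ps x) (ps y)",
          OF plin_comp[OF plin_ps plin_fmul(1)] plin_comp[OF plin_fmul(1) plin_ps]]) auto
qed

definition TB :: "('v list \<Rightarrow>\<^sub>0 'f) set" where "TB = {x. ks x \<subseteq> lists B}"

lemma TL_TB: "x \<in> TL n B \<Longrightarrow> x \<in> TB" by (auto simp: TB_def TL_def Wd_def lists_eq_set)

lemma ps_TB: "ps x \<in> TB"
proof -
  have "ks (wexp z) \<subseteq> lists B" for z using TL_TB[OF wexp_TL] by (simp add: TB_def)
  then show ?thesis unfolding TB_def ps_def using keys_lext[of wexp x] by blast
qed

lemma ps_id: "x \<in> TB \<Longrightarrow> ps x = x"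
  by (rule plin_eqI[where S = "lists B", OF plin_ps plin_id]) (auto simp: TB_def wexp_basis lists_eq_set)

lemma ps_ps: "ps (ps x) = ps x" by (simp add: ps_id ps_TB)

lemma ps_TL: "x \<in> TL n UNIV \<Longrightarrow> ps x \<in> TL n B"
proof -
  assume x: "x \<in> TL n UNIV"
  have "ks (wexp z) \<subseteq> Wd n B" if "z \<in> ks x" for z
    using wexp_TL[of z] x that by (auto simp: TL_def Wd_def)
  then show ?thesis unfolding TL_def ps_def using keys_lext[of wexp x] by blast
qed

abbreviation rel :: "('v list \<Rightarrow>\<^sub>0 'f) set" where "rel \<equiv> tensor_relations scale"

lemma ker_subspace: "pm.subspace {p. ps p = 0}"
  by (rule pm.subspaceI) (auto simp: plin_0[OF plin_ps] plin_add[OF plin_ps] plin_psc[OF plin_ps])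

text \<open>The kernel of \<open>ps\<close> is an ideal containing the linearity relations.
  Conversely \<open>[v]\<close> differs from its expansion by relations, hence so does every word
  from its normal form, and an element with zero normal form is itself a relation.\<close>

lemma rel_eq: "rel = {p. ps p = 0}"
proof
  let ?S = "{sng [u + v] 1 - sng [u] 1 - sng [v] (1::'f) | u v. True} \<union> {sng [scale c v] 1 - sng [v] c | c v. True}"
  interpret F: ring "free_algebra :: ('f, 'v list \<Rightarrow>\<^sub>0 'f) module" by (rule ring_free)
  have rel: "rel = Idl\<^bsub>free_algebra\<^esub> ?S" by (simp add: tensor_relations_def)
  have vexp_add: "vexp (u + v) = vexp u + vexp v" for u v
    by (simp add: vexp_def coord_add single_add sum.distrib)
  have vexp_scale: "vexp (scale c v) = psc c (vexp v)" for c v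
    by (simp add: vexp_def coord_scale pm.scale_sum_right)
  have "ideal {p. ps p = 0} free_algebra"
    by (rule subspace_ideal[OF amodel_free ring_free ker_subspace])
      (auto simp: ps_fmul plin_0[OF plin_fmul(1)] plin_0[OF plin_fmul(2)])
  moreover have "?S \<subseteq> {p. ps p = 0}"
    by (auto simp: plin_diff[OF plin_ps] vexp_add vexp_scale)
  ultimately show "rel \<subseteq> {p. ps p = 0}" unfolding rel by (rule F.genideal_minimal)
  have id: "ideal rel free_algebra" unfolding rel by (rule F.genideal_ideal) simp
  then interpret I: ideal rel "free_algebra :: ('f, 'v list \<Rightarrow>\<^sub>0 'f) module" .
  have "amodel (quot_alg free_algebra rel) UNIV rel fmul (sng [] 1) (\<lambda>x. rel +>\<^bsub>free_algebra\<^esub> x)"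
    by (rule ideal_amodel[OF amodel_free ring_free id]) (rule psc_fmul)
  then have sub: "pm.subspace rel" using vmodelD(2) amodelD(1) by blast
  have Irel: "fmul x y \<in> rel" "fmul y x \<in> rel" if "x \<in> rel" for x y
    using I.I_r_closed[OF that, of y] I.I_l_closed[OF that, of y] by auto
  have gens: "?S \<subseteq> rel" unfolding rel by (rule F.genideal_self) simp
  have g1: "sng [u + v] 1 - sng [u] 1 - sng [v] 1 \<in> rel" and g2: "sng [scale c v] 1 - sng [v] c \<in> rel" for u v c
    using gens by blast+
  have v: "sng [v] 1 - vexp v \<in> rel" for v
  proof -
    have 0: "sng [0] 1 \<in> rel" using g2[of 0 0] by simp
    have "sng [\<Sum>b\<in>S. scale (coord v b) b] 1 - (\<Sum>b\<in>S. sng [b] (coord v b)) \<in> rel" if "finite S" for S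
      using that
    proof induction
      case empty show ?case using 0 by simp
    next
      case (insert b S)
      let ?x = "scale (coord v b) b" and ?y = "\<Sum>b\<in>S. scale (coord v b) b"
      have "sng [?x + ?y] 1 - (sng [b] (coord v b) + (\<Sum>b\<in>S. sng [b] (coord v b)))
        = (sng [?x + ?y] 1 - sng [?x] 1 - sng [?y] 1) + (sng [?x] 1 - sng [b] (coord v b))
          + (sng [?y] 1 - (\<Sum>b\<in>S. sng [b] (coord v b)))" by simp
      also have "\<dots> \<in> rel" by (intro pm.subspace_add[OF sub] g1 g2 insert.IH)
      finally show ?case using insert by simp
    qed
    from this[OF finite_B] show ?thesis by (simp add: coord_sum vexp_def)
  qed
  have z: "sng z 1 - wexp z \<in> rel" for z
  proof (induction z)
    case Nil show ?case using pm.subspace_0[OF sub] by simp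
  next
    case (Cons v z)
    have "sng (v # z) 1 - wexp (v # z) = fmul (sng [v] 1) (sng z 1 - wexp z) + fmul (sng [v] 1 - vexp v) (wexp z)"
      by (simp add: plin_diff[OF plin_fmul(1)] plin_diff[OF plin_fmul(2)])
    then show ?case using Irel Cons v pm.subspace_add[OF sub] by metis
  qed
  show "{p. ps p = 0} \<subseteq> rel"
  proof
    fix p assume p: "p \<in> {p. ps p = 0}"
    have e: "p = (\<Sum>z\<in>ks p. psc (lk p z) (sng z 1))" by (rule poly_mapping_expand) auto
    have "p = p - ps p" using p by simp
    also have "\<dots> = (\<Sum>z\<in>ks p. psc (lk p z) (sng z 1 - wexp z))"
      by (subst (1) e) (simp add: ps_def lext_def pm.scale_right_diff_distrib sum_subtractf)
    also have "\<dots> \<in> rel" by (intro pm.subspace_sum pm.subspace_scale sub z)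
    finally show "p \<in> rel" .
  qed
qed

section \<open>Tensors and their signed action in coordinates\<close>

abbreviation T where "T \<equiv> tensor_algebra scale"

definition pi :: "('v list \<Rightarrow>\<^sub>0 'f) \<Rightarrow> ('v list \<Rightarrow>\<^sub>0 'f) set" where "pi p = rel +>\<^bsub>free_algebra\<^esub> p"

lemma T_model: "amodel T UNIV rel fmul (sng [] 1) pi"
proof -
  interpret F: ring "free_algebra :: ('f, 'v list \<Rightarrow>\<^sub>0 'f) module" by (rule ring_free)
  have "ideal rel free_algebra" unfolding tensor_relations_def by (rule F.genideal_ideal) simp
  from ideal_amodel[OF amodel_free ring_free this psc_fmul] show ?thesis
    by (simp add: tensor_algebra_def pi_def[abs_def])
qed

lemmas T_vmodel = amodelD(1)[OF T_model]
lemmas T_D = vmodelD[OF T_vmodel]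

lemma pi_eq_iff: "pi x = pi y \<longleftrightarrow> ps x = ps y"
  using T_D(8)[of x y] by (simp add: rel_eq plin_diff[OF plin_ps])

lemma pi_ps: "pi (ps x) = pi x" by (simp add: pi_eq_iff ps_ps)

lemma tensor_power_eq: "tensor_power scale n = pi ` TL n UNIV" "tensor_power scale n = pi ` TL n B"
proof -
  have "{pure_tensor scale z | z. length z = n} = pi ` (\<lambda>z. sng z 1) ` Wd n UNIV"
    by (auto simp: pure_tensor_def pi_def Wd_def)
  then show 1: "tensor_power scale n = pi ` TL n UNIV"
    unfolding tensor_power_def using vmodel_lin_span[OF T_vmodel, of "(\<lambda>z. sng z 1) ` Wd n UNIV"]
    by (simp add: span_words)
  show "tensor_power scale n = pi ` TL n B"
    unfolding 1
  proof (intro equalityI subsetI)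
    fix X assume "X \<in> pi ` TL n UNIV"
    then obtain x where "X = pi x" "x \<in> TL n UNIV" by blast
    then show "X \<in> pi ` TL n B" using pi_ps[of x] ps_TL by (metis imageI)
  qed (use TL_mono[of B UNIV] in blast)
qed

text \<open>The expansion of a nonzero homogeneous vector involves basis vectors of its own parity,
  so the sign is the same for all terms. The zero vector lies in both parts and has no parity; a
  word containing it expands to zero on both sides.\<close>

lemma wexp_act:
  assumes s: "ap s permutes {1..n}" and z: "length z = n" "set z \<subseteq> V0 \<union> V1"
  shows "act V1 (wexp z) (dl s) = psc (wsgn V1 n (ap s) z) (wexp (permute_word n (ap s) z))"
proof (cases "0 \<in> set z")
  case True
  then obtain i where i: "i < n" "z ! i = 0" using z(1) by (auto simp: in_set_conv_nth)
  have 1: "wexp z = 0"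
  proof -
    have "wcoef z b = 0" for b unfolding wcoef_def using i z(1) by (auto simp: coord_zero intro!: prod_zero bexI[of _ i])
    then show ?thesis by (simp add: wexp_closed)
  qed
  have "0 \<in> set (permute_word n (ap s) z)" using set_permute_word[OF s z(1)] True by simp
  then obtain j where j: "j < n" "permute_word n (ap s) z ! j = 0" by (auto simp: in_set_conv_nth)
  have "wcoef (permute_word n (ap s) z) b = 0" for b
    unfolding wcoef_def by (rule prod_zero) (use j in \<open>auto simp: coord_zero simp del: nth_permute_word intro!: bexI[of _ j]\<close>)
  then have "wexp (permute_word n (ap s) z) = 0" by (simp add: wexp_closed)
  with 1 show ?thesis by (simp add: plin_0[OF plin_act_left])
next
  case False
  have sin: "ap s i \<in> {1..n} \<longleftrightarrow> i \<in> {1..n}" for i using permutes_in_image[OF s] by blast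
  have sgn: "wsgn V1 n (ap s) b = (wsgn V1 n (ap s) z :: 'f)" if b: "b \<in> Wd n B" "wcoef z b \<noteq> 0" for b
  proof -
    have par: "b ! i \<in> V1 \<longleftrightarrow> z ! i \<in> V1" if "i < n" for i
    proof -
      have "coord (z ! i) (b ! i) \<noteq> 0" using b(2) that z(1) by (auto simp: wcoef_def)
      moreover have "z ! i \<in> V0 \<union> V1" "z ! i \<noteq> 0" using that z False nth_mem[of i z] by (blast, metis)
      ultimately show ?thesis using coord_homogeneous(2) by blast
    qed
    have "odd_inversions V1 n (ap s) b = odd_inversions V1 n (ap s) z"
      unfolding odd_inversions_def
    proof (rule arg_cong[where f = card], intro Collect_cong, clarify)
      fix i j
      have p1: "b ! (ap s m - 1) \<in> V1 \<longleftrightarrow> z ! (ap s m - 1) \<in> V1" if "m \<in> {1..n}" for m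
        using sin[of m] that by (intro par) auto
      then show "(i \<in> {1..n} \<and> j \<in> {1..n} \<and> i < j \<and> ap s j < ap s i \<and> b ! (ap s i - 1) \<in> V1 \<and> b ! (ap s j - 1) \<in> V1)
        = (i \<in> {1..n} \<and> j \<in> {1..n} \<and> i < j \<and> ap s j < ap s i \<and> z ! (ap s i - 1) \<in> V1 \<and> z ! (ap s j - 1) \<in> V1)"
        by blast
    qed
    then show ?thesis by simp
  qed
  have coefp: "wcoef (permute_word n (ap s) z) (permute_word n (ap s) b) = wcoef z b" for b
  proof -
    have bij: "bij_betw (\<lambda>i. ap s (Suc i) - 1) {..<n} {..<n}"
    proof (rule bij_betw_byWitness[where f' = "\<lambda>i. ap (- s) (Suc i) - 1"])
      have si: "ap (- s) i \<in> {1..n} \<longleftrightarrow> i \<in> {1..n}" for i using sin[of "ap (- s) i"] by simp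
      have 0: "ap s (Suc i) \<in> {1..n}" "ap (- s) (Suc i) \<in> {1..n}" if "i < n" for i
        using sin[of "Suc i"] si[of "Suc i"] that by auto
      have 1: "Suc (ap s (Suc i) - 1) = ap s (Suc i)" "Suc (ap (- s) (Suc i) - 1) = ap (- s) (Suc i)" if "i < n" for i
        using 0[OF that] by auto
      show "\<forall>i\<in>{..<n}. ap (- s) (Suc (ap s (Suc i) - 1)) - 1 = i"
      proof
        fix i assume "i \<in> {..<n}"
        then have "Suc (ap s (Suc i) - 1) = ap s (Suc i)" using 1 by blast
        then show "ap (- s) (Suc (ap s (Suc i) - 1)) - 1 = i" by (simp only: ap_uminus diff_Suc_1)
      qed
      show "\<forall>i\<in>{..<n}. ap s (Suc (ap (- s) (Suc i) - 1)) - 1 = i"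
      proof
        fix i assume "i \<in> {..<n}"
        then have "Suc (ap (- s) (Suc i) - 1) = ap (- s) (Suc i)" using 1 by blast
        then show "ap s (Suc (ap (- s) (Suc i) - 1)) - 1 = i" by (simp only: ap_uminus diff_Suc_1)
      qed
      show "(\<lambda>i. ap s (Suc i) - 1) ` {..<n} \<subseteq> {..<n}" "(\<lambda>i. ap (- s) (Suc i) - 1) ` {..<n} \<subseteq> {..<n}"
        using 0 by fastforce+
    qed
    have "wcoef (permute_word n (ap s) z) (permute_word n (ap s) b)
      = (\<Prod>i<n. coord (z ! (ap s (Suc i) - 1)) (b ! (ap s (Suc i) - 1)))"
      unfolding wcoef_def by (intro prod.cong) auto
    also have "\<dots> = (\<Prod>i<n. coord (z ! i) (b ! i))"
      using prod.reindex_bij_betw[OF bij, of "\<lambda>i. coord (z ! i) (b ! i)"] by simp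
    finally show ?thesis by (simp add: wcoef_def z(1))
  qed
  have pinv: "permute_word n (ap (- s)) (permute_word n (ap s) b) = b" "permute_word n (ap s) (permute_word n (ap (- s)) b) = b"
    if "length b = n" for b
  proof -
    have "ap (- s) permutes {1..n}" unfolding ap_uminus_fun by (rule permutes_inv[OF s])
    moreover have "ap s \<circ> ap (- s) = id" "ap (- s) \<circ> ap s = id" by auto
    ultimately show "permute_word n (ap (- s)) (permute_word n (ap s) b) = b" "permute_word n (ap s) (permute_word n (ap (- s)) b) = b"
      using s that by (simp_all add: permute_word_comp permute_word_id)
  qed
  have Wp: "permute_word n (ap t) b \<in> Wd n B" if "b \<in> Wd n B" "ap t permutes {1..n}" for b t
    using that set_permute_word[of "ap t" n b] by (simp add: Wd_def)
  have "act V1 (wexp z) (dl s) = (\<Sum>b\<in>Wd n B. psc (wcoef z b) (wact V1 b s))"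
  proof -
    have "wexp z = (\<Sum>b\<in>Wd n B. psc (wcoef z b) (sng b 1))" by (simp add: wexp_closed z(1))
    then show ?thesis by (simp add: plin_sum[OF plin_act_left] plin_psc[OF plin_act_left] del: psc_sng)
  qed
  also have "\<dots> = (\<Sum>b\<in>Wd n B. psc (wsgn V1 n (ap s) z) (sng (permute_word n (ap s) b) (wcoef z b)))"
  proof (rule sum.cong[OF refl])
    fix b assume b: "b \<in> Wd n B"
    then have "length b = n" by (simp add: Wd_def)
    then show "psc (wcoef z b) (wact V1 b s) = psc (wsgn V1 n (ap s) z) (sng (permute_word n (ap s) b) (wcoef z b))"
      using sgn[OF b] by (cases "wcoef z b = 0") (auto simp: wact_def mult.commute)
  qed
  also have "\<dots> = psc (wsgn V1 n (ap s) z) (\<Sum>b\<in>Wd n B. sng (permute_word n (ap s) b) (wcoef z b))"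
    by (simp only: pm.scale_sum_right)
  also have "(\<Sum>b\<in>Wd n B. sng (permute_word n (ap s) b) (wcoef z b))
    = (\<Sum>b\<in>Wd n B. sng b (wcoef (permute_word n (ap s) z) b))"
  proof (rule sum.reindex_bij_witness[of _ "permute_word n (ap (- s))" "permute_word n (ap s)"])
    have s': "ap (- s) permutes {1..n}" unfolding ap_uminus_fun by (rule permutes_inv[OF s])
    fix b assume b: "b \<in> Wd n B"
    then have l: "length b = n" by (simp add: Wd_def)
    show "permute_word n (ap (- s)) (permute_word n (ap s) b) = b" "permute_word n (ap s) (permute_word n (ap (- s)) b) = b"
      using pinv[OF l] .
    show "permute_word n (ap s) b \<in> Wd n B" "permute_word n (ap (- s)) b \<in> Wd n B" using Wp[OF b s] Wp[OF b s'] .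
    show "sng (permute_word n (ap s) b) (wcoef (permute_word n (ap s) z) (permute_word n (ap s) b))
      = sng (permute_word n (ap s) b) (wcoef z b)" by (simp only: coefp)
  qed
  also have "\<dots> = wexp (permute_word n (ap s) z)" by (simp add: wexp_closed)
  finally show ?thesis .
qed

text \<open>The definite description is resolved: acting on normal forms satisfies the required
  properties by \<open>wexp_act\<close>, and a linear map is determined by its values on basis
  words.\<close>

lemma sign_action_eq:
  assumes s: "ap s permutes {1..n}" and y: "y \<in> TL n B"
  shows "sign_action scale V0 V1 n (ap s) (pi y) = pi (act V1 y (dl s))"
proof -
  let ?P = "tensor_power scale n"
  have sS: "s \<in> Sym {1..n}" using s by (simp add: Sym_def)
  define f0 where "f0 = (\<lambda>X\<in>?P. pi (act V1 (ps (SOME p. pi p = X)) (dl s)))"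
  have f0: "f0 (pi p) = pi (act V1 (ps p) (dl s))" if "p \<in> TL n UNIV" for p
  proof -
    have "pi (SOME q. pi q = pi p) = pi p" by (rule someI[of _ p]) simp
    then have "ps (SOME q. pi q = pi p) = ps p" by (simp add: pi_eq_iff)
    then show ?thesis using that by (simp add: f0_def tensor_power_eq(1))
  qed
  have padd: "pi p \<oplus>\<^bsub>T\<^esub> pi q = pi (p + q)" "c \<odot>\<^bsub>T\<^esub> pi p = pi (psc c p)" for p q c using T_D(6,7) by auto
  have "sign_action scale V0 V1 n (ap s) = f0"
    unfolding sign_action_def
  proof (rule the_equality, intro conjI ballI allI impI)
    show "f0 \<in> extensional ?P" by (simp add: f0_def)
    fix X Y assume "X \<in> ?P" "Y \<in> ?P"
    then obtain p q where pq: "X = pi p" "Y = pi q" "p \<in> TL n UNIV" "q \<in> TL n UNIV" unfolding tensor_power_eq(1) by blast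
    show "f0 (X \<oplus>\<^bsub>T\<^esub> Y) = f0 X \<oplus>\<^bsub>T\<^esub> f0 Y"
      by (simp add: pq padd f0 TL_add plin_add[OF plin_ps] plin_add[OF plin_act_left])
  next
    fix c X assume "X \<in> ?P"
    then obtain p where p: "X = pi p" "p \<in> TL n UNIV" unfolding tensor_power_eq(1) by blast
    show "f0 (c \<odot>\<^bsub>T\<^esub> X) = c \<odot>\<^bsub>T\<^esub> f0 X"
      by (simp add: p padd f0 TL_psc plin_psc[OF plin_ps] plin_psc[OF plin_act_left])
  next
    fix z assume z: "length z = n \<and> set z \<subseteq> V0 \<union> V1"
    have pt: "pure_tensor scale w = pi (sng w 1)" for w by (simp add: pure_tensor_def pi_def)
    have "sng z (1::'f) \<in> TL n UNIV" using z by (intro TL_sng) (simp add: Wd_def)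
    then have "f0 (pure_tensor scale z) = pi (psc (wsgn V1 n (ap s) z) (wexp (permute_word n (ap s) z)))"
      using z by (simp add: pt f0 wexp_act[OF s])
    also have "\<dots> = wsgn V1 n (ap s) z \<odot>\<^bsub>T\<^esub> pi (ps (sng (permute_word n (ap s) z) 1))"
      by (simp add: padd)
    finally show "f0 (pure_tensor scale z) = wsgn V1 n (ap s) z \<odot>\<^bsub>T\<^esub> pure_tensor scale (permute_word n (ap s) z)"
      by (simp only: pi_ps pt)
  next
    fix f assume f: "f \<in> extensional ?P \<and> (\<forall>x\<in>?P. \<forall>y\<in>?P. f (x \<oplus>\<^bsub>T\<^esub> y) = f x \<oplus>\<^bsub>T\<^esub> f y)
      \<and> (\<forall>c. \<forall>x\<in>?P. f (c \<odot>\<^bsub>T\<^esub> x) = c \<odot>\<^bsub>T\<^esub> f x)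
      \<and> (\<forall>z. length z = n \<and> set z \<subseteq> V0 \<union> V1 \<longrightarrow>
           f (pure_tensor scale z) = wsgn V1 n (ap s) z \<odot>\<^bsub>T\<^esub> pure_tensor scale (permute_word n (ap s) z))"
    have add: "f (pi (p + q)) = f (pi p) \<oplus>\<^bsub>T\<^esub> f (pi q)" if "p \<in> TL n UNIV" "q \<in> TL n UNIV" for p q
      using f that unfolding tensor_power_eq(1) by (simp flip: padd)
    have sc: "f (pi (psc c p)) = c \<odot>\<^bsub>T\<^esub> f (pi p)" if "p \<in> TL n UNIV" for p c
      using f that unfolding tensor_power_eq(1) by (simp flip: padd)
    have word: "f (pi (sng z 1)) = pi (act V1 (sng z 1) (dl s))" if "z \<in> Wd n B" for z
    proof -
      have "length z = n" "set z \<subseteq> V0 \<union> V1" using that BV by (auto simp: Wd_def B_def)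
      moreover have "sng w 1 \<in> TL n UNIV" "pure_tensor scale w = pi (sng w 1)" if "length w = n" for w
        using that by (auto simp: pure_tensor_def pi_def TL_def Wd_def)
      ultimately have "f (pi (sng z 1)) = wsgn V1 n (ap s) z \<odot>\<^bsub>T\<^esub> pi (sng (permute_word n (ap s) z) 1)"
        using f by (metis length_permute_word)
      then show ?thesis using \<open>length z = n\<close> by (simp add: padd wact_def)
    qed
    have main: "f (pi (\<Sum>z\<in>S. psc (g z) (sng z 1))) = pi (act V1 (\<Sum>z\<in>S. psc (g z) (sng z 1)) (dl s))"
      if "finite S" "S \<subseteq> Wd n B" for S g
      using that
    proof (induction S)
      case empty
      have "f (pi (psc 0 0)) = 0 \<odot>\<^bsub>T\<^esub> f (pi 0)" by (rule sc) auto
      \<comment> \<open>Before the scalar 0 can be evaluated on \<open>f (pi 0)\<close>, this value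
        must be known to lie in the carrier. In positive degree \<open>pi 0\<close> is the class of
        a word of zero vectors, whose image is prescribed; in degree 0 the empty word
        serves.\<close>
      moreover have "f (pi 0) \<in> carrier T"
      proof -
        show ?thesis
        proof (cases "n = 0")
          case True
          then have "f (pi (psc 0 (sng [] 1))) = 0 \<odot>\<^bsub>T\<^esub> f (pi (sng [] 1))" by (intro sc) (auto simp: TL_def Wd_def)
          also have "\<dots> = pi 0" using word[of "[]"] True by (simp add: Wd_def padd)
          finally show ?thesis using T_D(4) by simp
        next
          case False
          have "length (replicate n (0::'v)) = n \<and> set (replicate n (0::'v)) \<subseteq> V0 \<union> V1"
            using subspace_0[OF subspace_V0] by auto
          then have "f (pure_tensor scale (replicate n 0)) = wsgn V1 n (ap s) (replicate n 0)
              \<odot>\<^bsub>T\<^esub> pure_tensor scale (permute_word n (ap s) (replicate n 0))" using f by blast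
          then have "f (pi (sng (replicate n 0) 1)) \<in> carrier T"
            unfolding pure_tensor_def pi_def[symmetric] padd T_D(4) by simp
          moreover have "pi (sng (replicate n 0) 1) = pi 0"
          proof -
            obtain m where "n = Suc m" using False by (cases n) auto
            then have "wexp (replicate n 0) = 0"
              by (simp add: vexp_def coord_zero plin_0[OF plin_fmul(1)])
            then show ?thesis by (simp add: pi_eq_iff plin_0[OF plin_ps])
          qed
          ultimately show ?thesis by simp
        qed
      qed
      then obtain q where "f (pi 0) = pi q" using T_D(4) by auto
      ultimately have "f (pi 0) = pi 0" by (simp add: padd)
      then show ?case by (simp add: plin_0[OF plin_act_left])
    next
      case (insert z S)
      have in1: "psc (g z) (sng z 1) \<in> TL n UNIV" "sng z (1::'f) \<in> TL n UNIV"
        using insert.prems by (auto intro!: TL_sng simp: Wd_def)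
      have in2: "(\<Sum>z\<in>S. psc (g z) (sng z 1)) \<in> TL n UNIV"
        by (intro TL_sum TL_psc TL_sng) (use insert.prems in \<open>auto simp: Wd_def\<close>)
      have "f (pi (psc (g z) (sng z 1) + (\<Sum>z\<in>S. psc (g z) (sng z 1))))
        = (g z \<odot>\<^bsub>T\<^esub> f (pi (sng z 1))) \<oplus>\<^bsub>T\<^esub> f (pi (\<Sum>z\<in>S. psc (g z) (sng z 1)))"
        unfolding add[OF in1(1) in2] sc[OF in1(2)] ..
      also have "\<dots> = pi (act V1 (psc (g z) (sng z 1) + (\<Sum>z\<in>S. psc (g z) (sng z 1))) (dl s))"
        using insert word[of z] by (simp add: padd plin_add[OF plin_act_left] plin_psc[OF plin_act_left] del: psc_sng)
      finally show ?case using insert by simp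
    qed
    show "f = f0"
    proof (rule extensionalityI[of _ ?P])
      fix X assume "X \<in> ?P"
      then obtain y where y: "X = pi y" "y \<in> TL n B" unfolding tensor_power_eq(2) by blast
      have e: "y = (\<Sum>z\<in>ks y. psc (lk y z) (sng z 1))" by (rule poly_mapping_expand) auto
      have "f (pi y) = pi (act V1 y (dl s))"
        using main[of "ks y" "lk y"] y(2) unfolding e[symmetric] by (simp add: TL_def)
      moreover have "f0 (pi y) = pi (act V1 y (dl s))"
        using f0[of y] y(2) ps_id[OF TL_TB[OF y(2)]] TL_mono[of B UNIV] by auto
      ultimately show "f X = f0 X" by (simp add: y(1))
    qed (use f in \<open>auto simp: f0_def\<close>)
  qed
  then show ?thesis using f0[of y] y ps_id[OF TL_TB[OF y]] TL_mono[of B UNIV] by auto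
qed

end

section \<open>Isotypic components\<close>

text \<open>Translates the group algebra of \<open>sym_group n\<close>, in which Specht modules are
  stated, into that of \<open>fperm\<close>; \<open>ginv\<close> is the way back.\<close>

definition gconv :: "((nat \<Rightarrow> nat) \<Rightarrow>\<^sub>0 'f) \<Rightarrow> (fperm \<Rightarrow>\<^sub>0 'f::field_char_0)" where
  "gconv = lext (\<lambda>s. dl (Ap s))"

definition ginv :: "(fperm \<Rightarrow>\<^sub>0 'f) \<Rightarrow> ((nat \<Rightarrow> nat) \<Rightarrow>\<^sub>0 'f::field_char_0)" where
  "ginv = lext (\<lambda>a. sng (ap a) 1)"

abbreviation SG :: "nat \<Rightarrow> ('f::field_char_0, (nat \<Rightarrow> nat) \<Rightarrow>\<^sub>0 'f) module" where
  "SG n \<equiv> monoid_algebra (sym_group n)"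

lemma plin_gconv: "plin gconv" and plin_ginv: "plin ginv" by (simp_all add: gconv_def ginv_def plin_lext)

lemma gconv_sng [simp]: "gconv (sng s c) = psc c (dl (Ap s))" by (simp add: gconv_def)
lemma ginv_sng [simp]: "ginv (sng a c) = psc c (sng (ap a) 1)" by (simp add: ginv_def)

lemma sym_group_sel: "s \<in> carrier (sym_group n) \<longleftrightarrow> s permutes {1..n}" "mult (sym_group n) = (\<circ>)"
  by (simp_all add: sym_group_def)

lemma Ap_Sym: "s permutes {1..n} \<Longrightarrow> Ap s \<in> Sym {1..n} \<and> ap (Ap s) = s"
  by (simp add: Sym_def ap_Ap)

lemma gconv_GA: "p \<in> carrier (SG n) \<Longrightarrow> gconv p \<in> GA {1..n}"
  using keys_lext[of "\<lambda>s. dl (Ap s)" p] Ap_Sym by (fastforce simp: gconv_def GA_def sym_group_sel)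

lemma ginv_carrier: "x \<in> GA {1..n} \<Longrightarrow> ginv x \<in> carrier (SG n)"
  using keys_lext[of "\<lambda>a. sng (ap a) 1" x] by (fastforce simp: ginv_def GA_def sym_group_sel Sym_def)

lemma gconv_ginv: "x \<in> GA {1..n} \<Longrightarrow> gconv (ginv x) = x"
  by (rule plin_eqI[where S = "Sym {1..n}", OF plin_comp[OF plin_gconv plin_ginv] plin_id])
    (auto simp: GA_def ap_inverse)

lemma ginv_gconv: "p \<in> carrier (SG n) \<Longrightarrow> ginv (gconv p) = p"
  by (rule plin_eqI[where S = "{s. s permutes {1..n}}", OF plin_comp[OF plin_ginv plin_gconv] plin_id])
    (use Ap_Sym in \<open>auto simp: sym_group_sel\<close>)

lemma gconv_mult:
  assumes "p \<in> carrier (SG n)" "q \<in> carrier (SG n)"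
  shows "gconv (p \<otimes>\<^bsub>SG n\<^esub> q) = gconv p * gconv q"
proof -
  let ?P = "{s. s permutes {1..n}}"
  have pq: "ks p \<subseteq> ?P" "ks q \<subseteq> ?P" using assms by (auto simp: sym_group_sel)
  have 1: "gconv (sng s 1 \<otimes>\<^bsub>SG n\<^esub> sng t 1) = gconv (sng s 1) * (gconv (sng t 1) :: fperm \<Rightarrow>\<^sub>0 'a)"
    if "s \<in> ?P" "t \<in> ?P" for s t
  proof -
    have "Ap (s \<circ> t) = Ap s + Ap t"
      using that Ap_Sym[of s n] Ap_Sym[of t n] Ap_Sym[OF permutes_compose[of t "{1..n}" s]]
      by (intro fperm_eqI) (auto simp: ap_plus)
    then show ?thesis by (simp add: dl_mult sym_group_sel)
  qed
  have 2: "gconv (sng s 1 \<otimes>\<^bsub>SG n\<^esub> q) = gconv (sng s 1) * gconv q" if "s \<in> ?P" for s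
    by (rule plin_eqI[where p = q and S = ?P and F = "\<lambda>q. gconv (sng s 1 \<otimes>\<^bsub>SG n\<^esub> q)" and G = "\<lambda>q. gconv (sng s 1) * gconv q",
          OF plin_comp[OF plin_gconv plin_mult_right] plin_comp[OF plin_times(1) plin_gconv] pq(2)])
      (use that 1 in blast)
  show ?thesis
    by (rule plin_eqI[where p = p and S = ?P and F = "\<lambda>p. gconv (p \<otimes>\<^bsub>SG n\<^esub> q)" and G = "\<lambda>p. gconv p * gconv q",
          OF plin_comp[OF plin_gconv plin_mult_left] plin_comp[OF plin_times(2) plin_gconv] pq(1)])
      (use 2 in blast)
qed

lemma SG_closed: "p \<in> carrier (SG n) \<Longrightarrow> q \<in> carrier (SG n) \<Longrightarrow> p \<otimes>\<^bsub>SG n\<^esub> q \<in> carrier (SG n)"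
  using keys_mult_monoid_algebraI[OF group.is_monoid[OF sym_group_is_group], of p n q] by simp

text \<open>The tableaux of the statement send cells to entries, those of \<open>tab\<close> send
  entries to coordinates; hence the inverse.\<close>

definition trow :: "(nat \<Rightarrow> nat) \<Rightarrow> (nat \<times> nat \<Rightarrow> nat) \<Rightarrow> nat \<Rightarrow> nat" where
  "trow \<nu> t x = fst (inv_into (cells \<nu>) t x)"

definition tcol :: "(nat \<Rightarrow> nat) \<Rightarrow> (nat \<times> nat \<Rightarrow> nat) \<Rightarrow> nat \<Rightarrow> nat" where
  "tcol \<nu> t x = snd (inv_into (cells \<nu>) t x)"

lemma tableau_coordinates:
  assumes t: "is_tableau \<nu> t" and nuP: "\<nu> \<in> pn n"
  shows "tab {1..n} (trow \<nu> t) (tcol \<nu> t) \<nu>"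
    "row_group \<nu> t = ap ` Stab {1..n} (trow \<nu> t)" "column_group \<nu> t = ap ` Stab {1..n} (tcol \<nu> t)"
proof -
  have bij: "bij_betw t (cells \<nu>) {1..n}" using assms by (simp add: is_tableau_def pn_def)
  have n: "psize \<nu> = n" using nuP by (simp add: pn_def)
  have e: "(\<lambda>x. (trow \<nu> t x, tcol \<nu> t x)) = inv_into (cells \<nu>) t" by (simp add: trow_def tcol_def)
  show "tab {1..n} (trow \<nu> t) (tcol \<nu> t) \<nu>"
    unfolding tab_def e using bij_betw_inv_into[OF bij] nuP by (simp add: pn_def)
  have rc: "trow \<nu> t (t (i, j)) = i" "tcol \<nu> t (t (i, j)) = j" if "(i, j) \<in> cells \<nu>" for i j
    using that bij by (simp_all add: trow_def tcol_def bij_betw_def)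
  have tx: "(trow \<nu> t x, tcol \<nu> t x) \<in> cells \<nu>" "t (trow \<nu> t x, tcol \<nu> t x) = x" if "x \<in> {1..n}" for x
    using that bij by (auto simp: trow_def tcol_def bij_betw_def intro: inv_into_into f_inv_into_f)
  have tn: "t z \<in> {1..n}" if "z \<in> cells \<nu>" for z using that bij by (auto simp: bij_betw_def)
  have St: "ap ` Stab {1..n} f = {p. p permutes {1..n} \<and> (\<forall>x\<in>{1..n}. f (p x) = f x)}" for f :: "nat \<Rightarrow> nat"
  proof (intro equalityI subsetI)
    fix p assume "p \<in> {p. p permutes {1..n} \<and> (\<forall>x\<in>{1..n}. f (p x) = f x)}"
    then show "p \<in> ap ` Stab {1..n} f" using Ap_Sym[of p n] by (intro image_eqI[of _ _ "Ap p"]) (auto simp: Stab_def)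
  qed (auto simp: Stab_def Sym_def)
  have "(\<forall>(i, j)\<in>cells \<nu>. \<exists>j'. (i, j') \<in> cells \<nu> \<and> p (t (i, j)) = t (i, j')) \<longleftrightarrow> (\<forall>x\<in>{1..n}. trow \<nu> t (p x) = trow \<nu> t x)"
    "(\<forall>(i, j)\<in>cells \<nu>. \<exists>i'. (i', j) \<in> cells \<nu> \<and> p (t (i, j)) = t (i', j)) \<longleftrightarrow> (\<forall>x\<in>{1..n}. tcol \<nu> t (p x) = tcol \<nu> t x)"
    if p: "p permutes {1..n}" for p
  proof -
    have pn: "p x \<in> {1..n}" if "x \<in> {1..n}" for x using permutes_in_image[OF p] that by blast
    {
      assume A: "\<forall>(i, j)\<in>cells \<nu>. \<exists>j'. (i, j') \<in> cells \<nu> \<and> p (t (i, j)) = t (i, j')"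
      have "trow \<nu> t (p x) = trow \<nu> t x" if "x \<in> {1..n}" for x
        using A tx[OF that] rc by fastforce
    } moreover {
      assume A: "\<forall>x\<in>{1..n}. trow \<nu> t (p x) = trow \<nu> t x"
      have "\<exists>j'. (i, j') \<in> cells \<nu> \<and> p (t (i, j)) = t (i, j')" if "(i, j) \<in> cells \<nu>" for i j
        using A tn[OF that] rc[OF that] tx[OF pn[OF tn[OF that]]] by (intro exI[of _ "tcol \<nu> t (p (t (i, j)))"]) auto
    } moreover {
      assume A: "\<forall>(i, j)\<in>cells \<nu>. \<exists>i'. (i', j) \<in> cells \<nu> \<and> p (t (i, j)) = t (i', j)"
      have "tcol \<nu> t (p x) = tcol \<nu> t x" if "x \<in> {1..n}" for x
        using A tx[OF that] rc by fastforce
    } moreover {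
      assume A: "\<forall>x\<in>{1..n}. tcol \<nu> t (p x) = tcol \<nu> t x"
      have "\<exists>i'. (i', j) \<in> cells \<nu> \<and> p (t (i, j)) = t (i', j)" if "(i, j) \<in> cells \<nu>" for i j
        using A tn[OF that] rc[OF that] tx[OF pn[OF tn[OF that]]] by (intro exI[of _ "trow \<nu> t (p (t (i, j)))"]) auto
    } ultimately show "(\<forall>(i, j)\<in>cells \<nu>. \<exists>j'. (i, j') \<in> cells \<nu> \<and> p (t (i, j)) = t (i, j')) \<longleftrightarrow> (\<forall>x\<in>{1..n}. trow \<nu> t (p x) = trow \<nu> t x)"
    "(\<forall>(i, j)\<in>cells \<nu>. \<exists>i'. (i', j) \<in> cells \<nu> \<and> p (t (i, j)) = t (i', j)) \<longleftrightarrow> (\<forall>x\<in>{1..n}. tcol \<nu> t (p x) = tcol \<nu> t x)"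
      by blast+
  qed
  then show "row_group \<nu> t = ap ` Stab {1..n} (trow \<nu> t)" "column_group \<nu> t = ap ` Stab {1..n} (tcol \<nu> t)"
    unfolding row_group_def column_group_def St n sym_group_sel by blast+
qed

lemma young_symmetrizer_gconv:
  assumes t: "is_tableau \<nu> t" and nuP: "\<nu> \<in> pn n"
  shows "gconv (young_symmetrizer \<nu> t) = (tableau.u {1..n} (trow \<nu> t) (tcol \<nu> t) :: fperm \<Rightarrow>\<^sub>0 'f::field_char_0)"
    "young_symmetrizer \<nu> t \<in> carrier (SG n :: ('f, _) module)"
proof -
  interpret tableau "{1..n}" "trow \<nu> t" "tcol \<nu> t" \<nu> "TYPE('f)"
    by unfold_locales (rule tableau_coordinates[OF assms])
  have n: "psize \<nu> = n" using nuP by (simp add: pn_def)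
  let ?R = "Stab {1..n} (trow \<nu> t)" and ?C = "Stab {1..n} (tcol \<nu> t)"
  have inj: "inj_on ap S" for S by (auto simp: inj_on_def ap_inject)
  have y: "young_symmetrizer \<nu> t = (\<Sum>a\<in>?R. \<Sum>b\<in>?C. sng (ap a \<circ> ap b) (psgn b :: 'f))"
    unfolding young_symmetrizer_def tableau_coordinates[OF assms] n sym_group_sel
    by (simp add: sum.reindex[OF inj] psgn_def)
  have Ap: "Ap (ap a \<circ> ap b) = a + b" for a b by (simp add: plus_fperm.rep_eq[symmetric] ap_inverse)
  show "gconv (young_symmetrizer \<nu> t) = (u :: fperm \<Rightarrow>\<^sub>0 'f)"
    unfolding y u_def gsum_def sum_product by (simp add: plin_sum[OF plin_gconv] Ap mult_single)
  show "young_symmetrizer \<nu> t \<in> carrier (SG n :: ('f, _) module)"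
  proof -
    have "ap a \<circ> ap b permutes {1..n}" if "a \<in> ?R" "b \<in> ?C" for a b
    proof (rule permutes_compose)
      show "ap a permutes {1..n}" "ap b permutes {1..n}" using that by (simp_all add: Stab_def Sym_def)
    qed
    then have "ks (sng (ap a \<circ> ap b) (psgn b :: 'f)) \<subseteq> {s. s permutes {1..n}}" if "a \<in> ?R" "b \<in> ?C" for a b
      using that by auto
    then have "ks (young_symmetrizer \<nu> t :: _ \<Rightarrow>\<^sub>0 'f) \<subseteq> {s. s permutes {1..n}}"
      unfolding y by (intro keys_sumI) blast
    then show ?thesis by (auto simp: sym_group_sel)
  qed
qed

lemma specht_gconv:
  assumes t: "is_tableau \<nu> t" and nuP: "\<nu> \<in> pn n"
  shows "specht \<nu> t \<subseteq> carrier (SG n :: ('f::field_char_0, _) module)"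
    "gconv ` specht \<nu> t = {tableau.u {1..n} (trow \<nu> t) (tcol \<nu> t) * x | x :: fperm \<Rightarrow>\<^sub>0 'f. x \<in> GA {1..n}}"
proof -
  note Y = young_symmetrizer_gconv[OF assms, where 'f = 'f]
  have n: "psize \<nu> = n" using nuP by (simp add: pn_def)
  have sp: "specht \<nu> t = {young_symmetrizer \<nu> t \<otimes>\<^bsub>SG n\<^esub> x | x. x \<in> carrier (SG n :: ('f, _) module)}"
    unfolding specht_def n ..
  show "specht \<nu> t \<subseteq> carrier (SG n :: ('f, _) module)"
    unfolding sp using SG_closed[OF Y(2)] by blast
  show "gconv ` specht \<nu> t = {tableau.u {1..n} (trow \<nu> t) (tcol \<nu> t) * x | x :: fperm \<Rightarrow>\<^sub>0 'f. x \<in> GA {1..n}}"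
  proof (intro equalityI subsetI)
    fix z :: "fperm \<Rightarrow>\<^sub>0 'f" assume "z \<in> gconv ` specht \<nu> t"
    then show "z \<in> {tableau.u {1..n} (trow \<nu> t) (tcol \<nu> t) * x | x :: fperm \<Rightarrow>\<^sub>0 'f. x \<in> GA {1..n}}"
      unfolding sp using gconv_mult[OF Y(2)] gconv_GA Y(1) by fastforce
  next
    fix z :: "fperm \<Rightarrow>\<^sub>0 'f" assume "z \<in> {tableau.u {1..n} (trow \<nu> t) (tcol \<nu> t) * x | x :: fperm \<Rightarrow>\<^sub>0 'f. x \<in> GA {1..n}}"
    then obtain x :: "fperm \<Rightarrow>\<^sub>0 'f" where x: "x \<in> GA {1..n}" "z = tableau.u {1..n} (trow \<nu> t) (tcol \<nu> t) * x" by blast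
    have "z = gconv (young_symmetrizer \<nu> t \<otimes>\<^bsub>SG n\<^esub> ginv x)"
      unfolding gconv_mult[OF Y(2) ginv_carrier[OF x(1)]] Y(1) gconv_ginv[OF x(1)] x(2) ..
    then show "z \<in> gconv ` specht \<nu> t" unfolding sp using ginv_carrier[OF x(1)] by blast
  qed
qed

lemma subspace_plin_image:
  assumes F: "plin F" and S: "pm.subspace S"
  shows "pm.subspace (F ` S)"
proof (rule pm.subspaceI)
  show "0 \<in> F ` S" using pm.subspace_0[OF S] plin_0[OF F] by (metis imageI)
  fix x y c assume "x \<in> F ` S"
  then obtain a where a: "a \<in> S" "x = F a" by blast
  show "psc c x \<in> F ` S" using pm.subspace_scale[OF S a(1), of c] plin_psc[OF F, of c a] a(2) by (metis imageI)
  assume "y \<in> F ` S"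
  then obtain b where b: "b \<in> S" "y = F b" by blast
  show "x + y \<in> F ` S" using pm.subspace_add[OF S a(1) b(1)] plin_add[OF F, of a b] a(2) b(2) by (metis imageI)
qed

section \<open>The idempotents of a filter\<close>

definition eOm :: "(nat \<Rightarrow> nat) set \<Rightarrow> nat \<Rightarrow> (fperm \<Rightarrow>\<^sub>0 'f::field_char_0)" where
  "eOm \<Omega> n = (\<Sum>\<nu>\<in>\<Omega> \<inter> pn n. eidem \<nu>)"

lemma eOm_GA: "eOm \<Omega> n \<in> GA {1..n}"
  unfolding eOm_def by (rule GA_sum) (rule eidem_props(1), blast)

lemma eOm_compl: "(\<Sum>\<nu>\<in>pn n - \<Omega>. eidem \<nu>) = (1 - eOm \<Omega> n :: fperm \<Rightarrow>\<^sub>0 'f::field_char_0)"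
proof -
  have "(\<Sum>\<nu>\<in>pn n \<inter> \<Omega>. eidem \<nu>) + (\<Sum>\<nu>\<in>pn n - \<Omega>. eidem \<nu>) = (1 :: fperm \<Rightarrow>\<^sub>0 'f)"
    unfolding sum.Int_Diff[OF finite_pn, symmetric] by (rule eidem_complete)
  then have "eOm \<Omega> n + (\<Sum>\<nu>\<in>pn n - \<Omega>. eidem \<nu>) = (1 :: fperm \<Rightarrow>\<^sub>0 'f)"
    by (simp only: eOm_def Int_commute)
  then show ?thesis by (simp only: eq_diff_eq add.commute)
qed

text \<open>This is where upward closure enters: a member of size \<open>n\<close> is not contained
  in a non-member of size \<open>m\<close>, so their idempotents annihilate each other, and by
  completeness the non-members of size \<open>m\<close> add up to
  \<open>1 - eOm \<Omega> m\<close>.\<close>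

lemma eOm_mult:
  assumes fil: "is_filter_of_partitions \<Omega>" and "n \<le> m"
  shows "eOm \<Omega> n * eOm \<Omega> m = (eOm \<Omega> n :: fperm \<Rightarrow>\<^sub>0 'f::field_char_0)"
proof -
  have "eidem \<nu> * eidem \<mu> = (0 :: fperm \<Rightarrow>\<^sub>0 'f)" if "\<nu> \<in> \<Omega> \<inter> pn n" "\<mu> \<in> pn m - \<Omega>" for \<nu> \<mu>
  proof (rule eidem_mult_zero[OF _ _ \<open>n \<le> m\<close>])
    show "\<not> \<nu> \<le> \<mu>" using fil that unfolding is_filter_of_partitions_def pn_def by blast
  qed (use that in auto)
  then have "eOm \<Omega> n * (\<Sum>\<mu>\<in>pn m - \<Omega>. eidem \<mu>) = (0 :: fperm \<Rightarrow>\<^sub>0 'f)"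
    unfolding eOm_def[of \<Omega> n] sum_product by (intro sum.neutral ballI) auto
  then show ?thesis by (simp add: eOm_compl right_diff_distrib)
qed

context fin_graded
begin

text \<open>The isotypic component in coordinates: the basis-word tensors fixed by the central
  idempotent.\<close>

definition Wn :: "(nat \<Rightarrow> nat) \<Rightarrow> ('v list \<Rightarrow>\<^sub>0 'f) set" where
  "Wn \<nu> = {y \<in> TL (psize \<nu>) B. act V1 y (eidem \<nu>) = y}"

text \<open>Right multiplication by the central idempotent fixes the Specht module. Written as a
  combination of permutations, it is carried by the equivariant map \<phi> to the action of
  \<open>eidem \<nu>\<close> on the image.\<close>

lemma specht_submodule_Wn:
  assumes M: "specht_submodule scale V0 V1 \<nu> M" and nuP: "\<nu> \<in> pn n"
  shows "M \<subseteq> pi ` Wn \<nu>"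
proof
  have n: "psize \<nu> = n" using nuP by (simp add: pn_def)
  note M' = M[unfolded specht_submodule_def n]
  define H' where "H' t \<phi> \<longleftrightarrow> is_tableau \<nu> t \<and> bij_betw \<phi> (specht \<nu> t) M \<and>
      (\<forall>x\<in>specht \<nu> t. \<forall>y\<in>specht \<nu> t. \<phi> (x + y) = \<phi> x \<oplus>\<^bsub>T\<^esub> \<phi> y) \<and>
      (\<forall>c. \<forall>x\<in>specht \<nu> t. \<phi> (c \<odot>\<^bsub>SG n\<^esub> x) = c \<odot>\<^bsub>T\<^esub> \<phi> x) \<and>
      (\<forall>s\<in>carrier (sym_group n). \<forall>x\<in>specht \<nu> t.
        \<phi> (x \<otimes>\<^bsub>SG n\<^esub> sng s 1) = sign_action scale V0 V1 n s (\<phi> x))" for t \<phi>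
  have "\<exists>t \<phi>. H' t \<phi>" unfolding H'_def by (rule conjunct2[OF M'])
  then obtain t \<phi> where "H' t \<phi>" by blast
  note H = this[unfolded H'_def]
  note MT = conjunct1[OF M'] and t = conjunct1[OF H] and bij = conjunct1[OF conjunct2[OF H]]
    and add' = conjunct1[OF conjunct2[OF conjunct2[OF H]]]
    and sc' = conjunct1[OF conjunct2[OF conjunct2[OF conjunct2[OF H]]]]
    and eqv' = conjunct2[OF conjunct2[OF conjunct2[OF conjunct2[OF H]]]]
  have add: "\<phi> (x + y) = \<phi> x \<oplus>\<^bsub>T\<^esub> \<phi> y" if "x \<in> specht \<nu> t" "y \<in> specht \<nu> t" for x y
    using add' that by blast
  have sc: "\<phi> (psc c x) = c \<odot>\<^bsub>T\<^esub> \<phi> x" if "x \<in> specht \<nu> t" for c x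
    using sc' that by simp
  have eqv: "\<phi> (x \<otimes>\<^bsub>SG n\<^esub> sng s 1) = sign_action scale V0 V1 n s (\<phi> x)"
    if "s permutes {1..n}" "x \<in> specht \<nu> t" for s x
    by (rule bspec[OF bspec[OF eqv']]) (use that in \<open>simp_all only: sym_group_sel\<close>)
  interpret tableau "{1..n}" "trow \<nu> t" "tcol \<nu> t" \<nu> "TYPE('f)"
    by unfold_locales (rule tableau_coordinates[OF t nuP])
  note spc = specht_gconv(1)[OF t nuP, where 'f = 'f] and spg = specht_gconv(2)[OF t nuP, where 'f = 'f]
  have spI: "p \<in> specht \<nu> t" if "p \<in> carrier (SG n)" "gconv p = u * x" "x \<in> GA {1..n}" for p x
  proof -
    have "gconv p \<in> gconv ` specht \<nu> t" unfolding spg using that by blast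
    then obtain q where q: "q \<in> specht \<nu> t" "gconv p = gconv q" by blast
    then have "ginv (gconv p) = ginv (gconv q)" by simp
    moreover have "q \<in> carrier (SG n)" using q(1) spc by blast
    ultimately have "p = q" using ginv_gconv[OF that(1)] ginv_gconv[of q n] by simp
    then show ?thesis using q(1) by simp
  qed
  fix m assume "m \<in> M"
  then obtain x where x: "x \<in> specht \<nu> t" "m = \<phi> x" using bij by (auto simp: bij_betw_def)
  have xc: "x \<in> carrier (SG n)" using x(1) spc by blast
  obtain w where w: "w \<in> GA {1..n}" "gconv x = u * w" using x(1) spg by blast
  obtain y where y: "m = pi y" "y \<in> TL n B" using \<open>m \<in> M\<close> MT tensor_power_eq(2) by blast
  have ei: "eidem \<nu> = (eid :: fperm \<Rightarrow>\<^sub>0 'f)" by (rule eidem_eq[OF tab nuP])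
  define e where "e = (ginv eid :: (nat \<Rightarrow> nat) \<Rightarrow>\<^sub>0 'f)"
  have ec: "e \<in> carrier (SG n)" unfolding e_def by (rule ginv_carrier[OF eid_GA])
  have xe: "x \<otimes>\<^bsub>SG n\<^esub> e = x"
  proof -
    have "gconv e = eid" unfolding e_def by (rule gconv_ginv[OF eid_GA])
    then have "gconv (x \<otimes>\<^bsub>SG n\<^esub> e) = u * w * eid" unfolding gconv_mult[OF xc ec] w(2) by simp
    also have "\<dots> = gconv x" unfolding w(2) mult.assoc eid_central[OF w(1)]
      by (simp only: mult.assoc[symmetric] u_eid)
    finally show ?thesis using ginv_gconv[OF xc] ginv_gconv[OF SG_closed[OF xc ec]] by metis
  qed
  have xs: "x \<otimes>\<^bsub>SG n\<^esub> sng s 1 \<in> specht \<nu> t" if "s permutes {1..n}" for s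
  proof (rule spI[of _ "w * dl (Ap s)"])
    have s: "sng s 1 \<in> carrier (SG n :: ('f, _) module)" using that by (simp add: sym_group_sel)
    show "x \<otimes>\<^bsub>SG n\<^esub> sng s 1 \<in> carrier (SG n)" by (rule SG_closed[OF xc s])
    show "gconv (x \<otimes>\<^bsub>SG n\<^esub> sng s 1) = u * (w * dl (Ap s))"
      unfolding gconv_mult[OF xc s] w(2) by (simp add: mult.assoc)
    show "w * dl (Ap s) \<in> GA {1..n}" using w(1) Ap_Sym[OF that] by (intro GA_mult GA_dl) auto
  qed
  have sub: "pm.subspace (specht \<nu> t :: (_ \<Rightarrow>\<^sub>0 'f) set)"
  proof -
    have "specht \<nu> t = ginv ` {u * x | x :: fperm \<Rightarrow>\<^sub>0 'f. x \<in> GA {1..n}}"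
      unfolding spg[symmetric] image_image using ginv_gconv spc by force
    moreover have "pm.subspace {u * x | x :: fperm \<Rightarrow>\<^sub>0 'f. x \<in> GA {1..n}}"
    proof (rule pm.subspaceI)
      show "0 \<in> {u * x | x :: fperm \<Rightarrow>\<^sub>0 'f. x \<in> GA {1..n}}" using GA_0 by (intro CollectI exI[of _ 0]) simp
      fix a b :: "fperm \<Rightarrow>\<^sub>0 'f" and c
      assume "a \<in> {u * x | x. x \<in> GA {1..n}}"
      then obtain x where x: "a = u * x" "x \<in> GA {1..n}" by blast
      show "psc c a \<in> {u * x | x. x \<in> GA {1..n}}"
        using GA_psc[OF x(2), of c] x(1) by (intro CollectI exI[of _ "psc c x"]) simp
      assume "b \<in> {u * x | x. x \<in> GA {1..n}}"
      then obtain y where y: "b = u * y" "y \<in> GA {1..n}" by blast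
      show "a + b \<in> {u * x | x. x \<in> GA {1..n}}"
        using GA_add[OF x(2) y(2)] x(1) y(1) by (intro CollectI exI[of _ "x + y"]) (simp add: distrib_left)
    qed
    ultimately show ?thesis
      using subspace_plin_image[OF plin_ginv] by simp
  qed
  have phi0: "\<phi> 0 = pi 0"
  proof -
    have "\<phi> 0 \<in> M" using bij pm.subspace_0[OF sub] by (auto simp: bij_betw_def)
    then obtain q where q: "\<phi> 0 = pi q" using MT tensor_power_eq(2) by blast
    have "\<phi> (psc 0 0) = 0 \<odot>\<^bsub>T\<^esub> \<phi> 0" by (rule sc[OF pm.subspace_0[OF sub]])
    then show ?thesis using T_D(7)[of q 0] by (simp add: q)
  qed
  have phsum: "\<phi> (\<Sum>s\<in>S. psc (g s) (x \<otimes>\<^bsub>SG n\<^esub> sng s 1)) = pi (\<Sum>s\<in>S. psc (g s) (act V1 y (dl (Ap s))))"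
    if "finite S" "S \<subseteq> {s. s permutes {1..n}}" for S g
    using that
  proof (induction S)
    case empty then show ?case using phi0 by simp
  next
    case (insert s S)
    have s: "s permutes {1..n}" using insert.prems by blast
    have 1: "psc (g s) (x \<otimes>\<^bsub>SG n\<^esub> sng s 1) \<in> specht \<nu> t" using xs[OF s] by (rule pm.subspace_scale[OF sub])
    have 2: "(\<Sum>s\<in>S. psc (g s) (x \<otimes>\<^bsub>SG n\<^esub> sng s 1)) \<in> specht \<nu> t"
      using insert.prems xs by (intro pm.subspace_sum[OF sub] pm.subspace_scale[OF sub]) auto
    have "\<phi> (x \<otimes>\<^bsub>SG n\<^esub> sng s 1) = pi (act V1 y (dl (Ap s)))"
      using eqv[OF s x(1)] sign_action_eq[of "Ap s" n y] y Ap_Sym[OF s] s by (simp add: x(2)[symmetric])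
    then show ?case
      using insert add[OF 1 2] sc[OF xs[OF s], of "g s"] T_D(6,7) by simp
  qed
  have exp: "e = (\<Sum>s\<in>ks e. psc (lk e s) (sng s 1))" by (rule poly_mapping_expand) auto
  have kse: "ks e \<subseteq> {s. s permutes {1..n}}" using ec by (simp add: sym_group_sel subset_iff)
  have "x = x \<otimes>\<^bsub>SG n\<^esub> (\<Sum>s\<in>ks e. psc (lk e s) (sng s 1))" using xe exp by simp
  also have "\<dots> = (\<Sum>s\<in>ks e. psc (lk e s) (x \<otimes>\<^bsub>SG n\<^esub> sng s 1))"
    unfolding plin_sum[OF plin_mult_right] plin_psc[OF plin_mult_right] ..
  finally have "m = pi (\<Sum>s\<in>ks e. psc (lk e s) (act V1 y (dl (Ap s))))"
    using phsum[OF _ kse, of "lk e"] x(2) by simp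
  also have "(\<Sum>s\<in>ks e. psc (lk e s) (act V1 y (dl (Ap s)))) = act V1 y (gconv e)"
    by (subst (3) exp) (simp only: plin_sum[OF plin_gconv] plin_psc[OF plin_gconv] plin_sum[OF plin_act_right]
        plin_psc[OF plin_act_right] gconv_sng pm.scale_one)
  also have "gconv e = eidem \<nu>" unfolding ei e_def by (rule gconv_ginv[OF eid_GA])
  finally have "pi y = pi (act V1 y (eidem \<nu>))" using y(1) by simp
  moreover have "act V1 y (eidem \<nu>) \<in> TL n B" by (rule act_TL[OF y(2) eidem_props(1)[OF nuP]])
  ultimately have "act V1 y (eidem \<nu>) = y"
    using ps_id[OF TL_TB] y(2) by (metis pi_eq_iff)
  then show "m \<in> pi ` Wn \<nu>" using y by (auto simp: Wn_def n)
qed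

text \<open>Expanding the idempotent writes \<open>y\<close> as a sum of terms y' u x. If y' u is
  nonzero, then by \<open>right_regenerate\<close> the map x \<mapsto> y' x is injective on the
  right ideal of \<open>u\<close>, so y' u x lies in a copy of the Specht module.\<close>

lemma Wn_isotypic:
  assumes y: "y \<in> Wn \<nu>" and nuP: "\<nu> \<in> pn n"
  shows "pi y \<in> isotypic scale V0 V1 \<nu>"
proof -
  have n: "psize \<nu> = n" using nuP by (simp add: pn_def)
  have yT: "y \<in> TL n B" and ye: "act V1 y (eidem \<nu>) = y" using y by (auto simp: Wn_def n)
  have cn: "finite (cells \<nu>)" "card (cells \<nu>) = n" using finite_cells[of \<nu>] nuP by (auto simp: pn_def)
  then have "\<exists>t. bij_betw t (cells \<nu>) {1..n}" by (intro finite_same_card_bij) auto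
  then obtain t where t: "is_tableau \<nu> t" by (auto simp: is_tableau_def n)
  interpret tableau "{1..n}" "trow \<nu> t" "tcol \<nu> t" \<nu> "TYPE('f)"
    by unfold_locales (rule tableau_coordinates[OF t nuP])
  note spc = specht_gconv(1)[OF t nuP, where 'f = 'f] and spg = specht_gconv(2)[OF t nuP, where 'f = 'f]
  have ei: "eidem \<nu> = (eid :: fperm \<Rightarrow>\<^sub>0 'f)" by (rule eidem_eq[OF tab nuP])
  let ?Ms = "\<Union>{M. specht_submodule scale V0 V1 \<nu> M}"
  have MsT: "?Ms \<subseteq> pi ` TL n B" using tensor_power_eq(2) by (auto simp: specht_submodule_def n)
  have key: "pi (act V1 y' (u * x)) \<in> pi ` pm.span {z \<in> TL n B. pi z \<in> ?Ms}"
    if y': "y' \<in> TL n B" and x: "x \<in> GA {1..n}" for y' x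
  proof (cases "act V1 y' u = 0")
    case True
    have "act V1 y' (u * x) = act V1 (act V1 y' u) x"
      by (rule act_mult[symmetric]) (use y' TL_mono[of B UNIV] u_GA x in auto)
    then show ?thesis using True by (simp add: plin_0[OF plin_act_left] pm.span_zero)
  next
    case False
    define \<phi> where "\<phi> = (\<lambda>p. pi (act V1 y' (gconv p)))"
    define M where "M = \<phi> ` specht \<nu> t"
    have y'U: "y' \<in> TL n UNIV" using y' TL_mono[of B UNIV] by auto
    have aT: "act V1 y' g \<in> TL n B" if "g \<in> GA {1..n}" for g using act_TL[OF y' that] .
    have inj: "inj_on \<phi> (specht \<nu> t)"
    proof (rule inj_onI)
      fix p q assume pq: "p \<in> specht \<nu> t" "q \<in> specht \<nu> t" "\<phi> p = \<phi> q"
      obtain a b where ab: "gconv p = u * a" "a \<in> GA {1..n}" "gconv q = u * b" "b \<in> GA {1..n}"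
        using pq(1,2) spg by blast
      have d: "a - b \<in> GA {1..n}" using ab by (intro GA_diff)
      have "ps (act V1 y' (gconv p)) = ps (act V1 y' (gconv q))" using pq(3) by (simp add: \<phi>_def pi_eq_iff)
      then have "act V1 y' (gconv p) = act V1 y' (gconv q)"
        using ps_id[OF TL_TB[OF aT]] ab u_GA by (metis GA_mult)
      then have 0: "act V1 y' (u * (a - b)) = 0"
        by (simp add: ab plin_diff[OF plin_act_right] right_diff_distrib)
      have "u * (a - b) = 0"
      proof (rule ccontr)
        assume "u * (a - b) \<noteq> 0"
        then obtain g where g: "g \<in> GA {1..n}" "u * (a - b) * g = u" using right_regenerate[OF d] by blast
        have "act V1 y' u = act V1 (act V1 y' (u * (a - b))) g"
          by (subst g(2)[symmetric], rule act_mult[symmetric]) (use y'U u_GA d g in \<open>auto intro: GA_mult\<close>)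
        then show False using 0 False by (simp add: plin_0[OF plin_act_left])
      qed
      then have "gconv p = gconv q" by (simp add: ab right_diff_distrib)
      then show "p = q" using ginv_gconv spc pq(1,2) by (metis subset_iff)
    qed
    have "specht_submodule scale V0 V1 \<nu> M"
      unfolding specht_submodule_def n
    proof (intro conjI exI[of _ t] exI[of _ \<phi>] ballI allI)
      show "M \<subseteq> tensor_power scale n"
        unfolding M_def \<phi>_def tensor_power_eq(2) using aT gconv_GA spc by blast
      show "is_tableau \<nu> t" by fact
      show "bij_betw \<phi> (specht \<nu> t) M" using inj by (simp add: M_def bij_betw_def)
      show "\<phi> (p + q) = \<phi> p \<oplus>\<^bsub>T\<^esub> \<phi> q" for p q
        using T_D(6) by (simp add: \<phi>_def plin_add[OF plin_gconv] plin_add[OF plin_act_right])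
      show "\<phi> (c \<odot>\<^bsub>SG n\<^esub> p) = c \<odot>\<^bsub>T\<^esub> \<phi> p" for c p
        using T_D(7) by (simp add: \<phi>_def plin_psc[OF plin_gconv] plin_psc[OF plin_act_right])
      fix s and p :: "(nat \<Rightarrow> nat) \<Rightarrow>\<^sub>0 'f" assume s: "s \<in> carrier (sym_group n)" and p: "p \<in> specht \<nu> t"
      have sp: "s permutes {1..n}" "sng s (1::'f) \<in> carrier (SG n)" using s by (simp_all add: sym_group_sel)
      have pc: "p \<in> carrier (SG n)" using p spc by blast
      have "\<phi> (p \<otimes>\<^bsub>SG n\<^esub> sng s 1) = pi (act V1 y' (gconv p * dl (Ap s)))"
        by (simp add: \<phi>_def gconv_mult[OF pc sp(2)])
      also have "\<dots> = pi (act V1 (act V1 y' (gconv p)) (dl (Ap s)))"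
        using act_mult[OF y'U gconv_GA[OF pc] GA_dl] Ap_Sym[OF sp(1)] by simp
      also have "\<dots> = sign_action scale V0 V1 n s (\<phi> p)"
        using sign_action_eq[of "Ap s" n "act V1 y' (gconv p)"] aT[OF gconv_GA[OF pc]] Ap_Sym[OF sp(1)] sp(1)
        by (simp add: \<phi>_def)
      finally show "\<phi> (p \<otimes>\<^bsub>SG n\<^esub> sng s 1) = sign_action scale V0 V1 n s (\<phi> p)" .
    qed
    then have MM: "M \<subseteq> ?Ms" by blast
    have "u * x \<in> gconv ` specht \<nu> t" unfolding spg using x by blast
    then have "pi (act V1 y' (u * x)) \<in> M" unfolding M_def \<phi>_def by auto
    then have "act V1 y' (u * x) \<in> {z \<in> TL n B. pi z \<in> ?Ms}" using MM aT[OF GA_mult[OF u_GA x]] by blast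
    then show ?thesis by (intro imageI pm.span_base)
  qed
  have iso: "isotypic scale V0 V1 \<nu> = pi ` pm.span {z \<in> TL n B. pi z \<in> ?Ms}"
  proof -
    define Q where "Q = {z \<in> TL n B. pi z \<in> ?Ms}"
    have eqn: "?Ms = pi ` Q" unfolding Q_def using MsT by blast
    show ?thesis unfolding isotypic_def Q_def[symmetric] unfolding eqn by (rule vmodel_lin_span[OF T_vmodel]) simp
  qed
  let ?g = "\<lambda>a. psc (inverse kap) (star u * dl (- a))"
  have gGA: "?g a \<in> GA {1..n}" if "a \<in> Sym {1..n}" for a
    using that u_GA by (intro GA_psc GA_mult GA_star GA_dl Sym_uminus)
  have yU: "y \<in> TL n UNIV" using yT TL_mono[of B UNIV] by auto
  have "pi (act V1 y (dl a * u * ?g a)) \<in> pi ` pm.span {z \<in> TL n B. pi z \<in> ?Ms}" if a: "a \<in> Sym {1..n}" for a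
  proof -
    have "act V1 y (dl a * u * ?g a) = act V1 (act V1 y (dl a)) (u * ?g a)"
      unfolding mult.assoc by (rule act_mult[symmetric, OF yU GA_dl[OF a] GA_mult[OF u_GA gGA[OF a]]])
    then show ?thesis using key[OF act_TL[OF yT GA_dl[OF a]] gGA[OF a]] by (simp only:)
  qed
  then have "\<forall>a\<in>Sym {1..n}. \<exists>w. w \<in> pm.span {z \<in> TL n B. pi z \<in> ?Ms} \<and> pi (act V1 y (dl a * u * ?g a)) = pi w"
    unfolding image_iff by (meson bexE)
  from bchoice[OF this] obtain w where w: "\<And>a. a \<in> Sym {1..n} \<Longrightarrow> w a \<in> pm.span {z \<in> TL n B. pi z \<in> ?Ms}"
    "\<And>a. a \<in> Sym {1..n} \<Longrightarrow> pi (act V1 y (dl a * u * ?g a)) = pi (w a)" by auto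
  have "act V1 y (eidem \<nu>) = (\<Sum>a\<in>Sym {1..n}. act V1 y (dl a * u * ?g a))"
    by (simp only: ei eid_expand plin_sum[OF plin_act_right])
  from arg_cong[OF this, of ps] have "ps y = (\<Sum>a\<in>Sym {1..n}. ps (act V1 y (dl a * u * ?g a)))"
    unfolding ye plin_sum[OF plin_ps] .
  also have "\<dots> = (\<Sum>a\<in>Sym {1..n}. ps (w a))"
    by (rule sum.cong[OF refl]) (use w(2) in \<open>simp only: pi_eq_iff\<close>)
  finally have "pi y = pi (\<Sum>a\<in>Sym {1..n}. w a)" by (simp only: pi_eq_iff plin_sum[OF plin_ps])
  moreover have "(\<Sum>a\<in>Sym {1..n}. w a) \<in> pm.span {z \<in> TL n B. pi z \<in> ?Ms}" using w(1) by (rule pm.span_sum)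
  ultimately show ?thesis unfolding iso by blast
qed

end

lemma eOm_central: "x \<in> GA {1..n} \<Longrightarrow> x * eOm \<Omega> n = eOm \<Omega> n * x"
  unfolding eOm_def sum_distrib_left sum_distrib_right by (rule sum.cong[OF refl]) (rule eidem_props(4), auto)

lemma lin_span_mono: "S \<subseteq> S' \<Longrightarrow> lin_span M S \<subseteq> lin_span M S'"
  unfolding lin_span_def by blast

lemma partition_pn: "\<nu> \<in> partitions \<Longrightarrow> \<nu> \<in> pn (psize \<nu>)" by (simp add: pn_def)

section \<open>The ideal of a filter as a kernel\<close>

locale fin_filter = fin_graded scale V0 V1 B0 B1
  for scale :: "'f::field_char_0 \<Rightarrow> 'v::ab_group_add \<Rightarrow> 'v" and V0 V1 B0 B1 +
  fixes \<Omega> :: "(nat \<Rightarrow> nat) set"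
  assumes fil: "is_filter_of_partitions \<Omega>"
begin

lemma Om_pn: "\<nu> \<in> \<Omega> \<Longrightarrow> \<nu> \<in> pn (psize \<nu>)"
  using fil partition_pn unfolding is_filter_of_partitions_def by blast

text \<open>The projection onto the ideal in all degrees at once.\<close>

definition Ep :: "('v list \<Rightarrow>\<^sub>0 'f) \<Rightarrow> ('v list \<Rightarrow>\<^sub>0 'f)" where
  "Ep = lext (\<lambda>z. act V1 (sng z 1) (eOm \<Omega> (length z)))"

lemma plin_Ep: "plin Ep" by (simp add: Ep_def plin_lext)

lemma Ep_TL: "y \<in> TL n UNIV \<Longrightarrow> Ep y = act V1 y (eOm \<Omega> n)"
  by (rule plin_eqI[where p = y and S = "Wd n UNIV", OF plin_Ep plin_act_left])
    (auto simp: Ep_def TL_def Wd_def)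

text \<open>The idempotent of the left factor acts on the first places of the product, where
  \<open>eOm_mult\<close> lets the idempotent of the larger degree disappear into it.\<close>

lemma Ep_fmul_left: "Ep (fmul (Ep x) y) = fmul (Ep x) y"
proof -
  have 1: "Ep (fmul (Ep (sng z 1)) (sng w 1)) = fmul (Ep (sng z 1)) (sng w 1)" for z w
  proof -
    let ?n = "length z" and ?m = "length w"
    let ?z = "sng z (1::'f)" and ?w = "sng w (1::'f)"
    have z: "?z \<in> TL ?n UNIV" and w: "?w \<in> TL ?m UNIV" by (simp_all add: TL_def Wd_def)
    have e: "Ep ?z = act V1 ?z (eOm \<Omega> ?n)" by (rule Ep_TL[OF z])
    have zw: "fmul ?z ?w \<in> TL (?n + ?m) UNIV" by (rule fmul_TL[OF z w])
    have ezw: "fmul (Ep ?z) ?w \<in> TL (?n + ?m) UNIV" unfolding e by (rule fmul_TL[OF act_TL[OF z eOm_GA] w])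
    have g: "eOm \<Omega> ?n \<in> GA {1..?n + ?m}" by (rule GA_mono[OF _ eOm_GA]) auto
    have s: "act V1 (fmul ?z ?w) (eOm \<Omega> ?n) = fmul (Ep ?z) ?w" unfolding e by (rule act_fmul_left[OF z eOm_GA])
    have "Ep (fmul (Ep ?z) ?w) = act V1 (act V1 (fmul ?z ?w) (eOm \<Omega> ?n)) (eOm \<Omega> (?n + ?m))"
      unfolding s by (rule Ep_TL[OF ezw])
    also have "\<dots> = fmul (Ep ?z) ?w"
      unfolding act_mult[OF zw g eOm_GA] eOm_mult[OF fil le_add1] by (rule s)
    finally show ?thesis .
  qed
  have 2: "Ep (fmul (Ep (sng z 1)) y) = fmul (Ep (sng z 1)) y" for z
    by (rule plin_eqI[where p = y and S = UNIV and F = "\<lambda>y. Ep (fmul (Ep (sng z 1)) y)" and G = "\<lambda>y. fmul (Ep (sng z 1)) y",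
          OF plin_comp[OF plin_Ep plin_fmul(2)] plin_fmul(2)]) (use 1 in auto)
  show ?thesis
    by (rule plin_eqI[where p = x and S = UNIV and F = "\<lambda>x. Ep (fmul (Ep x) y)" and G = "\<lambda>x. fmul (Ep x) y",
          OF plin_comp[OF plin_Ep plin_comp[OF plin_fmul(1) plin_Ep]] plin_comp[OF plin_fmul(1) plin_Ep]]) (use 2 in auto)
qed

text \<open>As for the left factor after conjugation by the block rotation, with which the central
  idempotent of the larger degree commutes.\<close>

lemma Ep_fmul_right: "Ep (fmul y (Ep x)) = fmul y (Ep x)"
proof -
  have 1: "Ep (fmul (sng w 1) (Ep (sng z 1))) = fmul (sng w 1) (Ep (sng z 1))" for z w
  proof -
    let ?n = "length z" and ?m = "length w"
    let ?z = "sng z (1::'f)" and ?w = "sng w (1::'f)"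
    have z: "?z \<in> TL ?n UNIV" and w: "?w \<in> TL ?m UNIV" by (simp_all add: TL_def Wd_def)
    have e: "Ep ?z = act V1 ?z (eOm \<Omega> ?n)" by (rule Ep_TL[OF z])
    obtain t where t: "t \<in> Sym {1..?m + ?n}"
      "act V1 (fmul ?w ?z) (dl t * eOm \<Omega> ?n * dl (- t)) = fmul ?w (act V1 ?z (eOm \<Omega> ?n))"
      using act_fmul_right[OF eOm_GA[of \<Omega> ?n], of ?m V1] z w by blast
    have wz: "fmul ?w ?z \<in> TL (?m + ?n) UNIV" by (rule fmul_TL[OF w z])
    have ewz: "fmul ?w (Ep ?z) \<in> TL (?m + ?n) UNIV" unfolding e by (rule fmul_TL[OF w act_TL[OF z eOm_GA]])
    have g: "(eOm \<Omega> ?n :: fperm \<Rightarrow>\<^sub>0 'f) \<in> GA {1..?m + ?n}" by (rule GA_mono[OF _ eOm_GA]) auto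
    have tG: "dl t \<in> (GA {1..?m + ?n} :: (fperm \<Rightarrow>\<^sub>0 'f) set)" "dl (- t) \<in> (GA {1..?m + ?n} :: (fperm \<Rightarrow>\<^sub>0 'f) set)"
      using t(1) Sym_uminus by (auto intro: GA_dl)
    have c: "dl t * eOm \<Omega> ?n * dl (- t) * eOm \<Omega> (?m + ?n) = (dl t * eOm \<Omega> ?n * dl (- t) :: fperm \<Rightarrow>\<^sub>0 'f)"
      unfolding mult.assoc eOm_central[OF tG(2)]
      by (simp only: mult.assoc[symmetric]) (simp only: mult.assoc eOm_mult[OF fil le_add2])
    have s: "act V1 (fmul ?w ?z) (dl t * eOm \<Omega> ?n * dl (- t)) = fmul ?w (Ep ?z)" unfolding e by (rule t(2))
    have "Ep (fmul ?w (Ep ?z)) = act V1 (act V1 (fmul ?w ?z) (dl t * eOm \<Omega> ?n * dl (- t))) (eOm \<Omega> (?m + ?n))"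
      unfolding s by (rule Ep_TL[OF ewz])
    also have "\<dots> = fmul ?w (Ep ?z)"
      unfolding act_mult[OF wz GA_mult[OF GA_mult[OF tG(1) g] tG(2)] eOm_GA] c by (rule s)
    finally show ?thesis .
  qed
  have 2: "Ep (fmul (sng w 1) (Ep x)) = fmul (sng w 1) (Ep x)" for w
    by (rule plin_eqI[where p = x and S = UNIV and F = "\<lambda>x. Ep (fmul (sng w 1) (Ep x))" and G = "\<lambda>x. fmul (sng w 1) (Ep x)",
          OF plin_comp[OF plin_Ep plin_comp[OF plin_fmul(2) plin_Ep]] plin_comp[OF plin_fmul(2) plin_Ep]]) (use 1 in auto)
  show ?thesis
    by (rule plin_eqI[where p = y and S = UNIV and F = "\<lambda>y. Ep (fmul y (Ep x))" and G = "\<lambda>y. fmul y (Ep x)",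
          OF plin_comp[OF plin_Ep plin_fmul(1)] plin_fmul(1)]) (use 2 in auto)
qed

text \<open>The complementary projection, applied to the normal form. Its kernel consists of the
  representatives of elements of the ideal, so identities and dimensions of the quotient are read
  off from it.\<close>

definition kappa :: "('v list \<Rightarrow>\<^sub>0 'f) \<Rightarrow> ('v list \<Rightarrow>\<^sub>0 'f)" where "kappa p = ps p - Ep (ps p)"

lemma plin_kappa: "plin kappa"
  by (rule plinI) (simp_all add: kappa_def plin_add[OF plin_ps] plin_add[OF plin_Ep] plin_psc[OF plin_ps]
      plin_psc[OF plin_Ep] pm.scale_right_diff_distrib)

lemma kappa_fmul:
  assumes "kappa x = 0" shows "kappa (fmul x y) = 0" "kappa (fmul y x) = 0"
  using assms Ep_fmul_left[of "ps x" "ps y"] Ep_fmul_right[of "ps y" "ps x"] by (simp_all add: kappa_def ps_fmul)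

lemma kappa_TL: "y \<in> TL n B \<Longrightarrow> kappa y = (\<Sum>\<nu>\<in>pn n - \<Omega>. act V1 y (eidem \<nu>))"
proof -
  assume y: "y \<in> TL n B"
  have "kappa y = act V1 y 1 - act V1 y (eOm \<Omega> n)"
    using y Ep_TL[OF TL_mono[OF subset_UNIV y]] by (simp add: kappa_def ps_id[OF TL_TB[OF y]] act_one[OF y])
  also have "\<dots> = act V1 y (\<Sum>\<nu>\<in>pn n - \<Omega>. eidem \<nu>)"
    by (simp only: eOm_compl plin_diff[OF plin_act_right])
  finally show ?thesis by (simp only: plin_sum[OF plin_act_right])
qed

abbreviation Jd :: "('v list \<Rightarrow>\<^sub>0 'f) set" where "Jd \<equiv> {p. kappa p = 0}"

lemma Jd_subspace: "pm.subspace Jd"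
  by (rule pm.subspaceI) (auto simp: plin_0[OF plin_kappa] plin_add[OF plin_kappa] plin_psc[OF plin_kappa])

lemma isotypic_eq:
  assumes "\<nu> \<in> \<Omega>" shows "isotypic scale V0 V1 \<nu> = pi ` Wn \<nu>"
proof
  note nu = Om_pn[OF assms]
  have "pm.subspace (Wn \<nu>)"
    using TL_subspace[of "psize \<nu>" B] unfolding Wn_def
    by (auto simp: pm.subspace_def plin_0[OF plin_act_left] plin_add[OF plin_act_left] plin_psc[OF plin_act_left])
  then have "pm.span (Wn \<nu>) = Wn \<nu>" by (simp add: pm.span_eq_iff)
  moreover have "isotypic scale V0 V1 \<nu> \<subseteq> lin_span T (pi ` Wn \<nu>)"
    unfolding isotypic_def by (rule lin_span_mono) (use specht_submodule_Wn[OF _ nu] in blast)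
  ultimately show "isotypic scale V0 V1 \<nu> \<subseteq> pi ` Wn \<nu>"
    by (simp only: vmodel_lin_span[OF T_vmodel subset_UNIV])
qed (use Wn_isotypic[OF _ Om_pn[OF assms]] in blast)

text \<open>Orthogonality makes \<open>kappa\<close> vanish on the component of every member of the
  filter. Conversely, an element whose normal form is fixed by \<open>Ep\<close> is a sum of images
  under idempotents of members, and each such image lies in its component.\<close>

lemma I_ideal_eq: "I_ideal scale V0 V1 \<Omega> = pi ` Jd"
proof -
  let ?U = "\<Union>\<nu>\<in>\<Omega>. Wn \<nu>"
  have "I_ideal scale V0 V1 \<Omega> = lin_span T (pi ` ?U)"
    unfolding I_ideal_def by (rule arg_cong[where f = "lin_span T"]) (use isotypic_eq in auto)
  also have "\<dots> = pi ` pm.span ?U" by (rule vmodel_lin_span[OF T_vmodel]) simp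
  also have "\<dots> = pi ` Jd"
  proof
    have "y \<in> Jd" if y: "y \<in> Wn \<nu>" "\<nu> \<in> \<Omega>" for y \<nu>
    proof -
      note nu = Om_pn[OF y(2)]
      have yT: "y \<in> TL (psize \<nu>) B" and ye: "act V1 y (eidem \<nu>) = y" using y(1) by (simp_all add: Wn_def)
      have "act V1 y (eidem \<mu>) = 0" if "\<mu> \<in> pn (psize \<nu>) - \<Omega>" for \<mu>
      proof -
        have m: "\<mu> \<in> pn (psize \<nu>)" "\<nu> \<noteq> \<mu>" using that y(2) by auto
        have "act V1 y (eidem \<mu>) = act V1 (act V1 y (eidem \<nu>)) (eidem \<mu>)" by (simp only: ye)
        also have "\<dots> = act V1 y (eidem \<nu> * eidem \<mu>)"
          by (rule act_mult[OF TL_mono[OF subset_UNIV yT] eidem_props(1)[OF nu] eidem_props(1)[OF m(1)]])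
        also have "\<dots> = 0" using eidem_orth[OF nu m(1) m(2), where 'f = 'f] by (simp add: plin_0[OF plin_act_right])
        finally show ?thesis .
      qed
      then show ?thesis by (simp add: kappa_TL[OF yT])
    qed
    then have "pm.span ?U \<subseteq> Jd" by (intro pm.span_minimal Jd_subspace) auto
    then show "pi ` pm.span ?U \<subseteq> pi ` Jd" by (rule image_mono)
    show "pi ` Jd \<subseteq> pi ` pm.span ?U"
    proof
      fix X assume "X \<in> pi ` Jd"
      then obtain p where p: "X = pi p" "ps p = Ep (ps p)" by (auto simp: kappa_def)
      have w: "Ep (sng z 1) \<in> pm.span ?U" if z: "z \<in> lists B" for z
      proof -
        have zT: "sng z (1::'f) \<in> TL (length z) B" using z by (auto simp: TL_def Wd_def)
        have "act V1 (sng z 1) (eidem \<nu>) \<in> pm.span ?U" if nu: "\<nu> \<in> \<Omega> \<inter> pn (length z)" for \<nu>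
        proof (rule pm.span_base, rule UN_I)
          have n: "psize \<nu> = length z" and nup: "\<nu> \<in> pn (length z)" using nu by (simp_all add: pn_def)
          show "act V1 (sng z 1) (eidem \<nu>) \<in> Wn \<nu>"
            unfolding Wn_def n using act_TL[OF zT eidem_props(1)[OF nup]]
              act_mult[OF TL_mono[OF subset_UNIV zT] eidem_props(1)[OF nup] eidem_props(1)[OF nup], of V1]
              eidem_props(2)[OF nup, where 'f = 'f] by simp
        qed (use nu in blast)
        then show ?thesis unfolding Ep_TL[OF TL_mono[OF subset_UNIV zT]] eOm_def plin_sum[OF plin_act_right]
          by (intro pm.span_sum) blast
      qed
      have "ks (ps p) \<subseteq> lists B" using ps_TB[of p] by (simp add: TB_def)
      moreover have "Ep (ps p) = (\<Sum>z\<in>ks (ps p). psc (lk (ps p) z) (Ep (sng z 1)))"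
        by (simp add: Ep_def lext_def[of _ "ps p"])
      ultimately have "Ep (ps p) \<in> pm.span ?U" by (simp only:) (intro pm.span_sum pm.span_scale w, blast)
      moreover have "pi p = pi (Ep (ps p))" using p(2) pi_ps by metis
      ultimately show "X \<in> pi ` pm.span ?U" using p(1) by blast
    qed
  qed
  finally show ?thesis .
qed

abbreviation A where "A \<equiv> A_algebra scale V0 V1 \<Omega>"

lemma rel_Jd: "rel \<subseteq> Jd" by (auto simp: rel_eq kappa_def plin_0[OF plin_Ep])

lemma A_model: "amodel A UNIV Jd fmul (sng [] 1) (\<lambda>x. I_ideal scale V0 V1 \<Omega> +>\<^bsub>T\<^esub> pi x)"
  unfolding A_algebra_def I_ideal_eq
  by (rule amodel_quot[OF T_model Jd_subspace rel_Jd subset_UNIV]) (use kappa_fmul in auto)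

text \<open>Elements of the quotient may be replaced by arbitrary representatives, so an identity is
  tested inside the free algebra on all vectors.\<close>

lemma A_identity: "is_identity A f \<longleftrightarrow> (\<forall>q. kappa (lext (mprod fmul (sng [] 1) q) f) = 0)"
proof -
  note D = vmodelD[OF amodelD(1)[OF A_model]]
  have z: "nc_eval A (\<lambda>i. I_ideal scale V0 V1 \<Omega> +>\<^bsub>T\<^esub> pi (q i)) f = \<zero>\<^bsub>A\<^esub>
      \<longleftrightarrow> kappa (lext (mprod fmul (sng [] 1) q) f) = 0" for q
    unfolding amodel_nc_eval[OF A_model UNIV_I] D(5) using D(8)[of "lext (mprod fmul (sng [] 1) q) f" 0] by simp
  show ?thesis
  proof
    assume "is_identity A f"
    then have "nc_eval A (\<lambda>i. I_ideal scale V0 V1 \<Omega> +>\<^bsub>T\<^esub> pi (q i)) f = \<zero>\<^bsub>A\<^esub>" for q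
      unfolding is_identity_def D(4) by simp
    then show "\<forall>q. kappa (lext (mprod fmul (sng [] 1) q) f) = 0" unfolding z by blast
  next
    assume k: "\<forall>q. kappa (lext (mprod fmul (sng [] 1) q) f) = 0"
    show "is_identity A f"
      unfolding is_identity_def
    proof (intro allI impI)
      fix a :: "nat \<Rightarrow> ('v list \<Rightarrow>\<^sub>0 'f) set set" assume "\<forall>i. a i \<in> carrier A"
      then have "\<forall>i. \<exists>x. a i = I_ideal scale V0 V1 \<Omega> +>\<^bsub>T\<^esub> pi x" unfolding D(4) by blast
      from choice[OF this] obtain q where "a = (\<lambda>i. I_ideal scale V0 V1 \<Omega> +>\<^bsub>T\<^esub> pi (q i))" by auto
      then show "nc_eval A a f = \<zero>\<^bsub>A\<^esub>" using z k by simp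
    qed
  qed
qed

lemma vdim_A_component: "vdim (A_component scale V0 V1 \<Omega> n) = pm.dim (kappa ` TL n UNIV)"
proof -
  let ?Q = "TL n UNIV :: ('v list \<Rightarrow>\<^sub>0 'f) set"
  have V: "vmodel (T\<lparr>carrier := tensor_power scale n\<rparr>) ?Q (rel \<inter> ?Q) pi"
    unfolding vmodel_def
    using T_D pm.subspace_diff[OF TL_subspace[of n UNIV]]
    by (auto simp: TL_subspace tensor_power_eq(1) intro!: pm.subspace_inter)
  \<comment> \<open>An element of the intersection has one representative killed by
    \<open>kappa\<close> and another of degree \<open>n\<close>. They share their normal form, on
    which alone \<open>kappa\<close> depends.\<close>
  have I: "I_ideal scale V0 V1 \<Omega> \<inter> tensor_power scale n = pi ` (Jd \<inter> ?Q)"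
  proof (intro equalityI subsetI)
    fix X assume "X \<in> I_ideal scale V0 V1 \<Omega> \<inter> tensor_power scale n"
    then obtain p q where pq: "X = pi p" "kappa p = 0" "X = pi q" "q \<in> ?Q"
      unfolding I_ideal_eq tensor_power_eq(1) by blast
    then have "ps p = ps q" by (simp add: pi_eq_iff)
    then have "kappa q = 0" using pq(2) by (simp add: kappa_def)
    then show "X \<in> pi ` (Jd \<inter> ?Q)" using pq by blast
  qed (auto simp: I_ideal_eq tensor_power_eq(1))
  have "vmodel (A_component scale V0 V1 \<Omega> n) ?Q (Jd \<inter> ?Q)
      (\<lambda>x. (pi ` (Jd \<inter> ?Q)) +>\<^bsub>T\<lparr>carrier := tensor_power scale n\<rparr>\<^esub> pi x)"
    unfolding A_component_def I
    by (rule vmodel_quot[OF V]) (use rel_Jd Jd_subspace TL_subspace in \<open>auto intro!: pm.subspace_inter\<close>)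
  from vmodel_dim[OF this plin_kappa] show ?thesis by simp
qed

end

section \<open>Exponential growth when a corner shape is missing\<close>

lemma psize_bounds:
  assumes "\<nu> \<in> partitions"
  shows "\<nu> i \<le> psize \<nu>" "psize \<nu> \<le> i \<Longrightarrow> \<nu> i = 0"
proof -
  have fin: "finite {i. \<nu> i \<noteq> 0}" and anti: "antimono \<nu>" using assms by (auto simp: partitions_def)
  show "\<nu> i \<le> psize \<nu>"
  proof (cases "\<nu> i = 0")
    case False then show ?thesis unfolding psize_def by (intro member_le_sum fin) auto
  qed simp
  show "\<nu> i = 0" if "psize \<nu> \<le> i"
  proof (rule ccontr)
    assume i: "\<nu> i \<noteq> 0"
    have "\<nu> j \<noteq> 0" if "j \<le> i" for j using antimonoD[OF anti that] i by simp
    then have sub: "{..i} \<subseteq> {i. \<nu> i \<noteq> 0}" by auto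
    have "card {..i} \<le> card {i. \<nu> i \<noteq> 0}" by (rule card_mono[OF fin sub])
    also have "\<dots> = (\<Sum>j | \<nu> j \<noteq> 0. 1)" by simp
    also have "\<dots> \<le> psize \<nu>" unfolding psize_def by (rule sum_mono) auto
    finally show False using that by simp
  qed
qed

lemma D_partition: "a1 \<le> b \<Longrightarrow> a2 \<le> b \<Longrightarrow> D a1 a2 b \<in> partitions"
  unfolding partitions_def
proof (intro CollectI conjI antimonoI)
  have "{i. D a1 a2 b i \<noteq> 0} \<subseteq> {..<a1 + b}" by (auto simp: D_def split: if_splits)
  then show "finite {i. D a1 a2 b i \<noteq> 0}" by (rule finite_subset) simp
qed (auto simp: D_def)

text \<open>A partition without the cell (a0, a1) lies below \<open>D a0 a1 b\<close> as soon as
  \<open>b\<close> exceeds its size, which bounds both its rows and their number; the filter would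
  then contain that shape.\<close>

lemma missing_corner:
  assumes fil: "is_filter_of_partitions \<Omega>" and D: "\<And>b. b > 0 \<Longrightarrow> D a0 a1 b \<notin> \<Omega>" and nu: "\<nu> \<in> \<Omega>"
  shows "a1 < \<nu> a0"
proof (rule ccontr)
  assume le: "\<not> a1 < \<nu> a0"
  define b where "b = psize \<nu> + a0 + a1 + 1"
  have nup: "\<nu> \<in> partitions" using fil nu by (auto simp: is_filter_of_partitions_def)
  then have anti: "antimono \<nu>" by (simp add: partitions_def)
  have "\<nu> i \<le> D a0 a1 b i" for i
    using psize_bounds[OF nup, of i] antimonoD[OF anti, of a0 i] le by (auto simp: D_def b_def)
  then have "\<nu> \<le> D a0 a1 b" by (rule le_funI)
  moreover have "D a0 a1 b \<in> partitions" by (rule D_partition) (auto simp: b_def)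
  ultimately have "D a0 a1 b \<in> \<Omega>" using fil nu unfolding is_filter_of_partitions_def by blast
  then show False using D[of b] by (simp add: b_def)
qed

lemma card_independent_le_dim:
  assumes "finite F" "U \<subseteq> pm.span F" "S \<subseteq> U" "pm.independent S"
  shows "card S \<le> pm.dim U"
proof -
  obtain C where C: "C \<subseteq> U" "pm.independent C" "U \<subseteq> pm.span C" "card C = pm.dim U" using pm.basis_exists by blast
  have "finite C" using pm.independent_span_bound[OF assms(1) C(2)] C(1) assms(2) by blast
  then show ?thesis using pm.independent_span_bound[OF _ assms(4), of C] assms(3) C(3,4) by auto
qed

lemma independent_words: "finite W \<Longrightarrow> pm.independent ((\<lambda>z. sng z (1::'f::field)) ` W)"
proof (rule pm.independent_if_scalars_zero)
  assume W: "finite W"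
  then show "finite ((\<lambda>z. sng z (1::'f)) ` W)" by simp
  have inj: "inj_on (\<lambda>z. sng z (1::'f)) W"
    by (rule inj_onI) (metis keys_single one_neq_zero singleton_inject)
  fix g and x :: "'a \<Rightarrow>\<^sub>0 'f" assume 0: "(\<Sum>x\<in>(\<lambda>z. sng z 1) ` W. psc (g x) x) = (0 :: _ \<Rightarrow>\<^sub>0 'f)" and x: "x \<in> (\<lambda>z. sng z 1) ` W"
  obtain z where z: "z \<in> W" "x = sng z 1" using x by blast
  have "(\<Sum>w\<in>W. sng w (g (sng w 1))) = (0 :: _ \<Rightarrow>\<^sub>0 'f)"
    using 0 by (simp add: sum.reindex[OF inj])
  from arg_cong[OF this, of "\<lambda>p. lk p z"] show "g x = 0"
    using W z by (simp add: lookup_sum lookup_single when_def sum.delta)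
qed

lemma poly_less_power_two: "\<exists>n. poly p (real n) < 2 ^ n"
proof -
  have 1: "(\<lambda>n. real n ^ k / 2 ^ n) \<longlonglongrightarrow> 0" for k
  proof -
    have "filterlim (\<lambda>n. real n * ln 2) at_top sequentially"
      by (rule filterlim_at_top_mult_tendsto_pos[OF tendsto_const _ filterlim_real_sequentially, THEN filterlim_cong[THEN iffD1, rotated -1]])
        (auto simp: mult.commute)
    from filterlim_compose[OF tendsto_power_div_exp_0[of k] this]
    have "(\<lambda>n. (real n * ln 2) ^ k / exp (real n * ln 2)) \<longlonglongrightarrow> 0" .
    from tendsto_mult_left[OF this, of "inverse (ln 2 ^ k)"]
    show ?thesis by (simp add: power_mult_distrib exp_of_nat_mult field_simps)
  qed
  have "(\<lambda>n. \<Sum>i\<le>degree p. coeff p i * (real n ^ i / 2 ^ n)) \<longlonglongrightarrow> (\<Sum>i\<le>degree p. coeff p i * 0)"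
    by (intro tendsto_sum tendsto_mult tendsto_const 1)
  moreover have "(\<Sum>i\<le>degree p. coeff p i * (real n ^ i / 2 ^ n)) = poly p (real n) / 2 ^ n" for n
    by (simp add: poly_altdef sum_divide_distrib)
  ultimately have "(\<lambda>n. poly p (real n) / 2 ^ n) \<longlonglongrightarrow> 0" by simp
  from order_tendstoD(2)[OF this zero_less_one] obtain n where "poly p (real n) / 2 ^ n < 1"
    by (auto simp: eventually_sequentially)
  then show ?thesis by (auto simp: divide_less_eq)
qed

text \<open>The words p^i q form a prefix code, since \<open>i\<close> is the length of the initial
  run of \<open>p\<close>. Two letters thus contain free generators for countably many
  variables.\<close>

lemma prefix_code_inj:
  assumes "p \<noteq> q"
  shows "concat (map (\<lambda>i. replicate i p @ [q]) w) = concat (map (\<lambda>i. replicate i p @ [q]) w') \<Longrightarrow> w = w'"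
proof (induction w arbitrary: w')
  case Nil then show ?case by (cases w') auto
next
  case (Cons i w)
  then obtain j v where w': "w' = j # v" by (cases w') auto
  have tw: "takeWhile (\<lambda>x. x = p) (replicate m p @ q # y) = replicate m p" for m y
    using assms by (induction m) auto
  have "replicate i p @ q # concat (map (\<lambda>i. replicate i p @ [q]) w)
      = replicate j p @ q # concat (map (\<lambda>i. replicate i p @ [q]) v)" using Cons.prems w' by simp
  moreover from arg_cong[OF this, of "\<lambda>y. length (takeWhile (\<lambda>x. x = p) y)"] have "i = j" unfolding tw by simp
  ultimately show ?case using Cons.IH[of v] w' by simp
qed

context fin_filter
begin

lemma kappa_bound: "kappa ` TL n UNIV \<subseteq> TL n B"
proof
  fix y assume "y \<in> kappa ` TL n UNIV"
  then obtain x where x: "x \<in> TL n UNIV" "y = kappa x" by blast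
  have p: "ps x \<in> TL n B" by (rule ps_TL[OF x(1)])
  show "y \<in> TL n B"
    unfolding x(2) kappa_def Ep_TL[OF TL_mono[OF subset_UNIV p]] by (rule TL_diff[OF p act_TL[OF p eOm_GA]])
qed

text \<open>Every member of the filter contains the cell (a0, a1), so \<open>Ep\<close> vanishes on
  words in L and the free algebra on L embeds into the quotient.\<close>

lemma kappa_words:
  assumes corner: "\<And>\<nu>. \<nu> \<in> \<Omega> \<Longrightarrow> a1 < \<nu> a0"
    and L: "L \<subseteq> B" "card (L - V1) \<le> a0" "card (L \<inter> V1) \<le> a1" and x: "ks x \<subseteq> lists L"
  shows "kappa x = x"
proof (rule plin_eqI[where S = "lists L", OF plin_kappa plin_id x])
  fix z assume z: "z \<in> lists L"
  let ?n = "length z"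
  have zT: "sng z (1::'f) \<in> TL ?n L" using z by (auto simp: TL_def Wd_def)
  have zB: "sng z (1::'f) \<in> TL ?n B" by (rule TL_mono[OF L(1) zT])
  have zU: "sng z (1::'f) \<in> TL ?n UNIV" by (rule TL_mono[OF subset_UNIV zT])
  have "act V1 (sng z 1) (eidem \<nu>) = (0 :: _ \<Rightarrow>\<^sub>0 'f)" if nuO: "\<nu> \<in> \<Omega> \<inter> pn ?n" for \<nu>
  proof -
    obtain r c where rc: "tab {1..?n} r c \<nu>" using tab_ex nuO by blast
    interpret tableau "{1..?n}" r c \<nu> "TYPE('f)" by unfold_locales fact
    have "eidem \<nu> = (eid :: fperm \<Rightarrow>\<^sub>0 'f)" by (rule eidem_eq[OF rc]) (use nuO in blast)
    moreover have "act V1 (sng z 1) (dl a * u * psc (inverse kap) (star u * dl (- a))) = (0 :: _ \<Rightarrow>\<^sub>0 'f)"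
      if a: "a \<in> Sym {1..?n}" for a
    proof -
      have g: "psc (inverse kap) (star u * dl (- a)) \<in> GA {1..?n}"
        by (intro GA_psc GA_mult GA_star GA_dl Sym_uminus a u_GA)
      have k: "act V1 (sng z 1) (dl a * u) = (0 :: _ \<Rightarrow>\<^sub>0 'f)"
        by (rule hook_kills_words[OF finite_subset[OF L(1) finite_B] L(2,3) rc _ zT GA_dl[OF a]])
          (use corner nuO in blast)
      show ?thesis
        unfolding act_mult[OF zU GA_mult[OF GA_dl[OF a] u_GA] g, symmetric] k by (rule plin_0[OF plin_act_left])
    qed
    ultimately show ?thesis by (simp only: eid_expand plin_sum[OF plin_act_right] sum.neutral_const cong: sum.cong)
  qed
  then have "Ep (sng z 1) = (0 :: _ \<Rightarrow>\<^sub>0 'f)"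
    unfolding Ep_TL[OF zU] eOm_def plin_sum[OF plin_act_right] by (rule sum.neutral[OF ballI])
  then show "kappa (sng z 1) = sng z 1" by (simp only: kappa_def ps_id[OF TL_TB[OF zB]] diff_zero)
qed

lemma two_letters:
  assumes "a0 + a1 = 2" "a0 \<le> card B0" "a1 \<le> card B1"
  obtains p q where "p \<noteq> q" "{p, q} \<subseteq> B" "card ({p, q} - V1) \<le> a0" "card ({p, q} \<inter> V1) \<le> a1"
proof -
  obtain L0 where L0: "L0 \<subseteq> B0" "card L0 = a0" "finite L0" using obtain_subset_with_card_n[OF assms(2)] by blast
  obtain L1 where L1: "L1 \<subseteq> B1" "card L1 = a1" "finite L1" using obtain_subset_with_card_n[OF assms(3)] by blast
  have p: "L0 \<inter> V1 = {}" "L1 \<subseteq> V1" using L0 L1 B0_V1 BV by blast+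
  then have "L0 \<inter> L1 = {}" by blast
  then have "card (L0 \<union> L1) = 2" using L0 L1 assms(1) by (simp add: card_Un_disjoint)
  then obtain p q where pq: "L0 \<union> L1 = {p, q}" "p \<noteq> q" by (auto simp: card_2_iff)
  have "{p, q} - V1 = L0" "{p, q} \<inter> V1 = L1" using p unfolding pq(1)[symmetric] by blast+
  moreover have "{p, q} \<subseteq> B" unfolding pq(1)[symmetric] B_def using L0(1) L1(1) by blast
  ultimately show thesis using that[OF pq(2)] L0(2) L1(2) by simp
qed

text \<open>The substitution of p^i q for the i-th variable is injective on words, so it recovers
  each coefficient of a supposed identity.\<close>

lemma missing_corner_not_PI:
  assumes corner: "\<And>\<nu>. \<nu> \<in> \<Omega> \<Longrightarrow> a1 < \<nu> a0"
    and a: "a0 + a1 = 2" "a0 \<le> card B0" "a1 \<le> card B1"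
  shows "\<not> PI_algebra A"
proof
  assume "PI_algebra A"
  then obtain f where f: "f \<noteq> 0" "is_identity A f" by (auto simp: PI_algebra_def)
  obtain p q where pq: "p \<noteq> q" "{p, q} \<subseteq> B" "card ({p, q} - V1) \<le> a0" "card ({p, q} \<inter> V1) \<le> a1"
    using two_letters[OF a] by blast
  let ?c = "\<lambda>w. concat (map (\<lambda>i. replicate i p @ [q]) w)"
  have m: "mprod fmul (sng [] 1) (\<lambda>i. sng (replicate i p @ [q]) 1) w = sng (?c w) (1::'f)" for w
    by (induction w) (auto simp: mprod_def)
  let ?x = "lext (\<lambda>w. sng (?c w) (1::'f)) f"
  have "ks ?x \<subseteq> lists {p, q}"
  proof -
    have "?c w \<in> lists {p, q}" for w by (induction w) (auto simp: lists_eq_set)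
    then show ?thesis using keys_lext[of "\<lambda>w. sng (?c w) (1::'f)" f] by fastforce
  qed
  from kappa_words[of a1 a0, OF _ pq(2-4) this] have "kappa ?x = ?x" using corner by blast
  moreover have "kappa ?x = 0"
    using f(2) unfolding A_identity by (drule_tac spec[of _ "\<lambda>i. sng (replicate i p @ [q]) 1"]) (simp only: m[abs_def])
  ultimately have 0: "?x = 0" by simp
  have "lk f w = 0" for w
  proof -
    have inj: "?c v = ?c w \<longleftrightarrow> v = w" for v using prefix_code_inj[OF pq(1), of v w] by blast
    have "lk ?x (?c w) = (\<Sum>v\<in>ks f. if v = w then lk f v else 0)"
      by (simp add: lext_def lookup_sum lookup_single when_def inj)
    then show ?thesis using 0 by (auto simp: sum.delta in_keys_iff split: if_splits)
  qed
  then have "f = 0" by (intro poly_mapping_eqI) simp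
  then show False using f(1) by simp
qed

lemma missing_corner_not_polynomial:
  assumes corner: "\<And>\<nu>. \<nu> \<in> \<Omega> \<Longrightarrow> a1 < \<nu> a0"
    and a: "a0 + a1 = 2" "a0 \<le> card B0" "a1 \<le> card B1"
  shows "\<not> polynomial_growth scale V0 V1 \<Omega>"
proof
  assume "polynomial_growth scale V0 V1 \<Omega>"
  then obtain P :: "real poly" where P: "real (vdim (A_component scale V0 V1 \<Omega> n)) \<le> poly P (real n)" for n
    by (auto simp: polynomial_growth_def)
  obtain p q where pq: "p \<noteq> q" "{p, q} \<subseteq> B" "card ({p, q} - V1) \<le> a0" "card ({p, q} \<inter> V1) \<le> a1"
    using two_letters[OF a] by blast
  have "2 ^ n \<le> real (vdim (A_component scale V0 V1 \<Omega> n))" for n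
  proof -
    let ?W = "Wd n {p, q}" and ?s = "\<lambda>z. sng z (1::'f)"
    have W: "?W = {z. set z \<subseteq> {p, q} \<and> length z = n}" by (auto simp: Wd_def)
    have cW: "card ?W = 2 ^ n" unfolding W using pq(1) by (simp add: card_lists_length_eq numeral_2_eq_2)
    have "?s z \<in> kappa ` TL n UNIV" if "z \<in> ?W" for z
    proof -
      have z: "ks (?s z) \<subseteq> lists {p, q}" using that by (auto simp: Wd_def lists_eq_set)
      have "kappa (?s z) = ?s z" by (rule kappa_words[of a1 a0, OF _ pq(2-4) z]) (rule corner)
      moreover have "?s z \<in> TL n UNIV" using that by (auto simp: TL_def Wd_def)
      ultimately show ?thesis by (metis imageI)
    qed
    then have sub: "?s ` ?W \<subseteq> kappa ` TL n UNIV" by blast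
    have "card (?s ` ?W) \<le> pm.dim (kappa ` TL n UNIV)"
    proof (rule card_independent_le_dim[OF _ _ sub])
      show "finite (?s ` Wd n B)" by (simp add: finite_Wd)
      show "kappa ` TL n UNIV \<subseteq> pm.span (?s ` Wd n B)" unfolding span_words by (rule kappa_bound)
      show "pm.independent (?s ` ?W)" by (rule independent_words) (simp add: finite_Wd)
    qed
    moreover have "card (?s ` ?W) = card ?W"
      by (intro card_image inj_onI) (metis keys_single one_neq_zero singleton_inject)
    ultimately have "2 ^ n \<le> pm.dim (kappa ` TL n UNIV)" by (simp only: cW)
    then show ?thesis unfolding vdim_A_component by (simp only: of_nat_le_iff[where 'a = real, symmetric] of_nat_power of_nat_numeral)
  qed
  then have "2 ^ n \<le> poly P (real n)" for n using P[of n] by (meson order_trans)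
  then show False using poly_less_power_two[of P] by (meson not_le)
qed

end

section \<open>Identities of the tensor square of the Grassmann algebra\<close>

text \<open>The sign of the rearrangement of the letters in \<open>U\<close> into increasing order.\<close>

fun sgl :: "nat set \<Rightarrow> nat list \<Rightarrow> 'f::field_char_0" where
  "sgl U [] = 1" |
  "sgl U (a # w) = (if a \<in> U then (- 1) ^ length (filter (\<lambda>b. b \<in> U \<and> b < a) w) else 1) * sgl U w"

text \<open>The coefficient at e_U \<otimes> e_U' of the value of \<open>g\<close>, when the i-th
  variable receives the generator e_i in the first factor for i \<in> U, in the second for i \<in>
  U', and 1 otherwise.\<close>

definition sgsum :: "(nat list \<Rightarrow>\<^sub>0 'f) \<Rightarrow> nat set \<Rightarrow> nat set \<Rightarrow> 'f::field_char_0" where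
  "sgsum g U U' = (\<Sum>w\<in>ks g. lk g w * (sgl U w * sgl U' w))"

lemma sgl_filter: "sgl UNIV (filter (\<lambda>a. a \<in> U) w) = sgl U w"
  by (induction w) (auto simp: filter_filter conj_commute)

lemma sgl_cong: "U \<inter> set w = U' \<inter> set w \<Longrightarrow> sgl U w = sgl U' w"
proof (induction w)
  case (Cons a w)
  then have "filter (\<lambda>b. b \<in> U \<and> b < a) w = filter (\<lambda>b. b \<in> U' \<and> b < a) w" by (intro filter_cong) auto
  moreover have "a \<in> U \<longleftrightarrow> a \<in> U'" "U \<inter> set w = U' \<inter> set w" using Cons.prems by auto
  ultimately show ?case using Cons.IH by simp
qed simp

lemma sgl_swap: "i \<noteq> j \<Longrightarrow> sgl UNIV (x @ i # j # y) = - sgl UNIV (x @ j # i # y)"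
  by (induction x) auto

text \<open>The elements that stay in the kernel of the functional after multiplication by basis
  elements on both sides form an ideal. Functionals take values in functions on \<open>unit\<close>,
  so that \<open>lext\<close> and \<open>plin\<close> cover them too.\<close>

lemma functional_genideal:
  fixes \<theta> :: "'g \<Rightarrow> 'f::field_char_0" and G :: "('g, 'm) monoid_scheme"
  assumes G: "monoid G" and S: "S \<subseteq> {p. ks p \<subseteq> carrier G}"
    and 0: "\<And>x y s. x \<in> carrier G \<Longrightarrow> y \<in> carrier G \<Longrightarrow> s \<in> S \<Longrightarrow>
      lext (\<lambda>x. sng () (\<theta> x)) (sng x 1 \<otimes>\<^bsub>monoid_algebra G\<^esub> (s \<otimes>\<^bsub>monoid_algebra G\<^esub> sng y 1)) = 0"
    and p: "p \<in> Idl\<^bsub>monoid_algebra G\<^esub> S"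
  shows "lext (\<lambda>x. sng () (\<theta> x)) p = 0"
proof -
  interpret G: monoid G by fact
  let ?M = "monoid_algebra G :: ('f, 'g \<Rightarrow>\<^sub>0 'f) module"
  let ?L = "lext (\<lambda>x. sng () (\<theta> x))"
  let ?Q = "{p :: 'g \<Rightarrow>\<^sub>0 'f. ks p \<subseteq> carrier G}"
  define J where "J = {p \<in> ?Q. \<forall>x\<in>carrier G. \<forall>y\<in>carrier G. ?L (sng x 1 \<otimes>\<^bsub>?M\<^esub> (p \<otimes>\<^bsub>?M\<^esub> sng y 1)) = 0}"
  have A: "amodel ?M ?Q {0} (\<lambda>x y. x \<otimes>\<^bsub>?M\<^esub> y) (sng \<one>\<^bsub>G\<^esub> 1) (\<lambda>x. x)" by (rule amodel_monoid_algebra[OF G])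
  note As = amodelD[OF A]
  have R: "ring ?M" by (rule ring_monoid_algebra[OF G])
  have assoc: "(x \<otimes>\<^bsub>?M\<^esub> y) \<otimes>\<^bsub>?M\<^esub> z = x \<otimes>\<^bsub>?M\<^esub> (y \<otimes>\<^bsub>?M\<^esub> z)" if "x \<in> ?Q" "y \<in> ?Q" "z \<in> ?Q" for x y z
    using monoid_algebra_assoc[OF G] that by blast
  have sQ: "sng x (1::'f) \<in> ?Q" if "x \<in> carrier G" for x using that by simp
  have pl: "plin (\<lambda>p. ?L (x \<otimes>\<^bsub>?M\<^esub> (p \<otimes>\<^bsub>?M\<^esub> y)))" for x y
    by (rule plin_comp[OF plin_lext plin_comp[OF plin_mult_right plin_mult_left]])
  have Js: "pm.subspace J"
  proof (rule pm.subspaceI)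
    show "0 \<in> J" using plin_0[OF pl] by (simp add: J_def)
    fix a b c assume a: "a \<in> J"
    have Qs: "pm.subspace ?Q" using vmodelD(1)[OF As(1)] .
    show "psc c a \<in> J" using a pm.subspace_scale[OF Qs, of a c] by (simp add: J_def plin_psc[OF pl])
    assume b: "b \<in> J"
    show "a + b \<in> J" using a b pm.subspace_add[OF Qs, of a b] by (simp add: J_def plin_add[OF pl])
  qed
  have "ideal J ?M"
  proof (rule subspace_ideal[OF A R Js])
    show "J \<subseteq> ?Q" by (auto simp: J_def)
    fix a q assume a: "a \<in> J" and q: "q \<in> ?Q"
    have aQ: "a \<in> ?Q" using a by (simp add: J_def)
    have kq: "ks q \<subseteq> carrier G" using q by simp
    have "?L (sng x 1 \<otimes>\<^bsub>?M\<^esub> ((a \<otimes>\<^bsub>?M\<^esub> q) \<otimes>\<^bsub>?M\<^esub> sng y 1)) = 0"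
      if xy: "x \<in> carrier G" "y \<in> carrier G" for x y
    proof (rule plin_eqI[where p = q and S = "carrier G" and G = "\<lambda>_. 0" and
          F = "\<lambda>q. ?L (sng x 1 \<otimes>\<^bsub>?M\<^esub> ((a \<otimes>\<^bsub>?M\<^esub> q) \<otimes>\<^bsub>?M\<^esub> sng y 1))", OF _ _ kq])
      show "plin (\<lambda>q. ?L (sng x 1 \<otimes>\<^bsub>?M\<^esub> ((a \<otimes>\<^bsub>?M\<^esub> q) \<otimes>\<^bsub>?M\<^esub> sng y 1)))"
        by (rule plin_comp[OF pl plin_mult_right])
      show "plin (\<lambda>_. 0 :: unit \<Rightarrow>\<^sub>0 'f)" by (rule plinI) simp_all
      fix z assume z: "z \<in> carrier G"
      show "?L (sng x 1 \<otimes>\<^bsub>?M\<^esub> ((a \<otimes>\<^bsub>?M\<^esub> sng z 1) \<otimes>\<^bsub>?M\<^esub> sng y 1)) = 0"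
        using a xy z unfolding assoc[OF aQ sQ[OF z] sQ[OF xy(2)]] by (simp add: J_def)
    qed
    moreover have "?L (sng x 1 \<otimes>\<^bsub>?M\<^esub> ((q \<otimes>\<^bsub>?M\<^esub> a) \<otimes>\<^bsub>?M\<^esub> sng y 1)) = 0"
      if xy: "x \<in> carrier G" "y \<in> carrier G" for x y
    proof (rule plin_eqI[where p = q and S = "carrier G" and G = "\<lambda>_. 0" and
          F = "\<lambda>q. ?L (sng x 1 \<otimes>\<^bsub>?M\<^esub> ((q \<otimes>\<^bsub>?M\<^esub> a) \<otimes>\<^bsub>?M\<^esub> sng y 1))", OF _ _ kq])
      show "plin (\<lambda>q. ?L (sng x 1 \<otimes>\<^bsub>?M\<^esub> ((q \<otimes>\<^bsub>?M\<^esub> a) \<otimes>\<^bsub>?M\<^esub> sng y 1)))"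
        by (rule plin_comp[OF pl plin_mult_left])
      show "plin (\<lambda>_. 0 :: unit \<Rightarrow>\<^sub>0 'f)" by (rule plinI) simp_all
      fix z assume z: "z \<in> carrier G"
      have ay: "a \<otimes>\<^bsub>?M\<^esub> sng y 1 \<in> ?Q" by (rule As(6)[OF aQ sQ[OF xy(2)]])
      have e: "sng x 1 \<otimes>\<^bsub>?M\<^esub> ((sng z 1 \<otimes>\<^bsub>?M\<^esub> a) \<otimes>\<^bsub>?M\<^esub> sng y 1)
          = sng (x \<otimes>\<^bsub>G\<^esub> z) 1 \<otimes>\<^bsub>?M\<^esub> (a \<otimes>\<^bsub>?M\<^esub> sng y 1)"
        unfolding assoc[OF sQ[OF z] aQ sQ[OF xy(2)]] assoc[OF sQ[OF xy(1)] sQ[OF z] ay, symmetric] by simp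
      show "?L (sng x 1 \<otimes>\<^bsub>?M\<^esub> ((sng z 1 \<otimes>\<^bsub>?M\<^esub> a) \<otimes>\<^bsub>?M\<^esub> sng y 1)) = 0"
        using a xy z unfolding e by (simp add: J_def)
    qed
    ultimately show "a \<otimes>\<^bsub>?M\<^esub> q \<in> J \<and> q \<otimes>\<^bsub>?M\<^esub> a \<in> J"
      using As(6)[OF aQ q] As(6)[OF q aQ] by (simp add: J_def)
  qed
  moreover have "S \<subseteq> J" using S 0 by (auto simp: J_def)
  ultimately have "p \<in> J" using ring.genideal_minimal[OF R] p by blast
  then have "?L (sng \<one>\<^bsub>G\<^esub> 1 \<otimes>\<^bsub>?M\<^esub> (p \<otimes>\<^bsub>?M\<^esub> sng \<one>\<^bsub>G\<^esub> 1)) = 0" and pQ: "p \<in> ?Q" by (auto simp: J_def)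
  moreover have "sng \<one>\<^bsub>G\<^esub> 1 \<otimes>\<^bsub>?M\<^esub> (p \<otimes>\<^bsub>?M\<^esub> sng \<one>\<^bsub>G\<^esub> 1) = p"
    using ring.ring_simprules(12)[OF R] monoid.l_one[OF ring.is_monoid[OF R], of p] monoid.r_one[OF ring.is_monoid[OF R], of p] pQ
    by simp
  ultimately show ?thesis by simp
qed

section \<open>The Grassmann algebra and its tensor square\<close>

abbreviation EE :: "('f::field_char_0, (nat list \<Rightarrow>\<^sub>0 'f) set) module" where "EE \<equiv> grassmann"

definition grel :: "(nat list \<Rightarrow>\<^sub>0 'f::field_char_0) set" where
  "grel = Idl\<^bsub>free_algebra\<^esub> {sng [i, j] 1 + sng [j, i] 1 | i j. True}"

definition gcl :: "(nat list \<Rightarrow>\<^sub>0 'f) \<Rightarrow> (nat list \<Rightarrow>\<^sub>0 'f::field_char_0) set" where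
  "gcl p = grel +>\<^bsub>free_algebra\<^esub> p"

lemma grassmann_model: "amodel (EE :: ('f::field_char_0, _) module) UNIV grel fmul (sng [] 1) gcl"
proof -
  interpret F: ring "free_algebra :: ('f, nat list \<Rightarrow>\<^sub>0 'f) module" by (rule ring_free)
  have "ideal (grel :: (nat list \<Rightarrow>\<^sub>0 'f) set) free_algebra" unfolding grel_def by (rule F.genideal_ideal) simp
  from ideal_amodel[OF amodel_free ring_free this psc_fmul] show ?thesis
    by (simp add: grassmann_def gcl_def[abs_def] grel_def)
qed

lemmas E_D = vmodelD[OF amodelD(1)[OF grassmann_model]]
lemmas E_A = amodelD[OF grassmann_model]

lemma gcl_carrier [simp]: "gcl p \<in> carrier EE" by (simp add: E_D(4))

lemma gcl_mult [simp]: "gcl x \<otimes>\<^bsub>EE\<^esub> gcl y = gcl (fmul x y)" by (rule E_A(7)) simp_all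

text \<open>The coefficient of the increasing monomial with letters \<open>U\<close>.\<close>

definition gcoef :: "nat set \<Rightarrow> (nat list \<Rightarrow>\<^sub>0 'f) \<Rightarrow> (unit \<Rightarrow>\<^sub>0 'f::field_char_0)" where
  "gcoef U = lext (\<lambda>w. sng () (if distinct w \<and> set w = U then sgl UNIV w else 0))"

lemma plin_gcoef: "plin (gcoef U)" by (simp add: gcoef_def plin_lext)

lemma gcoef_grel: "p \<in> grel \<Longrightarrow> gcoef U p = 0"
  unfolding gcoef_def grel_def free_algebra_def
proof (rule functional_genideal[OF monoid_words])
  let ?L = "lext (\<lambda>w. sng () (if distinct w \<and> set w = U then sgl UNIV w else (0::'a)))"
  fix x y :: "nat list" and s :: "nat list \<Rightarrow>\<^sub>0 'a"
  assume "s \<in> {sng [i, j] 1 + sng [j, i] 1 | i j. True}"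
  then obtain i j where s: "s = sng [i, j] 1 + sng [j, i] 1" by blast
  have "fmul (sng x 1) (fmul s (sng y 1)) = sng (x @ i # j # y) 1 + sng (x @ j # i # y) 1"
    by (simp add: s plin_add[OF plin_fmul(1)] plin_add[OF plin_fmul(2)])
  then have "?L (fmul (sng x 1) (fmul s (sng y 1))) = 0"
    by (simp add: plin_add[OF plin_lext]) (auto simp: sgl_swap[of i j x y] insert_commute single_add[symmetric])
  then show "?L (sng x 1 \<otimes>\<^bsub>monoid_algebra \<lparr>carrier = UNIV, mult = (@), one = []\<rparr>\<^esub>
      (s \<otimes>\<^bsub>monoid_algebra \<lparr>carrier = UNIV, mult = (@), one = []\<rparr>\<^esub> sng y 1)) = 0"
    by (simp add: free_algebra_def)
qed auto

definition ecoef :: "nat set \<Rightarrow> (nat list \<Rightarrow>\<^sub>0 'f) set \<Rightarrow> 'f::field_char_0" where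
  "ecoef U X = lk (gcoef U (SOME p. gcl p = X)) ()"

lemma ecoef: "ecoef U (gcl p) = lk (gcoef U p) ()"
proof -
  have "gcl (SOME q. gcl q = gcl p) = gcl p" by (rule someI[of "\<lambda>q. gcl q = gcl p"]) simp
  then have "(SOME q. gcl q = gcl p) - p \<in> grel" using E_D(8) by blast
  then have "gcoef U (SOME q. gcl q = gcl p) - gcoef U p = 0"
    unfolding plin_diff[OF plin_gcoef, symmetric] by (rule gcoef_grel)
  then show ?thesis by (simp add: ecoef_def)
qed

lemma monoid_grassmann: "monoid EE"
proof (rule monoidI)
  show "\<And>x y. x \<in> carrier EE \<Longrightarrow> y \<in> carrier EE \<Longrightarrow> x \<otimes>\<^bsub>EE\<^esub> y \<in> carrier EE"
    "\<one>\<^bsub>EE\<^esub> \<in> carrier EE" "\<And>x. x \<in> carrier EE \<Longrightarrow> \<one>\<^bsub>EE\<^esub> \<otimes>\<^bsub>EE\<^esub> x = x" "\<And>x. x \<in> carrier EE \<Longrightarrow> x \<otimes>\<^bsub>EE\<^esub> \<one>\<^bsub>EE\<^esub> = x"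
    unfolding E_D(4) by (auto simp: E_A(3) E_A(7))
  show "\<And>x y z. x \<in> carrier EE \<Longrightarrow> y \<in> carrier EE \<Longrightarrow> z \<in> carrier EE \<Longrightarrow>
      x \<otimes>\<^bsub>EE\<^esub> y \<otimes>\<^bsub>EE\<^esub> z = x \<otimes>\<^bsub>EE\<^esub> (y \<otimes>\<^bsub>EE\<^esub> z)"
    unfolding E_D(4) by (auto simp: E_A(7) fmul_assoc)
qed

text \<open>The product of the coefficients at e_U and e_U' is bilinear, so it defines a functional
  on the tensor square. Applied to the value of \<open>g\<close> at tensors of generators and units
  it returns \<open>sgsum g U U'\<close>, because a word in anticommuting generators is its sign
  times the increasing monomial.\<close>

lemma tensor_square_identity:
  fixes g :: "nat list \<Rightarrow>\<^sub>0 'f::field_char_0"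
  assumes g: "multilinear r g" and id: "is_identity (tensor_product grassmann grassmann) g"
    and U: "U \<subseteq> {1..r}" "U' \<subseteq> {1..r}"
  shows "sgsum g U U' = 0"
proof -
  let ?G = "(EE :: ('f, _) module) \<times>\<times> (EE :: ('f, _) module)"
  let ?M = "monoid_algebra ?G :: ('f, _) module"
  let ?Q = "{p :: _ \<Rightarrow>\<^sub>0 'f. ks p \<subseteq> carrier ?G}"
  let ?\<Lambda> = "lext (\<lambda>x. sng () (ecoef U (fst x) * ecoef U' (snd x) :: 'f))"
  have G: "monoid ?G" by (rule DirProd_monoid[OF monoid_grassmann monoid_grassmann])
  interpret G: monoid ?G by (rule G)
  have cG: "carrier ?G = range gcl \<times> range gcl" by (simp add: DirProd_def E_D(4))
  have mG: "(gcl a, gcl b) \<otimes>\<^bsub>?G\<^esub> (gcl c, gcl d) = (gcl (fmul a c), gcl (fmul b d))" for a b c d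
    by (simp add: mult_DirProd E_A(7))
  have R: "ring ?M" by (rule ring_monoid_algebra[OF G])
  have A: "amodel ?M ?Q {0} (\<lambda>x y. x \<otimes>\<^bsub>?M\<^esub> y) (sng \<one>\<^bsub>?G\<^esub> 1) (\<lambda>x. x)" by (rule amodel_monoid_algebra[OF G])
  define S where "S = {sng (a \<oplus>\<^bsub>EE\<^esub> a', b) 1 - sng (a, b) 1 - sng (a', b) (1::'f) | a a' b.
             a \<in> carrier EE \<and> a' \<in> carrier EE \<and> b \<in> carrier EE} \<union>
          {sng (a, b \<oplus>\<^bsub>EE\<^esub> b') 1 - sng (a, b) 1 - sng (a, b') 1 | a b b'.
             a \<in> carrier EE \<and> b \<in> carrier EE \<and> b' \<in> carrier EE} \<union>
          {sng (c \<odot>\<^bsub>EE\<^esub> a, b) 1 - sng (a, b) c | c a b. a \<in> carrier EE \<and> b \<in> carrier EE} \<union>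
          {sng (a, c \<odot>\<^bsub>EE\<^esub> b) 1 - sng (a, b) c | c a b. a \<in> carrier EE \<and> b \<in> carrier EE}"
  have Sf: "s \<in> S \<Longrightarrow> (\<exists>p p' q. s = sng (gcl (p + p'), gcl q) 1 - sng (gcl p, gcl q) 1 - sng (gcl p', gcl q) 1)
      \<or> (\<exists>p q q'. s = sng (gcl p, gcl (q + q')) 1 - sng (gcl p, gcl q) 1 - sng (gcl p, gcl q') 1)
      \<or> (\<exists>c p q. s = sng (gcl (psc c p), gcl q) 1 - sng (gcl p, gcl q) c)
      \<or> (\<exists>c p q. s = sng (gcl p, gcl (psc c q)) 1 - sng (gcl p, gcl q) c)" for s
  proof -
    assume s: "s \<in> S"
    consider (1) a a' b where "a \<in> carrier EE" "a' \<in> carrier EE" "b \<in> carrier EE" "s = sng (a \<oplus>\<^bsub>EE\<^esub> a', b) 1 - sng (a, b) 1 - sng (a', b) 1"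
      | (2) a b b' where "a \<in> carrier EE" "b \<in> carrier EE" "b' \<in> carrier EE" "s = sng (a, b \<oplus>\<^bsub>EE\<^esub> b') 1 - sng (a, b) 1 - sng (a, b') 1"
      | (3) c a b where "a \<in> carrier EE" "b \<in> carrier EE" "s = sng (c \<odot>\<^bsub>EE\<^esub> a, b) 1 - sng (a, b) c"
      | (4) c a b where "a \<in> carrier EE" "b \<in> carrier EE" "s = sng (a, c \<odot>\<^bsub>EE\<^esub> b) 1 - sng (a, b) c"
      using s unfolding S_def by (elim UnE CollectE exE conjE) blast+
    then show ?thesis
    proof cases
      case 1
      then obtain p p' q where "a = gcl p" "a' = gcl p'" "b = gcl q" unfolding E_D(4) by blast
      then have "s = sng (gcl (p + p'), gcl q) 1 - sng (gcl p, gcl q) 1 - sng (gcl p', gcl q) 1"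
        using 1(4) E_D(6)[of p p'] by simp
      then show ?thesis by blast
    next
      case 2
      then obtain p q q' where "a = gcl p" "b = gcl q" "b' = gcl q'" unfolding E_D(4) by blast
      then have "s = sng (gcl p, gcl (q + q')) 1 - sng (gcl p, gcl q) 1 - sng (gcl p, gcl q') 1"
        using 2(4) E_D(6)[of q q'] by simp
      then show ?thesis by blast
    next
      case 3
      then obtain p q where "a = gcl p" "b = gcl q" unfolding E_D(4) by blast
      then have "s = sng (gcl (psc c p), gcl q) 1 - sng (gcl p, gcl q) c" using 3(3) E_D(7)[of p c] by simp
      then show ?thesis by blast
    next
      case 4
      then obtain p q where "a = gcl p" "b = gcl q" unfolding E_D(4) by blast
      then have "s = sng (gcl p, gcl (psc c q)) 1 - sng (gcl p, gcl q) c" using 4(3) E_D(7)[of q c] by simp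
      then show ?thesis by blast
    qed
  qed
  have SQ: "S \<subseteq> ?Q"
  proof
    fix s assume "s \<in> S"
    from Sf[OF this] show "s \<in> ?Q" by (elim disjE exE) (simp_all only: mem_Collect_eq, (rule keys_diffI | simp)+)
  qed
  have TP: "tensor_product EE EE = quot_alg ?M (Idl\<^bsub>?M\<^esub> S)" unfolding tensor_product_def S_def ..
  have I: "ideal (Idl\<^bsub>?M\<^esub> S) ?M" by (rule ring.genideal_ideal[OF R]) (use SQ in simp)
  have sc: "psc c x = (psc c (sng \<one>\<^bsub>?G\<^esub> 1)) \<otimes>\<^bsub>?M\<^esub> x" if "x \<in> ?Q" for c x
  proof -
    have "sng \<one>\<^bsub>?G\<^esub> 1 \<otimes>\<^bsub>?M\<^esub> x = x" using monoid.l_one[OF ring.is_monoid[OF R], of x] that by simp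
    then show ?thesis using plin_psc[OF plin_mult_left, of ?G c "sng \<one>\<^bsub>?G\<^esub> 1" x] by simp
  qed
  have AT: "amodel (tensor_product EE EE) ?Q (Idl\<^bsub>?M\<^esub> S) (\<lambda>x y. x \<otimes>\<^bsub>?M\<^esub> y) (sng \<one>\<^bsub>?G\<^esub> 1) (\<lambda>x. Idl\<^bsub>?M\<^esub> S +>\<^bsub>?M\<^esub> x)"
    unfolding TP by (rule ideal_amodel[OF A R I]) (rule sc)
  note DT = vmodelD[OF amodelD(1)[OF AT]]
  have vanish: "?\<Lambda> p = 0" if "p \<in> Idl\<^bsub>?M\<^esub> S" for p
  proof (rule functional_genideal[OF G SQ _ that])
    fix x y s assume "x \<in> carrier ?G" "y \<in> carrier ?G" and s: "s \<in> S"
    then obtain x1 x2 y1 y2 where xy: "x = (gcl x1, gcl x2)" "y = (gcl y1, gcl y2)" unfolding cG by blast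
    have m: "sng x 1 \<otimes>\<^bsub>?M\<^esub> (sng (gcl p, gcl q) c \<otimes>\<^bsub>?M\<^esub> sng y 1)
        = sng (gcl (fmul x1 (fmul p y1)), gcl (fmul x2 (fmul q y2))) c" for p q c
      by (simp add: xy mG)
    have l: "?\<Lambda> (sng x 1 \<otimes>\<^bsub>?M\<^esub> (sng (gcl p, gcl q) c \<otimes>\<^bsub>?M\<^esub> sng y 1))
        = sng () (c * (lk (gcoef U (fmul x1 (fmul p y1))) () * lk (gcoef U' (fmul x2 (fmul q y2))) ()))" for p q c
      unfolding m by (simp add: ecoef)
    have pd: "?\<Lambda> (sng x 1 \<otimes>\<^bsub>?M\<^esub> ((a - b) \<otimes>\<^bsub>?M\<^esub> sng y 1))
        = ?\<Lambda> (sng x 1 \<otimes>\<^bsub>?M\<^esub> (a \<otimes>\<^bsub>?M\<^esub> sng y 1)) - ?\<Lambda> (sng x 1 \<otimes>\<^bsub>?M\<^esub> (b \<otimes>\<^bsub>?M\<^esub> sng y 1))" for a b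
      by (simp only: plin_diff[OF plin_mult_left] plin_diff[OF plin_mult_right] plin_diff[OF plin_lext])
    note pl = plin_add[OF plin_fmul(1)] plin_add[OF plin_fmul(2)] plin_psc[OF plin_fmul(1)] plin_psc[OF plin_fmul(2)]
      plin_add[OF plin_gcoef] plin_psc[OF plin_gcoef]
    from Sf[OF s] show "?\<Lambda> (sng x 1 \<otimes>\<^bsub>?M\<^esub> (s \<otimes>\<^bsub>?M\<^esub> sng y 1)) = 0"
      by (elim disjE exE) (simp_all only: pd l pl lookup_add lk_psc single_diff[symmetric], simp_all add: algebra_simps)
  qed
  define q where "q = (\<lambda>i. sng (gcl (sng (if i \<in> U then [i] else []) (1::'f)), gcl (sng (if i \<in> U' then [i] else []) (1::'f))) (1::'f))"
  have qQ: "q i \<in> ?Q" for i by (simp add: q_def cG)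
  have pr: "mprod (\<lambda>x y. x \<otimes>\<^bsub>?M\<^esub> y) (sng \<one>\<^bsub>?G\<^esub> 1) q w
      = sng (gcl (sng (filter (\<lambda>a. a \<in> U) w) 1), gcl (sng (filter (\<lambda>a. a \<in> U') w) 1)) 1" for w
    by (induction w) (simp_all add: mprod_def q_def mG E_A(3))
  let ?a = "\<lambda>i. Idl\<^bsub>?M\<^esub> S +>\<^bsub>?M\<^esub> q i"
  have "nc_eval (tensor_product EE EE) ?a g = \<zero>\<^bsub>tensor_product EE EE\<^esub>"
  proof (rule id[unfolded is_identity_def, rule_format])
    show "?a i \<in> carrier (tensor_product EE EE)" for i unfolding DT(4) using qQ by blast
  qed
  then have "lext (mprod (\<lambda>x y. x \<otimes>\<^bsub>?M\<^esub> y) (sng \<one>\<^bsub>?G\<^esub> 1) q) g \<in> Idl\<^bsub>?M\<^esub> S"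
  proof -
    assume e: "nc_eval (tensor_product EE EE) ?a g = \<zero>\<^bsub>tensor_product EE EE\<^esub>"
    have "ks (lext (mprod (\<lambda>x y. x \<otimes>\<^bsub>?M\<^esub> y) (sng \<one>\<^bsub>?G\<^esub> 1) q) g) \<subseteq> carrier ?G"
      by (rule order_trans[OF keys_lext UN_least]) (unfold pr, simp)
    then show ?thesis
      using e DT(8)[of "lext (mprod (\<lambda>x y. x \<otimes>\<^bsub>?M\<^esub> y) (sng \<one>\<^bsub>?G\<^esub> 1) q) g" 0]
      unfolding amodel_nc_eval[OF AT qQ] DT(5) by (simp del: mult_monoid_algebra)
  qed
  from vanish[OF this] have "?\<Lambda> (lext (mprod (\<lambda>x y. x \<otimes>\<^bsub>?M\<^esub> y) (sng \<one>\<^bsub>?G\<^esub> 1) q) g) = 0" .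
  then have "0 = lk (\<Sum>w\<in>ks g. psc (lk g w) (?\<Lambda> (mprod (\<lambda>x y. x \<otimes>\<^bsub>?M\<^esub> y) (sng \<one>\<^bsub>?G\<^esub> 1) q w))) ()"
    by (simp only: lext_def[of "mprod _ _ q"] plin_sum[OF plin_lext] plin_psc[OF plin_lext] lookup_zero)
  also have "\<dots> = (\<Sum>w\<in>ks g. lk g w * (sgl U w * sgl U' w))"
    unfolding lookup_sum
  proof (rule sum.cong[OF refl])
    fix w assume "w \<in> ks g"
    then have w: "distinct w" "set w = {1..r}" using g by (auto simp: multilinear_def)
    have c: "lk (gcoef V (sng (filter (\<lambda>a. a \<in> V) w) 1)) () = (sgl V w :: 'f)" if "V \<subseteq> {1..r}" for V
    proof -
      have "set (filter (\<lambda>a. a \<in> V) w) = V" using that w(2) by auto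
      then show ?thesis using w(1) by (simp add: gcoef_def sgl_filter)
    qed
    show "lk (psc (lk g w) (?\<Lambda> (mprod (\<lambda>x y. x \<otimes>\<^bsub>?M\<^esub> y) (sng \<one>\<^bsub>?G\<^esub> 1) q w))) () = lk g w * (sgl U w * sgl U' w)"
      unfolding pr by (simp add: ecoef c[OF U(1)] c[OF U(2)])
  qed
  finally show ?thesis by (simp add: sgsum_def)
qed

section \<open>Evaluation of multilinear polynomials at words\<close>

abbreviation mp :: "(nat \<Rightarrow> ('v list \<Rightarrow>\<^sub>0 'f)) \<Rightarrow> nat list \<Rightarrow> ('v list \<Rightarrow>\<^sub>0 'f::field_char_0)" where
  "mp q \<equiv> mprod fmul (sng [] 1) q"

definition ev :: "(nat \<Rightarrow> ('v list \<Rightarrow>\<^sub>0 'f)) \<Rightarrow> (nat list \<Rightarrow>\<^sub>0 'f) \<Rightarrow> ('v list \<Rightarrow>\<^sub>0 'f::field_char_0)" where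
  "ev q = lext (mp q)"

abbreviation wev :: "(nat \<Rightarrow> 'v list) \<Rightarrow> (nat list \<Rightarrow>\<^sub>0 'f) \<Rightarrow> ('v list \<Rightarrow>\<^sub>0 'f::field_char_0)" where
  "wev z \<equiv> ev (\<lambda>i. sng (z i) 1)"

lemma plin_ev: "plin (ev q)" by (simp add: ev_def plin_lext)

lemma plin_zero: "plin (\<lambda>_. 0)" by (rule plinI) simp_all

lemma plin_sum_fun: "(\<And>i. i \<in> I \<Longrightarrow> plin (F i)) \<Longrightarrow> plin (\<lambda>x. \<Sum>i\<in>I. F i x)"
  by (rule plinI) (simp_all add: plin_add plin_psc sum.distrib pm.scale_sum_right)

lemma plin_psc_fun: "plin F \<Longrightarrow> plin (\<lambda>x. psc c (F x))"
  by (rule plinI) (simp_all add: plin_add plin_psc pm.scale_right_distrib mult.commute)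

lemma plin_span: "plin F \<Longrightarrow> (\<And>x. x \<in> X \<Longrightarrow> F x \<in> pm.span S) \<Longrightarrow> a \<in> pm.span X \<Longrightarrow> F a \<in> pm.span S"
proof -
  assume F: "plin F" and X: "\<And>x. x \<in> X \<Longrightarrow> F x \<in> pm.span S" and a: "a \<in> pm.span X"
  have "pm.subspace {x. F x \<in> pm.span S}"
    by (rule pm.subspaceI) (auto simp: plin_0[OF F] plin_add[OF F] plin_psc[OF F] intro: pm.span_zero pm.span_add pm.span_scale)
  then show ?thesis using pm.span_minimal[of X "{x. F x \<in> pm.span S}"] X a by blast
qed

lemma mp_simps: "mp q [] = sng [] 1" "mp q (a # w) = fmul (q a) (mp q w)"
  by (simp_all add: mprod_def)

lemma mp_append: "mp q (u @ w) = fmul (mp q u) (mp q w)"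
  by (induction u) (simp_all add: mp_simps fmul_assoc)

lemma mp_cong: "(\<And>i. i \<in> set w \<Longrightarrow> q i = q' i) \<Longrightarrow> mp q w = mp q' w"
  by (induction w) (simp_all add: mp_simps)

lemma mp_words: "mp (\<lambda>i. sng (z i) 1) w = sng (concat (map z w)) 1"
  by (induction w) (simp_all add: mp_simps)

lemma ev_sng: "ev q (sng w c) = psc c (mp q w)" by (simp add: ev_def)

lemma ev_cong: "(\<And>w i. w \<in> ks g \<Longrightarrow> i \<in> set w \<Longrightarrow> q i = q' i) \<Longrightarrow> ev q g = ev q' g"
  unfolding ev_def lext_def by (rule sum.cong[OF refl], rule arg_cong[where f = "psc _"], rule mp_cong) blast

lemma ev_fmul: "ev q (fmul f f') = fmul (ev q f) (ev q f')"
proof -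
  have "ev q (fmul (sng z 1) f') = fmul (ev q (sng z 1)) (ev q f')" for z
    by (rule plin_eqI[where p = f' and S = UNIV and F = "\<lambda>y. ev q (fmul (sng z 1) y)" and G = "\<lambda>y. fmul (ev q (sng z 1)) (ev q y)",
          OF plin_comp[OF plin_ev plin_fmul(2)] plin_comp[OF plin_fmul(2) plin_ev]]) (auto simp: ev_sng mp_append)
  then show ?thesis
    by (intro plin_eqI[where p = f and S = UNIV and F = "\<lambda>x. ev q (fmul x f')" and G = "\<lambda>x. fmul (ev q x) (ev q f')",
          OF plin_comp[OF plin_ev plin_fmul(1)] plin_comp[OF plin_fmul(1) plin_ev]]) auto
qed

lemma ev_rename: "ev q (ev (\<lambda>i. sng [s i] 1) g) = ev (\<lambda>i. q (s i)) g"
proof (rule plin_eqI[where p = g and S = UNIV, OF plin_comp[OF plin_ev plin_ev] plin_ev])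
  fix w :: "nat list"
  have "mp q (map s w) = mp (\<lambda>i. q (s i)) w" by (induction w) (simp_all add: mp_simps)
  moreover have "concat (map (\<lambda>i. [s i]) w) = map s w" by (induction w) auto
  ultimately show "ev q (ev (\<lambda>i. sng [s i] 1) (sng w 1)) = ev (\<lambda>i. q (s i)) (sng w 1)"
    by (simp add: ev_sng mp_words)
qed simp

lemma nc_eval_free: "nc_eval free_algebra q g = ev q g"
  using amodel_nc_eval[OF amodel_free UNIV_I, of q g] by (simp add: ev_def)

lemma shifted_product_eq:
  "shifted_product r t g = foldr (\<lambda>j y. fmul (ev (\<lambda>i. sng [j * r + i] 1) g) y) [0..<t] (sng [] 1)"
  unfolding shifted_product_def nc_eval_free by simp

lemma ev_shifted_product:
  "ev q (shifted_product r t g) = foldr (\<lambda>j y. fmul (ev (\<lambda>i. q (j * r + i)) g) y) [0..<t] (sng [] 1)"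
proof -
  have "ev q (foldr (\<lambda>j y. fmul (ev (\<lambda>i. sng [j * r + i] 1) g) y) js (sng [] 1))
      = foldr (\<lambda>j y. fmul (ev (\<lambda>i. q (j * r + i)) g) y) js (sng [] 1)" for js
    by (induction js) (simp_all add: ev_fmul ev_rename ev_sng mp_simps)
  then show ?thesis unfolding shifted_product_eq .
qed

text \<open>The expansion replaces one variable at a time by a single word.\<close>

lemma ev_span_words:
  assumes g: "multilinear r g" and q: "\<And>i. ks (q i) \<subseteq> lists L"
  shows "ev q g \<in> pm.span {wev z g | z. \<forall>i. z i \<in> lists L}"
proof -
  let ?S = "pm.span {wev z g | z. \<forall>i. z i \<in> lists L}"
  have main: "ev q g \<in> ?S"
    if "finite S" "\<And>i. ks (q i) \<subseteq> lists L" "\<And>i. i \<notin> S \<Longrightarrow> \<exists>u\<in>lists L. q i = sng u 1" for S q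
    using that
  proof (induction S arbitrary: q rule: finite_induct)
    case empty
    then have "\<forall>i. \<exists>u. u \<in> lists L \<and> q i = sng u 1" by blast
    from choice[OF this] obtain z where z: "\<And>i. z i \<in> lists L" "\<And>i. q i = sng (z i) 1" by blast
    have "q = (\<lambda>i. sng (z i) 1)" using z(2) by blast
    then show ?case using z(1) by (intro pm.span_base) blast
  next
    case (insert s S)
    have step: "ev (q(s := sng u 1)) g \<in> ?S" if u: "u \<in> lists L" for u
    proof (rule insert.IH)
      show "ks ((q(s := sng u 1)) i) \<subseteq> lists L" for i using insert.prems(1)[of i] u by auto
      show "\<exists>v\<in>lists L. (q(s := sng u 1)) i = sng v 1" if "i \<notin> S" for i
        using insert.prems(2)[of i] u that by auto
    qed
    show ?case
    proof (cases "s \<in> {1..r}")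
      case False
      have "ev q g = ev (q(s := sng [] 1)) g"
        by (rule ev_cong) (use g False in \<open>auto simp: multilinear_def\<close>)
      then show ?thesis using step[of "[]"] by simp
    next
      case True
      \<comment> \<open>The variable \<open>s\<close> occurs exactly once in every word of
        \<open>g\<close>, so the value is linear in what is substituted for it.\<close>
      have pF: "plin (\<lambda>x. ev (q(s := x)) g)"
        unfolding ev_def lext_def
      proof (intro plin_sum_fun plin_psc_fun)
        fix w assume "w \<in> ks g"
        then have "distinct w" "s \<in> set w" using g True by (auto simp: multilinear_def)
        then obtain u v where w: "w = u @ s # v" "s \<notin> set u" "s \<notin> set v" by (auto simp: in_set_conv_decomp)
        have "mp (q(s := x)) u = mp q u" "mp (q(s := x)) v = mp q v" for x
          using w(2,3) by (auto intro!: mp_cong)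
        then have "mp (q(s := x)) w = fmul (mp q u) (fmul x (mp q v))" for x
          unfolding w(1) mp_append mp_simps by simp
        then show "plin (\<lambda>x. mp (q(s := x)) w)" using plin_comp[OF plin_fmul(2) plin_fmul(1)] by simp
      qed
      have "q s = (\<Sum>u\<in>ks (q s). psc (lk (q s) u) (sng u 1))" by (rule poly_mapping_expand) auto
      then have "ev (q(s := q s)) g = ev (q(s := (\<Sum>u\<in>ks (q s). psc (lk (q s) u) (sng u 1)))) g"
        by (rule arg_cong[where f = "\<lambda>x. ev (q(s := x)) g"])
      also have "\<dots> = (\<Sum>u\<in>ks (q s). psc (lk (q s) u) (ev (q(s := sng u 1)) g))"
        by (simp only: plin_sum[OF pF] plin_psc[OF pF])
      also have "\<dots> \<in> ?S"
        using insert.prems(1)[of s] by (intro pm.span_sum pm.span_scale step) blast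
      finally show ?thesis by simp
    qed
  qed
  define q' where "q' = (\<lambda>i. if i \<in> {1..r} then q i else sng [] 1)"
  have "ev q g = ev q' g" by (rule ev_cong) (use g in \<open>auto simp: multilinear_def q'_def\<close>)
  moreover have "ev q' g \<in> ?S"
  proof (rule main[of "{1..r}"])
    show "ks (q' i) \<subseteq> lists L" for i using q[of i] by (auto simp: q'_def)
    show "\<exists>u\<in>lists L. q' i = sng u 1" if "i \<notin> {1..r}" for i
      using that by (intro bexI[of _ "[]"]) (auto simp: q'_def)
  qed simp
  ultimately show ?thesis by simp
qed

text \<open>The list holds one substitution for each factor: the factors of the shifted product have
  disjoint variables, so the substitutions vary independently.\<close>

definition PG :: "(nat list \<Rightarrow>\<^sub>0 'f) \<Rightarrow> (nat \<Rightarrow> 'v list) list \<Rightarrow> ('v list \<Rightarrow>\<^sub>0 'f::field_char_0)" where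
  "PG g zs = foldr (\<lambda>z y. fmul (wev z g) y) zs (sng [] 1)"

lemma PG_simps: "PG g [] = sng [] 1" "PG g (z # zs) = fmul (wev z g) (PG g zs)"
  by (simp_all add: PG_def)

lemma product_span:
  assumes "\<And>j. G j \<in> pm.span {wev z g | z. z \<in> Z}"
  shows "foldr (\<lambda>j y. fmul (G j) y) js (sng [] 1) \<in> pm.span {PG g zs | zs. length zs = length js \<and> set zs \<subseteq> Z}"
proof (induction js)
  case Nil
  have "PG g [] \<in> {PG g zs | zs. length zs = length [] \<and> set zs \<subseteq> Z}" by fastforce
  then show ?case unfolding PG_simps by (simp add: pm.span_base)
next
  case (Cons j js)
  let ?S = "{PG g zs | zs. length zs = length (j # js) \<and> set zs \<subseteq> Z}"
  let ?b = "foldr (\<lambda>j y. fmul (G j) y) js (sng [] 1)"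
  have 1: "fmul (wev z g) (PG g zs) \<in> pm.span ?S" if "z \<in> Z" "length zs = length js" "set zs \<subseteq> Z" for z zs
    unfolding PG_simps[symmetric] by (rule pm.span_base) (use that in force)
  have 2: "fmul (wev z g) ?b \<in> pm.span ?S" if "z \<in> Z" for z
    by (rule plin_span[where F = "fmul (wev z g)", OF plin_fmul(2) _ Cons.IH]) (use 1 that in blast)
  show ?case
    unfolding foldr.simps comp_apply
    by (rule plin_span[where F = "\<lambda>x. fmul x ?b", OF plin_fmul(1) _ assms[of j]]) (use 2 in blast)
qed


section \<open>Symmetrizers kill products of identities\<close>

lemma neg_one_power_mult: "(- 1 :: 'f::field) ^ (m * n) = (if odd m \<and> odd n then - 1 else 1)"
  by (simp add: minus_one_power_iff)

definition oddn :: "'v set \<Rightarrow> 'v list \<Rightarrow> nat" where "oddn OD u = length (filter (\<lambda>v. v \<in> OD) u)"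

lemma oddn_simps [simp]: "oddn OD [] = 0" "oddn OD (a # u) = (if a \<in> OD then Suc (oddn OD u) else oddn OD u)"
  by (simp_all add: oddn_def)

context
  fixes OD :: "'v set" and X :: "nat set" and \<chi> :: "fperm \<Rightarrow> 'f::field_char_0" and e :: 'f
  assumes chi: "pchar \<chi>" and e: "\<And>i. \<chi> (Ap (transpose (i + 1) (i + 2))) = e"
begin

abbreviation AX :: "'v list \<Rightarrow> ('v list \<Rightarrow>\<^sub>0 'f)" where "AX w \<equiv> act OD (sng w 1) (gsum (Sym X) \<chi>)"

lemma letter_block_swap:
  "{length x + 1..length x + 1 + length v} \<subseteq> X \<Longrightarrow> X \<subseteq> {1..length x + 1 + length v + length y} \<Longrightarrow>
    AX (x @ a # v @ y) = psc (e ^ length v * (if a \<in> OD then (- 1) ^ oddn OD v else 1)) (AX (x @ v @ a # y))"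
proof (induction v arbitrary: x)
  case (Cons b v)
  have "AX (x @ a # b # (v @ y)) = psc (\<chi> (Ap (transpose (length x + 1) (length x + 2)))
      * (if a \<in> OD \<and> b \<in> OD then - 1 else 1)) (AX (x @ b # a # (v @ y)))"
    by (rule act_swap[OF _ _ chi]) (use Cons.prems in auto)
  also have "AX (x @ b # a # (v @ y)) = AX ((x @ [b]) @ a # v @ y)" by simp
  also have "\<dots> = psc (e ^ length v * (if a \<in> OD then (- 1) ^ oddn OD v else 1)) (AX ((x @ [b]) @ v @ a # y))"
    by (rule Cons.IH) (use Cons.prems in auto)
  finally show ?case using e[of "length x"] by (simp add: mult_ac)
qed simp

text \<open>Exchanging two blocks costs one adjacent transposition per pair of letters, and one sign
  per pair of odd letters. Blocks therefore commute like monomials of the tensor square of the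
  Grassmann algebra, one parity coming from the number of odd letters and, if e = -1, the other from
  the length.\<close>

lemma block_swap:
  "{length x + 1..length x + length u + length v} \<subseteq> X \<Longrightarrow> X \<subseteq> {1..length x + length u + length v + length y} \<Longrightarrow>
    AX (x @ u @ v @ y) = psc (e ^ (length u * length v) * (- 1) ^ (oddn OD u * oddn OD v)) (AX (x @ v @ u @ y))"
proof (induction u arbitrary: x)
  case (Cons a u)
  have "AX ((x @ [a]) @ u @ v @ y) = psc (e ^ (length u * length v) * (- 1) ^ (oddn OD u * oddn OD v)) (AX ((x @ [a]) @ v @ u @ y))"
    by (rule Cons.IH) (use Cons.prems in auto)
  also have "AX ((x @ [a]) @ v @ u @ y) = AX (x @ a # v @ (u @ y))" by simp
  also have "\<dots> = psc (e ^ length v * (if a \<in> OD then (- 1) ^ oddn OD v else 1)) (AX (x @ v @ a # (u @ y)))"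
    by (rule letter_block_swap) (use Cons.prems in auto)
  finally show ?case by (simp add: power_add mult_ac)
qed simp

end

text \<open>Insertion sort: a letter inserted into the sorted rest passes exactly the smaller ones,
  and \<open>cs\<close> is the factor that \<open>sgl\<close> assigns to it. The exchange rule is
  asked only for words with the multiset M, since the positions available for an exchange depend on
  the total length.\<close>

lemma sort_sign:
  fixes F :: "nat list \<Rightarrow> ('b \<Rightarrow>\<^sub>0 'f::field_char_0)"
  defines "s \<equiv> \<lambda>U a b. if a \<in> U \<and> b \<in> U then - 1 else (1::'f)"
  assumes F: "\<And>w1 a b w2. mset (w1 @ a # b # w2) = M \<Longrightarrow> F (w1 @ a # b # w2) = psc (s U a b * s U' a b) (F (w1 @ b # a # w2))"
  shows "distinct w \<Longrightarrow> mset w = M \<Longrightarrow> F w = psc (sgl U w * sgl U' w) (F (sorted_list_of_multiset M))"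
proof -
  define cs where "cs = (\<lambda>(U :: nat set) a v. if a \<in> U then (- 1) ^ length (filter (\<lambda>b. b \<in> U \<and> b < a) v) else (1::'f))"
  have ins: "F (w1 @ a # v) = psc (cs U a v * cs U' a v) (F (w1 @ insort a v))"
    if "sorted v" "a \<notin> set v" "mset (w1 @ a # v) = M" for w1 a v
    using that
  proof (induction v arbitrary: w1)
    case (Cons b v)
    show ?case
    proof (cases "a \<le> b")
      case True
      then have "filter (\<lambda>c. c \<in> V \<and> c < a) (b # v) = []" for V
        using Cons.prems(1) by (auto simp: filter_empty_conv)
      then have "cs V a (b # v) = 1" for V unfolding cs_def by (simp only: list.size power_0 if_cancel)
      then show ?thesis using True by simp
    next
      case False
      then have c: "cs V a (b # v) = s V a b * cs V a v" for V by (simp add: cs_def s_def)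
      have "F (w1 @ a # b # v) = psc (s U a b * s U' a b) (F (w1 @ b # a # v))" by (rule F[OF Cons.prems(3)])
      also have "F (w1 @ b # a # v) = psc (cs U a v * cs U' a v) (F ((w1 @ [b]) @ insort a v))"
        using Cons.IH[of "w1 @ [b]"] Cons.prems by (simp add: add_mset_commute)
      finally show ?thesis using False by (simp add: c mult_ac)
    qed
  qed (simp add: cs_def)
  have main: "F (w1 @ w) = psc (sgl U w * sgl U' w) (F (w1 @ sort w))" if "distinct w" "mset (w1 @ w) = M" for w1 w
    using that
  proof (induction w arbitrary: w1)
    case (Cons a w)
    have c: "cs V a (sort w) = cs V a w" for V
    proof -
      have "mset (filter (\<lambda>b. b \<in> V \<and> b < a) (sort w)) = mset (filter (\<lambda>b. b \<in> V \<and> b < a) w)" by simp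
      then have "length (filter (\<lambda>b. b \<in> V \<and> b < a) (sort w)) = length (filter (\<lambda>b. b \<in> V \<and> b < a) w)"
        by (rule mset_eq_length)
      then show ?thesis unfolding cs_def by (simp only:)
    qed
    have "F (w1 @ a # w) = psc (sgl U w * sgl U' w) (F (w1 @ a # sort w))"
      using Cons.IH[of "w1 @ [a]"] Cons.prems by simp
    also have "F (w1 @ a # sort w) = psc (cs U a w * cs U' a w) (F (w1 @ insort a (sort w)))"
      unfolding c[symmetric] by (rule ins) (use Cons.prems in auto)
    finally show ?case by (simp add: cs_def mult_ac)
  qed simp
  assume "distinct w" "mset w = M"
  then show "F w = psc (sgl U w * sgl U' w) (F (sorted_list_of_multiset M))"
    using main[of w "[]"] by (auto simp: sorted_list_of_multiset_mset)
qed

text \<open>The part of being an identity of the tensor square that the argument uses. Unlike the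
  identity itself, it is a finite system of linear equations on the coefficients.\<close>

definition balanced :: "nat \<Rightarrow> (nat list \<Rightarrow>\<^sub>0 'f::field_char_0) \<Rightarrow> bool" where
  "balanced r g \<longleftrightarrow> multilinear r g \<and> (\<forall>U\<subseteq>{1..r}. \<forall>U'\<subseteq>{1..r}. sgsum g U U' = 0)"

lemma balanced_sgsum: "balanced r g \<Longrightarrow> sgsum g U U' = 0"
proof -
  assume b: "balanced r g"
  have "sgl (V \<inter> {1..r}) w = (sgl V w :: 'a)" if "w \<in> ks g" for V w
    using b that by (intro sgl_cong) (auto simp: balanced_def multilinear_def)
  then have "sgsum g U U' = sgsum g (U \<inter> {1..r}) (U' \<inter> {1..r})" unfolding sgsum_def by (intro sum.cong) auto
  then show ?thesis using b by (simp add: balanced_def)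
qed

definition bl :: "nat \<Rightarrow> (nat \<Rightarrow> 'v list) \<Rightarrow> nat" where "bl r z = (\<Sum>i\<in>{1..r}. length (z i))"

lemma length_block: "length (concat (map z w)) = (\<Sum>i\<in>#mset w. length (z i))"
  by (induction w) auto

lemma length_block_multilinear: "distinct w \<Longrightarrow> set w = {1..r} \<Longrightarrow> length (concat (map z w)) = bl r z"
  by (simp add: length_block bl_def sum_unfold_sum_mset flip: mset_set_set)

lemma wev_TL:
  fixes g :: "nat list \<Rightarrow>\<^sub>0 'f::field_char_0"
  assumes g: "multilinear r g" and z: "\<And>i. set (z i) \<subseteq> L"
  shows "wev z g \<in> TL (bl r z) L"
proof -
  have "ks (mp (\<lambda>i. sng (z i) (1::'f)) w) \<subseteq> Wd (bl r z) L" if "w \<in> ks g" for w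
    unfolding mp_words using g that z length_block_multilinear[of w r z] by (auto simp: multilinear_def Wd_def)
  then show ?thesis unfolding ev_def TL_def using keys_lext[of "mp (\<lambda>i. sng (z i) (1::'f))" g] by blast
qed

definition pl :: "nat \<Rightarrow> (nat \<Rightarrow> 'v list) list \<Rightarrow> nat" where "pl r zs = sum_list (map (bl r) zs)"

lemma PG_TL: "multilinear r g \<Longrightarrow> (\<And>z i. z \<in> set zs \<Longrightarrow> set (z i) \<subseteq> L) \<Longrightarrow> PG g zs \<in> TL (pl r zs) L"
proof (induction zs)
  case Nil show ?case by (simp add: PG_simps pl_def TL_def Wd_def)
next
  case (Cons z zs)
  have "PG g (z # zs) \<in> TL (bl r z + pl r zs) L"
    unfolding PG_simps by (intro fmul_TL wev_TL Cons) (use Cons.prems in auto)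
  then show ?case by (simp add: pl_def)
qed

text \<open>When all positions of the block lie in X, the terms of \<open>g\<close> differ from the
  sorted one only by two signs, and their sum is a multiple of \<open>sgsum g U U'\<close>.\<close>

lemma block_killed:
  fixes g :: "nat list \<Rightarrow>\<^sub>0 'f::field_char_0"
  assumes g: "balanced r g" and X: "{length x + 1..length x + bl r z} \<subseteq> X" "X \<subseteq> {1..length x + bl r z + length y}"
    and chi: "pchar \<chi>" and e: "\<And>i. \<chi> (Ap (transpose (i + 1) (i + 2))) = e" "e = 1 \<or> e = - 1"
  shows "act OD (fmul (sng x 1) (fmul (wev z g) (sng y 1))) (gsum (Sym X) \<chi>) = 0"
proof -
  define F where "F = (\<lambda>w. act OD (sng (x @ concat (map z w) @ y) 1) (gsum (Sym X) \<chi>))"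
  define U where "U = {i. odd (oddn OD (z i))}"
  \<comment> \<open>For the symmetrizer, e = 1, lengths produce no sign and this set is
    empty.\<close>
  define U' where "U' = {i. e = - 1 \<and> odd (length (z i))}"
  have ml: "multilinear r g" using g by (simp add: balanced_def)
  have swap: "F (w1 @ a # b # w2) = psc ((if a \<in> U \<and> b \<in> U then - 1 else 1) * (if a \<in> U' \<and> b \<in> U' then - 1 else 1))
      (F (w1 @ b # a # w2))" if M: "mset (w1 @ a # b # w2) = mset_set {1..r}" for w1 a b w2
  proof -
    let ?x = "x @ concat (map z w1)" and ?y = "concat (map z w2) @ y"
    have "length (concat (map z (w1 @ a # b # w2))) = bl r z"
      unfolding length_block M bl_def by (simp add: sum_unfold_sum_mset)
    then have len: "length (concat (map z w1)) + length (z a) + length (z b) + length (concat (map z w2)) = bl r z"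
      by simp
    have "act OD (sng (?x @ z a @ z b @ ?y) 1) (gsum (Sym X) \<chi>)
        = psc (e ^ (length (z a) * length (z b)) * (- 1) ^ (oddn OD (z a) * oddn OD (z b)))
          (act OD (sng (?x @ z b @ z a @ ?y) 1) (gsum (Sym X) \<chi>))"
    proof (rule block_swap[OF chi e(1)])
      show "{length ?x + 1..length ?x + length (z a) + length (z b)} \<subseteq> X"
        by (rule order_trans[OF _ X(1)]) (use len in auto)
      show "X \<subseteq> {1..length ?x + length (z a) + length (z b) + length ?y}"
        using X(2) len by (auto simp del: length_concat)
    qed
    moreover have "e ^ (length (z a) * length (z b)) = (if a \<in> U' \<and> b \<in> U' then - 1 else 1)"
      using e(2) by (auto simp: U'_def neg_one_power_mult)
    moreover have "(- 1) ^ (oddn OD (z a) * oddn OD (z b)) = (if a \<in> U \<and> b \<in> U then - 1 else (1::'f))"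
      by (simp add: U_def neg_one_power_mult)
    ultimately show ?thesis unfolding F_def by (simp add: mult.commute)
  qed
  have sorted: "F w = psc (sgl U w * sgl U' w) (F (sorted_list_of_multiset (mset_set {1..r})))" if "w \<in> ks g" for w
    by (rule sort_sign[OF swap]) (use ml that in \<open>auto simp: multilinear_def mset_set_set[symmetric]\<close>)
  have "act OD (fmul (sng x 1) (fmul (wev z g) (sng y 1))) (gsum (Sym X) \<chi>)
      = (\<Sum>w\<in>ks g. psc (lk g w) (F w))"
    unfolding ev_def lext_def mp_words
    by (simp only: plin_sum[OF plin_fmul(1)] plin_psc[OF plin_fmul(1)] plin_sum[OF plin_fmul(2)] plin_psc[OF plin_fmul(2)]
        plin_sum[OF plin_act_left] plin_psc[OF plin_act_left] free_algebra_sel F_def mult_1)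
  also have "\<dots> = (\<Sum>w\<in>ks g. psc (lk g w * (sgl U w * sgl U' w)) (F (sorted_list_of_multiset (mset_set {1..r}))))"
    by (rule sum.cong[OF refl]) (simp add: sorted)
  also have "\<dots> = psc (sgsum g U U') (F (sorted_list_of_multiset (mset_set {1..r})))"
    by (simp add: sgsum_def pm.scale_sum_left)
  finally show ?thesis by (simp add: balanced_sgsum[OF g])
qed

text \<open>A pigeonhole argument: fewer positions lie outside X than there are factors, so the
  block of some factor lies inside X. In the induction a block that meets the complement uses up one
  of its points and, expanded into words, joins the prefix \<open>x\<close>.\<close>

lemma product_killed:
  fixes g :: "nat list \<Rightarrow>\<^sub>0 'f::field_char_0"
  assumes g: "balanced r g" and chi: "pchar \<chi>" and e: "\<And>i. \<chi> (Ap (transpose (i + 1) (i + 2))) = e" "e = 1 \<or> e = - 1"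
  shows "X \<subseteq> {1..length x + pl r zs} \<Longrightarrow> card ({length x + 1..length x + pl r zs} - X) < length zs \<Longrightarrow>
    act OD (fmul (sng x 1) (PG g zs)) (gsum (Sym X) \<chi>) = 0"
proof (induction zs arbitrary: x)
  case (Cons z zs)
  have ml: "multilinear r g" using g by (simp add: balanced_def)
  have pl: "pl r (z # zs) = bl r z + pl r zs" by (simp add: pl_def)
  show ?case
  proof (cases "{length x + 1..length x + bl r z} \<subseteq> X")
    case True
    have "PG g zs \<in> TL (pl r zs) UNIV" by (rule PG_TL[OF ml]) simp
    then have k: "ks (PG g zs) \<subseteq> Wd (pl r zs) UNIV" by (simp add: TL_def)
    show ?thesis
      unfolding PG_simps
    proof (rule plin_eqI[where p = "PG g zs" and F = "\<lambda>y. act OD (fmul (sng x 1) (fmul (wev z g) y)) (gsum (Sym X) \<chi>)"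
            and G = "\<lambda>_. 0", OF plin_comp[OF plin_act_left plin_comp[OF plin_fmul(2) plin_fmul(2)]] plin_zero k])
      fix y assume "y \<in> Wd (pl r zs) (UNIV :: 'a set)"
      then have "length y = pl r zs" by (simp add: Wd_def)
      then show "act OD (fmul (sng x 1) (fmul (wev z g) (sng y 1))) (gsum (Sym X) \<chi>) = 0"
        using Cons.prems(1) pl by (intro block_killed[OF g True _ chi e]) (simp add: add.assoc)
    qed
  next
    case False
    then obtain i where i: "i \<in> {length x + 1..length x + bl r z} - X" by blast
    have "wev z g \<in> TL (bl r z) UNIV" by (rule wev_TL[OF ml]) simp
    then have k: "ks (wev z g) \<subseteq> Wd (bl r z) UNIV" by (simp add: TL_def)
    show ?thesis
      unfolding PG_simps
    proof (rule plin_eqI[where p = "wev z g" and F = "\<lambda>v. act OD (fmul (sng x 1) (fmul v (PG g zs))) (gsum (Sym X) \<chi>)"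
            and G = "\<lambda>_. 0", OF plin_comp[OF plin_act_left plin_comp[OF plin_fmul(2) plin_fmul(1)]] plin_zero k])
      fix v assume "v \<in> Wd (bl r z) (UNIV :: 'a set)"
      then have v: "length v = bl r z" by (simp add: Wd_def)
      have e1: "fmul (sng x 1) (fmul (sng v 1) (PG g zs)) = fmul (sng (x @ v) 1) (PG g zs)"
        unfolding fmul_assoc[symmetric] by simp
      have "act OD (fmul (sng (x @ v) 1) (PG g zs)) (gsum (Sym X) \<chi>) = 0"
      proof (rule Cons.IH)
        show "X \<subseteq> {1..length (x @ v) + pl r zs}" using Cons.prems(1) by (simp add: pl v add.assoc)
        have "insert i ({length (x @ v) + 1..length (x @ v) + pl r zs} - X) \<subseteq> {length x + 1..length x + pl r (z # zs)} - X"
          using i by (auto simp: pl v)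
        then have "card (insert i ({length (x @ v) + 1..length (x @ v) + pl r zs} - X)) \<le> card ({length x + 1..length x + pl r (z # zs)} - X)"
          by (intro card_mono) auto
        moreover have "i \<notin> {length (x @ v) + 1..length (x @ v) + pl r zs} - X" using i v by auto
        ultimately show "card ({length (x @ v) + 1..length (x @ v) + pl r zs} - X) < length zs"
          using Cons.prems(2) by simp
      qed
      then show "act OD (fmul (sng x 1) (fmul (sng v 1) (PG g zs))) (gsum (Sym X) \<chi>) = 0" unfolding e1 .
    qed
  qed
qed simp

section \<open>Shapes outside the filter\<close>

lemma gsum_Sym_conj:
  "pchar \<chi> \<Longrightarrow> dl a * gsum (Sym S) \<chi> = gsum (Sym (ap a ` S)) \<chi> * dl a"
  "pchar \<chi> \<Longrightarrow> gsum (Sym S) \<chi> * dl a = dl a * gsum (Sym (ap (- a) ` S)) \<chi>"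
proof -
  assume chi: "pchar \<chi>"
  show 1: "dl a * gsum (Sym S) \<chi> = gsum (Sym (ap a ` S)) \<chi> * dl a" for S
    using gsum_Stab_conj[OF chi, of a S "\<lambda>_. 0 :: nat"] by (simp only: Sym_eq_Stab)
  have "ap a ` ap (- a) ` S = S" by (simp add: image_image)
  then show "gsum (Sym S) \<chi> * dl a = dl a * gsum (Sym (ap (- a) ` S)) \<chi>" by (simp only: 1)
qed

lemma card_ap_image: "card (ap a ` S) = card S"
  by (rule card_image) (simp add: inj_on_def)

text \<open>Not containing the three shapes means, respectively, a second row shorter than
  \<open>b\<close>, either a first row shorter than \<open>b\<close> or fewer than \<open>b\<close>
  rows, and at most one cell in row number b - 1. In either case of the middle alternative the cells
  off the first row, or off the first column, fit into b - 1 rows of length at most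
  \<open>b\<close>.\<close>

lemma shape_outside:
  assumes fil: "is_filter_of_partitions \<Omega>" and D: "b > 0" "D 2 0 b \<in> \<Omega>" "D 1 1 b \<in> \<Omega>" "D 0 2 b \<in> \<Omega>"
    and tab: "tab Y r c \<nu>" and out: "\<nu> \<notin> \<Omega>"
  shows "card {x \<in> Y. r x \<noteq> 0} < b\<^sup>2 \<or> card {x \<in> Y. c x \<noteq> 0} < b\<^sup>2"
proof -
  interpret tableau Y r c \<nu> "TYPE(rat)" by unfold_locales fact
  have anti: "\<nu> j \<le> \<nu> i" if "i \<le> j" for i j using nu antimonoD[of \<nu> i j] that by (simp add: partitions_def)
  have nle: "\<not> \<mu> \<le> \<nu>" if "\<mu> \<in> \<Omega>" for \<mu>
    using fil that out nu unfolding is_filter_of_partitions_def by blast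
  have 1: "\<nu> 1 < b"
  proof (rule ccontr)
    assume "\<not> \<nu> 1 < b"
    then have "D 2 0 b i \<le> \<nu> i" for i using anti[of i 1] by (auto simp: D_def)
    then show False using nle[OF D(2)] by (auto simp: le_fun_def)
  qed
  have 2: "\<nu> (b - 1) \<le> 1"
  proof (rule ccontr)
    assume h: "\<not> \<nu> (b - 1) \<le> 1"
    have "D 0 2 b i \<le> \<nu> i" for i
    proof (cases "i < b")
      case True
      then have "i \<le> b - 1" by simp
      from anti[OF this] show ?thesis using h by (simp add: D_def)
    qed (simp add: D_def)
    then show False using nle[OF D(4)] by (auto simp: le_fun_def)
  qed
  have 3: "\<nu> 0 < b \<or> \<nu> (b - 1) = 0"
  proof (rule ccontr)
    assume h: "\<not> (\<nu> 0 < b \<or> \<nu> (b - 1) = 0)"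
    have "D 1 1 b i \<le> \<nu> i" for i
    proof (cases "i < b")
      case True
      then have "i \<le> b - 1" by simp
      from anti[OF this] show ?thesis using h by (cases "i = 0") (auto simp: D_def)
    qed (use D(1) in \<open>auto simp: D_def\<close>)
    then show False using nle[OF D(3)] by (auto simp: le_fun_def)
  qed
  have box: "card S < b\<^sup>2" if S: "S \<subseteq> Y" "\<And>x. x \<in> S \<Longrightarrow> r x < b - 1 \<and> c x < b" for S
  proof -
    have "card S = card ((\<lambda>x. (r x, c x)) ` S)"
    proof (rule card_image[symmetric, OF inj_onI])
      fix x y assume "x \<in> S" "y \<in> S" "(r x, c x) = (r y, c y)"
      then show "x = y" using inj[of x y] S(1) by auto
    qed
    also have "\<dots> \<le> card ({..<b - 1} \<times> {..<b})" by (rule card_mono) (use S in auto)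
    also have "\<dots> = (b - 1) * b" by simp
    also have "\<dots> < b\<^sup>2" using D(1) by (simp add: power2_eq_square)
    finally show ?thesis .
  qed
  from 3 show ?thesis
  proof
    assume z: "\<nu> (b - 1) = 0"
    have "card {x \<in> Y. r x \<noteq> 0} < b\<^sup>2"
    proof (rule box)
      fix x assume x: "x \<in> {x \<in> Y. r x \<noteq> 0}"
      then have "c x < \<nu> (r x)" using cellsI by blast
      then show "r x < b - 1 \<and> c x < b" using anti[of "b - 1" "r x"] anti[of 1 "r x"] x z 1 by (cases "r x < b - 1") auto
    qed auto
    then show ?thesis ..
  next
    assume z: "\<nu> 0 < b"
    have "card {x \<in> Y. c x \<noteq> 0} < b\<^sup>2"
    proof (rule box)
      fix x assume x: "x \<in> {x \<in> Y. c x \<noteq> 0}"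
      then have "c x < \<nu> (r x)" using cellsI by blast
      then show "r x < b - 1 \<and> c x < b" using anti[of "b - 1" "r x"] anti[of 0 "r x"] x z 2 by (cases "r x < b - 1") auto
    qed auto
    then show ?thesis ..
  qed
qed

text \<open>The full symmetric group of one colour class is a subgroup, so its symmetrizer splits
  off as a factor.\<close>

lemma gsum_Sym_Stab:
  assumes "finite Y" "pchar \<chi>" "S \<subseteq> Y" "\<And>x y. x \<in> S \<Longrightarrow> y \<in> S \<Longrightarrow> f x = f y"
  shows "\<exists>k. gsum (Stab Y f) \<chi> = psc k (gsum (Sym S) \<chi> * gsum (Stab Y f) \<chi>)"
proof -
  have fS: "finite S" using assms(1,3) finite_subset by blast
  have "f (ap a x) = f x" if "a \<in> Sym S" for a x
    using assms(4)[of "ap a x" x] Sym_in[OF that, of x] Sym_out[OF that, of x] by (cases "x \<in> S") auto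
  then have sub: "Sym S \<subseteq> Stab Y f" using Sym_mono[OF assms(3)] by (auto simp: Stab_def)
  show ?thesis
    using gsum_mult_sub(1)[OF subgrp_Sym[OF fS] subgrp_Stab[OF assms(1)] sub assms(2)] subgrp_card[OF subgrp_Sym[OF fS]]
    by (intro exI[of _ "inverse (of_nat (card (Sym S)))"]) simp
qed

context fin_filter
begin

text \<open>Symmetrizers and antisymmetrizers that miss fewer than \<open>t\<close> positions; the
  additive form of the condition avoids truncated subtraction.\<close>

definition Sy :: "nat \<Rightarrow> nat \<Rightarrow> (nat set \<times> (fperm \<Rightarrow> 'f)) set" where
  "Sy t n = {(X, \<chi>). X \<subseteq> {1..n} \<and> n < card X + t \<and> (\<chi> = (\<lambda>_. 1) \<or> \<chi> = psgn)}"

text \<open>A permutation to the right of the symmetrizer is moved in front of it, which replaces S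
  by a translate of the same size.\<close>

lemma sandwich:
  assumes y: "y \<in> TL n B" and x: "x \<in> GA {1..n}" and z: "z \<in> GA {1..n}" and S: "(S, \<chi>) \<in> Sy t n"
  shows "act V1 y (x * gsum (Sym S) \<chi> * z)
    \<in> pm.span {act V1 (act V1 y x) (gsum (Sym X) \<chi>) | x X \<chi>. x \<in> GA {1..n} \<and> (X, \<chi>) \<in> Sy t n}" (is "_ \<in> pm.span ?S")
proof -
  have chi: "pchar \<chi>" using S by (auto simp: Sy_def)
  have yU: "y \<in> TL n UNIV" by (rule TL_mono[OF subset_UNIV y])
  have "act V1 y (x * gsum (Sym S) \<chi> * dl a) \<in> ?S" if a: "a \<in> Sym {1..n}" for a
  proof -
    let ?X = "ap (- a) ` S"
    have X: "(?X, \<chi>) \<in> Sy t n" using S Sym_in[OF Sym_uminus[OF a]] by (auto simp: Sy_def card_ap_image)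
    have xa: "x * dl a \<in> GA {1..n}" by (intro GA_mult x GA_dl a)
    have g: "gsum (Sym ?X) \<chi> \<in> GA {1..n}" using X by (intro GA_gsum) (auto simp: Sy_def intro: Sym_mono)
    have "x * gsum (Sym S) \<chi> * dl a = x * dl a * gsum (Sym ?X) \<chi>"
      by (simp only: mult.assoc gsum_Sym_conj(2)[OF chi])
    then have "act V1 y (x * gsum (Sym S) \<chi> * dl a) = act V1 (act V1 y (x * dl a)) (gsum (Sym ?X) \<chi>)"
      by (simp only: act_mult[OF yU xa g])
    then show ?thesis using X xa by blast
  qed
  then have s: "act V1 y (x * gsum (Sym S) \<chi> * dl a) \<in> pm.span ?S" if "a \<in> Sym {1..n}" for a
    using that by (intro pm.span_base)
  have "x * gsum (Sym S) \<chi> * z = (\<Sum>a\<in>Sym {1..n}. psc (lk z a) (x * gsum (Sym S) \<chi> * dl a))"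
    by (subst (1) GA_expand[OF z]) (simp_all only: finite_atLeastAtMost plin_sum[OF plin_times(1)] plin_psc[OF plin_times(1)])
  then have "act V1 y (x * gsum (Sym S) \<chi> * z) = (\<Sum>a\<in>Sym {1..n}. psc (lk z a) (act V1 y (x * gsum (Sym S) \<chi> * dl a)))"
    by (simp only: plin_sum[OF plin_act_right] plin_psc[OF plin_act_right])
  then show ?thesis by (simp only:) (intro pm.span_sum pm.span_scale s)
qed

text \<open>A Young symmetrizer has the symmetrizer of its first row and the antisymmetrizer of its
  first column as factors; for a shape outside the filter, one of the two covers all but fewer than
  b^2 positions.\<close>

lemma kappa_span:
  assumes D: "b > 0" "D 2 0 b \<in> \<Omega>" "D 1 1 b \<in> \<Omega>" "D 0 2 b \<in> \<Omega>" and y: "y \<in> TL n B"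
  shows "kappa y \<in> pm.span {act V1 (act V1 y x) (gsum (Sym X) \<chi>) | x X \<chi>. x \<in> GA {1..n} \<and> (X, \<chi>) \<in> Sy (b\<^sup>2) n}"
    (is "_ \<in> pm.span ?S")
proof -
  have "act V1 y (eidem \<nu>) \<in> pm.span ?S" if nuO: "\<nu> \<in> pn n - \<Omega>" for \<nu>
  proof -
    obtain r c where rc: "tab {1..n} r c \<nu>" using tab_ex nuO by blast
    interpret tableau "{1..n}" r c \<nu> "TYPE('f)" by unfold_locales fact
    have G: "Rs {1..n} r \<in> GA {1..n}" "Cs {1..n} c \<in> GA {1..n}" by (rule GA_Stab)+
    have key: "act V1 y (x * u * z) \<in> pm.span ?S" if x: "x \<in> GA {1..n}" and z: "z \<in> GA {1..n}" for x z
    proof -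
      have big: "n < card {x \<in> {1..n}. f x = (0::nat)} + b\<^sup>2" if "card {x \<in> {1..n}. f x \<noteq> 0} < b\<^sup>2" for f
      proof -
        have "card {1..n} \<le> card ({x \<in> {1..n}. f x = 0} \<union> {x \<in> {1..n}. f x \<noteq> 0})" by (rule card_mono) auto
        also have "\<dots> \<le> card {x \<in> {1..n}. f x = 0} + card {x \<in> {1..n}. f x \<noteq> 0}" by (rule card_Un_le)
        finally have "n \<le> card {x \<in> {1..n}. f x = 0} + card {x \<in> {1..n}. f x \<noteq> 0}" by simp
        then show ?thesis using that by simp
      qed
      from shape_outside[OF fil D rc] nuO
      consider "card {x \<in> {1..n}. r x \<noteq> 0} < b\<^sup>2" | "card {x \<in> {1..n}. c x \<noteq> 0} < b\<^sup>2" by blast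
      then show ?thesis
      proof cases
        case 1
        let ?X = "{x \<in> {1..n}. r x = 0}"
        have X: "(?X, (\<lambda>_. 1)) \<in> Sy (b\<^sup>2) n" using big[OF 1] by (auto simp: Sy_def)
        have "\<exists>k. Rs {1..n} r = psc k (gsum (Sym ?X) (\<lambda>_. 1) * Rs {1..n} r :: fperm \<Rightarrow>\<^sub>0 'f)"
          by (rule gsum_Sym_Stab) auto
        then obtain k where k: "Rs {1..n} r = psc k (gsum (Sym ?X) (\<lambda>_. 1) * Rs {1..n} r :: fperm \<Rightarrow>\<^sub>0 'f)" ..
        have "x * u * z = x * Rs {1..n} r * Cs {1..n} c * z" by (simp only: u_def mult.assoc)
        also have "\<dots> = x * psc k (gsum (Sym ?X) (\<lambda>_. 1) * Rs {1..n} r) * Cs {1..n} c * z"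
          by (rule arg_cong[OF k, of "\<lambda>v. x * v * Cs {1..n} c * z"])
        also have "\<dots> = psc k (x * gsum (Sym ?X) (\<lambda>_. 1) * (Rs {1..n} r * Cs {1..n} c * z))"
          by (simp only: psc_mult mult.assoc)
        finally have "act V1 y (x * u * z) = psc k (act V1 y (x * gsum (Sym ?X) (\<lambda>_. 1) * (Rs {1..n} r * Cs {1..n} c * z)))"
          by (simp only: plin_psc[OF plin_act_right])
        then show ?thesis
          using sandwich[OF y x GA_mult[OF GA_mult[OF G] z] X] by (simp only: pm.span_scale)
      next
        case 2
        let ?X = "{x \<in> {1..n}. c x = 0}"
        have X: "(?X, psgn) \<in> Sy (b\<^sup>2) n" using big[OF 2] by (auto simp: Sy_def)
        have "\<exists>k. Cs {1..n} c = psc k (gsum (Sym ?X) psgn * Cs {1..n} c :: fperm \<Rightarrow>\<^sub>0 'f)"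
          by (rule gsum_Sym_Stab) auto
        then obtain k where k: "Cs {1..n} c = psc k (gsum (Sym ?X) psgn * Cs {1..n} c :: fperm \<Rightarrow>\<^sub>0 'f)" ..
        have "x * u * z = x * Rs {1..n} r * Cs {1..n} c * z" by (simp only: u_def mult.assoc)
        also have "\<dots> = x * Rs {1..n} r * psc k (gsum (Sym ?X) psgn * Cs {1..n} c) * z"
          by (rule arg_cong[OF k, of "\<lambda>v. x * Rs {1..n} r * v * z"])
        also have "\<dots> = psc k ((x * Rs {1..n} r) * gsum (Sym ?X) psgn * (Cs {1..n} c * z))"
          by (simp only: psc_mult mult.assoc)
        finally have "act V1 y (x * u * z) = psc k (act V1 y ((x * Rs {1..n} r) * gsum (Sym ?X) psgn * (Cs {1..n} c * z)))"
          by (simp only: plin_psc[OF plin_act_right])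
        then show ?thesis
          using sandwich[OF y GA_mult[OF x G(1)] GA_mult[OF G(2) z] X] by (simp only: pm.span_scale)
      qed
    qed
    have "eidem \<nu> = (eid :: fperm \<Rightarrow>\<^sub>0 'f)" by (rule eidem_eq[OF rc]) (use nuO in blast)
    then have "act V1 y (eidem \<nu>) = (\<Sum>a\<in>Sym {1..n}. act V1 y (dl a * u * psc (inverse kap) (star u * dl (- a))))"
      by (simp only: eid_expand plin_sum[OF plin_act_right])
    also have "\<dots> \<in> pm.span ?S"
      by (intro pm.span_sum key GA_dl GA_psc GA_mult GA_star Sym_uminus u_GA)
    finally show ?thesis .
  qed
  then show ?thesis unfolding kappa_TL[OF y] by (rule pm.span_sum)
qed

text \<open>The vanishing is assumed for all large X at once, so a permutation standing before the
  symmetrizer can be moved past it at the price of another large set.\<close>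

lemma kappa_killed:
  assumes D: "b > 0" "D 2 0 b \<in> \<Omega>" "D 1 1 b \<in> \<Omega>" "D 0 2 b \<in> \<Omega>" and y: "y \<in> TL n B"
    and kill: "\<And>X \<chi>. (X, \<chi>) \<in> Sy (b\<^sup>2) n \<Longrightarrow> act V1 y (gsum (Sym X) \<chi>) = 0"
  shows "kappa y = 0"
proof -
  have yU: "y \<in> TL n UNIV" by (rule TL_mono[OF subset_UNIV y])
  have "act V1 (act V1 y x) (gsum (Sym X) \<chi>) = 0" if x: "x \<in> GA {1..n}" and X: "(X, \<chi>) \<in> Sy (b\<^sup>2) n" for x X \<chi>
  proof (rule plin_eqI[where p = x and S = "Sym {1..n}" and F = "\<lambda>x. act V1 (act V1 y x) (gsum (Sym X) \<chi>)" and G = "\<lambda>_. 0",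
        OF plin_comp[OF plin_act_left plin_act_right] plin_zero])
    show "ks x \<subseteq> Sym {1..n}" using x by (simp add: GA_def)
    fix a assume a: "a \<in> Sym {1..n}"
    have chi: "pchar \<chi>" using X by (auto simp: Sy_def)
    have X': "(ap a ` X, \<chi>) \<in> Sy (b\<^sup>2) n" using X Sym_in[OF a] by (auto simp: Sy_def card_ap_image)
    have g: "gsum (Sym Z) \<chi> \<in> GA {1..n}" if "(Z, \<chi>) \<in> Sy (b\<^sup>2) n" for Z
      using that by (intro GA_gsum) (auto simp: Sy_def intro: Sym_mono)
    have "act V1 (act V1 y (dl a)) (gsum (Sym X) \<chi>) = act V1 (act V1 y (gsum (Sym (ap a ` X)) \<chi>)) (dl a)"
      unfolding act_mult[OF yU GA_dl[OF a] g[OF X]] act_mult[OF yU g[OF X'] GA_dl[OF a]] gsum_Sym_conj(1)[OF chi] ..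
    then show "act V1 (act V1 y (dl a)) (gsum (Sym X) \<chi>) = 0" by (simp only: kill[OF X'] plin_0[OF plin_act_left])
  qed
  then have "{act V1 (act V1 y x) (gsum (Sym X) \<chi>) | x X \<chi>. x \<in> GA {1..n} \<and> (X, \<chi>) \<in> Sy (b\<^sup>2) n} \<subseteq> {0}" by blast
  then have "pm.span {act V1 (act V1 y x) (gsum (Sym X) \<chi>) | x X \<chi>. x \<in> GA {1..n} \<and> (X, \<chi>) \<in> Sy (b\<^sup>2) n} \<subseteq> {0}"
    by (rule pm.span_minimal) (rule pm.subspace_single_0)
  then show ?thesis using kappa_span[OF D y] by blast
qed

lemma ps_ev: "ps (ev q g) = ev (\<lambda>i. ps (q i)) g"
proof (rule plin_eqI[where p = g and S = UNIV, OF plin_comp[OF plin_ps plin_ev] plin_ev])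
  have "ps (mp q w) = mp (\<lambda>i. ps (q i)) w" for w by (induction w) (simp_all add: mp_simps ps_fmul)
  then show "ps (ev q (sng w 1)) = ev (\<lambda>i. ps (q i)) (sng w 1)" for w by (simp add: ev_sng)
qed simp

text \<open>Multilinearity reduces each factor separately to substitutions by words in the basis.
  The resulting products are homogeneous, so there is a definite degree in which the sets X can be
  compared with the blocks.\<close>

theorem balanced_identity:
  assumes D: "b > 0" "D 2 0 b \<in> \<Omega>" "D 1 1 b \<in> \<Omega>" "D 0 2 b \<in> \<Omega>" and g: "balanced r g"
  shows "is_identity A (shifted_product r (b\<^sup>2) g)"
  unfolding A_identity ev_def[symmetric]
proof
  fix q :: "nat \<Rightarrow> 'v list \<Rightarrow>\<^sub>0 'f"
  have ml: "multilinear r g" using g by (simp add: balanced_def)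
  define Z where "Z = {z :: nat \<Rightarrow> 'v list. \<forall>i. z i \<in> lists B}"
  have "ks (ps (q i)) \<subseteq> lists B" for i using ps_TB by (simp add: TB_def)
  then have "ev (\<lambda>i. ps (q (j * r + i))) g \<in> pm.span {wev z g | z. z \<in> Z}" for j
    unfolding Z_def mem_Collect_eq by (rule ev_span_words[OF ml])
  from product_span[OF this, where js = "[0..<b\<^sup>2]"]
  have "foldr (\<lambda>j y. fmul (ev (\<lambda>i. ps (q (j * r + i))) g) y) [0..<b\<^sup>2] (sng [] 1)
      \<in> pm.span {PG g zs | zs. length zs = b\<^sup>2 \<and> set zs \<subseteq> Z}" by simp
  moreover have "ps (ev q (shifted_product r (b\<^sup>2) g))
      = foldr (\<lambda>j y. fmul (ev (\<lambda>i. ps (q (j * r + i))) g) y) [0..<b\<^sup>2] (sng [] 1)"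
    unfolding ps_ev by (rule ev_shifted_product)
  ultimately have "ps (ev q (shifted_product r (b\<^sup>2) g)) \<in> pm.span {PG g zs | zs. length zs = b\<^sup>2 \<and> set zs \<subseteq> Z}"
    by simp
  moreover have "{PG g zs | zs. length zs = b\<^sup>2 \<and> set zs \<subseteq> Z} \<subseteq> Jd"
  proof clarify
    fix zs assume zs: "length zs = b\<^sup>2" "set zs \<subseteq> Z"
    show "kappa (PG g zs) = 0"
    proof (rule kappa_killed[OF D])
      show "PG g zs \<in> TL (pl r zs) B" by (rule PG_TL[OF ml]) (use zs(2) in \<open>auto simp: Z_def lists_eq_set\<close>)
      fix X and \<chi> :: "fperm \<Rightarrow> 'f" assume X: "(X, \<chi>) \<in> Sy (b\<^sup>2) (pl r zs)"
      have "psgn (Ap (transpose (i + 1) (i + 2))) = (- 1 :: 'f)" for i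
      proof -
        have "transpose (i + 1) (i + 2) permutes {i + 1, i + 2}" by (rule permutes_swap_id) auto
        then show ?thesis by (simp add: psgn_def ap_Ap sign_swap_id)
      qed
      then obtain e where e: "\<And>i. \<chi> (Ap (transpose (i + 1) (i + 2))) = e" "e = 1 \<or> e = - 1"
        using X by (auto simp: Sy_def)
      have chi: "pchar \<chi>" using X by (auto simp: Sy_def)
      have XS: "X \<subseteq> {1..pl r zs}" and lt: "pl r zs < card X + b\<^sup>2" using X by (auto simp: Sy_def)
      have "card ({1..pl r zs} - X) = pl r zs - card X"
        using card_Diff_subset[OF finite_subset[OF XS] XS] by simp
      moreover have "p - c < t" if "p < c + t" "0 < t" for p c t :: nat using that by arith
      ultimately have "card ({1..pl r zs} - X) < length zs" unfolding zs(1) using lt D(1) by simp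
      then have "act V1 (fmul (sng [] 1) (PG g zs)) (gsum (Sym X) \<chi>) = 0"
        by (intro product_killed[OF g chi e]) (use XS in simp_all)
      then show "act V1 (PG g zs) (gsum (Sym X) \<chi>) = 0" by simp
    qed
  qed
  ultimately have "ps (ev q (shifted_product r (b\<^sup>2) g)) \<in> Jd" using pm.span_minimal[OF _ Jd_subspace] by blast
  then show "kappa (ev q (shifted_product r (b\<^sup>2) g)) = 0" by (simp add: kappa_def ps_ps)
qed

end


section \<open>A balanced multilinear polynomial\<close>

lemma family_dependent:
  fixes F :: "'w \<Rightarrow> ('b \<Rightarrow>\<^sub>0 'f::field)"
  assumes W: "finite W" "\<And>w. w \<in> W \<Longrightarrow> F w \<in> pm.span Q" and Q: "finite Q" "card Q < card W"
  shows "\<exists>c. (\<exists>w\<in>W. c w \<noteq> 0) \<and> (\<Sum>w\<in>W. psc (c w) (F w)) = 0"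
proof (cases "inj_on F W")
  case True
  have "\<not> pm.independent (F ` W)"
  proof
    assume "pm.independent (F ` W)"
    then have "card (F ` W) \<le> card Q" using pm.independent_span_bound[OF Q(1)] W(2) by blast
    then show False using Q(2) True by (simp add: card_image)
  qed
  then obtain v where v: "\<exists>x\<in>F ` W. v x \<noteq> 0" "(\<Sum>x\<in>F ` W. psc (v x) x) = 0"
    using pm.dependent_finite[of "F ` W"] W(1) by auto
  then show ?thesis by (intro exI[of _ "\<lambda>w. v (F w)"]) (simp add: sum.reindex[OF True])
next
  case False
  then obtain w w' where w: "w \<in> W" "w' \<in> W" "w \<noteq> w'" "F w = F w'" by (auto simp: inj_on_def)
  let ?c = "\<lambda>v. if v = w then 1 else if v = w' then - 1 else (0::'f)"
  have "(\<Sum>v\<in>W. psc (?c v) (F v)) = (\<Sum>v\<in>{w, w'}. psc (?c v) (F v))"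
    by (rule sum.mono_neutral_right) (use W(1) w in auto)
  also have "\<dots> = 0" using w(3,4) by simp
  finally show ?thesis using w(1) by (intro exI[of _ ?c]) auto
qed

text \<open>Each word gives a vector whose entry at (U, U') is the product of its two signs; a
  linear relation among the vectors of the r! words is a balanced polynomial.\<close>

lemma balanced_exists:
  fixes r :: nat
  assumes "4 ^ r < (fact r :: nat)"
  shows "\<exists>g :: nat list \<Rightarrow>\<^sub>0 'f::field_char_0. g \<noteq> 0 \<and> balanced r g"
proof -
  let ?W = "{w. length w = r \<and> distinct w \<and> set w \<subseteq> {1..r}}" and ?N = "Pow {1..r} \<times> Pow {1..r}"
  define F where "F = (\<lambda>w. \<Sum>p\<in>?N. psc (sgl (fst p) w * sgl (snd p) w) (sng p (1::'f)))"
  have W: "finite ?W"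
    by (rule finite_subset[OF _ finite_lists_length_eq[of "{1..r}" r]]) auto
  have cW: "card ?W = fact r"
    using card_lists_distinct_length_eq[of "{1..r}" r] by (simp add: fact_prod)
  have "card ((\<lambda>p. sng p (1::'f)) ` ?N) \<le> card ?N" by (rule card_image_le) simp
  also have "card ?N = 4 ^ r" by (simp add: card_cartesian_product card_Pow power_mult_distrib[symmetric])
  finally have Q: "card ((\<lambda>p. sng p (1::'f)) ` ?N) < card ?W" using assms cW by simp
  have "F w \<in> pm.span ((\<lambda>p. sng p 1) ` ?N)" for w
    unfolding F_def by (intro pm.span_sum pm.span_scale pm.span_base imageI)
  then obtain c where c: "\<exists>w\<in>?W. c w \<noteq> 0" "(\<Sum>w\<in>?W. psc (c w) (F w)) = 0"
    using family_dependent[OF W _ _ Q, of F] by auto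
  define g where "g = (\<Sum>w\<in>?W. sng w (c w))"
  have lkg: "lk g w = (if w \<in> ?W then c w else 0)" for w
    unfolding g_def lookup_sum lookup_single when_def using sum.delta[OF W, of w c] by simp
  have kg: "ks g \<subseteq> ?W"
  proof
    fix w assume "w \<in> ks g"
    then show "w \<in> ?W" using lkg[of w] by (auto simp: in_keys_iff split: if_splits)
  qed
  have "sgsum g U U' = 0" if U: "U \<subseteq> {1..r}" "U' \<subseteq> {1..r}" for U U'
  proof -
    have "lk (F w) (U, U') = sgl U w * sgl U' w" for w
      using U by (simp add: F_def lookup_sum lookup_single when_def if_distrib[of "\<lambda>x. _ * x"] sum.delta cong: if_cong)
    moreover have "lk (\<Sum>w\<in>?W. psc (c w) (F w)) (U, U') = 0" unfolding c(2) by simp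
    ultimately have 0: "(\<Sum>w\<in>?W. c w * (sgl U w * sgl U' w)) = 0" by (simp add: lookup_sum)
    have "sgsum g U U' = (\<Sum>w\<in>?W. lk g w * (sgl U w * sgl U' w))"
      unfolding sgsum_def by (rule sum.mono_neutral_left[OF W kg]) (simp add: in_keys_iff)
    also have "\<dots> = (\<Sum>w\<in>?W. c w * (sgl U w * sgl U' w))" by (rule sum.cong) (simp_all add: lkg)
    finally show ?thesis using 0 by simp
  qed
  moreover have "multilinear r g" unfolding multilinear_def
  proof
    fix w assume "w \<in> ks g"
    then have w: "length w = r" "distinct w" "set w \<subseteq> {1..r}" using kg by auto
    then have "set w = {1..r}" by (intro card_subset_eq) (simp_all add: distinct_card)
    then show "distinct w \<and> set w = {1..r}" using w(2) by blast
  qed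
  moreover obtain w where "w \<in> ?W" "c w \<noteq> 0" using c(1) by blast
  then have "g \<noteq> 0" using lkg[of w] by auto
  ultimately show ?thesis unfolding balanced_def by blast
qed

text \<open>Homogeneity of the left factor determines where a word is to be cut, so the coefficient
  at \<open>z @ w\<close> is a single product.\<close>

lemma fmul_nonzero:
  fixes x y :: "'v list \<Rightarrow>\<^sub>0 'f::field_char_0"
  assumes x: "x \<in> TL n UNIV" "x \<noteq> 0" and y: "y \<noteq> 0"
  shows "fmul x y \<noteq> 0"
proof -
  obtain z where z: "z \<in> ks x" using x(2) by (metis equals0I keys_eq_empty)
  obtain w where w: "w \<in> ks y" using y by (metis equals0I keys_eq_empty)
  have len: "length v = n" if "v \<in> ks x" for v using x(1) that by (auto simp: TL_def Wd_def)
  have "lk (fmul x y) (z @ w) = (\<Sum>v\<in>ks x. \<Sum>v'\<in>ks y. if v @ v' = z @ w then lk x v * lk y v' else 0)"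
    by (simp add: free_algebra_def mult_monoid_algebra monoid_algebra_def lookup_sum lookup_single when_def)
  also have "\<dots> = (\<Sum>v\<in>ks x. \<Sum>v'\<in>ks y. if v = z \<and> v' = w then lk x v * lk y v' else 0)"
    by (intro sum.cong refl if_cong) (use len len[OF z] in simp)
  also have "\<dots> = (\<Sum>v\<in>ks x. if v = z then lk x v * lk y w else 0)"
    by (rule sum.cong[OF refl]) (use w in \<open>simp add: sum.delta\<close>)
  also have "\<dots> = lk x z * lk y w" using z by (simp add: sum.delta)
  finally have "lk (fmul x y) (z @ w) \<noteq> 0" using z w by (simp add: in_keys_iff)
  then show ?thesis by (metis lookup_zero)
qed

lemma shifted_product_nonzero:
  fixes g :: "nat list \<Rightarrow>\<^sub>0 'f::field_char_0"
  assumes g: "multilinear r g" "g \<noteq> 0"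
  shows "shifted_product r t g \<noteq> 0"
proof -
  have f: "ev (\<lambda>i. sng [s + i] 1) g \<in> TL r UNIV \<and> ev (\<lambda>i. sng [s + i] 1) g \<noteq> 0" for s
  proof
    have "wev (\<lambda>i. [s + i]) g \<in> TL (bl r (\<lambda>i. [s + i])) UNIV" by (rule wev_TL[OF g(1)]) simp
    then show "ev (\<lambda>i. sng [s + i] 1) g \<in> TL r UNIV" by (simp add: bl_def)
    obtain w where w: "w \<in> ks g" using g(2) by (metis equals0I keys_eq_empty)
    have cm: "concat (map (\<lambda>i. [s + i]) v) = map (\<lambda>i. s + i) v" for v by (induction v) auto
    have inj: "map (\<lambda>i. s + i) v = map (\<lambda>i. s + i) w \<longleftrightarrow> v = w" for v
      by (simp add: inj_map_eq_map)
    have "lk (ev (\<lambda>i. sng [s + i] 1) g) (map (\<lambda>i. s + i) w) = (\<Sum>v\<in>ks g. if v = w then lk g v else 0)"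
      unfolding ev_def lext_def mp_words cm by (simp add: lookup_sum lookup_single when_def inj)
    also have "\<dots> = lk g w" using w by (simp add: sum.delta)
    finally show "ev (\<lambda>i. sng [s + i] 1) g \<noteq> 0" using w by (metis in_keys_iff lookup_zero)
  qed
  have "foldr (\<lambda>j y. fmul (ev (\<lambda>i. sng [j * r + i] 1) g) y) js (sng [] 1) \<noteq> 0" for js
  proof (induction js)
    case Nil
    show ?case unfolding foldr.simps id_apply by (metis lookup_single_eq lookup_zero one_neq_zero)
  next
    case (Cons j js)
    show ?case
      unfolding foldr.simps comp_apply by (rule fmul_nonzero[OF conjunct1[OF f] conjunct2[OF f] Cons.IH])
  qed
  then show ?thesis unfolding shifted_product_eq .
qed

section \<open>Polynomial growth\<close>

lemma rearrangement_exists: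
  assumes S: "finite S" and eq: "\<And>b. card {i \<in> S. f i = b} = card {i \<in> S. g i = b}"
  shows "\<exists>p. p permutes S \<and> (\<forall>i\<in>S. f (p i) = g i)"
proof -
  have "\<exists>h. bij_betw h {i \<in> S. g i = b} {i \<in> S. f i = b}" for b
    by (rule finite_same_card_bij) (use S eq in auto)
  then have "\<forall>b. \<exists>h. bij_betw h {i \<in> S. g i = b} {i \<in> S. f i = b}" by blast
  from choice[OF this] obtain h where h: "\<And>b. bij_betw (h b) {i \<in> S. g i = b} {i \<in> S. f i = b}" by blast
  define p where "p = (\<lambda>i. if i \<in> S then h (g i) i else i)"
  have p: "p i \<in> S \<and> f (p i) = g i" if "i \<in> S" for i
    using h[of "g i"] that by (auto simp: p_def bij_betw_def)
  have inj: "inj_on p S"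
  proof (rule inj_onI)
    fix i j assume ij: "i \<in> S" "j \<in> S" "p i = p j"
    then have "g i = g j" using p by metis
    then show "i = j" using h[of "g i"] ij by (auto simp: p_def bij_betw_def inj_on_def)
  qed
  have "p ` S = S" by (rule endo_inj_surj[OF S _ inj]) (use p in blast)
  then have "p permutes S" using inj by (intro bij_imp_permutes) (auto simp: bij_betw_def p_def)
  then show ?thesis using p by blast
qed

lemma dim_le_invariant:
  fixes v :: "'i \<Rightarrow> ('b \<Rightarrow>\<^sub>0 'f::field)"
  assumes U: "U \<subseteq> pm.span (v ` I)" and T: "finite T" "d ` I \<subseteq> T"
    and prp: "\<And>i j. i \<in> I \<Longrightarrow> j \<in> I \<Longrightarrow> d i = d j \<Longrightarrow> v i \<in> pm.span {v j}"
  shows "pm.dim U \<le> card T"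
proof -
  define rep where "rep = (\<lambda>t. SOME j. j \<in> I \<and> d j = t)"
  have rep: "rep (d i) \<in> I \<and> d (rep (d i)) = d i" if "i \<in> I" for i
    unfolding rep_def by (rule someI[of "\<lambda>j. j \<in> I \<and> d j = d i" i]) (use that in simp)
  have "v i \<in> pm.span ((\<lambda>t. v (rep t)) ` T)" if i: "i \<in> I" for i
  proof -
    have "v i \<in> pm.span {v (rep (d i))}" using prp[OF i, of "rep (d i)"] rep[OF i] by simp
    moreover have "{v (rep (d i))} \<subseteq> (\<lambda>t. v (rep t)) ` T" using T(2) i by blast
    ultimately show ?thesis using pm.span_mono by blast
  qed
  then have "pm.span (v ` I) \<subseteq> pm.span ((\<lambda>t. v (rep t)) ` T)"
    by (intro pm.span_minimal pm.subspace_span) auto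
  then have "pm.dim U \<le> card ((\<lambda>t. v (rep t)) ` T)"
    using U by (intro pm.dim_le_card) (use T(1) in auto)
  also have "\<dots> \<le> card T" by (rule card_image_le[OF T(1)])
  finally show ?thesis .
qed

context fin_filter
begin

definition ivec :: "(nat set \<times> (fperm \<Rightarrow> 'f)) \<times> 'v list \<Rightarrow> ('v list \<Rightarrow>\<^sub>0 'f)" where
  "ivec i = act V1 (sng (snd i) 1) (gsum (Sym (fst (fst i))) (snd (fst i)))"

text \<open>This information about the word and \<open>X\<close> determines \<^term>\<open>ivec i\<close> up to a scalar.\<close>

definition inv_data :: "nat \<Rightarrow> (nat set \<times> (fperm \<Rightarrow> 'f)) \<times> 'v list \<Rightarrow> ((fperm \<Rightarrow> 'f) \<times> (nat \<times> 'v) list) \<times> ('v \<Rightarrow> nat)" where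
  "inv_data n i = ((snd (fst i), map (\<lambda>j. (j, snd i ! (j - 1))) (sorted_list_of_set ({1..n} - fst (fst i)))),
     (\<lambda>v\<in>B. card {j \<in> fst (fst i). snd i ! (j - 1) = v}))"

text \<open>The letters inside X may be rearranged at will, at the cost of a sign, before
  symmetrizing; only their multiplicities matter. The letters outside X are recorded with their
  positions, which also recovers X.\<close>

lemma ivec_proportional:
  assumes i: "i \<in> Sy t n \<times> Wd n B" and j: "j \<in> Sy t n \<times> Wd n B" and eq: "inv_data n i = inv_data n j"
  shows "ivec i \<in> pm.span {ivec j}"
proof -
  obtain X \<chi> w where i': "i = ((X, \<chi>), w)" by (metis prod.collapse)
  obtain X' \<chi>' w' where j': "j = ((X', \<chi>'), w')" by (metis prod.collapse)
  have X: "X \<subseteq> {1..n}" "X' \<subseteq> {1..n}" and chi: "pchar \<chi>" using i j unfolding i' j' by (auto simp: Sy_def)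
  have w: "length w = n" "set w \<subseteq> B" "length w' = n" "set w' \<subseteq> B" using i j unfolding i' j' by (auto simp: Wd_def)
  let ?l = "\<lambda>X w. map (\<lambda>j. (j, w ! (j - 1))) (sorted_list_of_set ({1..n} - X))"
  have l: "?l X w = ?l X' w'" and c: "\<chi> = \<chi>'"
    and cnt: "(\<lambda>v\<in>B. card {j \<in> X. w ! (j - 1) = v}) = (\<lambda>v\<in>B. card {j \<in> X'. w' ! (j - 1) = v})"
    using eq unfolding i' j' inv_data_def by simp_all
  have s: "set (?l Z v) = (\<lambda>j. (j, v ! (j - 1))) ` ({1..n} - Z)" for Z v by simp
  have G: "(\<lambda>j. (j, w ! (j - 1))) ` ({1..n} - X) = (\<lambda>j. (j, w' ! (j - 1))) ` ({1..n} - X')"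
    unfolding s[symmetric] l ..
  from arg_cong[OF G, of "\<lambda>S. fst ` S"] have "{1..n} - X = {1..n} - X'" by (simp add: image_image)
  then have XX: "X' = X" using X by blast
  have out: "w ! (m - 1) = w' ! (m - 1)" if "m \<in> {1..n} - X" for m
  proof -
    have "(m, w ! (m - 1)) \<in> (\<lambda>j. (j, w' ! (j - 1))) ` ({1..n} - X')" unfolding G[symmetric] using that by blast
    then show ?thesis by auto
  qed
  have fX: "finite X" using X(1) finite_subset by blast
  have "card {m \<in> X. w' ! (m - 1) = v} = card {m \<in> X. w ! (m - 1) = v}" for v
  proof (cases "v \<in> B")
    case True
    then show ?thesis using fun_cong[OF cnt, of v] unfolding XX by simp
  next
    case False
    have wB: "w ! (m - 1) \<in> B \<and> w' ! (m - 1) \<in> B" if "m \<in> X" for m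
    proof -
      have "m - 1 < n" using that X(1) by fastforce
      then have "w ! (m - 1) \<in> set w" "w' ! (m - 1) \<in> set w'" using w(1,3) by simp_all
      then show ?thesis using w(2,4) by blast
    qed
    then have "{m \<in> X. w' ! (m - 1) = v} = {}" "{m \<in> X. w ! (m - 1) = v} = {}" using False by blast+
    then show ?thesis by (simp only:)
  qed
  from rearrangement_exists[OF fX this] obtain p where p: "p permutes X" "\<And>m. m \<in> X \<Longrightarrow> w' ! (p m - 1) = w ! (m - 1)"
    by blast
  define a where "a = Ap p"
  have ap: "ap a = p" unfolding a_def by (rule ap_Ap[OF p(1) fX])
  have aX: "a \<in> Sym X" using p(1) by (simp add: Sym_def ap)
  have pw: "permute_word n (ap a) w' = w"
  proof (rule nth_equalityI)
    fix m assume "m < length (permute_word n (ap a) w')"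
    then have m: "m < n" by simp
    show "permute_word n (ap a) w' ! m = w ! m"
    proof (cases "Suc m \<in> X")
      case True then show ?thesis using p(2)[OF True] m by (simp add: ap)
    next
      case False
      then have "p (Suc m) = Suc m" using p(1) by (simp add: permutes_def)
      then show ?thesis using out[of "Suc m"] False m by (simp add: ap)
    qed
  qed (simp add: w)
  let ?s = "wsgn V1 n (ap a) w' :: 'f"
  have s2: "?s * ?s = 1" by (simp flip: power_add)
  have w'U: "sng w' (1::'f) \<in> TL n UNIV" using w by (simp add: TL_def Wd_def)
  have "act V1 (sng w' 1) (dl a) = psc ?s (sng w 1)"
    unfolding act_sng_dl wact_def w(3) pw by simp
  then have "psc ?s (act V1 (sng w 1) (gsum (Sym X) \<chi>)) = act V1 (act V1 (sng w' 1) (dl a)) (gsum (Sym X) \<chi>)"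
    by (simp only: plin_psc[OF plin_act_left])
  also have "\<dots> = psc (\<chi> a) (act V1 (sng w' 1) (gsum (Sym X) \<chi>))"
    unfolding Sym_eq_Stab by (rule act_gsum[OF w'U _ X(1) chi]) (use aX in \<open>simp only: Sym_eq_Stab\<close>)
  finally have "psc ?s (psc ?s (act V1 (sng w 1) (gsum (Sym X) \<chi>))) = psc ?s (psc (\<chi> a) (act V1 (sng w' 1) (gsum (Sym X) \<chi>)))"
    by (rule arg_cong)
  then have "act V1 (sng w 1) (gsum (Sym X) \<chi>) = psc (?s * \<chi> a) (act V1 (sng w' 1) (gsum (Sym X) \<chi>))"
    by (simp only: pm.scale_scale s2 pm.scale_one)
  then show ?thesis
    unfolding ivec_def i' j' fst_conv snd_conv c[symmetric] XX by (simp only:) (intro pm.span_scale pm.span_base, simp)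
qed

text \<open>The factors count the two characters, the lists of at most b^2 pairs of a position
  outside X and its letter, and the multiplicities between 0 and \<open>n\<close> of the basis
  letters inside X.\<close>

lemma growth_bound:
  assumes D: "b > 0" "D 2 0 b \<in> \<Omega>" "D 1 1 b \<in> \<Omega>" "D 0 2 b \<in> \<Omega>"
  shows "vdim (A_component scale V0 V1 \<Omega> n) \<le> 2 * (\<Sum>i\<le>b\<^sup>2. (n * card B) ^ i) * (n + 1) ^ card B"
proof -
  let ?I = "Sy (b\<^sup>2) n \<times> Wd n B"
  let ?T = "({(\<lambda>_. 1 :: 'f), psgn} \<times> {xs. set xs \<subseteq> {1..n} \<times> B \<and> length xs \<le> b\<^sup>2}) \<times> (B \<rightarrow>\<^sub>E {..n})"
  have finT: "finite ?T" by (intro finite_cartesian_product finite_lists_length_le finite_PiE) auto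
  have "kappa x \<in> pm.span (ivec ` ?I)" if x: "x \<in> TL n UNIV" for x
  proof -
    let ?y = "ps x"
    have y: "?y \<in> TL n B" by (rule ps_TL[OF x])
    have "{act V1 (act V1 ?y x) (gsum (Sym X) \<chi>) | x X \<chi>. x \<in> GA {1..n} \<and> (X, \<chi>) \<in> Sy (b\<^sup>2) n}
        \<subseteq> pm.span (ivec ` ?I)"
    proof clarify
      fix z :: "fperm \<Rightarrow>\<^sub>0 'f" and X and \<chi> :: "fperm \<Rightarrow> 'f" assume z: "z \<in> GA {1..n}" and X: "(X, \<chi>) \<in> Sy (b\<^sup>2) n"
      have "act V1 ?y z \<in> pm.span ((\<lambda>w. sng w 1) ` Wd n B)" unfolding span_words by (rule act_TL[OF y z])
      then show "act V1 (act V1 ?y z) (gsum (Sym X) \<chi>) \<in> pm.span (ivec ` ?I)"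
      proof (rule plin_span[where F = "\<lambda>y. act V1 y (gsum (Sym X) \<chi>)", OF plin_act_left, rotated])
        fix v :: "'v list \<Rightarrow>\<^sub>0 'f" assume "v \<in> (\<lambda>w. sng w (1::'f)) ` Wd n B"
        then obtain w where "w \<in> Wd n B" "v = sng w 1" by blast
        then have "act V1 v (gsum (Sym X) \<chi>) = ivec ((X, \<chi>), w)" "((X, \<chi>), w) \<in> ?I" using X by (simp_all add: ivec_def)
        then show "act V1 v (gsum (Sym X) \<chi>) \<in> pm.span (ivec ` ?I)" by (simp only:) (intro pm.span_base imageI)
      qed
    qed
    then have "kappa ?y \<in> pm.span (ivec ` ?I)"
      using kappa_span[OF D y] pm.span_minimal[OF _ pm.subspace_span] by blast
    then show ?thesis by (simp add: kappa_def ps_ps)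
  qed
  then have "pm.dim (kappa ` TL n UNIV) \<le> card ?T"
  proof (intro dim_le_invariant[where v = ivec and I = ?I and d = "inv_data n"] finT)
    show "ivec i \<in> pm.span {ivec j}" if "i \<in> ?I" "j \<in> ?I" "inv_data n i = inv_data n j" for i j
      by (rule ivec_proportional[OF that])
    show "inv_data n ` ?I \<subseteq> ?T"
    proof (rule image_subsetI)
      fix i assume "i \<in> ?I"
      then obtain X \<chi> w where i: "i = ((X, \<chi>), w)" and X: "(X, \<chi>) \<in> Sy (b\<^sup>2) n" and w: "w \<in> Wd n B" by auto
      have XS: "X \<subseteq> {1..n}" using X by (auto simp: Sy_def)
      have fX: "finite X" using XS finite_subset by blast
      have "n - card X \<le> b\<^sup>2" using X by (auto simp: Sy_def)
      then have l: "card ({1..n} - X) \<le> b\<^sup>2" using card_Diff_subset[OF fX XS] by simp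
      have "w ! (j - 1) \<in> B" if "j \<in> {1..n} - X" for j
      proof -
        have "j - 1 < length w" using that w by (auto simp: Wd_def)
        then show ?thesis using w nth_mem by (fastforce simp: Wd_def)
      qed
      then have 1: "set (map (\<lambda>j. (j, w ! (j - 1))) (sorted_list_of_set ({1..n} - X))) \<subseteq> {1..n} \<times> B" by auto
      have 2: "card {j \<in> X. P j} \<le> n" for P
        using card_mono[of "{1..n}" "{j \<in> X. P j}"] XS by fastforce
      show "inv_data n i \<in> ?T"
        unfolding i inv_data_def fst_conv snd_conv
        by (intro SigmaI CollectI conjI 1) (use X l 2 in \<open>auto simp: Sy_def\<close>)
    qed
  qed auto
  also have "card ?T \<le> 2 * (\<Sum>i\<le>b\<^sup>2. (n * card B) ^ i) * (n + 1) ^ card B"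
  proof -
    have "card {(\<lambda>_. 1 :: 'f), psgn} \<le> 2" by (simp add: card_insert_if)
    moreover have "card {xs. set xs \<subseteq> {1..n} \<times> B \<and> length xs \<le> b\<^sup>2} = (\<Sum>i\<le>b\<^sup>2. (n * card B) ^ i)"
      using card_lists_length_le[of "{1..n} \<times> B" "b\<^sup>2"] by (simp add: card_cartesian_product)
    moreover have "card (B \<rightarrow>\<^sub>E {..n}) = (n + 1) ^ card B" by (simp add: card_PiE)
    ultimately show ?thesis by (simp only: card_cartesian_product mult_le_mono1)
  qed
  finally show ?thesis unfolding vdim_A_component .
qed

lemma polynomial_growth_if:
  assumes D: "b > 0" "D 2 0 b \<in> \<Omega>" "D 1 1 b \<in> \<Omega>" "D 0 2 b \<in> \<Omega>"
  shows "polynomial_growth scale V0 V1 \<Omega>"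
  unfolding polynomial_growth_def
proof (intro exI allI)
  let ?p = "[:2:] * (\<Sum>i\<le>b\<^sup>2. [:0, real (card B):] ^ i) * [:1, 1:] ^ card B"
  fix n
  have "real (vdim (A_component scale V0 V1 \<Omega> n)) \<le> real (2 * (\<Sum>i\<le>b\<^sup>2. (n * card B) ^ i) * (n + 1) ^ card B)"
    using growth_bound[OF D, of n] by (simp only: of_nat_le_iff)
  also have "\<dots> = poly ?p (real n)"
    by (simp add: poly_sum add.commute)
  finally show "real (vdim (A_component scale V0 V1 \<Omega> n)) \<le> poly ?p (real n)" .
qed

lemma PI_if:
  assumes D: "b > 0" "D 2 0 b \<in> \<Omega>" "D 1 1 b \<in> \<Omega>" "D 0 2 b \<in> \<Omega>"
  shows "PI_algebra A"
proof -
  have "4 ^ 9 < (fact 9 :: nat)" by (simp add: fact_numeral)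
  then obtain g :: "nat list \<Rightarrow>\<^sub>0 'f" where g: "g \<noteq> 0" "balanced 9 g" using balanced_exists[of 9] by blast
  then have "shifted_product 9 (b\<^sup>2) g \<noteq> 0" by (intro shifted_product_nonzero) (auto simp: balanced_def)
  then show ?thesis using balanced_identity[OF D g(2)] unfolding PI_algebra_def by blast
qed

text \<open>The rectangle in the filter contains the corner as well, which forces a0 and a1 to be at
  most the numbers of even and odd basis vectors: there are enough letters to build the free
  algebra.\<close>

lemma no_missing_corner:
  assumes rect: "rectangle (card B1 + 1) (card B0 + 1) \<in> \<Omega>"
    and P: "PI_algebra A \<or> polynomial_growth scale V0 V1 \<Omega>" and a: "a0 + a1 = 2"
  shows "\<exists>b>0. D a0 a1 b \<in> \<Omega>"
proof (rule ccontr)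
  assume "\<not> ?thesis"
  then have c: "a1 < \<nu> a0" if "\<nu> \<in> \<Omega>" for \<nu> using missing_corner[OF fil _ that, of a0 a1] by blast
  from c[OF rect] have ab: "a0 \<le> card B0" "a1 \<le> card B1" by (auto simp: rectangle_def split: if_splits)
  have "\<not> PI_algebra A" by (rule missing_corner_not_PI[of a1 a0, OF _ a ab]) (rule c)
  moreover have "\<not> polynomial_growth scale V0 V1 \<Omega>"
    by (rule missing_corner_not_polynomial[of a1 a0, OF _ a ab]) (rule c)
  ultimately show False using P by blast
qed

text \<open>The shapes grow with \<open>b\<close>, so one \<open>b\<close> can serve all three; b'
  \<ge> 2 keeps both parameters within the range of \<open>D_partition\<close>.\<close>

lemma D_monotone:
  assumes "D a0 a1 b \<in> \<Omega>" "b \<le> b'" "b' \<ge> 2" "a0 + a1 = 2"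
  shows "D a0 a1 b' \<in> \<Omega>"
proof -
  have "D a0 a1 b \<le> D a0 a1 b'"
    using assms(2-4) by (auto simp: le_fun_def D_def)
  moreover have "D a0 a1 b' \<in> partitions" by (rule D_partition) (use assms(3,4) in auto)
  ultimately show ?thesis using fil assms(1) unfolding is_filter_of_partitions_def by blast
qed

lemma corners_if:
  assumes "rectangle (card B1 + 1) (card B0 + 1) \<in> \<Omega>" "PI_algebra A \<or> polynomial_growth scale V0 V1 \<Omega>"
  shows "\<exists>b>0. D 2 0 b \<in> \<Omega> \<and> D 1 1 b \<in> \<Omega> \<and> D 0 2 b \<in> \<Omega>"
proof -
  obtain b1 b2 b3 where b: "D 2 0 b1 \<in> \<Omega>" "D 1 1 b2 \<in> \<Omega>" "D 0 2 b3 \<in> \<Omega>"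
    using no_missing_corner[OF assms, of 2 0] no_missing_corner[OF assms, of 1 1] no_missing_corner[OF assms, of 0 2] by auto
  have "D 2 0 (b1 + b2 + b3 + 2) \<in> \<Omega>" by (rule D_monotone[OF b(1)]) auto
  moreover have "D 1 1 (b1 + b2 + b3 + 2) \<in> \<Omega>" by (rule D_monotone[OF b(2)]) auto
  moreover have "D 0 2 (b1 + b2 + b3 + 2) \<in> \<Omega>" by (rule D_monotone[OF b(3)]) auto
  ultimately show ?thesis by (intro exI[of _ "b1 + b2 + b3 + 2"]) auto
qed

end

theorem theorem7p1:
  fixes scale :: "'f::field_char_0 \<Rightarrow> 'v::ab_group_add \<Rightarrow> 'v"
    and V0 V1 :: "'v set"
    and k l :: nat
    and \<Omega> :: "(nat \<Rightarrow> nat) set"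
  assumes "graded_space scale V0 V1"
    and "\<exists>B. finite B \<and> module.span scale B = V0"
    and "vector_space.dim scale V0 = k"
    and "\<exists>B. finite B \<and> module.span scale B = V1"
    and "vector_space.dim scale V1 = l"
    and "is_filter_of_partitions \<Omega>"
    and "rectangle (l + 1) (k + 1) \<in> \<Omega>"
  shows "(PI_algebra (A_algebra scale V0 V1 \<Omega>) \<longleftrightarrow> polynomial_growth scale V0 V1 \<Omega>)
       \<and> (polynomial_growth scale V0 V1 \<Omega>
            \<longleftrightarrow> (\<exists>b>0. D 2 0 b \<in> \<Omega> \<and> D 1 1 b \<in> \<Omega> \<and> D 0 2 b \<in> \<Omega>))
       \<and> (\<forall>b>0. D 2 0 b \<in> \<Omega> \<and> D 1 1 b \<in> \<Omega> \<and> D 0 2 b \<in> \<Omega> \<longrightarrow>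
            (\<forall>r (g :: nat list \<Rightarrow>\<^sub>0 'f).
               multilinear r g \<and> is_identity (tensor_product grassmann grassmann) g \<longrightarrow>
               is_identity (A_algebra scale V0 V1 \<Omega>) (shifted_product r (b\<^sup>2) g)))"
proof -
  interpret G: graded_space scale V0 V1 by fact
  have basis: "\<exists>C. finite C \<and> G.independent C \<and> G.span C = W \<and> card C = G.dim W"
    if W: "G.subspace W" "\<exists>B. finite B \<and> G.span B = W" for W
  proof -
    obtain C where C: "C \<subseteq> W" "G.independent C" "W \<subseteq> G.span C" "card C = G.dim W" using G.basis_exists by blast
    obtain B where B: "finite B" "G.span B = W" using W(2) by blast
    have "finite C" using G.independent_span_bound[OF B(1) C(2)] C(1) B(2) by blast
    moreover have "G.span C = W" using C(1,3) G.span_minimal[OF _ W(1)] by blast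
    ultimately show ?thesis using C by blast
  qed
  obtain B0 where B0: "finite B0" "G.independent B0" "G.span B0 = V0" "card B0 = k"
    using basis[OF G.subspace_V0] assms(2,3) by blast
  obtain B1 where B1: "finite B1" "G.independent B1" "G.span B1 = V1" "card B1 = l"
    using basis[OF G.subspace_V1] assms(4,5) by blast
  interpret fin_filter scale V0 V1 B0 B1 \<Omega>
    by unfold_locales (use B0 B1 assms(6) in auto)
  have rect: "rectangle (card B1 + 1) (card B0 + 1) \<in> \<Omega>" using assms(7) B0(4) B1(4) by simp
  have "is_identity A (shifted_product r (b\<^sup>2) g)"
    if d: "b > 0" "D 2 0 b \<in> \<Omega>" "D 1 1 b \<in> \<Omega>" "D 0 2 b \<in> \<Omega>"
      and g: "multilinear r g" "is_identity (tensor_product grassmann grassmann) g" for b r and g :: "nat list \<Rightarrow>\<^sub>0 'f"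
  proof (rule balanced_identity[OF d])
    show "balanced r g" unfolding balanced_def using g(1) tensor_square_identity[OF g] by blast
  qed
  then show ?thesis
    using PI_if polynomial_growth_if corners_if[OF rect] by blast
qed

end
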